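(* Let $\Omega\subset\mathbb{R}^n$ be a bounded domain satisfying the uniform interior cone condition, $T>0$, $\mathcal{U}=\Omega\times[0,T]$, $\beta>0$, $\rho>0$, and let $G$ be the Green's function of $\mathcal{P}$ on $\mathcal{U}$. Let $D_1,D_2\subset\mathbb{R}^n$ be domains with $D_1$ convex, and $I_1,I_2\subset(0,T)$ open bounded intervals such that $Q_X=(D_1\cap\Omega)\times I_1$ and $Q_Y=(D_2\cap\Omega)\times I_2$ are admissible, i.e. $\operatorname{dist}(Q_X,Q_Y)\ge\rho\max\{\operatorname{diam}Q_X,\operatorname{diam}Q_Y\}$. Then for every sufficiently small $\epsilon>0$ there exist an integer $k\le k_\epsilon:=c_{\rho/2}^{n+2}\lceil\log\tfrac1\epsilon\rceil^{n+3}+\lceil\log\tfrac1\epsilon\rceil$ and functions $u_1,\dots,u_k$ on $Q_X$, $v_1,\dots,v_k$ on $Q_Y$ such that $G_k(x,t,y,s)=\sum_{i=1}^k u_i(x,t)v_i(y,s)$ satisfies \[ \|G(\cdot,\cdot,y,s)-G_k(\cdot,\cdot,y,s)\|_{L^2(Q_X)}\le\epsilon\,\|G(\cdot,\cdot,y,s)\|_{L^2(\hat Q_X)}\quad\text{for all }(y,s)\in Q_Y, \] where $\hat Q_X:=\{X\in\mathcal{U}:\operatorname{dist}(X,Q_X)\le\frac\rho2\operatorname{diam}Q_X\}$. Consequently $\|G-G_k\|_{L^2(Q_X\times Q_Y)}\le\epsilon\|G\|_{L^2(\hat Q_X\times Q_Y)}$.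
   Context: Parabolic operator: $\mathcal{P}u=u_t-\nabla\cdot(A(x,t)\nabla u)$, $A(x,t)\in\mathbb{R}^{n\times n}$ symmetric with entries in $L^\infty(\mathcal{U})$, $\lambda|\xi|^2\le A\xi\cdot\xi\le\Lambda|\xi|^2$ for all $\xi$, $0<\lambda\le\Lambda$. The Green's function $G:\{(x,t,y,s)\in\mathcal{U}\times\mathcal{U}:(x,t)\ne(y,s)\}\to[0,\infty)$ is the nonnegative kernel with $\mathcal{P}G(\cdot,\cdot,y,s)=\delta_{(y,s)}$, $G(\cdot,t,y,s)=0$ on $\partial\Omega$, $G(\cdot,0,y,s)=0$, so that the solution of $\mathcal{P}u=f$ with zero Dirichlet and zero initial data is $u(x,t)=\int_0^T\int_\Omega G(x,t,y,s)f(y,s)\,dy\,ds$. Metric: $m(x,t,y,s)=\max(\|x-y\|_\infty,\sqrt{|t-s|/\beta})$; $\operatorname{diam}Q=\sup_{(x,t),(y,s)\in Q}m$, $\operatorname{dist}(Q,Q')=\inf_{(x,t)\in Q,(y,s)\in Q'}m$, and $\operatorname{dist}(X,Q)$ likewise. Uniform interior cone condition: there exist an angle in $(0,\pi/2)$ and $r>0$ such that every $x\in\Omega$ is the vertex of a cone with that opening and height $r$ contained in $\Omega$; it yields constants $\delta_0>0$ and $\theta\in(0,1)$ depending only on $\Omega$ such that every cube $D'$ of side at most $\delta_0$ meeting $\Omega$ satisfies $|D'\setminus\Omega|\ge\theta|D'|$ or contains a ball $B\subset\Omega\cap D'$ with $|B|\ge\theta|D'|$. Constants: $c_{\mathrm{appr}}=2^{n+2}(\omega_n^{2-2/n}\theta^{-2}+2\Lambda^2\omega_n^{2/n}\beta^2\theta^{-2-2/n})^{1/2}$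 ($\omega_n$ = volume of unit ball), $\kappa_c=\sqrt{4\Lambda^2/\lambda^2+1/(2\lambda\beta)}$, and $c_\rho=e(2+\rho^{-1})\kappa_c c_{\mathrm{appr}}$, so $c_{\rho/2}=e(2+2\rho^{-1})\kappa_c c_{\mathrm{appr}}$. *)

theory Defs
  imports "HOL-Analysis.Analysis"
begin

definition pmetric :: "real \<Rightarrow> ((real^'n) \<times> real) \<Rightarrow> ((real^'n) \<times> real) \<Rightarrow> real" where
  "pmetric \<beta> X Y = max (infnorm (fst X - fst Y)) (sqrt (\<bar>snd X - snd Y\<bar> / \<beta>))"

definition pdiam :: "real \<Rightarrow> ((real^'n) \<times> real) set \<Rightarrow> real" where
  "pdiam \<beta> Q = Sup {pmetric \<beta> X Y | X Y. X \<in> Q \<and> Y \<in> Q}"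

definition pdist :: "real \<Rightarrow> ((real^'n) \<times> real) set \<Rightarrow> ((real^'n) \<times> real) set \<Rightarrow> real" where
  "pdist \<beta> Q Q' = Inf {pmetric \<beta> X Y | X Y. X \<in> Q \<and> Y \<in> Q'}"

definition pdist_pt :: "real \<Rightarrow> ((real^'n) \<times> real) \<Rightarrow> ((real^'n) \<times> real) set \<Rightarrow> real" where
  "pdist_pt \<beta> X Q = Inf {pmetric \<beta> X Y | Y. Y \<in> Q}"

definition fcone :: "real^'n \<Rightarrow> real^'n \<Rightarrow> real \<Rightarrow> real \<Rightarrow> (real^'n) set" where
  "fcone x \<xi> \<alpha> r = {x + z | z. norm z * cos \<alpha> \<le> z \<bullet> \<xi> \<and> norm z \<le> r}"

definition uniform_interior_cone :: "(real^'n) set \<Rightarrow> bool" where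
  "uniform_interior_cone \<Omega> \<longleftrightarrow>
     (\<exists>\<alpha> r. 0 < \<alpha> \<and> \<alpha> < pi / 2 \<and> 0 < r \<and>
        (\<forall>x\<in>\<Omega>. \<exists>\<xi>. norm \<xi> = 1 \<and> fcone x \<xi> \<alpha> r \<subseteq> \<Omega>))"

text \<open>The cube property of the constants delta0 and theta obtained from the cone condition.\<close>
definition cube_property :: "(real^'n) set \<Rightarrow> real \<Rightarrow> real \<Rightarrow> bool" where
  "cube_property \<Omega> \<delta>\<^sub>0 \<theta> \<longleftrightarrow>
     (\<forall>a h. 0 < h \<and> h \<le> \<delta>\<^sub>0 \<and> cbox a (a + h *\<^sub>R One) \<inter> \<Omega> \<noteq> {} \<longrightarrow>
        measure lborel (cbox a (a + h *\<^sub>R One) - \<Omega>) \<ge> \<theta> * measure lborel (cbox a (a + h *\<^sub>R One))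
        \<or> (\<exists>c r. ball c r \<subseteq> \<Omega> \<inter> cbox a (a + h *\<^sub>R One) \<and>
               measure lborel (ball c r) \<ge> \<theta> * measure lborel (cbox a (a + h *\<^sub>R One))))"

definition dt :: "((real^'n) \<times> real \<Rightarrow> real) \<Rightarrow> (real^'n) \<times> real \<Rightarrow> real" where
  "dt \<phi> X = frechet_derivative \<phi> (at X) (0, 1)"

definition gradx :: "((real^'n) \<times> real \<Rightarrow> real) \<Rightarrow> (real^'n) \<times> real \<Rightarrow> real^'n" where
  "gradx \<phi> X = (\<chi> i. frechet_derivative \<phi> (at X) (axis i 1, 0))"

definition tsupp :: "((real^'n) \<times> real \<Rightarrow> real) \<Rightarrow> ((real^'n) \<times> real) set" where
  "tsupp \<phi> = closure {X. \<phi> X \<noteq> 0}"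

definition C1c :: "((real^'n) \<times> real) set \<Rightarrow> ((real^'n) \<times> real \<Rightarrow> real) \<Rightarrow> bool" where
  "C1c S \<phi> \<longleftrightarrow> (\<forall>X. \<phi> differentiable (at X)) \<and> continuous_on UNIV (dt \<phi>)
       \<and> continuous_on UNIV (gradx \<phi>) \<and> compact (tsupp \<phi>) \<and> tsupp \<phi> \<subseteq> S"

definition cyl :: "(real^'n) set \<Rightarrow> real \<Rightarrow> ((real^'n) \<times> real) set" where
  "cyl \<Omega> T = \<Omega> \<times> {0..T}"

text \<open>u is a weak solution of u_t - div(A grad u) = f in Omega x (0,T), u = 0 on the lateral
  boundary (u in L^2(0,T;H^1_0(Omega)), g being its spatial gradient, obtained as limit of
  C^1 functions compactly supported in Omega x R), u(.,0) = 0 (test functions need not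
  vanish at t = 0, only near t = T).\<close>
definition weak_sol :: "(real^'n) set \<Rightarrow> real \<Rightarrow> ((real^'n) \<times> real \<Rightarrow> (real^'n^'n))
     \<Rightarrow> ((real^'n) \<times> real \<Rightarrow> real) \<Rightarrow> ((real^'n) \<times> real \<Rightarrow> real) \<Rightarrow> bool" where
  "weak_sol \<Omega> T A f u \<longleftrightarrow>
     u \<in> borel_measurable lborel \<and> set_integrable lborel (cyl \<Omega> T) (\<lambda>X. (u X)\<^sup>2) \<and>
     (\<exists>g :: (real^'n) \<times> real \<Rightarrow> real^'n.
        g \<in> borel_measurable lborel \<and> set_integrable lborel (cyl \<Omega> T) (\<lambda>X. (norm (g X))\<^sup>2) \<and>
        (\<exists>\<psi> :: nat \<Rightarrow> (real^'n) \<times> real \<Rightarrow> real.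
            (\<forall>k. C1c (\<Omega> \<times> UNIV) (\<psi> k)) \<and>
            (\<lambda>k. LINT X:cyl \<Omega> T|lborel. (\<psi> k X - u X)\<^sup>2) \<longlonglongrightarrow> 0 \<and>
            (\<lambda>k. LINT X:cyl \<Omega> T|lborel. (norm (gradx (\<psi> k) X - g X))\<^sup>2) \<longlonglongrightarrow> 0) \<and>
        (\<forall>\<phi>. C1c (\<Omega> \<times> {..<T}) \<phi> \<longrightarrow>
            (LINT X:cyl \<Omega> T|lborel. - u X * dt \<phi> X + (A X *v g X) \<bullet> gradx \<phi> X)
              = (LINT X:cyl \<Omega> T|lborel. f X * \<phi> X)))"

text \<open>The Green's function: nonnegative, continuous off the diagonal in the interior of the
  cylinder (as all such Green's functions are, by Nash--De Giorgi--Aronson), and representing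
  the weak solution of P u = f with zero Dirichlet and initial data for every bounded
  measurable f.  These properties determine G uniquely on the open cylinder off the diagonal.\<close>
definition green_fun :: "(real^'n) set \<Rightarrow> real \<Rightarrow> ((real^'n) \<times> real \<Rightarrow> (real^'n^'n))
     \<Rightarrow> ((real^'n) \<times> real \<Rightarrow> (real^'n) \<times> real \<Rightarrow> real) \<Rightarrow> bool" where
  "green_fun \<Omega> T A G \<longleftrightarrow>
     (\<forall>X\<in>cyl \<Omega> T. \<forall>Y\<in>cyl \<Omega> T. X \<noteq> Y \<longrightarrow> 0 \<le> G X Y) \<and>
     continuous_on {(X, Y). X \<in> \<Omega> \<times> {0<..<T} \<and> Y \<in> \<Omega> \<times> {0<..<T} \<and> X \<noteq> Y} (\<lambda>(X, Y). G X Y) \<and>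
     (\<forall>f. f \<in> borel_measurable lborel \<and> bounded (range f) \<longrightarrow>
        (\<exists>u. weak_sol \<Omega> T A f u \<and>
           (AE X in lborel. X \<in> cyl \<Omega> T \<longrightarrow>
               set_integrable lborel (cyl \<Omega> T) (\<lambda>Y. G X Y * f Y) \<and>
               u X = (LINT Y:cyl \<Omega> T|lborel. G X Y * f Y))))"

definition L2sq :: "('a::euclidean_space) set \<Rightarrow> ('a \<Rightarrow> real) \<Rightarrow> ennreal" where
  "L2sq S f = (\<integral>\<^sup>+ X \<in> S. ennreal ((f X)\<^sup>2) \<partial>lborel)"

definition c_appr :: "nat \<Rightarrow> real \<Rightarrow> real \<Rightarrow> real \<Rightarrow> real \<Rightarrow> real" where
  "c_appr n \<omega> \<theta> \<Lambda> \<beta> = 2 ^ (n + 2) *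
     sqrt (\<omega> powr (2 - 2 / real n) * \<theta> powr (-2)
           + 2 * \<Lambda>\<^sup>2 * \<omega> powr (2 / real n) * \<beta>\<^sup>2 * \<theta> powr (-2 - 2 / real n))"

definition kappa_c :: "real \<Rightarrow> real \<Rightarrow> real \<Rightarrow> real" where
  "kappa_c lam \<Lambda> \<beta> = sqrt (4 * \<Lambda>\<^sup>2 / lam\<^sup>2 + 1 / (2 * lam * \<beta>))"

definition c_rho :: "real \<Rightarrow> real \<Rightarrow> real \<Rightarrow> real" where
  "c_rho \<rho> \<kappa> ca = exp 1 * (2 + 1 / \<rho>) * \<kappa> * ca"

end

theory Submission
  imports Defs
begin

text \<open>
  Cover \<open>Q\<^sub>X\<close> by parabolic cells of side \<open>\<eta>\<close> in space and \<open>\<beta> \<eta>\<^sup>2\<close> in time, with \<open>\<eta>\<close> of order \<open>1 / L\<close>,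
  so that \<open>L\<close> successive enlargements by neighbouring cells stay in the enlarged cylinder, and split every cell
  into \<open>m\<^sup>n\<^sup>+\<^sup>1\<close> subcells. On each cell a local solution satisfies the Caccioppoli inequality and, by testing with
  its own time differences, a bound for its time translations; together they control its oscillation over a
  subcell. Hence a solution all of whose subcell means vanish loses a factor \<open>exp (-2)\<close> in squared \<open>L\<^sup>2\<close> norm
  from each layer to the previous one once \<open>m\<close> is a large constant. Since the same means serve all layers,
  subtracting their Riesz representers approximates \<open>G(\<sqdot>, Y)\<close> with rank \<open>O(L\<^sup>n\<^sup>+\<^sup>2)\<close>, which for small \<open>\<epsilon>\<close> is below
  \<open>c\<^sup>n\<^sup>+\<^sup>2 L\<^sup>n\<^sup>+\<^sup>3\<close> whatever the constants are.

  The estimates apply to \<open>G(\<sqdot>, Y)\<close> because it is the limit, away from \<open>Y\<close>, of the solutions whose sources are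
  averages over small balls around \<open>Y\<close>; the maximum principle bounds these solutions uniformly.
\<close>

section \<open>Square-integrable functions\<close>

text \<open>A weak solution \<open>u\<close> has a spatial gradient but no time derivative, so it
  cannot simply be inserted into its own equation. Every estimate is therefore run with time
  differences of \<open>u\<close>; time derivatives occur only on C^1 test functions. The zero
  extension of \<open>u\<close> stays in the closure of the test functions, so a cell that crosses
  the boundary of \<Omega> is treated like an interior one.

  For a fixed Y nothing is given about a gradient of G(., Y): the hypothesis on G speaks of
  solutions with bounded sources, almost everywhere. Hence the local estimate is cast as a bound on
  the double integral of (u Y - u X)^2 over pairs in a common subcell by the squared norm of u over
  the neighbouring cells. It contains no gradient, so bounded pointwise convergence carries it to
  G(., Y).

  The span of the functions G(., Y) need not be complete. Orthogonal projections are replaced by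
  almost orthogonal ones inside the span, at the price of a factor exp 2 that one extra layer pays
  for. Parabolic scaling gives O(L^n) cells in space and O(L^2) in time, hence the exponent n +
  2.\<close>

definition L2 :: "('a::euclidean_space \<Rightarrow> 'b::euclidean_space) \<Rightarrow> bool" where
  "L2 f \<longleftrightarrow> f \<in> borel_measurable borel \<and> integrable lborel (\<lambda>x. (norm (f x))\<^sup>2)"

text \<open>Squared norms are used instead of norms: constants mostly matter only up to fixed
  factors, so \<open>2 * sqn f + 2 * sqn g\<close> takes the place of the triangle
  inequality.\<close>

definition sqn :: "('a::euclidean_space \<Rightarrow> 'b::euclidean_space) \<Rightarrow> real" where
  "sqn f = (LINT x|lborel. (norm (f x))\<^sup>2)"

lemma L2_meas [measurable_dest]: "L2 f \<Longrightarrow> f \<in> borel_measurable borel"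
  by (simp add: L2_def)

lemma L2_int: "L2 f \<Longrightarrow> integrable lborel (\<lambda>x. (norm (f x))\<^sup>2)"
  by (simp add: L2_def)

lemma sqn_nonneg [simp]: "0 \<le> sqn f"
  by (simp add: sqn_def)

lemma L2_bdd:
  fixes f :: "'a::euclidean_space \<Rightarrow> 'b::euclidean_space" and g :: "'a \<Rightarrow> 'c::euclidean_space"
  assumes f: "f \<in> borel_measurable borel" and g: "L2 g"
    and le: "AE x in lborel. norm (f x) \<le> C * norm (g x)"
  shows "L2 f" and "sqn f \<le> C\<^sup>2 * sqn g"
proof -
  have le2: "AE x in lborel. (norm (f x))\<^sup>2 \<le> C\<^sup>2 * (norm (g x))\<^sup>2"
    using le
  proof eventually_elim
    case (elim x)
    then have "(norm (f x))\<^sup>2 \<le> (C * norm (g x))\<^sup>2" by (intro power_mono) auto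
    then show ?case by (simp add: power_mult_distrib)
  qed
  have i: "integrable lborel (\<lambda>x. C\<^sup>2 * (norm (g x))\<^sup>2)" using L2_int[OF g] by simp
  have if': "integrable lborel (\<lambda>x. (norm (f x))\<^sup>2)"
    by (rule Bochner_Integration.integrable_bound[OF i]) (use f le2 in \<open>auto elim: eventually_mono\<close>)
  show "L2 f" using f if' by (simp add: L2_def)
  have "sqn f \<le> (LINT x|lborel. C\<^sup>2 * (norm (g x))\<^sup>2)"
    unfolding sqn_def by (rule integral_mono_AE[OF if' i le2])
  then show "sqn f \<le> C\<^sup>2 * sqn g" by (simp add: sqn_def)
qed

lemma norm_add_sq: "(norm (a + b :: 'a::real_inner))\<^sup>2 \<le> 2 * (norm a)\<^sup>2 + 2 * (norm b)\<^sup>2"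
proof -
  have "0 \<le> (norm (a - b))\<^sup>2" by simp
  then show ?thesis by (simp add: power2_norm_eq_inner inner_simps inner_commute)
qed

lemma L2_zero [simp]: "L2 (\<lambda>x. 0)"
  by (simp add: L2_def)

lemma L2_add:
  assumes "L2 f" "L2 g" shows "L2 (\<lambda>x. f x + g x)" and "sqn (\<lambda>x. f x + g x) \<le> 2 * sqn f + 2 * sqn g"
proof -
  note [measurable] = L2_meas[OF assms(1)] L2_meas[OF assms(2)]
  have i: "integrable lborel (\<lambda>x. 2 * (norm (f x))\<^sup>2 + 2 * (norm (g x))\<^sup>2)"
    using assms by (simp add: L2_def)
  have if': "integrable lborel (\<lambda>x. (norm (f x + g x))\<^sup>2)"
    by (rule Bochner_Integration.integrable_bound[OF i]) (use norm_add_sq in \<open>auto\<close>)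
  show "L2 (\<lambda>x. f x + g x)" using if' by (simp add: L2_def)
  have "sqn (\<lambda>x. f x + g x) \<le> (LINT x|lborel. 2 * (norm (f x))\<^sup>2 + 2 * (norm (g x))\<^sup>2)"
    unfolding sqn_def by (rule integral_mono[OF if' i]) (rule norm_add_sq)
  then show "sqn (\<lambda>x. f x + g x) \<le> 2 * sqn f + 2 * sqn g"
    using assms by (simp add: sqn_def L2_int)
qed

lemma L2_scaleR:
  assumes "L2 f" shows "L2 (\<lambda>x. c *\<^sub>R f x)" and "sqn (\<lambda>x. c *\<^sub>R f x) = c\<^sup>2 * sqn f"
  using assms by (auto simp: L2_def sqn_def power_mult_distrib)

lemma L2_mult:
  fixes f :: "'a::euclidean_space \<Rightarrow> real"
  assumes "L2 f" shows "L2 (\<lambda>x. c * f x)"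
  using L2_scaleR(1)[OF assms, of c] by simp

lemma L2_minus:
  assumes "L2 f" shows "L2 (\<lambda>x. - f x)" and "sqn (\<lambda>x. - f x) = sqn f"
  using assms by (auto simp: L2_def sqn_def)

lemma L2_diff:
  assumes "L2 f" "L2 g" shows "L2 (\<lambda>x. f x - g x)" and "sqn (\<lambda>x. f x - g x) \<le> 2 * sqn f + 2 * sqn g"
  using L2_add[OF assms(1) L2_minus(1)[OF assms(2)]] L2_minus(2)[OF assms(2)] by auto

lemma sqn_commute: "sqn (\<lambda>x. f x - g x) = sqn (\<lambda>x. g x - f x)"
  by (simp add: sqn_def norm_minus_commute)

lemma sqn_triangle:
  assumes "L2 f" "L2 g" "L2 h"
  shows "sqn (\<lambda>x. f x - h x) \<le> 2 * sqn (\<lambda>x. f x - g x) + 2 * sqn (\<lambda>x. g x - h x)"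
  using L2_add(2)[OF L2_diff(1)[OF assms(1,2)] L2_diff(1)[OF assms(2,3)]] by simp

lemma L2_inner:
  fixes f g :: "'a::euclidean_space \<Rightarrow> 'b::euclidean_space"
  assumes "L2 f" "L2 g"
  shows "integrable lborel (\<lambda>x. f x \<bullet> g x)"
    and "0 < s \<Longrightarrow> \<bar>LINT x|lborel. f x \<bullet> g x\<bar> \<le> s / 2 * sqn f + 1 / (2 * s) * sqn g"
    and "\<bar>LINT x|lborel. f x \<bullet> g x\<bar> \<le> sqrt (sqn f) * sqrt (sqn g)"
proof -
  note [measurable] = L2_meas[OF assms(1)] L2_meas[OF assms(2)]
  have pw: "\<bar>f x \<bullet> g x\<bar> \<le> s / 2 * (norm (f x))\<^sup>2 + 1 / (2 * s) * (norm (g x))\<^sup>2" if "0 < s" for s x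
  proof -
    have "\<bar>f x \<bullet> g x\<bar> \<le> norm (f x) * norm (g x)" by (rule Cauchy_Schwarz_ineq2)
    also have "\<dots> \<le> s / 2 * (norm (f x))\<^sup>2 + 1 / (2 * s) * (norm (g x))\<^sup>2"
    proof -
      have "0 \<le> (s * norm (f x) - norm (g x))\<^sup>2" by simp
      then have "2 * s * (norm (f x) * norm (g x)) \<le> s\<^sup>2 * (norm (f x))\<^sup>2 + (norm (g x))\<^sup>2"
        by (simp add: power2_eq_square algebra_simps)
      then show ?thesis using that by (simp add: field_simps power2_eq_square)
    qed
    finally show ?thesis .
  qed
  have ib: "integrable lborel (\<lambda>x. s / 2 * (norm (f x))\<^sup>2 + 1 / (2 * s) * (norm (g x))\<^sup>2)" for s
    by (intro Bochner_Integration.integrable_add integrable_mult_right L2_int assms)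
  show i: "integrable lborel (\<lambda>x. f x \<bullet> g x)"
    by (rule Bochner_Integration.integrable_bound[OF ib[of 1]]) (use pw[of 1] in \<open>auto simp: abs_of_nonneg\<close>)
  have young: "\<bar>LINT x|lborel. f x \<bullet> g x\<bar> \<le> s / 2 * sqn f + 1 / (2 * s) * sqn g" if s: "0 < s" for s
  proof -
    have "\<bar>LINT x|lborel. f x \<bullet> g x\<bar> \<le> (LINT x|lborel. \<bar>f x \<bullet> g x\<bar>)"
      by (rule integral_abs_bound)
    also have "\<dots> \<le> (LINT x|lborel. s / 2 * (norm (f x))\<^sup>2 + 1 / (2 * s) * (norm (g x))\<^sup>2)"
      by (rule integral_mono[OF _ ib]) (use i pw[OF s] in auto)
    also have "\<dots> = s / 2 * sqn f + 1 / (2 * s) * sqn g"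
      unfolding sqn_def
      by (subst Bochner_Integration.integral_add) (auto intro!: integrable_mult_right L2_int assms)
    finally show ?thesis .
  qed
  show "0 < s \<Longrightarrow> \<bar>LINT x|lborel. f x \<bullet> g x\<bar> \<le> s / 2 * sqn f + 1 / (2 * s) * sqn g"
    by (rule young)
  show "\<bar>LINT x|lborel. f x \<bullet> g x\<bar> \<le> sqrt (sqn f) * sqrt (sqn g)"
  proof (rule field_le_epsilon)
    fix e :: real assume e: "0 < e"
    define a where "a = sqrt (sqn f)"
    define b where "b = sqrt (sqn g)"
    have a: "0 \<le> a" "sqn f = a\<^sup>2" and b: "0 \<le> b" "sqn g = b\<^sup>2" by (auto simp: a_def b_def)
    define d where "d = e / (a + b + 1)"
    have d: "0 < d" using e a b by (simp add: d_def)
    \<comment> \<open>The optimal weight in Young's inequality is b / a. The shift by d keeps it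
      positive and finite when a or b vanishes, and d is so small that the resulting error is at
      most e.\<close>
    define s where "s = (b + d) / (a + d)"
    have s: "0 < s" using a b d by (simp add: s_def)
    have "\<bar>LINT x|lborel. f x \<bullet> g x\<bar> \<le> s / 2 * a\<^sup>2 + 1 / (2 * s) * b\<^sup>2"
      using young[OF s] a b by simp
    also have "\<dots> \<le> s / 2 * (a * (a + d)) + 1 / (2 * s) * (b * (b + d))"
      using s a b d by (intro add_mono mult_left_mono) (auto simp: power2_eq_square intro!: mult_left_mono)
    also have "\<dots> = a * (b + d) / 2 + b * (a + d) / 2"
    proof -
      have "s * (a + d) = b + d" "(b + d) / s = a + d" using a b d by (auto simp: s_def)
      have "s / 2 * (a * (a + d)) = a * (s * (a + d)) / 2" by (simp add: mult_ac)
      moreover have "1 / (2 * s) * (b * (b + d)) = b * ((b + d) / s) / 2" by (simp add: mult_ac)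
      ultimately show ?thesis using \<open>s * (a + d) = b + d\<close> \<open>(b + d) / s = a + d\<close> by (simp only:)
    qed
    also have "\<dots> \<le> a * b + d * (a + b + 1)"
      using a b d by (simp add: field_simps)
    also have "\<dots> = a * b + e" using a b by (simp add: d_def)
    finally show "\<bar>LINT x|lborel. f x \<bullet> g x\<bar> \<le> sqrt (sqn f) * sqrt (sqn g) + e"
      by (simp add: a_def b_def)
  qed
qed

section \<open>Translation invariance of integrals and L^2 norms\<close>

lemma distr_lborel_shift: "distr lborel borel (\<lambda>x. x + c) = (lborel :: 'a::euclidean_space measure)"
proof -
  have "(+) c = (\<lambda>x. x + c)" by (auto simp: add.commute)
  then show ?thesis using lborel_distr_plus[of c] by simp
qed

lemma integral_shift:
  fixes f :: "'a::euclidean_space \<Rightarrow> real"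
  assumes [measurable]: "f \<in> borel_measurable borel"
  shows "(LINT x|lborel. f (x + c)) = (LINT x|lborel. f x)"
    and "integrable lborel (\<lambda>x. f (x + c)) \<longleftrightarrow> integrable lborel f"
proof -
  have "(LINT x|lborel. f x) = (LINT x|distr lborel borel (\<lambda>x. x + c). f x)"
    by (simp add: distr_lborel_shift)
  also have "\<dots> = (LINT x|lborel. f (x + c))" by (subst integral_distr) auto
  finally show "(LINT x|lborel. f (x + c)) = (LINT x|lborel. f x)" by simp
  have "integrable (distr lborel borel (\<lambda>x. x + c)) f = integrable lborel (\<lambda>x. f (x + c))"
    by (rule integrable_distr_eq) auto
  then show "integrable lborel (\<lambda>x. f (x + c)) \<longleftrightarrow> integrable lborel f"
    by (simp add: distr_lborel_shift)
qed

lemma nn_integral_shift: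
  fixes f :: "'a::euclidean_space \<Rightarrow> ennreal"
  assumes [measurable]: "f \<in> borel_measurable borel"
  shows "(\<integral>\<^sup>+x. f (x + c) \<partial>lborel) = (\<integral>\<^sup>+x. f x \<partial>lborel)"
proof -
  have "(\<integral>\<^sup>+x. f x \<partial>lborel) = (\<integral>\<^sup>+x. f x \<partial>distr lborel borel (\<lambda>x. x + c))"
    by (simp add: distr_lborel_shift)
  also have "\<dots> = (\<integral>\<^sup>+x. f (x + c) \<partial>lborel)" by (subst nn_integral_distr) auto
  finally show ?thesis by simp
qed

lemma L2_shift:
  assumes "L2 f" shows "L2 (\<lambda>x. f (x + c))" and "sqn (\<lambda>x. f (x + c)) = sqn f"
proof -
  note [measurable] = L2_meas[OF assms]
  have "integrable lborel (\<lambda>x. (norm (f (x + c)))\<^sup>2) = integrable lborel (\<lambda>x. (norm (f x))\<^sup>2)"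
    by (rule integral_shift(2)) measurable
  then show "L2 (\<lambda>x. f (x + c))" using L2_int[OF assms] by (simp add: L2_def)
  show "sqn (\<lambda>x. f (x + c)) = sqn f"
    unfolding sqn_def by (rule integral_shift(1)[of "\<lambda>x. (norm (f x))\<^sup>2"]) measurable
qed

lemma sqn_shift_diff:
  assumes "L2 f" "L2 g"
  shows "sqn (\<lambda>x. f (x + c) - g (x + c)) = sqn (\<lambda>x. f x - g x)"
  using L2_shift(2)[OF L2_diff(1)[OF assms], of c] by simp

lemma L2_indicator:
  assumes "L2 f" and [measurable]: "A \<in> sets borel"
  shows "L2 (\<lambda>x. indicator A x *\<^sub>R f x)" and "sqn (\<lambda>x. indicator A x *\<^sub>R f x) \<le> sqn f"
proof -
  note [measurable] = L2_meas[OF assms(1)]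
  have le: "AE x in lborel. norm (indicator A x *\<^sub>R f x) \<le> 1 * norm (f x)"
    by (auto simp: indicator_def)
  show "L2 (\<lambda>x. indicator A x *\<^sub>R f x)" by (rule L2_bdd(1)[OF _ assms(1) le]) measurable
  show "sqn (\<lambda>x. indicator A x *\<^sub>R f x) \<le> sqn f"
    using L2_bdd(2)[OF _ assms(1) le] by simp
qed

lemma L2_Pair:
  assumes "L2 f" "L2 g"
  shows "L2 (\<lambda>x. (f x, g x))" and "sqn (\<lambda>x. (f x, g x)) = sqn f + sqn g"
proof -
  note [measurable] = L2_meas[OF assms(1)] L2_meas[OF assms(2)]
  have *: "(norm (f x, g x))\<^sup>2 = (norm (f x))\<^sup>2 + (norm (g x))\<^sup>2" for x
    by (simp add: norm_Pair)
  show "L2 (\<lambda>x. (f x, g x))" using assms by (simp add: L2_def *)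
  show "sqn (\<lambda>x. (f x, g x)) = sqn f + sqn g"
    using assms by (simp add: sqn_def * L2_int)
qed

lemma L2_fst: assumes "L2 p" shows "L2 (\<lambda>x. fst (p x))" "sqn (\<lambda>x. fst (p x)) \<le> sqn p"
proof -
  note [measurable] = L2_meas[OF assms]
  have le: "AE x in lborel. norm (fst (p x)) \<le> 1 * norm (p x)" by (intro AE_I2) (simp add: norm_fst_le[of "fst (p x)" "snd (p x)" for x, simplified])
  have m: "(\<lambda>x. fst (p x)) \<in> borel_measurable borel" by (rule measurable_compose[OF L2_meas[OF assms]]) (intro borel_measurable_continuous_onI continuous_intros)
  show "L2 (\<lambda>x. fst (p x))" "sqn (\<lambda>x. fst (p x)) \<le> sqn p"
    using L2_bdd[OF m assms le] by auto
qed

lemma L2_snd: assumes "L2 p" shows "L2 (\<lambda>x. snd (p x))" "sqn (\<lambda>x. snd (p x)) \<le> sqn p"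
proof -
  note [measurable] = L2_meas[OF assms]
  have le: "AE x in lborel. norm (snd (p x)) \<le> 1 * norm (p x)" by (intro AE_I2) (simp add: norm_snd_le[of "snd (p x)" "fst (p x)" for x, simplified])
  have m: "(\<lambda>x. snd (p x)) \<in> borel_measurable borel" by (rule measurable_compose[OF L2_meas[OF assms]]) (intro borel_measurable_continuous_onI continuous_intros)
  show "L2 (\<lambda>x. snd (p x))" "sqn (\<lambda>x. snd (p x)) \<le> sqn p"
    using L2_bdd[OF m assms le] by auto
qed

lemma L2_compact_support:
  fixes f :: "'a::euclidean_space \<Rightarrow> 'b::euclidean_space"
  assumes c: "continuous_on UNIV f" and K: "compact K" and z: "\<And>x. x \<notin> K \<Longrightarrow> f x = 0"
  shows "L2 f" and "\<exists>B. \<forall>x. norm (f x) \<le> B"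
proof -
  have m[measurable]: "f \<in> borel_measurable borel" using c by (rule borel_measurable_continuous_onI)
  have "compact (f ` K)" by (rule compact_continuous_image[OF continuous_on_subset[OF c] K]) auto
  then obtain B where B: "\<And>x. x \<in> K \<Longrightarrow> norm (f x) \<le> B" using compact_imp_bounded bounded_iff
    by (metis imageI)
  then have B': "norm (f x) \<le> \<bar>B\<bar>" for x by (cases "x \<in> K") (use z in force)+
  then show "\<exists>B. \<forall>x. norm (f x) \<le> B" by blast
  have Km: "K \<in> sets borel" "emeasure lborel K < \<infinity>"
    using K emeasure_bounded_finite[OF compact_imp_bounded[OF K]] by (auto simp: compact_imp_closed)
  have i: "integrable lborel (\<lambda>x. B\<^sup>2 * indicator K x :: real)"
    by (rule integrable_mult_right) (use Km in simp)
  have "integrable lborel (\<lambda>x. (norm (f x))\<^sup>2)"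
  proof (rule Bochner_Integration.integrable_bound[OF i])
    show "AE x in lborel. norm ((norm (f x))\<^sup>2) \<le> norm (B\<^sup>2 * indicator K x :: real)"
    proof (rule AE_I2)
      fix x
      show "norm ((norm (f x))\<^sup>2) \<le> norm (B\<^sup>2 * indicator K x :: real)"
        using z[of x] B[of x] by (cases "x \<in> K") (auto intro!: power_mono)
    qed
  qed measurable
  then show "L2 f" by (simp add: L2_def)
qed

text \<open>Cauchy-Schwarz with an explicit error. Through this bound, facts about test functions
  reach their L^2 limits.\<close>

lemma inner_tendsto:
  fixes F :: "'a::euclidean_space \<Rightarrow> 'b::euclidean_space"
  assumes F: "L2 F" and p: "L2 p" and q: "L2 q" and e: "sqn (\<lambda>x. p x - q x) \<le> e\<^sup>2" "0 \<le> e"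
  shows "\<bar>(LINT x|lborel. F x \<bullet> p x) - (LINT x|lborel. F x \<bullet> q x)\<bar> \<le> sqrt (sqn F) * e"
proof -
  have "(LINT x|lborel. F x \<bullet> p x) - (LINT x|lborel. F x \<bullet> q x) = (LINT x|lborel. F x \<bullet> (p x - q x))"
    by (simp add: inner_diff_right L2_inner[OF F p] L2_inner[OF F q])
  also have "\<bar>\<dots>\<bar> \<le> sqrt (sqn F) * sqrt (sqn (\<lambda>x. p x - q x))"
    by (rule L2_inner(3)[OF F L2_diff(1)[OF p q]])
  also have "\<dots> \<le> sqrt (sqn F) * e"
    using e by (intro mult_left_mono real_le_lsqrt) auto
  finally show ?thesis .
qed

section \<open>Test functions\<close>

type_synonym 'n st = "(real^'n) \<times> real"

text \<open>Regularity is separated from the support condition of \<open>C1c\<close> because the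
  cut-offs used later are constant in time or equal to 1 far away, and so have no compact
  support.\<close>

definition C1 :: "('n::finite st \<Rightarrow> real) \<Rightarrow> bool" where
  "C1 \<phi> \<longleftrightarrow> (\<forall>X. \<phi> differentiable (at X)) \<and> continuous_on UNIV (dt \<phi>) \<and> continuous_on UNIV (gradx \<phi>)"

lemma C1c_alt: "C1c S \<phi> \<longleftrightarrow> C1 \<phi> \<and> compact (tsupp \<phi>) \<and> tsupp \<phi> \<subseteq> S"
  by (auto simp: C1c_def C1_def)

text \<open>\<open>gradx\<close> and \<open>dt\<close> only record the Frechet derivative in the
  coordinate directions; linearity recovers the whole derivative, which is what the chain and
  product rules of the library work with.\<close>

lemma C1_has_derivative:
  fixes \<phi> :: "'n::finite st \<Rightarrow> real"
  assumes "C1 \<phi>"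
  shows "(\<phi> has_derivative (\<lambda>v. gradx \<phi> X \<bullet> fst v + snd v * dt \<phi> X)) (at X)"
proof -
  let ?D = "frechet_derivative \<phi> (at X)"
  have d: "(\<phi> has_derivative ?D) (at X)" using assms unfolding C1_def by (metis frechet_derivative_works)
  then interpret D: linear ?D by (rule has_derivative_linear)
  have "?D v = gradx \<phi> X \<bullet> fst v + snd v * dt \<phi> X" for v
  proof -
    have "v = (\<Sum>i\<in>UNIV. (fst v $ i) *\<^sub>R (axis i 1, 0)) + snd v *\<^sub>R (0, 1)"
    proof (rule prod_eqI)
      have "fst v = (\<Sum>i\<in>UNIV. (fst v $ i) *\<^sub>R axis i 1)"
        using basis_expansion[of "fst v"] by (simp add: scalar_mult_eq_scaleR)
      then show "fst v = fst ((\<Sum>i\<in>UNIV. (fst v $ i) *\<^sub>R (axis i 1, 0)) + snd v *\<^sub>R (0, 1))"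
        by (simp add: fst_sum)
    qed (simp add: snd_sum)
    then have "?D v = ?D ((\<Sum>i\<in>UNIV. (fst v $ i) *\<^sub>R (axis i 1, 0)) + snd v *\<^sub>R (0, 1))" by simp
    also have "\<dots> = (\<Sum>i\<in>UNIV. (fst v $ i) * ?D (axis i 1, 0)) + snd v * ?D (0, 1)"
      by (simp add: D.add D.sum D.scaleR del: scaleR_Pair)
    finally show ?thesis by (simp add: gradx_def dt_def inner_vec_def mult.commute)
  qed
  then show ?thesis using d by (metis (no_types, lifting) ext)
qed

lemma C1I:
  fixes \<phi> :: "'n::finite st \<Rightarrow> real"
  assumes d: "\<And>X. (\<phi> has_derivative (\<lambda>v. g X \<bullet> fst v + snd v * d X)) (at X)"
    and c: "continuous_on UNIV g" "continuous_on UNIV d"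
  shows "C1 \<phi>" "gradx \<phi> = g" "dt \<phi> = d"
proof -
  have f: "frechet_derivative \<phi> (at X) = (\<lambda>v. g X \<bullet> fst v + snd v * d X)" for X
    using frechet_derivative_at[OF d[of X]] by simp
  show 1: "gradx \<phi> = g" by (rule ext) (simp add: gradx_def f vec_eq_iff inner_axis)
  show 2: "dt \<phi> = d" by (rule ext) (simp add: dt_def f)
  show "C1 \<phi>" using d c by (auto simp: C1_def 1 2 differentiable_def)
qed

lemma C1_cont: "C1 \<phi> \<Longrightarrow> continuous_on UNIV \<phi>"
  by (auto simp: C1_def intro!: continuous_at_imp_continuous_on differentiable_imp_continuous_within)

lemma C1_meas:
  assumes "C1 \<phi>"
  shows "\<phi> \<in> borel_measurable borel" "gradx \<phi> \<in> borel_measurable borel" "dt \<phi> \<in> borel_measurable borel"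
  using C1_cont[OF assms] assms by (auto simp: C1_def intro!: borel_measurable_continuous_onI)

lemma C1_mult:
  fixes \<phi> :: "'n::finite st \<Rightarrow> real"
  assumes "C1 \<phi>" "C1 \<kappa>"
  shows "C1 (\<lambda>X. \<kappa> X * \<phi> X)"
    and "gradx (\<lambda>X. \<kappa> X * \<phi> X) = (\<lambda>X. \<kappa> X *\<^sub>R gradx \<phi> X + \<phi> X *\<^sub>R gradx \<kappa> X)"
    and "dt (\<lambda>X. \<kappa> X * \<phi> X) = (\<lambda>X. \<kappa> X * dt \<phi> X + \<phi> X * dt \<kappa> X)"
proof -
  have d: "((\<lambda>X. \<kappa> X * \<phi> X) has_derivative (\<lambda>v. (\<kappa> X *\<^sub>R gradx \<phi> X + \<phi> X *\<^sub>R gradx \<kappa> X) \<bullet> fst v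
      + snd v * (\<kappa> X * dt \<phi> X + \<phi> X * dt \<kappa> X))) (at X)" for X
    using has_derivative_mult[OF C1_has_derivative[OF assms(2)] C1_has_derivative[OF assms(1)], of X]
    by (simp add: inner_add_left algebra_simps)
  note c = C1_cont[OF assms(1)] C1_cont[OF assms(2)] assms[unfolded C1_def]
  have 1: "continuous_on UNIV (\<lambda>X. \<kappa> X *\<^sub>R gradx \<phi> X + \<phi> X *\<^sub>R gradx \<kappa> X)"
    using c by (auto intro!: continuous_intros)
  have 2: "continuous_on UNIV (\<lambda>X. \<kappa> X * dt \<phi> X + \<phi> X * dt \<kappa> X)"
    using c by (auto intro!: continuous_intros)
  note C1I[OF d 1 2]
  then show "C1 (\<lambda>X. \<kappa> X * \<phi> X)"
    and "gradx (\<lambda>X. \<kappa> X * \<phi> X) = (\<lambda>X. \<kappa> X *\<^sub>R gradx \<phi> X + \<phi> X *\<^sub>R gradx \<kappa> X)"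
    and "dt (\<lambda>X. \<kappa> X * \<phi> X) = (\<lambda>X. \<kappa> X * dt \<phi> X + \<phi> X * dt \<kappa> X)" by auto
qed

lemma C1_add:
  fixes \<phi> :: "'n::finite st \<Rightarrow> real"
  assumes "C1 \<phi>" "C1 \<psi>"
  shows "C1 (\<lambda>X. a * \<phi> X + b * \<psi> X)"
    and "gradx (\<lambda>X. a * \<phi> X + b * \<psi> X) = (\<lambda>X. a *\<^sub>R gradx \<phi> X + b *\<^sub>R gradx \<psi> X)"
proof -
  have d: "((\<lambda>X. a * \<phi> X + b * \<psi> X) has_derivative (\<lambda>v. (a *\<^sub>R gradx \<phi> X + b *\<^sub>R gradx \<psi> X) \<bullet> fst v
      + snd v * (a * dt \<phi> X + b * dt \<psi> X))) (at X)" for X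
    using has_derivative_add[OF has_derivative_mult_right[OF C1_has_derivative[OF assms(1)], of a] has_derivative_mult_right[OF C1_has_derivative[OF assms(2)], of b], of X]
    by (simp add: inner_add_left algebra_simps)
  note c = C1_cont[OF assms(1)] C1_cont[OF assms(2)] assms[unfolded C1_def]
  have 1: "continuous_on UNIV (\<lambda>X. a *\<^sub>R gradx \<phi> X + b *\<^sub>R gradx \<psi> X)"
    using c by (auto intro!: continuous_intros)
  have 2: "continuous_on UNIV (\<lambda>X. a * dt \<phi> X + b * dt \<psi> X)"
    using c by (auto intro!: continuous_intros)
  note C1I[OF d 1 2]
  then show "C1 (\<lambda>X. a * \<phi> X + b * \<psi> X)"
    and "gradx (\<lambda>X. a * \<phi> X + b * \<psi> X) = (\<lambda>X. a *\<^sub>R gradx \<phi> X + b *\<^sub>R gradx \<psi> X)" by auto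
qed

lemma C1_shift:
  fixes \<phi> :: "'n::finite st \<Rightarrow> real"
  assumes "C1 \<phi>"
  shows "C1 (\<lambda>X. \<phi> (X + a))"
    and "gradx (\<lambda>X. \<phi> (X + a)) = (\<lambda>X. gradx \<phi> (X + a))"
    and "dt (\<lambda>X. \<phi> (X + a)) = (\<lambda>X. dt \<phi> (X + a))"
proof -
  have i: "((\<lambda>X. X + a) has_derivative (\<lambda>v. v)) (at X)" for X :: "'n st"
    by (auto intro!: derivative_eq_intros)
  have d: "((\<lambda>X. \<phi> (X + a)) has_derivative (\<lambda>v. gradx \<phi> (X + a) \<bullet> fst v + snd v * dt \<phi> (X + a))) (at X)" for X
    by (rule has_derivative_compose[OF i, of \<phi>]) (rule C1_has_derivative[OF assms])
  have cs: "continuous_on UNIV (\<lambda>X. f (X + a))" if "continuous_on UNIV f" for f :: "'n st \<Rightarrow> 'b::topological_space"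
    by (rule continuous_on_compose2[OF that]) (auto intro!: continuous_intros)
  have 1: "continuous_on UNIV (\<lambda>X. gradx \<phi> (X + a))" "continuous_on UNIV (\<lambda>X. dt \<phi> (X + a))"
    using assms cs by (auto simp: C1_def)
  note C1I[OF d 1]
  then show "C1 (\<lambda>X. \<phi> (X + a))"
    and "gradx (\<lambda>X. \<phi> (X + a)) = (\<lambda>X. gradx \<phi> (X + a))"
    and "dt (\<lambda>X. \<phi> (X + a)) = (\<lambda>X. dt \<phi> (X + a))" by auto
qed

lemma C1_comp:
  fixes \<phi> :: "'n::finite st \<Rightarrow> real"
  assumes "C1 \<phi>" and h: "\<And>r. (h has_real_derivative h' r) (at r)" and ch: "continuous_on UNIV h'"
  shows "C1 (\<lambda>X. h (\<phi> X))" and "gradx (\<lambda>X. h (\<phi> X)) = (\<lambda>X. h' (\<phi> X) *\<^sub>R gradx \<phi> X)"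
    and "dt (\<lambda>X. h (\<phi> X)) = (\<lambda>X. h' (\<phi> X) * dt \<phi> X)"
proof -
  have d: "((\<lambda>X. h (\<phi> X)) has_derivative (\<lambda>v. (h' (\<phi> X) *\<^sub>R gradx \<phi> X) \<bullet> fst v + snd v * (h' (\<phi> X) * dt \<phi> X))) (at X)" for X
    using has_derivative_compose[OF C1_has_derivative[OF assms(1)] h[unfolded has_field_derivative_def], of X]
    by (simp add: algebra_simps)
  have c: "continuous_on UNIV (\<lambda>X. h' (\<phi> X))"
    by (rule continuous_on_compose2[OF ch C1_cont[OF assms(1)]]) auto
  have 1: "continuous_on UNIV (\<lambda>X. h' (\<phi> X) *\<^sub>R gradx \<phi> X)" "continuous_on UNIV (\<lambda>X. h' (\<phi> X) * dt \<phi> X)"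
    using c assms(1) by (auto simp: C1_def intro!: continuous_intros)
  note C1I[OF d 1]
  then show "C1 (\<lambda>X. h (\<phi> X))" and "gradx (\<lambda>X. h (\<phi> X)) = (\<lambda>X. h' (\<phi> X) *\<^sub>R gradx \<phi> X)"
    and "dt (\<lambda>X. h (\<phi> X)) = (\<lambda>X. h' (\<phi> X) * dt \<phi> X)" by auto
qed

lemma C1_time:
  assumes h: "\<And>r. (h has_real_derivative h' r) (at r)" and ch: "continuous_on UNIV h'"
  shows "C1 (\<lambda>X::'n::finite st. h (snd X))" and "gradx (\<lambda>X::'n st. h (snd X)) = (\<lambda>X. 0)"
proof -
  have i: "(snd has_derivative snd) (at X)" for X :: "'n st" by (rule has_derivative_snd) simp
  have d: "((\<lambda>X::'n st. h (snd X)) has_derivative (\<lambda>v. 0 \<bullet> fst v + snd v * h' (snd X))) (at X)" for X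
    using has_derivative_compose[OF i[of X] h[unfolded has_field_derivative_def]] by (simp add: mult.commute)
  have c: "continuous_on UNIV (\<lambda>X::'n st. h' (snd X))"
    by (rule continuous_on_compose2[OF ch]) (auto intro!: continuous_intros)
  show "C1 (\<lambda>X::'n st. h (snd X))" "gradx (\<lambda>X::'n st. h (snd X)) = (\<lambda>X. 0)"
    using C1I[OF d continuous_on_const c] by auto
qed

lemma notin_tsupp:
  assumes "X \<notin> tsupp \<phi>"
  shows "\<phi> X = 0" "gradx \<phi> X = 0" "dt \<phi> X = 0"
proof -
  show 0: "\<phi> X = 0" using assms closure_subset[of "{X. \<phi> X \<noteq> 0}"] by (auto simp: tsupp_def)
  have o: "open (- tsupp \<phi>)" by (auto simp: tsupp_def)
  have "((\<lambda>X. 0) has_derivative (\<lambda>v. 0)) (at X)" by simp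
  then have "(\<phi> has_derivative (\<lambda>v. 0)) (at X)"
    by (rule has_derivative_transform_within_open[OF _ o]) (use assms closure_subset[of "{X. \<phi> X \<noteq> 0}"] in \<open>auto simp: tsupp_def\<close>)
  then have "frechet_derivative \<phi> (at X) = (\<lambda>v. 0)" using frechet_derivative_at by metis
  then show "gradx \<phi> X = 0" "dt \<phi> X = 0" by (simp_all add: gradx_def dt_def vec_eq_iff)
qed

lemma tsupp_mono:
  assumes "\<And>X. \<psi> X \<noteq> 0 \<Longrightarrow> \<phi> X \<noteq> 0" shows "tsupp \<psi> \<subseteq> tsupp \<phi>"
  unfolding tsupp_def by (rule closure_mono) (use assms in auto)

lemma C1cI_sub:
  assumes "C1 \<psi>" "C1c S \<phi>" "\<And>X. \<psi> X \<noteq> 0 \<Longrightarrow> \<phi> X \<noteq> 0"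
  shows "C1c S \<psi>"
proof -
  have "tsupp \<psi> \<subseteq> tsupp \<phi>" by (rule tsupp_mono) (rule assms(3))
  moreover have "closed (tsupp \<psi>)" by (simp add: tsupp_def)
  ultimately show ?thesis using assms(1,2) unfolding C1c_alt
    by (metis compact_Int_closed inf.absorb2 subset_trans)
qed

text \<open>Bundles a function with its spatial gradient, so that convergence in L^2 in time with
  values in H^1 is \<open>sqn\<close> convergence of a single function. The time derivative is left
  out on purpose: limits do not have one.\<close>

definition jet :: "('n::finite st \<Rightarrow> real) \<Rightarrow> 'n st \<Rightarrow> real \<times> (real^'n)" where
  "jet \<phi> X = (\<phi> X, gradx \<phi> X)"

lemma C1c_C1: "C1c S \<phi> \<Longrightarrow> C1 \<phi>" by (simp add: C1c_alt)

lemma C1c_jet: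
  assumes "C1c S \<phi>"
  shows "continuous_on UNIV (jet \<phi>)" "L2 (jet \<phi>)" "\<And>X. X \<notin> tsupp \<phi> \<Longrightarrow> jet \<phi> X = 0" "L2 (dt \<phi>)"
    "\<exists>B. \<forall>X. \<bar>dt \<phi> X\<bar> \<le> B" "\<exists>B. \<forall>X. norm (gradx \<phi> X) \<le> B" "L2 \<phi>" "L2 (gradx \<phi>)"
proof -
  have C: "C1 \<phi>" and K: "compact (tsupp \<phi>)" using assms by (auto simp: C1c_alt)
  show c: "continuous_on UNIV (jet \<phi>)"
    using C1_cont[OF C] C unfolding jet_def[abs_def] by (auto simp: C1_def intro!: continuous_intros)
  show z: "\<And>X. X \<notin> tsupp \<phi> \<Longrightarrow> jet \<phi> X = 0" by (simp add: jet_def notin_tsupp zero_prod_def)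
  show "L2 (jet \<phi>)" by (rule L2_compact_support(1)[OF c K z])
  have cd: "continuous_on UNIV (dt \<phi>)" and cg: "continuous_on UNIV (gradx \<phi>)" using C by (auto simp: C1_def)
  show "L2 (dt \<phi>)" "\<exists>B. \<forall>X. \<bar>dt \<phi> X\<bar> \<le> B"
    using L2_compact_support[OF cd K notin_tsupp(3)] by simp_all
  show "L2 (gradx \<phi>)" "\<exists>B. \<forall>X. norm (gradx \<phi> X) \<le> B"
    using L2_compact_support[OF cg K notin_tsupp(2)] by simp_all
  show "L2 \<phi>" by (rule L2_compact_support(1)[OF C1_cont[OF C] K]) (rule notin_tsupp)
qed

lemma C1c_mono: "C1c S \<phi> \<Longrightarrow> S \<subseteq> S' \<Longrightarrow> C1c S' \<phi>"
  by (auto simp: C1c_def)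

lemma tsupp_shift: "tsupp (\<lambda>X. \<phi> (X + a)) = (\<lambda>X. X - a) ` tsupp \<phi>"
proof -
  have e: "(\<lambda>X. X - a) = (\<lambda>X. - a + X)" by auto
  have "{X. \<phi> (X + a) \<noteq> 0} = (\<lambda>X. X - a) ` {X. \<phi> X \<noteq> 0}"
  proof (intro equalityI subsetI)
    fix X assume "X \<in> {X. \<phi> (X + a) \<noteq> 0}"
    then show "X \<in> (\<lambda>X. X - a) ` {X. \<phi> X \<noteq> 0}" by (intro image_eqI[of _ _ "X + a"]) auto
  next
    fix X assume "X \<in> (\<lambda>X. X - a) ` {X. \<phi> X \<noteq> 0}"
    then show "X \<in> {X. \<phi> (X + a) \<noteq> 0}" by clarsimp
  qed
  then show ?thesis unfolding tsupp_def e by (simp only: closure_translation)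
qed

lemma C1c_shift:
  assumes "C1c S \<phi>" "(\<lambda>X. X - a) ` tsupp \<phi> \<subseteq> S'"
  shows "C1c S' (\<lambda>X. \<phi> (X + a))" "jet (\<lambda>X. \<phi> (X + a)) = (\<lambda>X. jet \<phi> (X + a))"
proof -
  have "compact ((\<lambda>X. X - a) ` tsupp \<phi>)"
    using assms(1) by (auto simp: C1c_alt intro!: compact_continuous_image continuous_intros)
  then show "C1c S' (\<lambda>X. \<phi> (X + a))"
    using assms C1_shift(1)[of \<phi> a] by (simp add: C1c_alt tsupp_shift)
  show "jet (\<lambda>X. \<phi> (X + a)) = (\<lambda>X. jet \<phi> (X + a))"
    using C1_shift(2)[of \<phi> a] assms(1) by (auto simp: jet_def C1c_alt)
qed

lemma jet_mult:
  assumes "C1 \<phi>" "C1 \<kappa>"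
  shows "jet (\<lambda>X. \<kappa> X * \<phi> X) X = (\<kappa> X * \<phi> X, \<kappa> X *\<^sub>R gradx \<phi> X + \<phi> X *\<^sub>R gradx \<kappa> X)"
  by (simp add: jet_def C1_mult(2)[OF assms])

lemma C1c_mult:
  assumes "C1c S \<phi>" "C1 \<kappa>"
  shows "C1c S (\<lambda>X. \<kappa> X * \<phi> X)"
  by (rule C1cI_sub[OF _ assms(1)]) (use assms C1_mult(1) C1c_C1 in auto)

lemma C1c_add:
  assumes "C1c S \<phi>" "C1c S \<psi>"
  shows "C1c S (\<lambda>X. a * \<phi> X + b * \<psi> X)"
    and "jet (\<lambda>X. a * \<phi> X + b * \<psi> X) = (\<lambda>X. a *\<^sub>R jet \<phi> X + b *\<^sub>R jet \<psi> X)"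
proof -
  have "tsupp (\<lambda>X. a * \<phi> X + b * \<psi> X) \<subseteq> tsupp \<phi> \<union> tsupp \<psi>"
    unfolding tsupp_def closure_Un[symmetric] by (rule closure_mono) auto
  moreover have "closed (tsupp (\<lambda>X. a * \<phi> X + b * \<psi> X))" by (simp add: tsupp_def)
  moreover have "compact (tsupp \<phi> \<union> tsupp \<psi>)" using assms by (auto simp: C1c_alt)
  ultimately have "compact (tsupp (\<lambda>X. a * \<phi> X + b * \<psi> X))" "tsupp (\<lambda>X. a * \<phi> X + b * \<psi> X) \<subseteq> S"
    using assms compact_Int_closed[of "tsupp \<phi> \<union> tsupp \<psi>" "tsupp (\<lambda>X. a * \<phi> X + b * \<psi> X)"]
    by (auto simp: C1c_alt Int_absorb1)
  then show "C1c S (\<lambda>X. a * \<phi> X + b * \<psi> X)"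
    using C1_add(1)[OF assms[THEN C1c_C1]] by (simp add: C1c_alt)
  show "jet (\<lambda>X. a * \<phi> X + b * \<psi> X) = (\<lambda>X. a *\<^sub>R jet \<phi> X + b *\<^sub>R jet \<psi> X)"
    using C1_add(2)[OF assms[THEN C1c_C1]] by (auto simp: jet_def)
qed

section \<open>A C^1 step function\<close>

definition ppart :: "real \<Rightarrow> real" where "ppart r = max 0 r"

text \<open>Piecewise quadratic step that rises from 0 to 1 on the unit interval; its derivative is
  the tent of height 2 with its peak at 1/2. C^1 is enough, since test functions are only required
  to be C^1.\<close>

definition sstep :: "real \<Rightarrow> real" where
  "sstep r = 2 * (ppart r)\<^sup>2 - 4 * (ppart (r - 1/2))\<^sup>2 + 2 * (ppart (r - 1))\<^sup>2"

definition sstep' :: "real \<Rightarrow> real" where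
  "sstep' r = 4 * ppart r - 8 * ppart (r - 1/2) + 4 * ppart (r - 1)"

lemma continuous_ppart [continuous_intros]:
  "continuous_on A f \<Longrightarrow> continuous_on A (\<lambda>x. ppart (f x))"
  unfolding ppart_def by (intro continuous_intros)

lemma ppart_sq_deriv: "((\<lambda>r. (ppart (r - a))\<^sup>2) has_real_derivative 2 * ppart (r - a)) (at r)"
proof -
  consider "r < a" | "r > a" | "r = a" by linarith
  then show ?thesis
  proof cases
    case 1
    have "((\<lambda>r. 0) has_real_derivative 0) (at r)" by simp
    then have "((\<lambda>r. (ppart (r - a))\<^sup>2) has_real_derivative 0) (at r)"
      by (rule has_field_derivative_transform_within_open[of _ _ _ "{..<a}"]) (use 1 in \<open>auto simp: ppart_def\<close>)
    then show ?thesis using 1 by (simp add: ppart_def)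
  next
    case 2
    have "((\<lambda>r. (r - a)\<^sup>2) has_real_derivative 2 * (r - a)) (at r)"
      by (auto intro!: derivative_eq_intros)
    then have "((\<lambda>r. (ppart (r - a))\<^sup>2) has_real_derivative 2 * (r - a)) (at r)"
      by (rule has_field_derivative_transform_within_open[of _ _ _ "{a<..}"]) (use 2 in \<open>auto simp: ppart_def\<close>)
    then show ?thesis using 2 by (simp add: ppart_def)
  next
    case 3
    have "((\<lambda>h. ((ppart (a + h - a))\<^sup>2 - (ppart (a - a))\<^sup>2) / h) \<longlongrightarrow> 0) (at 0)"
    proof (rule Lim_null_comparison)
      show "\<forall>\<^sub>F h in at 0. norm (((ppart (a + h - a))\<^sup>2 - (ppart (a - a))\<^sup>2) / h) \<le> \<bar>h\<bar>"
        by (rule always_eventually) (auto simp: ppart_def max_def power2_eq_square)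
      show "((\<lambda>h::real. \<bar>h\<bar>) \<longlongrightarrow> 0) (at 0)" by (auto intro!: tendsto_eq_intros)
    qed
    then show ?thesis using 3 by (simp add: DERIV_def ppart_def)
  qed
qed

lemma sstep_deriv: "(sstep has_real_derivative sstep' r) (at r)"
proof -
  have "((\<lambda>r. 2 * (ppart (r - 0))\<^sup>2 - 4 * (ppart (r - 1/2))\<^sup>2 + 2 * (ppart (r - 1))\<^sup>2)
      has_real_derivative 2 * (2 * ppart (r - 0)) - 4 * (2 * ppart (r - 1/2)) + 2 * (2 * ppart (r - 1))) (at r)"
    by (intro DERIV_add DERIV_diff DERIV_cmult ppart_sq_deriv)
  then show ?thesis unfolding sstep_def[abs_def] sstep'_def by simp
qed

lemma sstep'_cont: "continuous_on UNIV sstep'"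
  unfolding sstep'_def[abs_def] by (intro continuous_intros)

lemma sstep'_bounds: "0 \<le> sstep' r" "sstep' r \<le> 2" "r \<le> 0 \<Longrightarrow> sstep' r = 0" "1 \<le> r \<Longrightarrow> sstep' r = 0"
  by (auto simp: sstep'_def ppart_def max_def)

lemma sstep_values: "r \<le> 0 \<Longrightarrow> sstep r = 0" "1 \<le> r \<Longrightarrow> sstep r = 1"
  by (auto simp: sstep_def ppart_def max_def power2_eq_square algebra_simps)

lemma sstep_mono: "r \<le> s \<Longrightarrow> sstep r \<le> sstep s"
  by (rule DERIV_nonneg_imp_nondecreasing[of r s sstep]) (use sstep_deriv sstep'_bounds(1) in auto)

lemma sstep_bounds: "0 \<le> sstep r" "sstep r \<le> 1"
  using sstep_mono[of "min r 0" r] sstep_mono[of r "max r 1"] sstep_values(1)[of "min r 0"] sstep_values(2)[of "max r 1"]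
  by auto

lemma sstep_lip: "r \<le> s \<Longrightarrow> sstep s - sstep r \<le> 2 * (s - r)"
proof (cases "r = s")
  case False
  assume "r \<le> s"
  then obtain z where "sstep s - sstep r = (s - r) * sstep' z"
    using MVT2[of r s sstep sstep'] sstep_deriv False by auto
  then show ?thesis using mult_left_mono[OF sstep'_bounds(2)[of z], of "s - r"] \<open>r \<le> s\<close> by simp
qed auto

lemma sstep_cont: "continuous_on UNIV sstep"
  using sstep_deriv by (auto intro!: continuous_at_imp_continuous_on DERIV_isCont)

section \<open>The energy space\<close>

text \<open>The second component plays the role of the spatial gradient: \<open>Hcl S\<close> is the closure of the test functions in \<open>L\<^sup>2\<close> in time with values in \<open>H\<^sup>1\<^sub>0\<close>.\<close>

definition Hcl :: "'n::finite st set \<Rightarrow> ('n st \<Rightarrow> real \<times> (real^'n)) \<Rightarrow> bool" where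
  "Hcl S p \<longleftrightarrow> L2 p \<and> (\<forall>e>0. \<exists>\<psi>. C1c S \<psi> \<and> sqn (\<lambda>X. jet \<psi> X - p X) < e)"

lemma Hcl_L2: "Hcl S p \<Longrightarrow> L2 p" by (simp add: Hcl_def)

lemma HclE:
  assumes "Hcl S p" "0 < e" obtains \<psi> where "C1c S \<psi>" "sqn (\<lambda>X. jet \<psi> X - p X) < e"
  using assms by (auto simp: Hcl_def)

lemma Hcl_mono: "Hcl S p \<Longrightarrow> S \<subseteq> S' \<Longrightarrow> Hcl S' p"
  unfolding Hcl_def using C1c_mono by blast

lemma C1c_Hcl: "C1c S \<psi> \<Longrightarrow> Hcl S (jet \<psi>)"
  unfolding Hcl_def using C1c_jet(2) by (auto simp: sqn_def intro!: exI[of _ \<psi>])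

lemma Hcl_closed:
  assumes p: "L2 p" and a: "\<And>e. 0 < e \<Longrightarrow> \<exists>p'. Hcl S p' \<and> sqn (\<lambda>X. p' X - p X) < e"
  shows "Hcl S p"
  unfolding Hcl_def
proof (intro conjI allI impI)
  fix e :: real assume e: "0 < e"
  obtain p' where p': "Hcl S p'" "sqn (\<lambda>X. p' X - p X) < e / 4" using a[of "e / 4"] e by auto
  obtain \<psi> where \<psi>: "C1c S \<psi>" "sqn (\<lambda>X. jet \<psi> X - p' X) < e / 4" by (rule HclE[OF p'(1), of "e / 4"]) (use e in auto)
  have "sqn (\<lambda>X. jet \<psi> X - p X) \<le> 2 * sqn (\<lambda>X. jet \<psi> X - p' X) + 2 * sqn (\<lambda>X. p' X - p X)"
    by (rule sqn_triangle[OF C1c_jet(2)[OF \<psi>(1)] Hcl_L2[OF p'(1)] p])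
  then show "\<exists>\<psi>. C1c S \<psi> \<and> sqn (\<lambda>X. jet \<psi> X - p X) < e" using \<psi> p'(2) by (intro exI[of _ \<psi>]) auto
qed (rule p)

lemma Hcl_lin:
  assumes "Hcl S p" "Hcl S q"
  shows "Hcl S (\<lambda>X. a *\<^sub>R p X + b *\<^sub>R q X)"
  unfolding Hcl_def
proof (intro conjI allI impI)
  note L = Hcl_L2[OF assms(1)] Hcl_L2[OF assms(2)]
  show "L2 (\<lambda>X. a *\<^sub>R p X + b *\<^sub>R q X)" by (intro L2_add(1) L2_scaleR(1) L)
  fix e :: real assume e: "0 < e"
  define d where "d = e / (4 * (a\<^sup>2 + b\<^sup>2 + 1))"
  have pos: "0 < a\<^sup>2 + b\<^sup>2 + 1" by (smt (verit) zero_le_power2)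
  then have d: "0 < d" using e by (simp add: d_def)
  obtain \<psi> where \<psi>: "C1c S \<psi>" "sqn (\<lambda>X. jet \<psi> X - p X) < d" using HclE[OF assms(1) d] by auto
  obtain \<xi> where \<xi>: "C1c S \<xi>" "sqn (\<lambda>X. jet \<xi> X - q X) < d" using HclE[OF assms(2) d] by auto
  have "sqn (\<lambda>X. a *\<^sub>R jet \<psi> X + b *\<^sub>R jet \<xi> X - (a *\<^sub>R p X + b *\<^sub>R q X))
      = sqn (\<lambda>X. a *\<^sub>R (jet \<psi> X - p X) + b *\<^sub>R (jet \<xi> X - q X))"
    by (simp add: algebra_simps)
  also have "\<dots> \<le> 2 * sqn (\<lambda>X. a *\<^sub>R (jet \<psi> X - p X)) + 2 * sqn (\<lambda>X. b *\<^sub>R (jet \<xi> X - q X))"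
    by (intro L2_add(2) L2_scaleR(1) L2_diff(1) C1c_jet(2)[OF \<psi>(1)] C1c_jet(2)[OF \<xi>(1)] L)
  also have "\<dots> = 2 * (a\<^sup>2 * sqn (\<lambda>X. jet \<psi> X - p X)) + 2 * (b\<^sup>2 * sqn (\<lambda>X. jet \<xi> X - q X))"
    by (subst (1 2) L2_scaleR(2)) (auto intro: L2_diff(1) C1c_jet(2)[OF \<psi>(1)] C1c_jet(2)[OF \<xi>(1)] L)
  also have "\<dots> \<le> 2 * (a\<^sup>2 * d) + 2 * (b\<^sup>2 * d)"
    using \<psi> \<xi> by (intro add_mono mult_left_mono) auto
  also have "\<dots> \<le> 2 * (a\<^sup>2 + b\<^sup>2 + 1) * d" using d by (simp add: algebra_simps)
  also have "\<dots> = e / 2"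
  proof -
    have "2 * s * (e / (4 * s)) = e / 2" if "0 < s" for s :: real using that by simp
    from this[OF pos] show ?thesis unfolding d_def .
  qed
  also have "\<dots> < e" using e by simp
  finally show "\<exists>\<psi>. C1c S \<psi> \<and> sqn (\<lambda>X. jet \<psi> X - (a *\<^sub>R p X + b *\<^sub>R q X)) < e"
    using C1c_add[OF \<psi>(1) \<xi>(1), of a b] by (intro exI[of _ "\<lambda>X. a * \<psi> X + b * \<xi> X"]) auto
qed

text \<open>The Leibniz rule for a pair that stands for a function and its gradient. On jets of test
  functions it is the jet of the product, by \<open>jet_jmul\<close>.\<close>

definition jmul :: "('n::finite st \<Rightarrow> real) \<Rightarrow> ('n st \<Rightarrow> real \<times> (real^'n)) \<Rightarrow> 'n st \<Rightarrow> real \<times> (real^'n)" where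
  "jmul \<kappa> p X = (\<kappa> X * fst (p X), \<kappa> X *\<^sub>R snd (p X) + fst (p X) *\<^sub>R gradx \<kappa> X)"

lemma jmul_bound:
  assumes "\<bar>\<kappa> X\<bar> \<le> K" "norm (gradx \<kappa> X) \<le> K"
  shows "norm (jmul \<kappa> p X) \<le> 3 * K * norm (p X)"
proof -
  obtain z W where p: "p X = (z, W)" by force
  have K: "0 \<le> K" using assms(1) by linarith
  have zp: "\<bar>z\<bar> \<le> norm (p X)" "norm W \<le> norm (p X)" unfolding p using norm_fst_le[of z W] norm_snd_le[of W z] by auto
  have "norm (jmul \<kappa> p X) \<le> \<bar>\<kappa> X * z\<bar> + norm (\<kappa> X *\<^sub>R W + z *\<^sub>R gradx \<kappa> X)"
    unfolding jmul_def p using norm_Pair_le[of "\<kappa> X * z" "\<kappa> X *\<^sub>R W + z *\<^sub>R gradx \<kappa> X"] by simp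
  also have "\<dots> \<le> \<bar>\<kappa> X\<bar> * \<bar>z\<bar> + (\<bar>\<kappa> X\<bar> * norm W + \<bar>z\<bar> * norm (gradx \<kappa> X))"
    using norm_triangle_ineq[of "\<kappa> X *\<^sub>R W" "z *\<^sub>R gradx \<kappa> X"] by (simp add: abs_mult)
  also have "\<dots> \<le> K * norm (p X) + (K * norm (p X) + norm (p X) * K)"
    using assms zp K by (intro add_mono mult_mono) auto
  finally show ?thesis by simp
qed

lemma jmul_meas:
  assumes "C1 \<kappa>" "p \<in> borel_measurable borel"
  shows "jmul \<kappa> p \<in> borel_measurable borel"
proof -
  note [measurable] = C1_meas[OF assms(1)] assms(2)
  have [measurable]: "(\<lambda>X. fst (p X)) \<in> borel_measurable borel" "(\<lambda>X. snd (p X)) \<in> borel_measurable borel"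
    by (rule measurable_compose[OF assms(2)], intro borel_measurable_continuous_onI continuous_intros)+
  show ?thesis unfolding jmul_def[abs_def] by measurable
qed

lemma jmul_diff: "jmul \<kappa> (\<lambda>X. p X - q X) X = jmul \<kappa> p X - jmul \<kappa> q X"
  by (simp add: jmul_def algebra_simps)

lemma jet_jmul: "C1 \<phi> \<Longrightarrow> C1 \<kappa> \<Longrightarrow> jet (\<lambda>X. \<kappa> X * \<phi> X) X = jmul \<kappa> (jet \<phi>) X"
  by (simp add: jet_mult jmul_def) (simp add: jet_def)

lemma jmul_L2:
  assumes "C1 \<kappa>" and K: "\<And>X. \<bar>\<kappa> X\<bar> \<le> K" "\<And>X. norm (gradx \<kappa> X) \<le> K" and p: "L2 p"
  shows "L2 (jmul \<kappa> p)" "sqn (jmul \<kappa> p) \<le> (3 * K)\<^sup>2 * sqn p"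
  using L2_bdd[OF jmul_meas[OF assms(1) L2_meas[OF p]] p, of "3 * K"] jmul_bound[OF K] by auto

text \<open>\<open>jmul\<close> is linear in p, bounded on L^2 with constant 3 K, and maps jets of
  test functions to jets of test functions; so it preserves their closure.\<close>

lemma Hcl_jmul:
  assumes "Hcl S p" and \<kappa>: "C1 \<kappa>" and K: "\<And>X. \<bar>\<kappa> X\<bar> \<le> K" "\<And>X. norm (gradx \<kappa> X) \<le> K"
  shows "Hcl S (jmul \<kappa> p)"
  unfolding Hcl_def
proof (intro conjI allI impI)
  note p = Hcl_L2[OF assms(1)]
  show L: "L2 (jmul \<kappa> p)" by (rule jmul_L2(1)[OF \<kappa> K p])
  fix e :: real assume e: "0 < e"
  have pos: "0 < (3 * K)\<^sup>2 + 1" by (smt (verit) zero_le_power2)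
  then obtain \<psi> where \<psi>: "C1c S \<psi>" "sqn (\<lambda>X. jet \<psi> X - p X) < e / ((3 * K)\<^sup>2 + 1)"
    using HclE[OF assms(1), of "e / ((3 * K)\<^sup>2 + 1)"] e by auto
  have "sqn (\<lambda>X. jet (\<lambda>X. \<kappa> X * \<psi> X) X - jmul \<kappa> p X) = sqn (jmul \<kappa> (\<lambda>X. jet \<psi> X - p X))"
    using jet_jmul[OF C1c_C1[OF \<psi>(1)] \<kappa>] by (simp add: jmul_diff sqn_def)
  also have "\<dots> \<le> (3 * K)\<^sup>2 * sqn (\<lambda>X. jet \<psi> X - p X)"
    by (rule jmul_L2(2)[OF \<kappa> K L2_diff(1)[OF C1c_jet(2)[OF \<psi>(1)] p]])
  also have "\<dots> \<le> ((3 * K)\<^sup>2 + 1) * sqn (\<lambda>X. jet \<psi> X - p X)"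
    by (intro mult_right_mono) auto
  also have "\<dots> < e" using \<psi>(2) pos by (simp add: field_simps)
  finally show "\<exists>\<psi>. C1c S \<psi> \<and> sqn (\<lambda>X. jet \<psi> X - jmul \<kappa> p X) < e"
    using C1c_mult[OF \<psi>(1) \<kappa>] by blast
qed

section \<open>Translation and truncation in time\<close>

lemma Hcl_shift:
  assumes "Hcl (\<Omega> \<times> UNIV) p"
  shows "Hcl (\<Omega> \<times> UNIV) (\<lambda>X. p (X + (0, r)))"
  unfolding Hcl_def
proof (intro conjI allI impI)
  note p = Hcl_L2[OF assms]
  show "L2 (\<lambda>X. p (X + (0, r)))" by (rule L2_shift(1)[OF p])
  fix e :: real assume e: "0 < e"
  obtain \<psi> where \<psi>: "C1c (\<Omega> \<times> UNIV) \<psi>" "sqn (\<lambda>X. jet \<psi> X - p X) < e" using HclE[OF assms e] by auto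
  have s: "(\<lambda>X. X - (0, r)) ` tsupp \<psi> \<subseteq> \<Omega> \<times> UNIV" using \<psi>(1) by (auto simp: C1c_alt)
  show "\<exists>\<psi>. C1c (\<Omega> \<times> UNIV) \<psi> \<and> sqn (\<lambda>X. jet \<psi> X - p (X + (0, r))) < e"
    using C1c_shift[OF \<psi>(1) s] sqn_shift_diff[OF C1c_jet(2)[OF \<psi>(1)] p, of "(0, r)"] \<psi>(2) by auto
qed

definition slab :: "real \<Rightarrow> real \<Rightarrow> 'n::finite st set" where "slab a b = UNIV \<times> {a<..<b}"

lemma slab_iff: "X \<in> slab a b \<longleftrightarrow> a < snd X \<and> snd X < b"
  by (cases X) (auto simp: slab_def)

lemma slab_borel [measurable]: "slab a b \<in> sets borel"
  by (auto simp: slab_def intro!: borel_open open_Times)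

text \<open>Only spatial gradients enter \<open>jet\<close>, so multiplication by a function of time
  costs no derivative, and even a sharp cut-off in time stays in the closure. Approximation of p is
  asked for on the slab alone, because the approximating sequence in \<open>weak_sol\<close>
  converges only on the cylinder.\<close>

lemma Hcl_cut:
  fixes p :: "'n::finite st \<Rightarrow> real \<times> (real^'n)"
  assumes p: "L2 p"
    and a: "\<And>e. 0 < e \<Longrightarrow> \<exists>\<psi>. C1c (\<Omega> \<times> UNIV) \<psi> \<and> sqn (\<lambda>X. indicator (slab a b) X *\<^sub>R (jet \<psi> X - p X)) < e"
  shows "Hcl (\<Omega> \<times> {a<..<b}) (\<lambda>X. indicator (slab a b) X *\<^sub>R p X)"
proof (rule Hcl_closed)
  let ?I = "\<lambda>X. indicator (slab a b) X :: real"
  show Lp: "L2 (\<lambda>X. ?I X *\<^sub>R p X)" by (rule L2_indicator(1)[OF p]) measurable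
  fix e :: real assume e: "0 < e"
  obtain \<psi> where \<psi>: "C1c (\<Omega> \<times> UNIV) \<psi>" "sqn (\<lambda>X. ?I X *\<^sub>R (jet \<psi> X - p X)) < e / 4"
    using a[of "e / 4"] e by auto
  note j = C1c_jet(2)[OF \<psi>(1)]
  have [measurable]: "jet \<psi> \<in> borel_measurable borel" by (rule L2_meas[OF j])
  \<comment> \<open>Vanishes up to distance 1/n from either end and equals 1 where both distances
    are at least 2/n. So for n > 0 the support of the product with \<psi> stays inside the open
    slab.\<close>
  define \<alpha> where "\<alpha> n t = sstep (real n * (t - a) - 1) * sstep (real n * (b - t) - 1)" for n t
  define \<alpha>' where "\<alpha>' n t = real n * sstep' (real n * (t - a) - 1) * sstep (real n * (b - t) - 1)
     + sstep (real n * (t - a) - 1) * (- real n * sstep' (real n * (b - t) - 1))" for n t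
  have d1: "((\<lambda>t. sstep (real n * (t - a) - 1)) has_real_derivative real n * sstep' (real n * (t - a) - 1)) (at t)" for n t
    by (rule DERIV_cong[OF DERIV_chain2[OF sstep_deriv]]) (auto intro!: derivative_eq_intros)
  have d2: "((\<lambda>t. sstep (real n * (b - t) - 1)) has_real_derivative - real n * sstep' (real n * (b - t) - 1)) (at t)" for n t
    by (rule DERIV_cong[OF DERIV_chain2[OF sstep_deriv]]) (auto intro!: derivative_eq_intros)
  have d: "(\<alpha> n has_real_derivative \<alpha>' n t) (at t)" for n t
    unfolding \<alpha>_def[abs_def] \<alpha>'_def by (rule DERIV_cong[OF DERIV_mult[OF d1 d2]]) (simp add: algebra_simps)
  have c: "continuous_on UNIV (\<alpha>' n)" for n
    unfolding \<alpha>'_def[abs_def]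
    by (intro continuous_intros continuous_on_compose2[OF sstep'_cont] continuous_on_compose2[OF sstep_cont]) auto
  have C1\<alpha>: "C1 (\<lambda>X::'n st. \<alpha> n (snd X))" "gradx (\<lambda>X::'n st. \<alpha> n (snd X)) = (\<lambda>X. 0)" for n
    using C1_time[OF d c] by auto
  have \<alpha>01: "0 \<le> \<alpha> n t" "\<alpha> n t \<le> 1" for n t
    unfolding \<alpha>_def using sstep_bounds by (auto intro: mult_le_one)
  have \<alpha>0: "\<alpha> n t = 0" if "t \<le> a + 1 / real n \<or> b - 1 / real n \<le> t" "0 < n" for n t
    using that unfolding \<alpha>_def by (auto simp: field_simps intro!: sstep_values)
  have cn: "C1c (\<Omega> \<times> {a<..<b}) (\<lambda>X. \<alpha> n (snd X) * \<psi> X)" if n: "0 < n" for n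
  proof -
    have c1: "C1c (\<Omega> \<times> UNIV) (\<lambda>X. \<alpha> n (snd X) * \<psi> X)" by (rule C1c_mult[OF \<psi>(1) C1\<alpha>(1)])
    have "tsupp (\<lambda>X. \<alpha> n (snd X) * \<psi> X) \<subseteq> UNIV \<times> {a + 1 / real n..b - 1 / real n}"
      unfolding tsupp_def
    proof (rule closure_minimal)
      show "{X. \<alpha> n (snd X) * \<psi> X \<noteq> 0} \<subseteq> UNIV \<times> {a + 1 / real n..b - 1 / real n}"
      proof
        fix X assume "X \<in> {X. \<alpha> n (snd X) * \<psi> X \<noteq> 0}"
        then have "\<alpha> n (snd X) \<noteq> 0" by auto
        then have "a + 1 / real n \<le> snd X" "snd X \<le> b - 1 / real n" using \<alpha>0[of "snd X" n] n by force+
        then show "X \<in> UNIV \<times> {a + 1 / real n..b - 1 / real n}" by (cases X) auto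
      qed
    qed (intro closed_Times closed_UNIV closed_atLeastAtMost)
    also have "\<dots> \<subseteq> UNIV \<times> {a<..<b}"
    proof -
      have "0 < 1 / real n" using n by simp
      then show ?thesis by (intro Sigma_mono subset_refl) (auto simp only: atLeastAtMost_iff greaterThanLessThan_iff)
    qed
    finally have "tsupp (\<lambda>X. \<alpha> n (snd X) * \<psi> X) \<subseteq> UNIV \<times> {a<..<b}" .
    then show ?thesis using c1 by (auto simp: C1c_alt)
  qed
  have jn: "jet (\<lambda>X. \<alpha> n (snd X) * \<psi> X) = (\<lambda>X. \<alpha> n (snd X) *\<^sub>R jet \<psi> X)" for n
    using jet_mult[OF C1c_C1[OF \<psi>(1)] C1\<alpha>(1)] C1\<alpha>(2) by (auto simp: jet_def)
  have lim: "(\<lambda>n. \<alpha> n (snd X)) \<longlonglongrightarrow> ?I X" for X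
  proof (cases "a < snd X \<and> snd X < b")
    case True
    obtain N1 where N1: "2 / (snd X - a) < real N1" using reals_Archimedean2 by blast
    obtain N2 where N2: "2 / (b - snd X) < real N2" using reals_Archimedean2 by blast
    have "\<alpha> n (snd X) = 1" if "max N1 N2 \<le> n" for n
    proof -
      have "2 / (snd X - a) \<le> real n" "2 / (b - snd X) \<le> real n" using that N1 N2 by linarith+
      then have "2 \<le> real n * (snd X - a)" "2 \<le> real n * (b - snd X)" using True by (auto simp: pos_divide_le_eq)
      then show ?thesis by (simp add: \<alpha>_def sstep_values)
    qed
    then have "\<forall>\<^sub>F n in sequentially. \<alpha> n (snd X) = ?I X"
      using True by (intro eventually_sequentiallyI[of "max N1 N2"]) (auto simp: indicator_def slab_iff)
    then show ?thesis by (rule tendsto_eventually)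
  next
    case False
    have "\<alpha> n (snd X) = 0" for n
    proof (cases "n = 0")
      case True then show ?thesis by (simp add: \<alpha>_def sstep_values)
    next
      case n: False
      then have "0 < 1 / real n" by simp
      then have "snd X \<le> a + 1 / real n \<or> b - 1 / real n \<le> snd X" using False by linarith
      then show ?thesis using \<alpha>0 n by blast
    qed
    moreover have "?I X = 0" using False by (auto simp: indicator_def slab_iff)
    ultimately show ?thesis by simp
  qed
  have "(\<lambda>n. LINT X|lborel. (norm (\<alpha> n (snd X) *\<^sub>R jet \<psi> X - ?I X *\<^sub>R jet \<psi> X))\<^sup>2) \<longlonglongrightarrow> (LINT X|(lborel::'n st measure). 0)"
  proof (rule integral_dominated_convergence[OF _ _ L2_int[OF j]])
    show "(\<lambda>X. (norm (\<alpha> n (snd X) *\<^sub>R jet \<psi> X - ?I X *\<^sub>R jet \<psi> X))\<^sup>2) \<in> borel_measurable lborel" for n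
      using C1_meas(1)[OF C1\<alpha>(1)[of n]] by measurable
    show "AE X in lborel. (\<lambda>n. (norm (\<alpha> n (snd X) *\<^sub>R jet \<psi> X - ?I X *\<^sub>R jet \<psi> X))\<^sup>2) \<longlonglongrightarrow> 0"
    proof (rule AE_I2)
      fix X :: "'n st"
      have "(\<lambda>n. (norm (\<alpha> n (snd X) *\<^sub>R jet \<psi> X - ?I X *\<^sub>R jet \<psi> X))\<^sup>2) \<longlonglongrightarrow> (norm (?I X *\<^sub>R jet \<psi> X - ?I X *\<^sub>R jet \<psi> X))\<^sup>2"
        by (intro tendsto_intros lim)
      then show "(\<lambda>n. (norm (\<alpha> n (snd X) *\<^sub>R jet \<psi> X - ?I X *\<^sub>R jet \<psi> X))\<^sup>2) \<longlonglongrightarrow> 0" by simp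
    qed
    show "AE X in lborel. norm ((norm (\<alpha> n (snd X) *\<^sub>R jet \<psi> X - ?I X *\<^sub>R jet \<psi> X))\<^sup>2) \<le> (norm (jet \<psi> X))\<^sup>2" for n
    proof (rule AE_I2)
      fix X :: "'n st"
      have "norm (\<alpha> n (snd X) *\<^sub>R jet \<psi> X - ?I X *\<^sub>R jet \<psi> X) = \<bar>\<alpha> n (snd X) - ?I X\<bar> * norm (jet \<psi> X)"
        by (simp add: scaleR_left_diff_distrib[symmetric])
      also have "\<dots> \<le> 1 * norm (jet \<psi> X)"
        using \<alpha>01[of n "snd X"] by (intro mult_right_mono) (auto simp: indicator_def)
      finally show "norm ((norm (\<alpha> n (snd X) *\<^sub>R jet \<psi> X - ?I X *\<^sub>R jet \<psi> X))\<^sup>2) \<le> (norm (jet \<psi> X))\<^sup>2"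
        by (simp add: power_mono)
    qed
  qed simp
  then have "(\<lambda>n. sqn (\<lambda>X. \<alpha> n (snd X) *\<^sub>R jet \<psi> X - ?I X *\<^sub>R jet \<psi> X)) \<longlonglongrightarrow> 0"
    by (simp add: sqn_def)
  then have "\<forall>\<^sub>F n in sequentially. sqn (\<lambda>X. \<alpha> n (snd X) *\<^sub>R jet \<psi> X - ?I X *\<^sub>R jet \<psi> X) < e / 4"
    by (rule order_tendstoD(2)) (use e in auto)
  then have "\<forall>\<^sub>F n in sequentially. sqn (\<lambda>X. \<alpha> n (snd X) *\<^sub>R jet \<psi> X - ?I X *\<^sub>R jet \<psi> X) < e / 4 \<and> 0 < n"
    by (intro eventually_conj eventually_gt_at_top)
  then obtain n where n: "sqn (\<lambda>X. \<alpha> n (snd X) *\<^sub>R jet \<psi> X - ?I X *\<^sub>R jet \<psi> X) < e / 4" "0 < n"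
    by (auto simp: eventually_sequentially)
  have Ljn: "L2 (\<lambda>X. \<alpha> n (snd X) *\<^sub>R jet \<psi> X)" using C1c_jet(2)[OF cn[OF n(2)]] by (simp add: jn)
  have LIj: "L2 (\<lambda>X. ?I X *\<^sub>R jet \<psi> X)" by (rule L2_indicator(1)[OF j]) measurable
  have "sqn (\<lambda>X. \<alpha> n (snd X) *\<^sub>R jet \<psi> X - ?I X *\<^sub>R p X) \<le>
     2 * sqn (\<lambda>X. \<alpha> n (snd X) *\<^sub>R jet \<psi> X - ?I X *\<^sub>R jet \<psi> X) + 2 * sqn (\<lambda>X. ?I X *\<^sub>R jet \<psi> X - ?I X *\<^sub>R p X)"
    by (rule sqn_triangle[OF Ljn LIj Lp])
  also have "\<dots> < 2 * (e / 4) + 2 * (e / 4)"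
    using n(1) \<psi>(2) by (intro add_strict_mono) (auto simp: scaleR_right_diff_distrib)
  finally show "\<exists>p'. Hcl (\<Omega> \<times> {a<..<b}) p' \<and> sqn (\<lambda>X. p' X - ?I X *\<^sub>R p X) < e"
    using C1c_Hcl[OF cn[OF n(2)]] by (auto simp: jn)
qed

lemma Hcl_cut':
  assumes "Hcl (\<Omega> \<times> UNIV) p"
  shows "Hcl (\<Omega> \<times> {a<..<b}) (\<lambda>X. indicator (slab a b) X *\<^sub>R p X)"
proof (rule Hcl_cut[OF Hcl_L2[OF assms]])
  fix e :: real assume e: "0 < e"
  obtain \<psi> where \<psi>: "C1c (\<Omega> \<times> UNIV) \<psi>" "sqn (\<lambda>X. jet \<psi> X - p X) < e" using HclE[OF assms e] by auto
  have "sqn (\<lambda>X. indicator (slab a b) X *\<^sub>R (jet \<psi> X - p X)) \<le> sqn (\<lambda>X. jet \<psi> X - p X)"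
    by (rule L2_indicator(2)[OF L2_diff(1)[OF C1c_jet(2)[OF \<psi>(1)] Hcl_L2[OF assms]]]) measurable
  then show "\<exists>\<psi>. C1c (\<Omega> \<times> UNIV) \<psi> \<and> sqn (\<lambda>X. indicator (slab a b) X *\<^sub>R (jet \<psi> X - p X)) < e"
    using \<psi> by (intro exI[of _ \<psi>]) auto
qed

text \<open>The chain rule survives the closure. The first components converge because h is
  1-Lipschitz. For the gradients, \<open>h'\<close> is merely continuous and bounded, so a
  subsequence converging almost everywhere and dominated convergence are used.\<close>

lemma Hcl_comp:
  fixes p :: "'n::finite st \<Rightarrow> real \<times> (real^'n)"
  assumes Hp: "Hcl S p" and h: "\<And>r. (h has_real_derivative h' r) (at r)" and ch: "continuous_on UNIV h'"
    and h0: "h 0 = 0" and h1: "\<And>r. \<bar>h' r\<bar> \<le> 1"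
  shows "Hcl S (\<lambda>X. (h (fst (p X)), h' (fst (p X)) *\<^sub>R snd (p X)))" (is "Hcl S ?q")
proof -
  note p = Hcl_L2[OF Hp]
  have [measurable]: "(\<lambda>X. fst (p X)) \<in> borel_measurable borel" "(\<lambda>X. snd (p X)) \<in> borel_measurable borel"
    using L2_meas[OF L2_fst(1)[OF p]] L2_meas[OF L2_snd(1)[OF p]] by auto
  have [measurable]: "h \<in> borel_measurable borel" "h' \<in> borel_measurable borel"
    using h ch by (auto intro!: borel_measurable_continuous_onI continuous_at_imp_continuous_on DERIV_isCont)
  have lip: "\<bar>h r - h s\<bar> \<le> \<bar>r - s\<bar>" for r s
  proof -
    have "norm (h r - h s) \<le> 1 * norm (r - s)"
      by (rule field_differentiable_bound[of UNIV h h']) (use h h1 in auto)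
    then show ?thesis by simp
  qed
  have hq: "\<bar>h r\<bar> \<le> \<bar>r\<bar>" for r using lip[of r 0] h0 by simp
  have qb: "norm (?q X) \<le> 2 * norm (p X)" for X
  proof -
    have "norm (?q X) \<le> \<bar>h (fst (p X))\<bar> + \<bar>h' (fst (p X))\<bar> * norm (snd (p X))"
      using norm_Pair_le[of "h (fst (p X))" "h' (fst (p X)) *\<^sub>R snd (p X)"] by simp
    also have "\<dots> \<le> \<bar>fst (p X)\<bar> + 1 * norm (snd (p X))"
      by (intro add_mono mult_right_mono hq h1) auto
    also have "\<dots> \<le> 2 * norm (p X)"
      using norm_fst_le[of "fst (p X)" "snd (p X)"] norm_snd_le[of "snd (p X)" "fst (p X)"] by simp
    finally show ?thesis .
  qed
  have q: "L2 ?q" by (rule L2_bdd(1)[OF _ p, of _ 2]) (use qb in auto)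
  have "\<exists>\<psi>. C1c S \<psi> \<and> sqn (\<lambda>X. jet \<psi> X - p X) < 1 / (real k + 1)" for k
    using HclE[OF Hp, of "1 / (real k + 1)"] by auto
  then obtain \<psi> where \<psi>: "\<And>k. C1c S (\<psi> k)" "\<And>k. sqn (\<lambda>X. jet (\<psi> k) X - p X) < 1 / (real k + 1)" by metis
  note jk = C1c_jet(2)[OF \<psi>(1)]
  have [measurable]: "jet (\<psi> k) \<in> borel_measurable borel" for k by (rule L2_meas[OF jk])
  have z0: "(\<lambda>k. sqn (\<lambda>X. jet (\<psi> k) X - p X)) \<longlonglongrightarrow> 0"
    by (rule tendsto_sandwich[OF _ _ tendsto_const lim_inverse_n'[THEN LIMSEQ_Suc]])
       (use \<psi>(2) in \<open>auto intro!: always_eventually less_imp_le simp: add.commute\<close>)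
  have "\<exists>r. strict_mono r \<and> (AE X in lborel. (\<lambda>k. (norm (jet (\<psi> (r k)) X - p X))\<^sup>2) \<longlonglongrightarrow> 0)"
    by (rule tendsto_L1_AE_subseq[of lborel "\<lambda>k X. (norm (jet (\<psi> k) X - p X))\<^sup>2"])
       (use z0 L2_int[OF L2_diff(1)[OF jk p]] in \<open>auto simp: sqn_def\<close>)
  then obtain r where r: "strict_mono r" "AE X in lborel. (\<lambda>k. (norm (jet (\<psi> (r k)) X - p X))\<^sup>2) \<longlonglongrightarrow> 0" by auto
  have conv: "AE X in lborel. (\<lambda>k. h' (\<psi> (r k) X)) \<longlonglongrightarrow> h' (fst (p X))"
    using r(2)
  proof eventually_elim
    case (elim X)
    have "(\<lambda>k. sqrt ((norm (jet (\<psi> (r k)) X - p X))\<^sup>2)) \<longlonglongrightarrow> sqrt 0" by (intro tendsto_intros elim)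
    then have "(\<lambda>k. jet (\<psi> (r k)) X - p X) \<longlonglongrightarrow> 0" by (simp add: tendsto_norm_zero_iff)
    then have "(\<lambda>k. jet (\<psi> (r k)) X) \<longlonglongrightarrow> p X" by (simp add: LIM_zero_iff)
    then have "(\<lambda>k. fst (jet (\<psi> (r k)) X)) \<longlonglongrightarrow> fst (p X)" by (rule tendsto_fst)
    then have "(\<lambda>k. \<psi> (r k) X) \<longlonglongrightarrow> fst (p X)" by (simp add: jet_def)
    moreover have "isCont h' (fst (p X))" using ch by (simp add: continuous_on_eq_continuous_at)
    ultimately show ?case by (rule isCont_tendsto_compose[rotated])
  qed
  \<comment> \<open>The part of the gradient error that is not linear: h'(f) g - h'(z) W = h'(f) (g
    - W) + (h'(f) - h'(z)) W. The first term is controlled by |h'| <= 1, the second has squared norm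
    \<open>?R\<close>.\<close>
  let ?R = "\<lambda>k X. (h' (\<psi> (r k) X) - h' (fst (p X)))\<^sup>2 * (norm (snd (p X)))\<^sup>2"
  have mR: "?R k \<in> borel_measurable borel" for k
    using C1_meas(1)[OF C1c_C1[OF \<psi>(1)[of "r k"]]] by measurable
  have bR: "\<bar>?R k X\<bar> \<le> 4 * (norm (snd (p X)))\<^sup>2" for k X
  proof -
    have "\<bar>h' (\<psi> (r k) X) - h' (fst (p X))\<bar> \<le> 2" using h1[of "\<psi> (r k) X"] h1[of "fst (p X)"] by linarith
    then have "\<bar>h' (\<psi> (r k) X) - h' (fst (p X))\<bar>\<^sup>2 \<le> 2\<^sup>2" by (rule power_mono) simp
    then show ?thesis by (simp add: abs_mult mult_right_mono)
  qed
  have i4: "integrable lborel (\<lambda>X. 4 * (norm (snd (p X)))\<^sup>2)" using L2_int[OF L2_snd(1)[OF p]] by simp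
  have iR: "integrable lborel (?R k)" for k
    by (rule Bochner_Integration.integrable_bound[OF i4]) (use mR[of k] bR in \<open>auto simp: abs_mult\<close>)
  have "(\<lambda>k. LINT X|lborel. ?R k X) \<longlonglongrightarrow> (LINT X|(lborel::'n st measure). 0)"
  proof (rule integral_dominated_convergence[OF _ _ i4])
    show "AE X in lborel. (\<lambda>k. ?R k X) \<longlonglongrightarrow> 0"
      using conv
    proof eventually_elim
      case (elim X)
      have "(\<lambda>k. (h' (\<psi> (r k) X) - h' (fst (p X)))\<^sup>2 * (norm (snd (p X)))\<^sup>2) \<longlonglongrightarrow> (h' (fst (p X)) - h' (fst (p X)))\<^sup>2 * (norm (snd (p X)))\<^sup>2"
        by (intro tendsto_intros elim)
      then show ?case by simp
    qed
  qed (use mR bR in auto)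
  then have R0: "(\<lambda>k. LINT X|lborel. ?R k X) \<longlonglongrightarrow> 0" by simp
  show ?thesis
  proof (rule Hcl_closed[OF q])
    fix e :: real assume e: "0 < e"
    have "(\<lambda>k. 2 * sqn (\<lambda>X. jet (\<psi> (r k)) X - p X) + 2 * (LINT X|lborel. ?R k X)) \<longlonglongrightarrow> 2 * 0 + 2 * 0"
      by (intro tendsto_intros R0 LIMSEQ_subseq_LIMSEQ[OF z0 r(1), unfolded comp_def])
    then have "\<forall>\<^sub>F k in sequentially. 2 * sqn (\<lambda>X. jet (\<psi> (r k)) X - p X) + 2 * (LINT X|lborel. ?R k X) < e"
      by (rule order_tendstoD(2)) (use e in simp)
    then obtain k where k: "2 * sqn (\<lambda>X. jet (\<psi> (r k)) X - p X) + 2 * (LINT X|lborel. ?R k X) < e"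
      by (auto simp: eventually_sequentially)
    let ?\<psi> = "\<lambda>X. h (\<psi> (r k) X)"
    have C: "C1c S ?\<psi>"
      by (rule C1cI_sub[OF C1_comp(1)[OF C1c_C1[OF \<psi>(1)] h ch] \<psi>(1)[of "r k"]]) (use h0 in auto)
    have jet: "jet ?\<psi> X = (h (\<psi> (r k) X), h' (\<psi> (r k) X) *\<^sub>R gradx (\<psi> (r k)) X)" for X
      by (simp add: jet_def C1_comp(2)[OF C1c_C1[OF \<psi>(1)] h ch])
    have pw: "(norm (jet ?\<psi> X - ?q X))\<^sup>2 \<le> 2 * (norm (jet (\<psi> (r k)) X - p X))\<^sup>2 + 2 * ?R k X" for X
    proof -
      define z where "z = fst (p X)"
      define W where "W = snd (p X)"
      define f where "f = \<psi> (r k) X"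
      define g where "g = gradx (\<psi> (r k)) X"
      have "(norm (h' f *\<^sub>R g - h' z *\<^sub>R W))\<^sup>2 = (norm (h' f *\<^sub>R (g - W) + (h' f - h' z) *\<^sub>R W))\<^sup>2"
        by (simp add: algebra_simps)
      also have "\<dots> \<le> 2 * (norm (h' f *\<^sub>R (g - W)))\<^sup>2 + 2 * (norm ((h' f - h' z) *\<^sub>R W))\<^sup>2" by (rule norm_add_sq)
      also have "\<dots> \<le> 2 * (norm (g - W))\<^sup>2 + 2 * ((h' f - h' z)\<^sup>2 * (norm W)\<^sup>2)"
      proof -
        have "norm (h' f *\<^sub>R (g - W)) \<le> norm (g - W)" using mult_right_mono[OF h1[of f], of "norm (g - W)"] by simp
        then have "(norm (h' f *\<^sub>R (g - W)))\<^sup>2 \<le> (norm (g - W))\<^sup>2" by (rule power_mono) simp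
        then show ?thesis by (simp add: power_mult_distrib)
      qed
      finally have 1: "(norm (h' f *\<^sub>R g - h' z *\<^sub>R W))\<^sup>2 \<le> 2 * (norm (g - W))\<^sup>2 + 2 * ((h' f - h' z)\<^sup>2 * (norm W)\<^sup>2)" .
      have 2: "(h f - h z)\<^sup>2 \<le> 2 * (f - z)\<^sup>2"
        using power_mono[OF lip[of f z], of 2] by simp (smt (verit) zero_le_power2)
      have "(norm (jet ?\<psi> X - ?q X))\<^sup>2 = (h f - h z)\<^sup>2 + (norm (h' f *\<^sub>R g - h' z *\<^sub>R W))\<^sup>2"
        by (simp add: jet f_def g_def z_def W_def norm_Pair)
      moreover have "(norm (jet (\<psi> (r k)) X - p X))\<^sup>2 = (f - z)\<^sup>2 + (norm (g - W))\<^sup>2"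
        by (simp add: jet_def f_def g_def z_def W_def norm_prod_def)
      ultimately show ?thesis using 1 2 by (simp add: f_def z_def W_def)
    qed
    have "sqn (\<lambda>X. jet ?\<psi> X - ?q X) \<le> (LINT X|lborel. 2 * (norm (jet (\<psi> (r k)) X - p X))\<^sup>2 + 2 * ?R k X)"
      unfolding sqn_def
    proof (rule integral_mono[OF L2_int[OF L2_diff(1)[OF C1c_jet(2)[OF C] q]] _ pw])
      show "integrable lborel (\<lambda>X. 2 * (norm (jet (\<psi> (r k)) X - p X))\<^sup>2 + 2 * ?R k X)"
        by (intro Bochner_Integration.integrable_add integrable_mult_right iR L2_int L2_diff(1) jk p)
    qed
    also have "\<dots> = 2 * sqn (\<lambda>X. jet (\<psi> (r k)) X - p X) + 2 * (LINT X|lborel. ?R k X)"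
      unfolding sqn_def by (subst Bochner_Integration.integral_add)
        (auto simp: integral_mult_right_zero intro!: integrable_mult_right iR L2_int L2_diff(1) jk p)
    also have "\<dots> < e" by (rule k)
    finally show "\<exists>p'. Hcl S p' \<and> sqn (\<lambda>X. p' X - ?q X) < e" using C1c_Hcl[OF C] by blast
  qed
qed

lemma L2_norm_indicator_integrable:
  fixes v :: "'a::euclidean_space \<Rightarrow> real"
  assumes "L2 v" "compact K"
  shows "integrable lborel (\<lambda>X. \<bar>v X\<bar> * indicator K X)"
proof -
  have K: "K \<in> sets borel" "emeasure lborel K < \<infinity>"
    using assms(2) emeasure_bounded_finite[OF compact_imp_bounded[OF assms(2)]] by (auto simp: compact_imp_closed)
  have "L2 (\<lambda>X. \<bar>v X\<bar>)" using assms(1) by (auto simp: L2_def)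
  moreover have "L2 (\<lambda>X. indicator K X :: real)"
  proof -
    have "(\<lambda>x. (norm (indicator K x :: real))\<^sup>2) = indicator K" by (auto simp: indicator_def)
    then show ?thesis unfolding L2_def using K by simp
  qed
  ultimately show ?thesis using L2_inner(1)[of "\<lambda>X. \<bar>v X\<bar>" "\<lambda>X. indicator K X :: real"] by simp
qed

section \<open>Translation estimates\<close>

text \<open>Derivative in the space-time direction e. The directions (0, 1) and (z, 0) lead to the
  estimates for time and for space translations.\<close>

definition dird :: "('n::finite st \<Rightarrow> real) \<Rightarrow> 'n st \<Rightarrow> 'n st \<Rightarrow> real" where
  "dird \<psi> e X = gradx \<psi> X \<bullet> fst e + snd e * dt \<psi> X"

lemma line_deriv:
  assumes "C1 \<psi>"
  shows "((\<lambda>s. \<psi> (X + s *\<^sub>R e)) has_real_derivative dird \<psi> e (X + r *\<^sub>R e)) (at r)"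
proof -
  have "((\<lambda>s. X + s *\<^sub>R e) has_derivative (\<lambda>s. s *\<^sub>R e)) (at r)" by (auto intro!: derivative_eq_intros)
  from has_derivative_compose[OF this C1_has_derivative[OF assms]]
  show ?thesis unfolding has_field_derivative_def
    by (rule has_derivative_eq_rhs) (auto simp: dird_def algebra_simps)
qed

text \<open>The mean value theorem is applied to the integral as a function of the step, not
  pointwise in X. This gives one r for all X, so the right-hand side is again an integral against a
  translate of a test function, and in the time direction the weak equation can be inserted
  there.\<close>

lemma integral_MVT:
  fixes v :: "'n::finite st \<Rightarrow> real"
  assumes v: "L2 v" and \<psi>: "C1c S \<psi>" and \<tau>: "0 < \<tau>"
  shows "\<exists>r. 0 < r \<and> r < \<tau> \<and> (LINT X|lborel. v X * (\<psi> (X + \<tau> *\<^sub>R e) - \<psi> X)) = \<tau> * (LINT X|lborel. v X * dird \<psi> e (X + r *\<^sub>R e))"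
proof -
  note C = C1c_C1[OF \<psi>]
  note [measurable] = C1_meas[OF C] L2_meas[OF v]
  obtain B1 where B1: "\<And>X. \<bar>dt \<psi> X\<bar> \<le> B1" using C1c_jet(5)[OF \<psi>] by auto
  obtain B2 where B2: "\<And>X. norm (gradx \<psi> X) \<le> B2" using C1c_jet(6)[OF \<psi>] by auto
  define B where "B = B2 * norm (fst e) + \<bar>snd e\<bar> * B1"
  have B: "\<bar>dird \<psi> e X\<bar> \<le> B" for X
  proof -
    have "\<bar>dird \<psi> e X\<bar> \<le> \<bar>gradx \<psi> X \<bullet> fst e\<bar> + \<bar>snd e * dt \<psi> X\<bar>" unfolding dird_def by linarith
    also have "\<dots> \<le> norm (gradx \<psi> X) * norm (fst e) + \<bar>snd e\<bar> * \<bar>dt \<psi> X\<bar>"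
      by (intro add_mono Cauchy_Schwarz_ineq2) (simp add: abs_mult)
    also have "\<dots> \<le> B" unfolding B_def by (intro add_mono mult_right_mono mult_left_mono B1 B2) auto
    finally show ?thesis .
  qed
  have lip: "\<bar>\<psi> (X + s *\<^sub>R e) - \<psi> (X + r *\<^sub>R e)\<bar> \<le> B * \<bar>s - r\<bar>" for X s r
  proof -
    have "norm (\<psi> (X + s *\<^sub>R e) - \<psi> (X + r *\<^sub>R e)) \<le> B * norm (s - r)"
      by (rule field_differentiable_bound[of UNIV "\<lambda>s. \<psi> (X + s *\<^sub>R e)" "\<lambda>r. dird \<psi> e (X + r *\<^sub>R e)"])
        (use line_deriv[OF C] B in auto)
    then show ?thesis by simp
  qed
  have Lsh: "L2 (\<lambda>X. \<psi> (X + a))" for a by (rule L2_shift(1)[OF C1c_jet(7)[OF \<psi>]])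
  have int: "integrable lborel (\<lambda>X. v X * \<psi> (X + a))" for a
    using L2_inner(1)[OF v Lsh[of a]] by simp
  define \<Phi> where "\<Phi> r = (LINT X|lborel. v X * \<psi> (X + r *\<^sub>R e))" for r
  define D where "D r = (LINT X|lborel. v X * dird \<psi> e (X + r *\<^sub>R e))" for r
  have md: "dird \<psi> e \<in> borel_measurable borel" unfolding dird_def[abs_def] by measurable
  have der: "(\<Phi> has_real_derivative D r) (at r)" for r
    unfolding DERIV_def
    unfolding tendsto_at_iff_sequentially comp_def
  proof (intro allI impI)
    fix h :: "nat \<Rightarrow> real" assume "\<forall>n. h n \<in> UNIV - {0}" "h \<longlonglongrightarrow> 0"
    then have h0: "\<And>n. h n \<noteq> 0" and h: "h \<longlonglongrightarrow> 0" by auto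
    obtain c where c: "\<And>n. \<bar>h n\<bar> \<le> c"
      using convergent_imp_Bseq[OF convergentI[OF h]] by (auto simp: Bseq_def)
    \<comment> \<open>Contains the supports of all translates with steps between r - c and r + c, so
      that B |v| on K dominates every difference quotient of the sequence.\<close>
    define K where "K = (\<lambda>(Y, s). Y - s *\<^sub>R e) ` (tsupp \<psi> \<times> {r - c..r + c})"
    have K: "compact K" unfolding K_def
      by (rule compact_continuous_image) (use \<psi> in \<open>auto simp: C1c_alt case_prod_beta intro!: continuous_intros compact_Times\<close>)
    have out: "\<psi> (X + s *\<^sub>R e) = 0" if "X \<notin> K" "\<bar>s - r\<bar> \<le> c" for X s
    proof (rule notin_tsupp(1))
      show "X + s *\<^sub>R e \<notin> tsupp \<psi>"
      proof
        assume "X + s *\<^sub>R e \<in> tsupp \<psi>"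
        then have "(X + s *\<^sub>R e) - s *\<^sub>R e \<in> K" unfolding K_def
          by (intro image_eqI[of _ _ "(X + s *\<^sub>R e, s)"]) (use that(2) in auto)
        then show False using that(1) by simp
      qed
    qed
    have c0: "0 \<le> c" using c[of 0] by linarith
    have B0: "0 \<le> B" using B[of 0] by linarith
    let ?q = "\<lambda>n X. v X * ((\<psi> (X + (r + h n) *\<^sub>R e) - \<psi> (X + r *\<^sub>R e)) / h n)"
    have "(\<lambda>n. LINT X|lborel. ?q n X) \<longlonglongrightarrow> (LINT X|lborel. v X * dird \<psi> e (X + r *\<^sub>R e))"
    proof (rule integral_dominated_convergence)
      show "integrable lborel (\<lambda>X. B * (\<bar>v X\<bar> * indicator K X))"
        by (intro integrable_mult_right L2_norm_indicator_integrable[OF v K])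
      show "(\<lambda>X. v X * dird \<psi> e (X + r *\<^sub>R e)) \<in> borel_measurable lborel"
        using md by measurable
      show "?q n \<in> borel_measurable lborel" for n by measurable
      show "AE X in lborel. (\<lambda>n. ?q n X) \<longlonglongrightarrow> v X * dird \<psi> e (X + r *\<^sub>R e)"
      proof (rule AE_I2)
        fix X :: "'n st"
        have "(\<lambda>k. (\<psi> (X + (r + k) *\<^sub>R e) - \<psi> (X + r *\<^sub>R e)) / k) \<midarrow>0\<rightarrow> dird \<psi> e (X + r *\<^sub>R e)"
          using line_deriv[OF C, of X e r] by (simp add: DERIV_def)
        then have "(\<lambda>n. (\<psi> (X + (r + h n) *\<^sub>R e) - \<psi> (X + r *\<^sub>R e)) / h n) \<longlonglongrightarrow> dird \<psi> e (X + r *\<^sub>R e)"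
          using h0 h by (auto simp: tendsto_at_iff_sequentially comp_def)
        then show "(\<lambda>n. ?q n X) \<longlonglongrightarrow> v X * dird \<psi> e (X + r *\<^sub>R e)" by (rule tendsto_mult_left)
      qed
      show "AE X in lborel. norm (?q n X) \<le> B * (\<bar>v X\<bar> * indicator K X)" for n
      proof (rule AE_I2)
        fix X :: "'n st"
        show "norm (?q n X) \<le> B * (\<bar>v X\<bar> * indicator K X)"
        proof (cases "X \<in> K")
          case True
          have "\<bar>(\<psi> (X + (r + h n) *\<^sub>R e) - \<psi> (X + r *\<^sub>R e)) / h n\<bar> \<le> B"
            using lip[of X "r + h n" r] h0[of n] by (simp add: field_simps)
          then have "\<bar>v X\<bar> * \<bar>(\<psi> (X + (r + h n) *\<^sub>R e) - \<psi> (X + r *\<^sub>R e)) / h n\<bar> \<le> \<bar>v X\<bar> * B"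
            by (intro mult_left_mono) auto
          then show ?thesis using True by (simp add: abs_mult mult.commute)
        next
          case False
          then have "\<psi> (X + (r + h n) *\<^sub>R e) = 0" "\<psi> (X + r *\<^sub>R e) = 0" using out c[of n] c0 by auto
          then show ?thesis using False by simp
        qed
      qed
    qed
    moreover have "(LINT X|lborel. ?q n X) = (\<Phi> (r + h n) - \<Phi> r) / h n" for n
    proof -
      have "(LINT X|lborel. ?q n X) = (LINT X|lborel. (v X * \<psi> (X + (r + h n) *\<^sub>R e) - v X * \<psi> (X + r *\<^sub>R e)) / h n)"
        by (simp add: algebra_simps)
      then show ?thesis by (simp add: \<Phi>_def int)
    qed
    ultimately show "(\<lambda>n. (\<Phi> (r + h n) - \<Phi> r) / h n) \<longlonglongrightarrow> D r" unfolding D_def by (simp only:)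
  qed
  obtain r where r: "0 < r" "r < \<tau>" "\<Phi> \<tau> - \<Phi> 0 = (\<tau> - 0) * D r"
    using MVT2[OF \<tau>, of \<Phi> D] der by auto
  have "\<Phi> \<tau> - \<Phi> 0 = (LINT X|lborel. v X * (\<psi> (X + \<tau> *\<^sub>R e) - \<psi> X))"
    using int[of "\<tau> *\<^sub>R e"] int[of 0] by (simp add: \<Phi>_def right_diff_distrib)
  then show ?thesis using r by (auto simp: D_def)
qed

text \<open>By the mean value theorem in time, the time difference of a test function acts like \<open>\<tau>\<close> times the time
  derivative of one of its translates; the equation turns that into a bound free of time derivatives, which
  extends to limits of test functions.\<close>

lemma time_difference_bound:
  fixes u :: "'n::finite st \<Rightarrow> real"
  assumes u: "L2 u" and F: "L2 F"
    and weak: "\<And>\<phi>. C1c (\<Omega> \<times> {..<q}) \<phi> \<Longrightarrow> (LINT X|lborel. u X * dt \<phi> X) = (LINT X|lborel. F X \<bullet> jet \<phi> X)"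
    and p: "Hcl (\<Omega> \<times> {..<q}) p" and \<tau>: "0 < \<tau>"
    and B: "\<And>r. 0 \<le> r \<Longrightarrow> r \<le> \<tau> \<Longrightarrow> (LINT X|lborel. F X \<bullet> p (X + (0, r))) \<le> B"
  shows "(LINT X|lborel. u X * (fst (p (X + (0, \<tau>))) - fst (p X))) \<le> \<tau> * B"
proof (rule field_le_epsilon)
  fix e :: real assume e: "0 < e"
  \<comment> \<open>Collects the coefficients of d in the errors made when p is replaced by a test
    function; the summand 1 keeps it positive.\<close>
  define c where "c = 2 * sqrt (sqn u) + \<tau> * sqrt (sqn F) + 1"
  have c: "0 < c" unfolding c_def using \<tau> by (smt (verit) mult_nonneg_nonneg real_sqrt_ge_zero sqn_nonneg)
  define d where "d = e / c"
  have d: "0 < d" using e c by (simp add: d_def)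
  obtain \<psi> where \<psi>: "C1c (\<Omega> \<times> {..<q}) \<psi>" "sqn (\<lambda>X. jet \<psi> X - p X) < d\<^sup>2"
    by (rule HclE[OF p, of "d\<^sup>2"]) (use d in auto)
  note Lp = Hcl_L2[OF p] and Lj = C1c_jet(2)[OF \<psi>(1)]
  obtain r where r: "0 < r" "r < \<tau>"
    "(LINT X|lborel. u X * (\<psi> (X + \<tau> *\<^sub>R (0, 1)) - \<psi> X)) = \<tau> * (LINT X|lborel. u X * dird \<psi> (0, 1) (X + r *\<^sub>R (0, 1)))"
    using integral_MVT[OF u \<psi>(1) \<tau>, of "(0, 1)"] by auto
  \<comment> \<open>Evaluating \<psi> at a later time moves its support backward in time. It
    therefore stays before q, and the admissible test functions have no lower bound on their
    times.\<close>
  have s: "(\<lambda>X. X - (0, r)) ` tsupp \<psi> \<subseteq> \<Omega> \<times> {..<q}"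
  proof
    fix Y assume "Y \<in> (\<lambda>X. X - (0, r)) ` tsupp \<psi>"
    then obtain X where X: "X \<in> tsupp \<psi>" "Y = X - (0, r)" by auto
    have "X \<in> \<Omega> \<times> {..<q}" using X(1) \<psi>(1) by (auto simp: C1c_alt)
    then show "Y \<in> \<Omega> \<times> {..<q}" using X(2) r(1) by (cases X) auto
  qed
  note sh = C1c_shift[OF \<psi>(1) s]
  have "(LINT X|lborel. u X * dird \<psi> (0, 1) (X + r *\<^sub>R (0, 1))) = (LINT X|lborel. u X * dt (\<lambda>X. \<psi> (X + (0, r))) X)"
    using C1_shift(3)[OF C1c_C1[OF \<psi>(1)], of "(0, r)"] by (simp add: dird_def)
  also have "\<dots> = (LINT X|lborel. F X \<bullet> jet \<psi> (X + (0, r)))"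
    using weak[OF sh(1)] sh(2) by simp
  also have "\<dots> \<le> (LINT X|lborel. F X \<bullet> p (X + (0, r))) + sqrt (sqn F) * d"
  proof -
    have "sqn (\<lambda>X. jet \<psi> (X + (0, r)) - p (X + (0, r))) \<le> d\<^sup>2"
      using sqn_shift_diff[OF Lj Lp, of "(0, r)"] \<psi>(2) by simp
    from inner_tendsto[OF F L2_shift(1)[OF Lj] L2_shift(1)[OF Lp] this] d show ?thesis by auto
  qed
  also have "\<dots> \<le> B + sqrt (sqn F) * d" using B[of r] r by simp
  finally have 1: "(LINT X|lborel. u X * (\<psi> (X + (0, \<tau>)) - \<psi> X)) \<le> \<tau> * (B + sqrt (sqn F) * d)"
    using r(3) \<tau> by (simp add: mult_left_mono)
  have f1: "L2 (\<lambda>X. fst (p X))" "L2 (\<lambda>X. fst (p (X + (0, \<tau>))))"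
    using L2_fst(1)[OF Lp] L2_fst(1)[OF L2_shift(1)[OF Lp, of "(0, \<tau>)"]] by auto
  have f2: "L2 \<psi>" "L2 (\<lambda>X. \<psi> (X + (0, \<tau>)))"
    using C1c_jet(7)[OF \<psi>(1)] L2_shift(1)[OF C1c_jet(7)[OF \<psi>(1)]] by auto
  have near: "sqn (\<lambda>X. \<psi> X - fst (p X)) \<le> d\<^sup>2"
  proof -
    have "(\<lambda>X. \<psi> X - fst (p X)) = (\<lambda>X. fst (jet \<psi> X - p X))" by (simp add: jet_def)
    then show ?thesis using L2_fst(2)[OF L2_diff(1)[OF Lj Lp]] \<psi>(2) by simp
  qed
  have near': "sqn (\<lambda>X. \<psi> (X + (0, \<tau>)) - fst (p (X + (0, \<tau>)))) \<le> d\<^sup>2"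
    using sqn_shift_diff[OF f2(1) f1(1), of "(0, \<tau>)"] near by simp
  have a: "\<bar>(LINT X|lborel. u X * \<psi> X) - (LINT X|lborel. u X * fst (p X))\<bar> \<le> sqrt (sqn u) * d"
    using inner_tendsto[OF u f2(1) f1(1) near] d by simp
  have b: "\<bar>(LINT X|lborel. u X * \<psi> (X + (0, \<tau>))) - (LINT X|lborel. u X * fst (p (X + (0, \<tau>))))\<bar> \<le> sqrt (sqn u) * d"
    using inner_tendsto[OF u f2(2) f1(2) near'] d by simp
  have i: "integrable lborel (\<lambda>X. u X * \<psi> X)" "integrable lborel (\<lambda>X. u X * fst (p X))"
    "integrable lborel (\<lambda>X. u X * \<psi> (X + (0, \<tau>)))" "integrable lborel (\<lambda>X. u X * fst (p (X + (0, \<tau>))))"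
    using L2_inner(1)[OF u f2(1)] L2_inner(1)[OF u f1(1)] L2_inner(1)[OF u f2(2)] L2_inner(1)[OF u f1(2)] by auto
  have "(LINT X|lborel. u X * (fst (p (X + (0, \<tau>))) - fst (p X))) \<le> (LINT X|lborel. u X * (\<psi> (X + (0, \<tau>)) - \<psi> X)) + 2 * (sqrt (sqn u) * d)"
    using a b i by (simp add: right_diff_distrib)
  also have "\<dots> \<le> \<tau> * (B + sqrt (sqn F) * d) + 2 * (sqrt (sqn u) * d)" using 1 by simp
  also have "\<dots> \<le> \<tau> * B + c * d" using d by (simp add: c_def algebra_simps)
  also have "\<dots> = \<tau> * B + e" using c by (simp add: d_def)
  finally show "(LINT X|lborel. u X * (fst (p (X + (0, \<tau>))) - fst (p X))) \<le> \<tau> * B + e" .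
qed

text \<open>Dominated convergence for a test function, then density. In \<open>energy\<close> this
  removes the translation by r from the integral of F . p(X + (0, r)).\<close>

lemma Hcl_translation:
  fixes p :: "'n::finite st \<Rightarrow> real \<times> (real^'n)"
  assumes p: "Hcl S p" and e: "0 < e"
  shows "\<exists>d>0. \<forall>r. \<bar>r\<bar> < d \<longrightarrow> sqn (\<lambda>X. p (X + (0, r)) - p X) < e"
proof -
  obtain \<psi> where \<psi>: "C1c S \<psi>" "sqn (\<lambda>X. jet \<psi> X - p X) < e / 16" by (rule HclE[OF p, of "e / 16"]) (use e in auto)
  note Lp = Hcl_L2[OF p] and Lj = C1c_jet(2)[OF \<psi>(1)]
  have cj: "continuous_on UNIV (jet \<psi>)" by (rule C1c_jet(1)[OF \<psi>(1)])
  have [measurable]: "jet \<psi> \<in> borel_measurable borel" by (rule L2_meas[OF Lj])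
  have "\<exists>d>0. \<forall>r. \<bar>r\<bar> < d \<longrightarrow> sqn (\<lambda>X. jet \<psi> (X + (0, r)) - jet \<psi> X) < e / 16"
  proof (rule ccontr)
    assume n: "\<not> ?thesis"
    have "\<exists>r. \<bar>r\<bar> < 1 / (real k + 1) \<and> e / 16 \<le> sqn (\<lambda>X. jet \<psi> (X + (0, r)) - jet \<psi> X)" for k
    proof -
      have "0 < 1 / (real k + 1)" by simp
      then have "\<not> (\<forall>r. \<bar>r\<bar> < 1 / (real k + 1) \<longrightarrow> sqn (\<lambda>X. jet \<psi> (X + (0, r)) - jet \<psi> X) < e / 16)" using n by blast
      then show ?thesis by (auto simp: not_less)
    qed
    then have "\<exists>r. \<forall>k. \<bar>r k\<bar> < 1 / (real k + 1) \<and> e / 16 \<le> sqn (\<lambda>X. jet \<psi> (X + (0, r k)) - jet \<psi> X)"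
      by (intro choice allI)
    then obtain r where r: "\<And>k. \<bar>r k\<bar> < 1 / (real k + 1)" "\<And>k. e / 16 \<le> sqn (\<lambda>X. jet \<psi> (X + (0, r k)) - jet \<psi> X)"
      by blast
    have r0: "r \<longlonglongrightarrow> 0"
      by (rule Lim_null_comparison[OF _ lim_inverse_n'[THEN LIMSEQ_Suc]])
        (use r(1) in \<open>auto intro!: always_eventually less_imp_le simp: add.commute\<close>)
    have r1: "\<bar>r k\<bar> \<le> 1" for k
    proof -
      have "1 / (real k + 1) \<le> 1" by simp
      then show ?thesis using r(1)[of k] by linarith
    qed
    obtain B where B: "\<And>X. norm (jet \<psi> X) \<le> B"
      using L2_compact_support(2)[OF cj, of "tsupp \<psi>"] C1c_jet(3)[OF \<psi>(1)] \<psi>(1) by (auto simp: C1c_alt)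
    define K where "K = (\<lambda>(Y, s::real). Y - (0, s)) ` (tsupp \<psi> \<times> {-1..1})"
    have K: "compact K" unfolding K_def
      by (rule compact_continuous_image) (use \<psi> in \<open>auto simp: C1c_alt case_prod_beta intro!: continuous_intros compact_Times\<close>)
    have Km: "K \<in> sets borel" "emeasure lborel K < \<infinity>"
      using K emeasure_bounded_finite[OF compact_imp_bounded[OF K]] by (auto simp: compact_imp_closed)
    have out: "jet \<psi> (X + (0, s)) = 0" if "X \<notin> K" "\<bar>s\<bar> \<le> 1" for X s
    proof (rule C1c_jet(3)[OF \<psi>(1)])
      show "X + (0, s) \<notin> tsupp \<psi>"
      proof
        assume "X + (0, s) \<in> tsupp \<psi>"
        then have "(X + (0, s)) - (0, s) \<in> K" unfolding K_def
          by (intro image_eqI[of _ _ "(X + (0, s), s)"]) (use that(2) in auto)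
        then show False using that(1) by simp
      qed
    qed
    have "(\<lambda>k. LINT X|lborel. (norm (jet \<psi> (X + (0, r k)) - jet \<psi> X))\<^sup>2) \<longlonglongrightarrow> (LINT X|(lborel::'n st measure). 0)"
    proof (rule integral_dominated_convergence)
      show "integrable lborel (\<lambda>X. (2 * B)\<^sup>2 * indicator K X :: real)"
        by (rule integrable_mult_right) (use Km in simp)
      show "AE X in lborel. (\<lambda>k. (norm (jet \<psi> (X + (0, r k)) - jet \<psi> X))\<^sup>2) \<longlonglongrightarrow> 0"
      proof (rule AE_I2)
        fix X :: "'n st"
        have "(\<lambda>k. X + (0, r k)) \<longlonglongrightarrow> X + (0, 0)" by (intro tendsto_intros r0)
        then have "(\<lambda>k. X + (0, r k)) \<longlonglongrightarrow> X" by (simp add: zero_prod_def[symmetric])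
        moreover have "isCont (jet \<psi>) X" using continuous_on_eq_continuous_at[OF open_UNIV] cj by blast
        ultimately have "(\<lambda>k. jet \<psi> (X + (0, r k))) \<longlonglongrightarrow> jet \<psi> X" by (rule isCont_tendsto_compose[rotated])
        then have "(\<lambda>k. (norm (jet \<psi> (X + (0, r k)) - jet \<psi> X))\<^sup>2) \<longlonglongrightarrow> (norm (jet \<psi> X - jet \<psi> X))\<^sup>2" by (intro tendsto_intros)
        then show "(\<lambda>k. (norm (jet \<psi> (X + (0, r k)) - jet \<psi> X))\<^sup>2) \<longlonglongrightarrow> 0" by simp
      qed
      show "AE X in lborel. norm ((norm (jet \<psi> (X + (0, r k)) - jet \<psi> X))\<^sup>2) \<le> (2 * B)\<^sup>2 * indicator K X" for k
      proof (rule AE_I2)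
        fix X :: "'n st"
        show "norm ((norm (jet \<psi> (X + (0, r k)) - jet \<psi> X))\<^sup>2) \<le> (2 * B)\<^sup>2 * indicator K X"
        proof (cases "X \<in> K")
          case True
          have "norm (jet \<psi> (X + (0, r k)) - jet \<psi> X) \<le> 2 * B"
            using norm_triangle_ineq4[of "jet \<psi> (X + (0, r k))" "jet \<psi> X"] B[of X] B[of "X + (0, r k)"] by linarith
          then have "(norm (jet \<psi> (X + (0, r k)) - jet \<psi> X))\<^sup>2 \<le> (2 * B)\<^sup>2" by (rule power_mono) simp
          then show ?thesis using True by (simp add: power_mult_distrib)
        next
          case False
          then show ?thesis using out[OF False r1] out[OF False, of 0] by (simp add: zero_prod_def[symmetric])
        qed
      qed
    qed (measurable)
    then have "(\<lambda>k. sqn (\<lambda>X. jet \<psi> (X + (0, r k)) - jet \<psi> X)) \<longlonglongrightarrow> 0" by (simp add: sqn_def)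
    then have "e / 16 \<le> 0" by (rule LIMSEQ_le_const) (use r(2) in auto)
    then show False using e by simp
  qed
  then obtain d where d: "0 < d" "\<And>r. \<bar>r\<bar> < d \<Longrightarrow> sqn (\<lambda>X. jet \<psi> (X + (0, r)) - jet \<psi> X) < e / 16" by auto
  show ?thesis
  proof (intro exI[of _ d] conjI allI impI d(1))
    fix r assume r: "\<bar>r\<bar> < d"
    note Ljs = L2_shift(1)[OF Lj, of "(0, r)"] and Lps = L2_shift(1)[OF Lp, of "(0, r)"]
    have "sqn (\<lambda>X. p (X + (0, r)) - p X) \<le> 2 * sqn (\<lambda>X. p (X + (0, r)) - jet \<psi> (X + (0, r))) + 2 * sqn (\<lambda>X. jet \<psi> (X + (0, r)) - p X)"
      by (rule sqn_triangle[OF Lps Ljs Lp])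
    also have "sqn (\<lambda>X. p (X + (0, r)) - jet \<psi> (X + (0, r))) = sqn (\<lambda>X. p X - jet \<psi> X)" by (rule sqn_shift_diff[OF Lp Lj])
    also have "sqn (\<lambda>X. p X - jet \<psi> X) = sqn (\<lambda>X. jet \<psi> X - p X)" by (rule sqn_commute)
    also have "sqn (\<lambda>X. jet \<psi> (X + (0, r)) - p X) \<le> 2 * sqn (\<lambda>X. jet \<psi> (X + (0, r)) - jet \<psi> X) + 2 * sqn (\<lambda>X. jet \<psi> X - p X)"
      by (rule sqn_triangle[OF Ljs Lj Lp])
    finally have "sqn (\<lambda>X. p (X + (0, r)) - p X) \<le> 6 * sqn (\<lambda>X. jet \<psi> X - p X) + 4 * sqn (\<lambda>X. jet \<psi> (X + (0, r)) - jet \<psi> X)" by simp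
    then show "sqn (\<lambda>X. p (X + (0, r)) - p X) < e" using \<psi>(2) d(2)[OF r] e by linarith
  qed
qed

text \<open>The increment w is paired with itself. With a and b the norms of w and of the gradient,
  \<open>integral_MVT\<close> gives a^2 <= a |z| b up to errors of approximation, and a is
  cancelled. Since p is approximated by test functions on all of space-time, the translate may leave
  the domain.\<close>

lemma space_translation:
  fixes p :: "'n::finite st \<Rightarrow> real \<times> (real^'n)"
  assumes p: "Hcl S p"
  shows "sqn (\<lambda>X. fst (p (X + (z, 0))) - fst (p X)) \<le> (norm z)\<^sup>2 * sqn (\<lambda>X. snd (p X))"
proof (rule field_le_epsilon)
  fix e :: real assume e: "0 < e"
  define w where "w X = fst (p (X + (z, 0))) - fst (p X)" for X
  note Lp = Hcl_L2[OF p]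
  have f1: "L2 (\<lambda>X. fst (p X))" "L2 (\<lambda>X. fst (p (X + (z, 0))))" "L2 (\<lambda>X. snd (p X))"
    using L2_fst(1)[OF Lp] L2_fst(1)[OF L2_shift(1)[OF Lp, of "(z, 0)"]] L2_snd(1)[OF Lp] by auto
  have w: "L2 w" unfolding w_def[abs_def] by (rule L2_diff(1)[OF f1(2,1)])
  define a where "a = sqrt (sqn w)"
  define b where "b = sqrt (sqn (\<lambda>X. snd (p X)))"
  have ab: "0 \<le> a" "0 \<le> b" "sqn w = a\<^sup>2" "sqn (\<lambda>X. snd (p X)) = b\<^sup>2" by (auto simp: a_def b_def)
  have "a\<^sup>2 \<le> a * (norm z * b) + d * (2 * a + a * norm z)" if d: "0 < d" for d
  proof -
    obtain \<psi> where \<psi>: "C1c S \<psi>" "sqn (\<lambda>X. jet \<psi> X - p X) < d\<^sup>2"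
      by (rule HclE[OF p, of "d\<^sup>2"]) (use d in auto)
    note Lj = C1c_jet(2)[OF \<psi>(1)]
    obtain r where r: "0 < r" "r < 1"
      "(LINT X|lborel. w X * (\<psi> (X + 1 *\<^sub>R (z, 0)) - \<psi> X)) = 1 * (LINT X|lborel. w X * dird \<psi> (z, 0) (X + r *\<^sub>R (z, 0)))"
      using integral_MVT[OF w \<psi>(1), of 1 "(z, 0)"] by auto
    define r' where "r' = (r *\<^sub>R z, 0::real)"
    have ss: "L2 (\<lambda>X. snd (p (X + r')) \<bullet> z)" "L2 (\<lambda>X. gradx \<psi> (X + r') \<bullet> z)"
      "L2 (\<lambda>X. snd (p (X + r')))" "L2 (\<lambda>X. gradx \<psi> (X + r'))"
    proof -
      show 1: "L2 (\<lambda>X. snd (p (X + r')))" by (rule L2_snd(1)[OF L2_shift(1)[OF Lp]])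
      show 2: "L2 (\<lambda>X. gradx \<psi> (X + r'))" by (rule L2_shift(1)[OF C1c_jet(8)[OF \<psi>(1)]])
      note [measurable] = L2_meas[OF 1] L2_meas[OF 2]
      show "L2 (\<lambda>X. snd (p (X + r')) \<bullet> z)"
        by (rule L2_bdd(1)[OF _ 1, of _ "norm z"]) (auto intro!: AE_I2 order_trans[OF Cauchy_Schwarz_ineq2] simp: mult.commute)
      show "L2 (\<lambda>X. gradx \<psi> (X + r') \<bullet> z)"
        by (rule L2_bdd(1)[OF _ 2, of _ "norm z"]) (auto intro!: AE_I2 order_trans[OF Cauchy_Schwarz_ineq2] simp: mult.commute)
    qed
    have gb: "sqrt (sqn (\<lambda>X. gradx \<psi> (X + r') \<bullet> z)) \<le> norm z * (b + d)"
    proof -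
      have "sqn (\<lambda>X. gradx \<psi> (X + r') \<bullet> z) \<le> (norm z)\<^sup>2 * sqn (\<lambda>X. gradx \<psi> (X + r'))"
        by (rule L2_bdd(2)[OF L2_meas[OF ss(2)] ss(4)]) (auto intro!: AE_I2 order_trans[OF Cauchy_Schwarz_ineq2] simp: mult.commute)
      also have "sqn (\<lambda>X. gradx \<psi> (X + r')) = sqn (gradx \<psi>)" by (rule L2_shift(2)[OF C1c_jet(8)[OF \<psi>(1)]])
      also have "sqn (gradx \<psi>) \<le> (b + d)\<^sup>2"
      proof -
        have g: "L2 (gradx \<psi>)" by (rule C1c_jet(8)[OF \<psi>(1)])
        define v where "v X = gradx \<psi> X - snd (p X)" for X
        have Lv: "L2 v" unfolding v_def[abs_def] by (rule L2_diff(1)[OF g f1(3)])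
        have "v = (\<lambda>X. snd (jet \<psi> X - p X))" by (auto simp: jet_def v_def)
        then have vd: "sqn v < d\<^sup>2" using L2_snd(2)[OF L2_diff(1)[OF Lj Lp]] \<psi>(2) by simp
        have "sqn (gradx \<psi>) = (LINT X|lborel. (norm (v X + snd (p X)))\<^sup>2)" by (simp add: sqn_def v_def)
        also have "\<dots> = (LINT X|lborel. (norm (v X))\<^sup>2 + 2 * (v X \<bullet> snd (p X)) + (norm (snd (p X)))\<^sup>2)"
          by (simp add: power2_norm_eq_inner inner_simps inner_commute algebra_simps)
        also have "\<dots> = sqn v + 2 * (LINT X|lborel. v X \<bullet> snd (p X)) + b\<^sup>2"
          using L2_int[OF Lv] L2_int[OF f1(3)] L2_inner(1)[OF Lv f1(3)] ab(4) by (simp add: sqn_def)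
        also have "\<dots> \<le> d\<^sup>2 + 2 * (d * b) + b\<^sup>2"
        proof -
          have "sqrt (sqn v) \<le> d" using vd d by (intro real_le_lsqrt) auto
          then have "sqrt (sqn v) * b \<le> d * b" using ab(2) by (rule mult_right_mono)
          then show ?thesis using L2_inner(3)[OF Lv f1(3)] vd by (simp add: b_def)
        qed
        finally show ?thesis by (simp add: power2_eq_square algebra_simps)
      qed
      finally have "sqn (\<lambda>X. gradx \<psi> (X + r') \<bullet> z) \<le> (norm z * (b + d))\<^sup>2"
        by (simp add: power_mult_distrib mult_left_mono)
      then show ?thesis using ab(2) d by (intro real_le_lsqrt) auto
    qed
    have "(LINT X|lborel. w X * dird \<psi> (z, 0) (X + r *\<^sub>R (z, 0))) \<le> a * (norm z * (b + d))"
    proof -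
      have "(LINT X|lborel. w X * dird \<psi> (z, 0) (X + r *\<^sub>R (z, 0))) = (LINT X|lborel. w X \<bullet> (gradx \<psi> (X + r') \<bullet> z))"
        by (simp add: dird_def r'_def)
      also have "\<dots> \<le> a * sqrt (sqn (\<lambda>X. gradx \<psi> (X + r') \<bullet> z))"
        using L2_inner(3)[OF w ss(2)] by (simp add: a_def)
      also have "\<dots> \<le> a * (norm z * (b + d))" by (rule mult_left_mono[OF gb ab(1)])
      finally show ?thesis .
    qed
    then have 1: "(LINT X|lborel. w X * (\<psi> (X + (z, 0)) - \<psi> X)) \<le> a * (norm z * (b + d))" using r(3) by simp
    have f2: "L2 \<psi>" "L2 (\<lambda>X. \<psi> (X + (z, 0)))"
      using C1c_jet(7)[OF \<psi>(1)] L2_shift(1)[OF C1c_jet(7)[OF \<psi>(1)]] by auto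
    have near: "sqn (\<lambda>X. \<psi> X - fst (p X)) \<le> d\<^sup>2"
    proof -
      have "(\<lambda>X. \<psi> X - fst (p X)) = (\<lambda>X. fst (jet \<psi> X - p X))" by (simp add: jet_def)
      then show ?thesis using L2_fst(2)[OF L2_diff(1)[OF Lj Lp]] \<psi>(2) by simp
    qed
    have near': "sqn (\<lambda>X. \<psi> (X + (z, 0)) - fst (p (X + (z, 0)))) \<le> d\<^sup>2"
      using sqn_shift_diff[OF f2(1) f1(1), of "(z, 0)"] near by simp
    have A: "\<bar>(LINT X|lborel. w X * \<psi> X) - (LINT X|lborel. w X * fst (p X))\<bar> \<le> a * d"
      using inner_tendsto[OF w f2(1) f1(1) near] d by (simp add: a_def)
    have B: "\<bar>(LINT X|lborel. w X * \<psi> (X + (z, 0))) - (LINT X|lborel. w X * fst (p (X + (z, 0))))\<bar> \<le> a * d"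
      using inner_tendsto[OF w f2(2) f1(2) near'] d by (simp add: a_def)
    have i: "integrable lborel (\<lambda>X. w X * \<psi> X)" "integrable lborel (\<lambda>X. w X * fst (p X))"
      "integrable lborel (\<lambda>X. w X * \<psi> (X + (z, 0)))" "integrable lborel (\<lambda>X. w X * fst (p (X + (z, 0))))"
      using L2_inner(1)[OF w f2(1)] L2_inner(1)[OF w f1(1)] L2_inner(1)[OF w f2(2)] L2_inner(1)[OF w f1(2)] by auto
    have "a\<^sup>2 = (LINT X|lborel. w X * (fst (p (X + (z, 0))) - fst (p X)))"
      unfolding ab(3)[symmetric] sqn_def by (simp add: w_def power2_eq_square)
    also have "\<dots> \<le> (LINT X|lborel. w X * (\<psi> (X + (z, 0)) - \<psi> X)) + 2 * (a * d)"
      using A B i by (simp add: right_diff_distrib)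
    also have "\<dots> \<le> a * (norm z * (b + d)) + 2 * (a * d)" using 1 by simp
    finally show ?thesis by (simp add: algebra_simps)
  qed
  then have "a\<^sup>2 \<le> a * (norm z * b) + e'" if "0 < e'" for e'
  proof -
    define c where "c = 2 * a + a * norm z + 1"
    have "0 < c" unfolding c_def using ab(1) by (smt (verit) mult_nonneg_nonneg norm_ge_zero)
    then have "a\<^sup>2 \<le> a * (norm z * b) + e' / c * (c - 1)" using \<open>\<And>d. 0 < d \<Longrightarrow> a\<^sup>2 \<le> a * (norm z * b) + d * (2 * a + a * norm z)\<close>[of "e' / c"] that by (simp add: c_def)
    also have "\<dots> \<le> a * (norm z * b) + e'" using \<open>0 < c\<close> that by (simp add: field_simps)
    finally show ?thesis .
  qed
  then have "a * a \<le> a * (norm z * b)" using field_le_epsilon by (metis power2_eq_square)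
  then have "a \<le> norm z * b" using ab(1,2) by (cases "a = 0") auto
  then have "a\<^sup>2 \<le> (norm z * b)\<^sup>2" using ab(1) by (intro power_mono)
  then show "sqn (\<lambda>X. fst (p (X + (z, 0))) - fst (p X)) \<le> (norm z)\<^sup>2 * sqn (\<lambda>X. snd (p X)) + e"
    using ab e by (simp add: w_def[abs_def] power_mult_distrib)
qed

section \<open>Local estimates for weak solutions\<close>

text \<open>For a solution of \<open>u\<^sub>t - div (A \<nabla>u) = f\<close> the pair \<open>F\<close> is \<open>(- f, A \<nabla>u)\<close>; all functions are extended by zero.\<close>

definition wsol :: "(real^'n::finite) set \<Rightarrow> real \<Rightarrow> ('n st \<Rightarrow> real) \<Rightarrow> ('n st \<Rightarrow> real^'n) \<Rightarrow> ('n st \<Rightarrow> real \<times> (real^'n)) \<Rightarrow> bool" where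
  "wsol \<Omega> q u g F \<longleftrightarrow> L2 F \<and> Hcl (\<Omega> \<times> {0<..<q}) (\<lambda>X. (u X, g X)) \<and>
     (\<forall>X. X \<notin> \<Omega> \<times> {0<..<q} \<longrightarrow> u X = 0 \<and> g X = 0 \<and> F X = 0) \<and>
     (\<forall>\<phi>. C1c (\<Omega> \<times> {..<q}) \<phi> \<longrightarrow> (LINT X|lborel. u X * dt \<phi> X) = (LINT X|lborel. F X \<bullet> jet \<phi> X))"

lemma wsolD:
  assumes "wsol \<Omega> q u g F"
  shows "L2 F" "Hcl (\<Omega> \<times> {0<..<q}) (\<lambda>X. (u X, g X))" "L2 u" "L2 g"
    "\<And>X. X \<notin> \<Omega> \<times> {0<..<q} \<Longrightarrow> u X = 0" "\<And>X. X \<notin> \<Omega> \<times> {0<..<q} \<Longrightarrow> g X = 0" "\<And>X. X \<notin> \<Omega> \<times> {0<..<q} \<Longrightarrow> F X = 0"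
    "\<And>\<phi>. C1c (\<Omega> \<times> {..<q}) \<phi> \<Longrightarrow> (LINT X|lborel. u X * dt \<phi> X) = (LINT X|lborel. F X \<bullet> jet \<phi> X)"
proof -
  show H: "Hcl (\<Omega> \<times> {0<..<q}) (\<lambda>X. (u X, g X))" using assms unfolding wsol_def by blast
  show "L2 u" "L2 g" using L2_fst(1)[OF Hcl_L2[OF H]] L2_snd(1)[OF Hcl_L2[OF H]] by simp_all
qed (use assms in \<open>unfold wsol_def, blast+\<close>)

lemma minus_shift: "X - (0, \<tau>) = X + (0, - \<tau>)" for X :: "'n::finite st"
  by (cases X) simp

text \<open>Test functions supported before q' do not see what happens later, so the solution may be
  stopped there. For each cell the local estimates can then ignore everything after its upper end,
  including any later source.\<close>

lemma wsol_cut: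
  fixes u :: "'n::finite st \<Rightarrow> real"
  assumes w: "wsol \<Omega> q u g F" and q: "q' \<le> q"
  shows "wsol \<Omega> q' (\<lambda>X. indicator (slab 0 q') X * u X) (\<lambda>X. indicator (slab 0 q') X *\<^sub>R g X) (\<lambda>X. indicator (slab 0 q') X *\<^sub>R F X)"
  unfolding wsol_def
proof (intro conjI allI impI)
  let ?I = "\<lambda>X. indicator (slab 0 q') X :: real"
  show "L2 (\<lambda>X. ?I X *\<^sub>R F X)" by (rule L2_indicator(1)[OF wsolD(1)[OF w]]) measurable
  have "Hcl (\<Omega> \<times> UNIV) (\<lambda>X. (u X, g X))" by (rule Hcl_mono[OF wsolD(2)[OF w]]) auto
  from Hcl_cut'[OF this, of 0 q'] show "Hcl (\<Omega> \<times> {0<..<q'}) (\<lambda>X. (?I X * u X, ?I X *\<^sub>R g X))" by simp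
  {
    fix X assume X: "X \<notin> \<Omega> \<times> {0<..<q'}"
    have "?I X = 0 \<or> X \<notin> \<Omega> \<times> {0<..<q}"
      using X q by (cases X) (auto simp: indicator_def slab_iff)
    then show "?I X * u X = 0" "?I X *\<^sub>R g X = 0" "?I X *\<^sub>R F X = 0" using wsolD(5-7)[OF w, of X] by auto
  }
  fix \<phi> assume \<phi>: "C1c (\<Omega> \<times> {..<q'}) \<phi>"
  have \<phi>': "C1c (\<Omega> \<times> {..<q}) \<phi>" by (rule C1c_mono[OF \<phi>]) (use q in auto)
  have z: "?I X * u X * dt \<phi> X = u X * dt \<phi> X" "(?I X *\<^sub>R F X) \<bullet> jet \<phi> X = F X \<bullet> jet \<phi> X" for X
  proof -
    have "?I X = 1 \<or> X \<notin> \<Omega> \<times> {0<..<q} \<or> X \<notin> tsupp \<phi>"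
      using \<phi> by (cases X) (auto simp: indicator_def slab_iff C1c_alt)
    then show "?I X * u X * dt \<phi> X = u X * dt \<phi> X" "(?I X *\<^sub>R F X) \<bullet> jet \<phi> X = F X \<bullet> jet \<phi> X"
      using wsolD(5,7)[OF w, of X] notin_tsupp(3)[of X \<phi>] C1c_jet(3)[OF \<phi>, of X] by auto
  qed
  show "(LINT X|lborel. ?I X * u X * dt \<phi> X) = (LINT X|lborel. (?I X *\<^sub>R F X) \<bullet> jet \<phi> X)"
    using wsolD(8)[OF w \<phi>'] by (simp only: z)
qed

lemma fst_jmul: "fst (jmul \<kappa> p X) = \<kappa> X * fst (p X)" by (simp add: jmul_def)
lemma snd_jmul: "snd (jmul \<kappa> p X) = \<kappa> X *\<^sub>R snd (p X) + fst (p X) *\<^sub>R gradx \<kappa> X" by (simp add: jmul_def)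

text \<open>Discrete integration by parts: by translation invariance the forward difference of p
  becomes a backward difference of u, and the sign of the pairing with F changes.\<close>

lemma time_difference_bound':
  fixes u :: "'n::finite st \<Rightarrow> real"
  assumes w: "wsol \<Omega> q u g F" and p: "Hcl (\<Omega> \<times> {..<q}) p" and \<tau>: "0 < \<tau>"
    and B: "\<And>r. 0 \<le> r \<Longrightarrow> r \<le> \<tau> \<Longrightarrow> - (LINT X|lborel. F X \<bullet> p (X + (0, r))) \<le> B"
  shows "(LINT X|lborel. (u X - u (X - (0, \<tau>))) * fst (p X)) \<le> \<tau> * B"
proof -
  note Lp = Hcl_L2[OF p] and Lu = wsolD(3)[OF w]
  have f1: "L2 (\<lambda>X. fst (p X))" "L2 (\<lambda>X. fst (p (X + (0, \<tau>))))" "L2 (\<lambda>X. u (X + (0, - \<tau>)))"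
    using L2_fst(1)[OF Lp] L2_fst(1)[OF L2_shift(1)[OF Lp, of "(0, \<tau>)"]] L2_shift(1)[OF Lu] by auto
  note [measurable] = L2_meas[OF f1(1)] L2_meas[OF Lu]
  have i: "integrable lborel (\<lambda>X. u X * fst (p X))" "integrable lborel (\<lambda>X. u X * fst (p (X + (0, \<tau>))))"
    "integrable lborel (\<lambda>X. u (X + (0, - \<tau>)) * fst (p X))"
    using L2_inner(1)[OF Lu f1(1)] L2_inner(1)[OF Lu f1(2)] L2_inner(1)[OF f1(3) f1(1)] by auto
  have "(LINT X|lborel. (- u X) * (fst (p (X + (0, \<tau>))) - fst (p X))) \<le> \<tau> * B"
  proof (rule time_difference_bound[of _ "\<lambda>X. - F X" \<Omega> q])
    show "L2 (\<lambda>X. - u X)" "L2 (\<lambda>X. - F X)" using L2_minus(1) Lu wsolD(1)[OF w] by auto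
    show "(LINT X|lborel. - u X * dt \<phi> X) = (LINT X|lborel. - F X \<bullet> jet \<phi> X)" if "C1c (\<Omega> \<times> {..<q}) \<phi>" for \<phi>
      using wsolD(8)[OF w that] by simp
    show "(LINT X|lborel. - F X \<bullet> p (X + (0, r))) \<le> B" if "0 \<le> r" "r \<le> \<tau>" for r
      using B[OF that] by simp
  qed (rule p, rule \<tau>)
  also have "(LINT X|lborel. (- u X) * (fst (p (X + (0, \<tau>))) - fst (p X)))
      = (LINT X|lborel. u X * fst (p X)) - (LINT X|lborel. u X * fst (p (X + (0, \<tau>))))"
    using i by (simp add: algebra_simps)
  also have "(LINT X|lborel. u X * fst (p (X + (0, \<tau>)))) = (LINT X|lborel. u (X + (0, - \<tau>)) * fst (p X))"
  proof -
    have "(LINT X|lborel. u (X + (0, - \<tau>)) * fst (p X)) = (LINT X|lborel. u ((X + (0, \<tau>)) + (0, - \<tau>)) * fst (p (X + (0, \<tau>))))"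
      by (rule integral_shift(1)[of "\<lambda>X. u (X + (0, - \<tau>)) * fst (p X)" "(0, \<tau>)", symmetric]) measurable
    also have "\<dots> = (LINT X|lborel. u X * fst (p (X + (0, \<tau>))))"
      by (simp add: add.assoc zero_prod_def[symmetric])
    finally show ?thesis by simp
  qed
  also have "(LINT X|lborel. u X * fst (p X)) - (LINT X|lborel. u (X + (0, - \<tau>)) * fst (p X))
      = (LINT X|lborel. (u X - u (X - (0, \<tau>))) * fst (p X))"
  proof -
    show ?thesis using i by (simp add: left_diff_distrib minus_shift)
  qed
  finally show ?thesis .
qed

text \<open>Testing with \<kappa> h(u), where H is a convex antiderivative of h. Convexity bounds
  h(u) times the backward difference of u from below by the backward difference of H(u). A shift
  then puts the difference on \<kappa>, where k dominates it. Since u is extended by zero to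
  negative times, the initial condition leaves no boundary term. The choice h(r) = r yields the
  Caccioppoli inequality, a truncation yields the maximum principle.\<close>

lemma energy:
  fixes u :: "'n::finite st \<Rightarrow> real"
  assumes w: "wsol \<Omega> q u g F"
    and h: "\<And>r. (h has_real_derivative h' r) (at r)" and ch: "continuous_on UNIV h'"
    and h0: "h 0 = 0" and h1: "\<And>r. \<bar>h' r\<bar> \<le> 1"
    and H: "\<And>a b. h a * (b - a) \<le> H b - H a" "\<And>r. \<bar>H r\<bar> \<le> r\<^sup>2" "continuous_on UNIV H"
    and \<kappa>: "C1 \<kappa>" "\<And>X. 0 \<le> \<kappa> X" "\<And>X. \<bar>\<kappa> X\<bar> \<le> K" "\<And>X. norm (gradx \<kappa> X) \<le> K"
    and \<tau>0: "0 < \<tau>\<^sub>0" and k: "integrable lborel k"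
    and kb: "\<And>\<tau>. 0 < \<tau> \<Longrightarrow> \<tau> < \<tau>\<^sub>0 \<Longrightarrow> AE X in lborel. (\<kappa> (X + (0, \<tau>)) - \<kappa> X) * H (u X) \<le> \<tau> * k X"
  shows "(LINT X|lborel. F X \<bullet> jmul \<kappa> (\<lambda>X. (h (u X), h' (u X) *\<^sub>R g X)) X) \<le> (LINT X|lborel. k X)"
proof (rule field_le_epsilon)
  fix e :: real assume e: "0 < e"
  define p where "p = jmul \<kappa> (\<lambda>X. (h (u X), h' (u X) *\<^sub>R g X))"
  have Hp: "Hcl (\<Omega> \<times> {0<..<q}) p"
    unfolding p_def by (rule Hcl_jmul[OF _ \<kappa>(1,3,4)]) (use Hcl_comp[OF wsolD(2)[OF w] h ch h0 h1] in simp)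
  have Hp': "Hcl (\<Omega> \<times> {..<q}) p" by (rule Hcl_mono[OF Hp]) auto
  note Lp = Hcl_L2[OF Hp] and Lu = wsolD(3)[OF w] and LF = wsolD(1)[OF w]
  define c where "c = sqrt (sqn F) + 1"
  have c: "0 < c" unfolding c_def by (smt (verit) real_sqrt_ge_zero sqn_nonneg)
  obtain d where d: "0 < d" "\<And>r. \<bar>r\<bar> < d \<Longrightarrow> sqn (\<lambda>X. p (X + (0, r)) - p X) < (e / c)\<^sup>2"
    using Hcl_translation[OF Hp, of "(e / c)\<^sup>2"] e c by auto
  \<comment> \<open>One small step suffices: for steps below d the translation of p already changes
    the pairing with F by at most e, so no limit in \<tau> is taken.\<close>
  define \<tau> where "\<tau> = min d \<tau>\<^sub>0 / 2"
  have \<tau>: "0 < \<tau>" "\<tau> < d" "\<tau> < \<tau>\<^sub>0" using d(1) \<tau>0 by (auto simp: \<tau>_def min_def)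
  have pos: "0 \<le> e / c" using e c by simp
  have A: "(LINT X|lborel. (u X - u (X - (0, \<tau>))) * fst (p X)) \<le> \<tau> * (- (LINT X|lborel. F X \<bullet> p X) + e)"
  proof (rule time_difference_bound'[OF w Hp' \<tau>(1)])
    fix r assume r: "0 \<le> r" "r \<le> \<tau>"
    have "sqn (\<lambda>X. p (X + (0, r)) - p X) \<le> (e / c)\<^sup>2" using d(2)[of r] r \<tau> by (simp add: less_imp_le)
    from inner_tendsto[OF LF L2_shift(1)[OF Lp] Lp this pos]
    have "\<bar>(LINT X|lborel. F X \<bullet> p (X + (0, r))) - (LINT X|lborel. F X \<bullet> p X)\<bar> \<le> sqrt (sqn F) * (e / c)" .
    also have "\<dots> \<le> c * (e / c)" using pos by (intro mult_right_mono) (auto simp: c_def)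
    also have "\<dots> = e" using c by simp
    finally show "- (LINT X|lborel. F X \<bullet> p (X + (0, r))) \<le> - (LINT X|lborel. F X \<bullet> p X) + e" by linarith
  qed
  note [measurable] = L2_meas[OF Lu] C1_meas(1)[OF \<kappa>(1)] borel_measurable_continuous_onI[OF H(3)]
  have iH: "integrable lborel (\<lambda>X. H (u X))"
    by (rule Bochner_Integration.integrable_bound[OF L2_int[OF Lu]]) (use H(2) in auto)
  have iH2: "integrable lborel (\<lambda>X. H (u (X - (0, \<tau>))))"
    using integral_shift(2)[of "\<lambda>X. H (u X)" "(0, - \<tau>)"] iH by (simp add: minus_shift)
  have K: "norm (\<kappa> X * y) \<le> norm (K * y)" for X y
    using mult_right_mono[OF \<kappa>(3)[of X], of "\<bar>y\<bar>"] \<kappa>(3)[of X] by (simp add: abs_mult)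
  have i\<kappa>: "integrable lborel (\<lambda>X. \<kappa> (X + a) * H (u X))" for a
    by (rule Bochner_Integration.integrable_bound[OF integrable_mult_right[OF iH, of K]]) (use K in auto)
  have i\<kappa>0: "integrable lborel (\<lambda>X. \<kappa> X * H (u X))" using i\<kappa>[of 0] by simp
  have i\<kappa>2: "integrable lborel (\<lambda>X. \<kappa> X * H (u (X - (0, \<tau>))))"
    by (rule Bochner_Integration.integrable_bound[OF integrable_mult_right[OF iH2, of K]]) (use K in auto)
  have Lus: "L2 (\<lambda>X. u (X - (0, \<tau>)))" using L2_shift(1)[OF Lu, of "(0, - \<tau>)"] by (simp add: minus_shift)
  have i1: "integrable lborel (\<lambda>X. (u X - u (X - (0, \<tau>))) * fst (p X))"
    using L2_inner(1)[OF L2_diff(1)[OF Lu Lus] L2_fst(1)[OF Lp]] by simp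
  have "(LINT X|lborel. \<kappa> X * H (u X)) - (LINT X|lborel. \<kappa> X * H (u (X - (0, \<tau>))))
      = (LINT X|lborel. \<kappa> X * H (u X) - \<kappa> X * H (u (X - (0, \<tau>))))"
    using i\<kappa>0 i\<kappa>2 by simp
  also have "\<dots> \<le> (LINT X|lborel. (u X - u (X - (0, \<tau>))) * fst (p X))"
  proof (rule integral_mono[OF _ i1])
    show "integrable lborel (\<lambda>X. \<kappa> X * H (u X) - \<kappa> X * H (u (X - (0, \<tau>))))" using i\<kappa>0 i\<kappa>2 by simp
    fix X
    \<comment> \<open>The subgradient inequality at u X is the discrete form of d/dt H(u) = h(u)
      u_t.\<close>
    have "\<kappa> X * (H (u X) - H (u (X - (0, \<tau>)))) \<le> \<kappa> X * (h (u X) * (u X - u (X - (0, \<tau>))))"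
      using H(1)[of "u X" "u (X - (0, \<tau>))"] by (intro mult_left_mono \<kappa>(2)) (simp add: algebra_simps)
    then show "\<kappa> X * H (u X) - \<kappa> X * H (u (X - (0, \<tau>))) \<le> (u X - u (X - (0, \<tau>))) * fst (p X)"
      by (simp add: p_def fst_jmul algebra_simps)
  qed
  finally have B: "(LINT X|lborel. \<kappa> X * H (u X)) - (LINT X|lborel. \<kappa> X * H (u (X - (0, \<tau>)))) \<le> (LINT X|lborel. (u X - u (X - (0, \<tau>))) * fst (p X))" .
  \<comment> \<open>Summation by parts: the translation passes from u to the weight \<kappa>, whose
    increments are controlled by k.\<close>
  have "(LINT X|lborel. \<kappa> X * H (u (X - (0, \<tau>)))) = (LINT X|lborel. \<kappa> (X + (0, \<tau>)) * H (u X))"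
    using integral_shift(1)[of "\<lambda>X. \<kappa> X * H (u (X - (0, \<tau>)))" "(0, \<tau>)"] by simp
  then have "(LINT X|lborel. \<kappa> X * H (u (X - (0, \<tau>)))) - (LINT X|lborel. \<kappa> X * H (u X)) = (LINT X|lborel. (\<kappa> (X + (0, \<tau>)) - \<kappa> X) * H (u X))"
    using i\<kappa>[of "(0, \<tau>)"] i\<kappa>0 by (simp add: left_diff_distrib)
  also have "\<dots> \<le> (LINT X|lborel. \<tau> * k X)"
    by (rule integral_mono_AE) (use i\<kappa>[of "(0, \<tau>)"] i\<kappa>0 k kb[OF \<tau>(1,3)] in \<open>auto simp: left_diff_distrib\<close>)
  finally have C: "(LINT X|lborel. \<kappa> X * H (u (X - (0, \<tau>)))) - (LINT X|lborel. \<kappa> X * H (u X)) \<le> \<tau> * (LINT X|lborel. k X)" by simp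
  have "\<tau> * ((LINT X|lborel. F X \<bullet> p X) - e) \<le> \<tau> * (LINT X|lborel. k X)"
    using A B C by (simp add: algebra_simps)
  then have "(LINT X|lborel. F X \<bullet> p X) - e \<le> (LINT X|lborel. k X)" using \<tau>(1) by simp
  then show "(LINT X|lborel. F X \<bullet> jmul \<kappa> (\<lambda>X. (h (u X), h' (u X) *\<^sub>R g X)) X) \<le> (LINT X|lborel. k X) + e"
    by (simp add: p_def)
qed

text \<open>The cut-off \<open>\<xi>\<close> is independent of time, and the source vanishes on its support after time \<open>s\<^sub>0\<close>.\<close>

locale local_solution =
  fixes \<Omega> :: "(real^'n::finite) set" and q :: real and u :: "'n st \<Rightarrow> real" and g F and lam \<Lambda> :: real
    and \<xi> :: "'n st \<Rightarrow> real" and D :: "'n st set" and Gx s\<^sub>0 l :: real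
  assumes w: "wsol \<Omega> q u g F"
    and lam: "0 < lam" and ell1: "\<And>X. lam * (norm (g X))\<^sup>2 \<le> snd (F X) \<bullet> g X"
    and ell2: "\<And>X. norm (snd (F X)) \<le> \<Lambda> * norm (g X)"
    and Lam: "0 \<le> \<Lambda>"
    and \<xi>: "C1 \<xi>" "\<And>X. 0 \<le> \<xi> X" "\<And>X. \<xi> X \<le> 1" "\<And>X. norm (gradx \<xi> X) \<le> Gx" "\<And>X r. \<xi> (X + (0, r)) = \<xi> X"
    and D: "D \<in> sets borel" "\<And>X. X \<notin> D \<Longrightarrow> \<xi> X = 0" "\<And>X. X \<notin> D \<Longrightarrow> gradx \<xi> X = 0"
    and l: "0 < l"
    and f0: "\<And>X. \<xi> X \<noteq> 0 \<Longrightarrow> s\<^sub>0 < snd X \<Longrightarrow> fst (F X) = 0"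
begin

text \<open>The energy on the right of the estimates is taken from time \<open>s\<^sub>0\<close> on,
  while \<open>dgx\<close> and \<open>dux\<close> start 2 l later. The gap is the price for a
  cut-off in time that has to rise from 0 to 1.\<close>

definition E where "E = (LINT X|lborel. indicator (D \<inter> slab s\<^sub>0 q) X * (u X)\<^sup>2)"
definition dgx where "dgx X = indicator (slab (s\<^sub>0 + 2 * l) q) X * ((\<xi> X)\<^sup>2 * (norm (g X))\<^sup>2)"
definition dux where "dux X = indicator (slab (s\<^sub>0 + 2 * l) q) X * ((norm (gradx \<xi> X))\<^sup>2 * (u X)\<^sup>2)"

lemma Gx0: "0 \<le> Gx" using \<xi>(4)[of 0] norm_ge_zero order_trans by blast

lemmas meas [measurable] = L2_meas[OF wsolD(3)[OF w]] L2_meas[OF wsolD(4)[OF w]] L2_meas[OF wsolD(1)[OF w]]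
  C1_meas(1,2)[OF \<xi>(1)] D(1)

lemma iu: "integrable lborel (\<lambda>X. (u X)\<^sup>2)" using L2_int[OF wsolD(3)[OF w]] by simp
lemma ig: "integrable lborel (\<lambda>X. (norm (g X))\<^sup>2)" using L2_int[OF wsolD(4)[OF w]] by simp

lemma bdd_integrable:
  assumes "integrable lborel f" "\<And>X. \<bar>m X\<bar> \<le> C" "m \<in> borel_measurable borel"
  shows "integrable lborel (\<lambda>X::'n st. m X * f X :: real)"
proof (rule Bochner_Integration.integrable_bound[OF integrable_mult_right[OF assms(1), of C]])
  have [measurable]: "f \<in> borel_measurable borel" using assms(1) by (auto dest: borel_measurable_integrable)
  note [measurable] = assms(3)
  show "(\<lambda>X. m X * f X) \<in> borel_measurable lborel" by measurable
  show "AE X in lborel. norm (m X * f X) \<le> norm (C * f X)"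
  proof (rule AE_I2)
    fix X show "norm (m X * f X) \<le> norm (C * f X)"
      using mult_right_mono[OF assms(2)[of X], of "\<bar>f X\<bar>"] assms(2)[of X] by (simp add: abs_mult)
  qed
qed

lemma iE: "integrable lborel (\<lambda>X. indicator (D \<inter> slab s\<^sub>0 q) X * (u X)\<^sup>2)"
  by (rule bdd_integrable[OF iu, of _ 1]) (auto simp: indicator_def intro!: borel_measurable_indicator sets.Int D(1) slab_borel)

lemma \<xi>2: "(\<xi> X)\<^sup>2 \<le> 1" "\<bar>(\<xi> X)\<^sup>2\<bar> \<le> 1" using \<xi>(2,3)[of X] by (auto simp: power_le_one)

lemma idgx: "integrable lborel dgx"
proof -
  have "integrable lborel (\<lambda>X. (indicator (slab (s\<^sub>0 + 2 * l) q) X * (\<xi> X)\<^sup>2) * (norm (g X))\<^sup>2)"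
    by (rule bdd_integrable[OF ig, of _ 1]) (use \<xi>2 in \<open>auto simp: indicator_def\<close>)
  then show ?thesis unfolding dgx_def[abs_def] by (simp add: mult.assoc)
qed

lemma gx2: "(norm (gradx \<xi> X))\<^sup>2 \<le> Gx\<^sup>2" using \<xi>(4)[of X] by (intro power_mono) auto

lemma idux: "integrable lborel dux"
proof -
  have "integrable lborel (\<lambda>X. (indicator (slab (s\<^sub>0 + 2 * l) q) X * (norm (gradx \<xi> X))\<^sup>2) * (u X)\<^sup>2)"
    by (rule bdd_integrable[OF iu, of _ "Gx\<^sup>2"]) (use gx2 in \<open>auto simp: indicator_def\<close>)
  then show ?thesis unfolding dux_def[abs_def] by (simp add: mult.assoc)
qed

lemma dux_le: "(LINT X|lborel. dux X) \<le> Gx\<^sup>2 * E"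
proof -
  have "(LINT X|lborel. dux X) \<le> (LINT X|lborel. Gx\<^sup>2 * (indicator (D \<inter> slab s\<^sub>0 q) X * (u X)\<^sup>2))"
  proof (rule integral_mono[OF idux integrable_mult_right[OF iE]])
    fix X show "dux X \<le> Gx\<^sup>2 * (indicator (D \<inter> slab s\<^sub>0 q) X * (u X)\<^sup>2)"
      using D(3)[of X] l mult_right_mono[OF gx2, of "(u X)\<^sup>2" X] by (cases "X \<in> D") (auto simp: dux_def indicator_def slab_iff)
  qed
  then show ?thesis by (simp add: E_def)
qed

text \<open>1 / l comes from the slope of the cut-off in time, the term with Gx^2 from absorbing the
  gradient of \<xi> by Young's inequality, and 2 / lam from the half of the ellipticity that remains
  after this.\<close>

definition Ca where "Ca = 2 / lam * (1 / l + 2 * \<Lambda>\<^sup>2 / lam * Gx\<^sup>2)"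

text \<open>The energy inequality for h(r) = r with weight \<theta> \<xi>^2. Squaring \<xi> leaves a
  factor \<xi> in the gradient of the weight; paired with g, it produces \<xi> |g|, which the
  elliptic term can absorb.\<close>

lemma caccioppoli: "(LINT X|lborel. dgx X) \<le> Ca * E"
proof -
  \<comment> \<open>Zero up to \<open>s\<^sub>0\<close> + l and one from \<open>s\<^sub>0\<close> +
    2 l on. The idle first layer makes room for the shifts \<tau> < l: the shifted weight still
    vanishes at all times up to \<open>s\<^sub>0\<close>.\<close>
  define \<theta> where "\<theta> t = sstep ((t - (s\<^sub>0 + l)) / l)" for t
  have \<theta>d: "(\<theta> has_real_derivative sstep' ((t - (s\<^sub>0 + l)) / l) / l) (at t)" for t
    unfolding \<theta>_def[abs_def] by (rule DERIV_cong[OF DERIV_chain2[OF sstep_deriv]]) (auto intro!: derivative_eq_intros simp: l less_imp_neq[OF l, symmetric])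
  have \<theta>c: "continuous_on UNIV (\<lambda>t. sstep' ((t - (s\<^sub>0 + l)) / l) / l)"
    by (intro continuous_intros continuous_on_compose2[OF sstep'_cont]) (use l in auto)
  have \<theta>01: "0 \<le> \<theta> t" "\<theta> t \<le> 1" for t unfolding \<theta>_def using sstep_bounds by auto
  have \<theta>0: "\<theta> t = 0" if "t \<le> s\<^sub>0 + l" for t
    unfolding \<theta>_def using that l by (intro sstep_values) (auto simp: divide_nonpos_pos)
  have \<theta>1: "\<theta> t = 1" if "s\<^sub>0 + 2 * l \<le> t" for t
    unfolding \<theta>_def using that l by (intro sstep_values) (auto simp: field_simps)
  have \<theta>lip: "\<theta> (t + \<tau>) - \<theta> t \<le> 2 * \<tau> / l" if "0 < \<tau>" for t \<tau>
    using sstep_lip[of "(t - (s\<^sub>0 + l)) / l" "(t + \<tau> - (s\<^sub>0 + l)) / l"] that l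
    by (simp add: \<theta>_def divide_right_mono diff_divide_distrib add_divide_distrib)
  define \<kappa> where "\<kappa> X = \<theta> (snd X) * (\<xi> X * \<xi> X)" for X
  note C\<theta> = C1_time[OF \<theta>d \<theta>c]
  note C\<xi> = C1_mult[OF \<xi>(1) \<xi>(1)]
  have C\<kappa>: "C1 \<kappa>" unfolding \<kappa>_def[abs_def] by (rule C1_mult(1)[OF C\<xi>(1) C\<theta>(1)])
  have g\<kappa>: "gradx \<kappa> X = (2 * \<theta> (snd X) * \<xi> X) *\<^sub>R gradx \<xi> X" for X
  proof -
    have "gradx \<kappa> X = \<theta> (snd X) *\<^sub>R (\<xi> X *\<^sub>R gradx \<xi> X + \<xi> X *\<^sub>R gradx \<xi> X)"
      unfolding \<kappa>_def[abs_def] C1_mult(2)[OF C\<xi>(1) C\<theta>(1)] C\<xi>(2) C\<theta>(2) by simp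
    also have "\<dots> = (\<theta> (snd X) * (\<xi> X + \<xi> X)) *\<^sub>R gradx \<xi> X" by (simp only: scaleR_left_distrib[symmetric] scaleR_scaleR)
    finally show ?thesis by (simp add: algebra_simps)
  qed
  have \<kappa>0: "0 \<le> \<kappa> X" for X using \<theta>01 by (simp add: \<kappa>_def)
  have \<kappa>1: "\<kappa> X \<le> 1" for X using \<theta>01(2)[of "snd X"] \<theta>01(1)[of "snd X"] \<xi>2(1)[of X]
    by (auto simp: \<kappa>_def power2_eq_square intro!: mult_le_one)
  define K where "K = max 1 (2 * Gx)"
  have K1: "\<bar>\<kappa> X\<bar> \<le> K" for X using \<kappa>0[of X] \<kappa>1[of X] by (simp add: K_def)
  have K2: "norm (gradx \<kappa> X) \<le> K" for X
  proof -
    have "norm (gradx \<kappa> X) = 2 * (\<theta> (snd X) * \<xi> X) * norm (gradx \<xi> X)"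
      using \<theta>01(1)[of "snd X"] \<xi>(2)[of X] by (simp add: g\<kappa> abs_mult)
    also have "\<dots> \<le> 2 * 1 * Gx"
      using \<theta>01[of "snd X"] \<xi>(2,3,4)[of X] Gx0 by (intro mult_mono mult_le_one) auto
    finally show ?thesis by (simp add: K_def)
  qed
  \<comment> \<open>\<theta> increases by at most 2 \<tau> / l over a step \<tau>, and H(u) is half
    of u^2; the product is \<tau> u^2 / l.\<close>
  define k where "k X = 1 / l * (indicator (D \<inter> slab s\<^sub>0 q) X * (u X)\<^sup>2)" for X
  have ik: "integrable lborel k" unfolding k_def[abs_def] by (rule integrable_mult_right[OF iE])
  have en: "(LINT X|lborel. F X \<bullet> jmul \<kappa> (\<lambda>X. (u X, 1 *\<^sub>R g X)) X) \<le> (LINT X|lborel. k X)"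
  proof (rule energy[OF w, of "\<lambda>r. r" "\<lambda>r. 1" "\<lambda>r. r\<^sup>2 / 2" \<kappa> K l k])
    show "a * (b - a) \<le> b\<^sup>2 / 2 - a\<^sup>2 / 2" for a b :: real
      using zero_le_power2[of "b - a"] by (simp add: power2_eq_square algebra_simps)
    show "continuous_on UNIV (\<lambda>r::real. r\<^sup>2 / 2)" by (intro continuous_intros) auto
    show "C1 \<kappa>" "0 \<le> \<kappa> X" "\<bar>\<kappa> X\<bar> \<le> K" "norm (gradx \<kappa> X) \<le> K" for X by (rule C\<kappa> \<kappa>0 K1 K2)+
    show "0 < l" "integrable lborel k" by (rule l ik)+
    fix \<tau> assume \<tau>: "0 < \<tau>" "\<tau> < l"
    show "AE X in lborel. (\<kappa> (X + (0, \<tau>)) - \<kappa> X) * ((u X)\<^sup>2 / 2) \<le> \<tau> * k X"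
    proof (rule AE_I2)
    fix X
    show "(\<kappa> (X + (0, \<tau>)) - \<kappa> X) * ((u X)\<^sup>2 / 2) \<le> \<tau> * k X"
    proof (cases "X \<in> D \<inter> slab s\<^sub>0 q \<or> u X = 0")
      case True
      have "\<kappa> (X + (0, \<tau>)) - \<kappa> X = (\<theta> (snd X + \<tau>) - \<theta> (snd X)) * (\<xi> X)\<^sup>2"
        by (simp add: \<kappa>_def \<xi>(5) algebra_simps power2_eq_square)
      also have "\<dots> \<le> 2 * \<tau> / l * 1"
      proof (rule order_trans)
        show "(\<theta> (snd X + \<tau>) - \<theta> (snd X)) * (\<xi> X)\<^sup>2 \<le> 2 * \<tau> / l * (\<xi> X)\<^sup>2"
          by (rule mult_right_mono[OF \<theta>lip[OF \<tau>(1)]]) simp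
        show "2 * \<tau> / l * (\<xi> X)\<^sup>2 \<le> 2 * \<tau> / l * 1" using \<tau> l \<xi>2 by (intro mult_left_mono) auto
      qed
      finally have "(\<kappa> (X + (0, \<tau>)) - \<kappa> X) * ((u X)\<^sup>2 / 2) \<le> 2 * \<tau> / l * 1 * ((u X)\<^sup>2 / 2)"
        by (rule mult_right_mono) simp
      also have "\<dots> = \<tau> * k X" using True by (auto simp: k_def)
      finally show ?thesis .
    next
      case False
      have "X \<in> \<Omega> \<times> {0<..<q}" using wsolD(5)[OF w, of X] False by blast
      then have "snd X < q" by (cases X) auto
      then have "X \<notin> D \<or> snd X \<le> s\<^sub>0" using False by (auto simp: slab_iff)
      then have "\<kappa> (X + (0, \<tau>)) = 0"
        using D(2)[of X] \<theta>0[of "snd X + \<tau>"] \<tau> by (auto simp: \<kappa>_def \<xi>(5))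
      then have "(\<kappa> (X + (0, \<tau>)) - \<kappa> X) * ((u X)\<^sup>2 / 2) \<le> 0" using \<kappa>0[of X] by (simp add: mult_nonpos_nonneg)
      also have "0 \<le> \<tau> * k X" using \<tau> l by (simp add: k_def)
      finally show ?thesis .
    qed
    qed
  qed (auto intro!: derivative_eq_intros)
  define m where "m X = 2 * \<Lambda>\<^sup>2 / lam * Gx\<^sup>2 * (indicator (D \<inter> slab s\<^sub>0 q) X * (u X)\<^sup>2)" for X
  have im: "integrable lborel m" unfolding m_def[abs_def] by (rule integrable_mult_right[OF iE])
  have Lq: "L2 (\<lambda>X. (u X, g X))" by (rule Hcl_L2[OF wsolD(2)[OF w]])
  have iF: "integrable lborel (\<lambda>X. F X \<bullet> jmul \<kappa> (\<lambda>X. (u X, 1 *\<^sub>R g X)) X)"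
    using L2_inner(1)[OF wsolD(1)[OF w] jmul_L2(1)[OF C\<kappa> K1 K2 Lq]] by simp
  have pw: "lam / 2 * dgx X \<le> F X \<bullet> jmul \<kappa> (\<lambda>X. (u X, 1 *\<^sub>R g X)) X + m X" for X
  proof -
    define a where "a = norm (g X)"
    define b where "b = \<bar>u X\<bar> * norm (gradx \<xi> X)"
    define t where "t = \<theta> (snd X)"
    define c where "c = \<xi> X"
    have nn: "0 \<le> a" "0 \<le> b" "0 \<le> t" "t \<le> 1" "0 \<le> c" using \<theta>01 \<xi>(2) by (auto simp: a_def b_def t_def c_def)
    have F0: "fst (F X) * (\<kappa> X * u X) = 0"
    proof (cases "\<kappa> X = 0")
      case False
      then have "\<xi> X \<noteq> 0" "\<theta> (snd X) \<noteq> 0" by (auto simp: \<kappa>_def)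
      then have "fst (F X) = 0" using f0[of X] \<theta>0[of "snd X"] l by force
      then show ?thesis by simp
    qed simp
    have cross: "- (\<Lambda> * a * (2 * t * c * b)) \<le> snd (F X) \<bullet> (u X *\<^sub>R gradx \<kappa> X)"
    proof -
      have "\<bar>snd (F X) \<bullet> (u X *\<^sub>R gradx \<kappa> X)\<bar> \<le> norm (snd (F X)) * norm (u X *\<^sub>R gradx \<kappa> X)" by (rule Cauchy_Schwarz_ineq2)
      also have "\<dots> \<le> (\<Lambda> * a) * norm (u X *\<^sub>R gradx \<kappa> X)" using ell2[of X] by (intro mult_right_mono) (auto simp: a_def)
      also have "norm (u X *\<^sub>R gradx \<kappa> X) = 2 * t * c * b"
        using nn by (simp add: g\<kappa> abs_mult b_def t_def c_def)
      finally show ?thesis by linarith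
    qed
    have main: "lam * (t * c\<^sup>2) * a\<^sup>2 \<le> snd (F X) \<bullet> (\<kappa> X *\<^sub>R g X)"
      using mult_left_mono[OF ell1[of X] \<kappa>0[of X]]
      by (simp add: \<kappa>_def a_def t_def c_def power2_eq_square algebra_simps)
    have "F X \<bullet> jmul \<kappa> (\<lambda>X. (u X, 1 *\<^sub>R g X)) X = snd (F X) \<bullet> (\<kappa> X *\<^sub>R g X) + snd (F X) \<bullet> (u X *\<^sub>R gradx \<kappa> X)"
      using F0 by (simp add: inner_prod_def jmul_def inner_add_right)
    then have 1: "lam * (t * c\<^sup>2) * a\<^sup>2 - \<Lambda> * a * (2 * t * c * b) \<le> F X \<bullet> jmul \<kappa> (\<lambda>X. (u X, 1 *\<^sub>R g X)) X"
      using main cross by linarith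
    \<comment> \<open>Completing the square: half of the elliptic term pays for the cross term, and
      what is left over is bounded by \<open>m\<close>.\<close>
    have "0 \<le> t * (lam * c * a - 2 * \<Lambda> * b)\<^sup>2 / (2 * lam)" using nn lam by simp
    also have "\<dots> = lam / 2 * (t * c\<^sup>2) * a\<^sup>2 - \<Lambda> * a * (2 * t * c * b) + t * (2 * \<Lambda>\<^sup>2 / lam * b\<^sup>2)"
      using lam by (simp add: power2_eq_square field_simps)
    finally have 2: "lam / 2 * (t * c\<^sup>2) * a\<^sup>2 \<le> lam * (t * c\<^sup>2) * a\<^sup>2 - \<Lambda> * a * (2 * t * c * b) + t * (2 * \<Lambda>\<^sup>2 / lam * b\<^sup>2)"
      by (simp add: algebra_simps)
    have 3: "t * (2 * \<Lambda>\<^sup>2 / lam * b\<^sup>2) \<le> m X"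
    proof (cases "X \<in> D \<inter> slab s\<^sub>0 q \<or> u X = 0")
      case True
      have "b\<^sup>2 \<le> Gx\<^sup>2 * (u X)\<^sup>2" using mult_right_mono[OF gx2[of X], of "(u X)\<^sup>2"] by (simp add: b_def power_mult_distrib mult.commute)
      then have "t * (2 * \<Lambda>\<^sup>2 / lam * b\<^sup>2) \<le> 1 * (2 * \<Lambda>\<^sup>2 / lam * (Gx\<^sup>2 * (u X)\<^sup>2))"
        using nn lam by (intro mult_mono mult_left_mono) auto
      then show ?thesis using True by (auto simp: m_def)
    next
      case False
      have "X \<in> \<Omega> \<times> {0<..<q}" using wsolD(5)[OF w, of X] False by blast
      then have "snd X < q" by (cases X) auto
      then have "X \<notin> D \<or> snd X \<le> s\<^sub>0" using False by (auto simp: slab_iff)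
      then have "t * (2 * \<Lambda>\<^sup>2 / lam * b\<^sup>2) = 0" using D(3)[of X] \<theta>0[of "snd X"] l by (auto simp: b_def t_def)
      moreover have "0 \<le> m X" using lam by (simp add: m_def)
      ultimately show ?thesis by linarith
    qed
    have 4: "dgx X \<le> t * c\<^sup>2 * a\<^sup>2"
      using \<theta>1[of "snd X"] nn by (auto simp: dgx_def indicator_def slab_iff t_def c_def a_def)
    have "lam / 2 * dgx X \<le> lam / 2 * (t * c\<^sup>2) * a\<^sup>2" using mult_left_mono[OF 4, of "lam / 2"] lam by simp
    then show ?thesis using 1 2 3 by linarith
  qed
  have "lam / 2 * (LINT X|lborel. dgx X) = (LINT X|lborel. lam / 2 * dgx X)" by simp
  also have "\<dots> \<le> (LINT X|lborel. F X \<bullet> jmul \<kappa> (\<lambda>X. (u X, 1 *\<^sub>R g X)) X + m X)"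
    by (rule integral_mono[OF integrable_mult_right[OF idgx] _ pw]) (use iF im in simp)
  also have "\<dots> \<le> (LINT X|lborel. k X) + (LINT X|lborel. m X)" using iF im en by simp
  also have "\<dots> = (1 / l + 2 * \<Lambda>\<^sup>2 / lam * Gx\<^sup>2) * E" by (simp add: k_def m_def E_def algebra_simps)
  finally have "lam / 2 * (LINT X|lborel. dgx X) \<le> (1 / l + 2 * \<Lambda>\<^sup>2 / lam * Gx\<^sup>2) * E" .
  then have "2 / lam * (lam / 2 * (LINT X|lborel. dgx X)) \<le> 2 / lam * ((1 / l + 2 * \<Lambda>\<^sup>2 / lam * Gx\<^sup>2) * E)"
    using lam by (intro mult_left_mono) auto
  moreover have "2 / lam * (lam / 2 * x) = x" for x using lam by simp
  ultimately show ?thesis unfolding Ca_def by (simp only: mult.assoc)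
qed

end

section \<open>Translations in time and space, and the local oscillation\<close>

context local_solution
begin

lemma gx_shift: "gradx \<xi> (X + (0, r)) = gradx \<xi> X"
proof -
  have "(\<lambda>X. \<xi> (X + (0, r))) = \<xi>" by (rule ext) (rule \<xi>(5))
  then show ?thesis using C1_shift(2)[OF \<xi>(1), of "(0, r)"] by metis
qed

lemma nonneg: "0 \<le> dgx X" "0 \<le> dux X" by (auto simp: dgx_def dux_def)

lemma H_univ: "Hcl (\<Omega> \<times> UNIV) (\<lambda>X. (u X, g X))" by (rule Hcl_mono[OF wsolD(2)[OF w]]) auto

text \<open>The test function is \<xi>^2 times the time difference of u itself. One side is then the
  squared difference, the other is \<tau> times a quadratic expression in gradients at shifted
  times. So L^2 increments in time are of order sqrt \<tau>, although no time derivative is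
  available.\<close>

lemma time_diff:
  assumes \<tau>: "0 < \<tau>"
  shows "(LINT X|lborel. indicator (slab (s\<^sub>0 + 2 * l + \<tau>) q) X * ((\<xi> X)\<^sup>2 * (u X - u (X - (0, \<tau>)))\<^sup>2))
    \<le> \<tau> * (\<Lambda> * (4 * (LINT X|lborel. dgx X) + 2 * (LINT X|lborel. dux X)))"
proof -
  let ?s = "s\<^sub>0 + 2 * l"
  let ?I = "\<lambda>X. indicator (slab (?s + \<tau>) q) X :: real"
  define \<kappa> where "\<kappa> X = \<xi> X * \<xi> X" for X
  note C\<xi> = C1_mult[OF \<xi>(1) \<xi>(1)]
  have C\<kappa>: "C1 \<kappa>" unfolding \<kappa>_def[abs_def] by (rule C\<xi>(1))
  have g\<kappa>: "gradx \<kappa> X = (2 * \<xi> X) *\<^sub>R gradx \<xi> X" for X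
    unfolding \<kappa>_def[abs_def] C\<xi>(2) by (simp only: scaleR_left_distrib[symmetric] mult_2)
  define K where "K = max 1 (2 * Gx)"
  have K1: "\<bar>\<kappa> X\<bar> \<le> K" for X using \<xi>2(2)[of X] by (simp add: K_def \<kappa>_def power2_eq_square)
  have K2: "norm (gradx \<kappa> X) \<le> K" for X
  proof -
    have "norm (gradx \<kappa> X) = 2 * (\<xi> X * norm (gradx \<xi> X))" using \<xi>(2)[of X] by (simp add: g\<kappa>)
    also have "\<dots> \<le> 2 * (1 * Gx)" using \<xi>(2,3,4)[of X] by (intro mult_left_mono mult_mono) auto
    finally show ?thesis by (simp add: K_def)
  qed
  define v where "v X = 1 *\<^sub>R (u X, g X) + (-1) *\<^sub>R (u (X + (0, - \<tau>)), g (X + (0, - \<tau>)))" for X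
  \<comment> \<open>When X + (0, r) lies in the slab starting at \<open>s\<^sub>0\<close> + 2 l +
    \<tau>, the three points X, X + (0, r) and X + (0, r - \<tau>) all lie above
    \<open>s\<^sub>0\<close> + 2 l, because r is between 0 and \<tau>. The sharp cut is allowed by
    \<open>Hcl_cut'\<close>.\<close>
  define p where "p X = ?I X *\<^sub>R jmul \<kappa> v X" for X
  have "Hcl (\<Omega> \<times> UNIV) v" unfolding v_def[abs_def] by (rule Hcl_lin[OF H_univ Hcl_shift[OF H_univ, of "- \<tau>"]])
  from Hcl_cut'[OF Hcl_jmul[OF this C\<kappa> K1 K2]]
  have "Hcl (\<Omega> \<times> {?s + \<tau><..<q}) p" unfolding p_def[abs_def] .
  then have Hp: "Hcl (\<Omega> \<times> {..<q}) p" by (rule Hcl_mono) auto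
  have [measurable]: "dgx \<in> borel_measurable borel" "dux \<in> borel_measurable borel"
    using idgx idux by (auto dest: borel_measurable_integrable)
  have ish: "integrable lborel (\<lambda>X. dgx (X + a))" "integrable lborel (\<lambda>X. dux (X + a))"
    "(LINT X|lborel. dgx (X + a)) = (LINT X|lborel. dgx X)" "(LINT X|lborel. dux (X + a)) = (LINT X|lborel. dux X)" for a
    using integral_shift[of dgx a] integral_shift[of dux a] idgx idux by auto
  have "(LINT X|lborel. (u X - u (X - (0, \<tau>))) * fst (p X)) \<le> \<tau> * (\<Lambda> * (4 * (LINT X|lborel. dgx X) + 2 * (LINT X|lborel. dux X)))"
  proof (rule time_difference_bound'[OF w Hp \<tau>])
    fix r assume r: "0 \<le> r" "r \<le> \<tau>"
    \<comment> \<open>Young's inequality for the products x y, x y', x m and x m' below.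
      Translations do not change the integrals, so the weights add up to 3 + 1/2 + 1/2 = 4 for
      \<open>dgx\<close> and to 2 for \<open>dux\<close>.\<close>
    define R where "R X = \<Lambda> * (3 * dgx X + 1/2 * dgx (X + (0, r)) + 1/2 * dgx (X + (0, r - \<tau>)) + dux (X + (0, r)) + dux (X + (0, r - \<tau>)))" for X
    have iR: "integrable lborel R" unfolding R_def[abs_def]
      by (intro integrable_mult_right Bochner_Integration.integrable_add ish idgx idux)
    have vR: "(LINT X|lborel. R X) = \<Lambda> * (4 * (LINT X|lborel. dgx X) + 2 * (LINT X|lborel. dux X))"
      unfolding R_def using idgx idux ish by simp
    have pw: "- (F X \<bullet> p (X + (0, r))) \<le> R X" for X
    proof (cases "X + (0, r) \<in> slab (?s + \<tau>) q")
      case False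
      then have "- (F X \<bullet> p (X + (0, r))) = 0" by (simp add: p_def)
      also have "0 \<le> R X" unfolding R_def using nonneg Lam by simp
      finally show ?thesis .
    next
      case True
      define c where "c = \<xi> X"
      define Y where "Y = X + (0, r)"
      define Y' where "Y' = X + (0, r - \<tau>)"
      have t: "?s + \<tau> < snd X + r" "snd X + r < q" using True by (auto simp: slab_iff)
      have sl: "X \<in> slab ?s q" "Y \<in> slab ?s q" "Y' \<in> slab ?s q"
        using t r \<tau> by (auto simp: slab_iff Y_def Y'_def)
      have c0: "0 \<le> c" unfolding c_def by (rule \<xi>(2))
      have \<xi>Y: "\<xi> Y = c" "\<xi> Y' = c" "gradx \<xi> Y = gradx \<xi> X" "gradx \<xi> Y' = gradx \<xi> X"
        by (auto simp: Y_def Y'_def c_def \<xi>(5) gx_shift)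
      define G where "G = norm (gradx \<xi> X)"
      define x where "x = c * norm (g X)"
      define y where "y = c * norm (g Y)"
      define y' where "y' = c * norm (g Y')"
      define m where "m = G * \<bar>u Y\<bar>"
      define m' where "m' = G * \<bar>u Y'\<bar>"
      have dd: "dgx X = x\<^sup>2" "dgx Y = y\<^sup>2" "dgx Y' = y'\<^sup>2" "dux Y = m\<^sup>2" "dux Y' = m'\<^sup>2"
        using sl by (simp_all add: dgx_def dux_def \<xi>Y x_def y_def y'_def m_def m'_def G_def power_mult_distrib) (simp add: c_def)
      have Ys: "X + (0, r) + (0, - \<tau>) = Y'" by (cases X) (simp add: Y'_def)
      have pY: "p Y = ((c * c) * (u Y - u Y'), (c * c) *\<^sub>R (g Y - g Y') + (u Y - u Y') *\<^sub>R ((2 * c) *\<^sub>R gradx \<xi> X))"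
        using True Ys by (simp add: p_def jmul_def v_def g\<kappa> \<kappa>_def \<xi>Y Y_def[symmetric])
      have F0: "fst (F X) * ((c * c) * (u Y - u Y')) = 0"
        using f0[of X] sl(1) l by (cases "c = 0") (auto simp: c_def slab_iff)
      have "norm ((c * c) *\<^sub>R (g Y - g Y') + (u Y - u Y') *\<^sub>R ((2 * c) *\<^sub>R gradx \<xi> X))
          \<le> norm ((c * c) *\<^sub>R (g Y - g Y')) + norm ((u Y - u Y') *\<^sub>R ((2 * c) *\<^sub>R gradx \<xi> X))" by (rule norm_triangle_ineq)
      also have "\<dots> = c * (c * norm (g Y - g Y') + 2 * (\<bar>u Y - u Y'\<bar> * G))"
        unfolding norm_scaleR using c0 by (simp add: G_def abs_mult distrib_left mult.assoc mult.left_commute)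
      also have "\<dots> \<le> c * (c * (norm (g Y) + norm (g Y')) + 2 * ((\<bar>u Y\<bar> + \<bar>u Y'\<bar>) * G))"
        using c0 by (intro mult_left_mono add_mono mult_right_mono norm_triangle_ineq4) (auto simp: G_def)
      also have "\<dots> = c * (y + y' + 2 * m + 2 * m')" by (simp add: y_def y'_def m_def m'_def algebra_simps)
      finally have nb: "norm ((c * c) *\<^sub>R (g Y - g Y') + (u Y - u Y') *\<^sub>R ((2 * c) *\<^sub>R gradx \<xi> X)) \<le> c * (y + y' + 2 * m + 2 * m')" .
      have "- (F X \<bullet> p Y) = - (snd (F X) \<bullet> ((c * c) *\<^sub>R (g Y - g Y') + (u Y - u Y') *\<^sub>R ((2 * c) *\<^sub>R gradx \<xi> X)))"
        using F0 unfolding pY inner_prod_def by simp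
      also have "\<dots> \<le> norm (snd (F X)) * norm ((c * c) *\<^sub>R (g Y - g Y') + (u Y - u Y') *\<^sub>R ((2 * c) *\<^sub>R gradx \<xi> X))"
        using Cauchy_Schwarz_ineq2[of "snd (F X)" "(c * c) *\<^sub>R (g Y - g Y') + (u Y - u Y') *\<^sub>R ((2 * c) *\<^sub>R gradx \<xi> X)"] by linarith
      also have "\<dots> \<le> (\<Lambda> * norm (g X)) * (c * (y + y' + 2 * m + 2 * m'))"
        using Lam by (intro mult_mono ell2 nb) auto
      also have "\<dots> = \<Lambda> * (x * y + x * y' + 2 * (x * m) + 2 * (x * m'))" by (simp add: x_def algebra_simps)
      also have "\<dots> \<le> \<Lambda> * (3 * x\<^sup>2 + 1/2 * y\<^sup>2 + 1/2 * y'\<^sup>2 + m\<^sup>2 + m'\<^sup>2)"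
      proof (rule mult_left_mono[OF _ Lam])
        show "x * y + x * y' + 2 * (x * m) + 2 * (x * m') \<le> 3 * x\<^sup>2 + 1/2 * y\<^sup>2 + 1/2 * y'\<^sup>2 + m\<^sup>2 + m'\<^sup>2"
          using zero_le_power2[of "x - y"] zero_le_power2[of "x - y'"] zero_le_power2[of "x - m"] zero_le_power2[of "x - m'"]
          by (simp add: power2_diff)
      qed
      also have "\<dots> = R X" by (simp add: R_def dd[symmetric] Y_def Y'_def)
      finally show ?thesis by (simp add: Y_def)
    qed
    have "- (LINT X|lborel. F X \<bullet> p (X + (0, r))) = (LINT X|lborel. - (F X \<bullet> p (X + (0, r))))" by simp
    also have "\<dots> \<le> (LINT X|lborel. R X)"
      by (rule integral_mono[OF _ iR pw]) (use L2_inner(1)[OF wsolD(1)[OF w] L2_shift(1)[OF Hcl_L2[OF Hp]]] in simp)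
    finally show "- (LINT X|lborel. F X \<bullet> p (X + (0, r))) \<le> \<Lambda> * (4 * (LINT X|lborel. dgx X) + 2 * (LINT X|lborel. dux X))"
      by (simp add: vR)
  qed
  also have "(\<lambda>X. (u X - u (X - (0, \<tau>))) * fst (p X)) = (\<lambda>X. ?I X * ((\<xi> X)\<^sup>2 * (u X - u (X - (0, \<tau>)))\<^sup>2))"
    by (rule ext) (simp add: p_def fst_jmul v_def \<kappa>_def minus_shift power2_eq_square)
  finally show ?thesis .
qed

definition wx where "wx X = indicator (slab (s\<^sub>0 + 2 * l) q) X * (\<xi> X * u X)"

text \<open>\<open>space_translation\<close> for \<xi> u cut to the slab; its gradient is \<xi> g
  plus u times the gradient of \<xi>, whence the two factors 2.\<close>

lemma space_diff:
  "(LINT X|lborel. (wx (X + (z, 0)) - wx X)\<^sup>2) \<le> (norm z)\<^sup>2 * (2 * (LINT X|lborel. dgx X) + 2 * (LINT X|lborel. dux X))"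
    "integrable lborel (\<lambda>X. (wx (X + (z, 0)) - wx X)\<^sup>2)"
proof -
  let ?I = "\<lambda>X. indicator (slab (s\<^sub>0 + 2 * l) q) X :: real"
  define p where "p X = ?I X *\<^sub>R jmul \<xi> (\<lambda>X. (u X, g X)) X" for X
  define K where "K = max 1 Gx"
  have K: "\<bar>\<xi> X\<bar> \<le> K" "norm (gradx \<xi> X) \<le> K" for X using \<xi>(2,3,4)[of X] by (auto simp: K_def)
  have Hp: "Hcl (\<Omega> \<times> {s\<^sub>0 + 2 * l<..<q}) p" unfolding p_def[abs_def]
    by (rule Hcl_cut'[OF Hcl_jmul[OF H_univ \<xi>(1) K]])
  have f: "fst (p X) = wx X" for X by (simp add: p_def wx_def fst_jmul)
  have Ls: "L2 (\<lambda>X. snd (p X))" by (rule L2_snd(1)[OF Hcl_L2[OF Hp]])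
  have "sqn (\<lambda>X. snd (p X)) \<le> (LINT X|lborel. 2 * dgx X + 2 * dux X)"
    unfolding sqn_def
  proof (rule integral_mono[OF L2_int[OF Ls]])
    show "integrable lborel (\<lambda>X. 2 * dgx X + 2 * dux X)" using idgx idux by simp
    fix X
    have "(norm (\<xi> X *\<^sub>R g X + u X *\<^sub>R gradx \<xi> X))\<^sup>2 \<le> 2 * (norm (\<xi> X *\<^sub>R g X))\<^sup>2 + 2 * (norm (u X *\<^sub>R gradx \<xi> X))\<^sup>2"
      by (rule norm_add_sq)
    then show "(norm (snd (p X)))\<^sup>2 \<le> 2 * dgx X + 2 * dux X"
      by (simp add: p_def snd_jmul dgx_def dux_def indicator_def power_mult_distrib mult.commute)
  qed
  then have b: "sqn (\<lambda>X. snd (p X)) \<le> 2 * (LINT X|lborel. dgx X) + 2 * (LINT X|lborel. dux X)" using idgx idux by simp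
  have "sqn (\<lambda>X. fst (p (X + (z, 0))) - fst (p X)) \<le> (norm z)\<^sup>2 * sqn (\<lambda>X. snd (p X))" by (rule space_translation[OF Hp])
  also have "\<dots> \<le> (norm z)\<^sup>2 * (2 * (LINT X|lborel. dgx X) + 2 * (LINT X|lborel. dux X))" by (rule mult_left_mono[OF b]) simp
  finally show "(LINT X|lborel. (wx (X + (z, 0)) - wx X)\<^sup>2) \<le> (norm z)\<^sup>2 * (2 * (LINT X|lborel. dgx X) + 2 * (LINT X|lborel. dux X))"
    by (simp add: sqn_def f)
  have "L2 (\<lambda>X. fst (p (X + (z, 0))) - fst (p X))"
    by (rule L2_diff(1)[OF L2_fst(1)[OF L2_shift(1)[OF Hcl_L2[OF Hp]]] L2_fst(1)[OF Hcl_L2[OF Hp]]])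
  from L2_int[OF this] show "integrable lborel (\<lambda>X. (wx (X + (z, 0)) - wx X)\<^sup>2)" by (simp add: f)
qed

definition Ms where "Ms dz \<tau> = 2 * (dz\<^sup>2 * (2 * (LINT X|lborel. dgx X) + 2 * (LINT X|lborel. dux X)))
   + 2 * (\<tau> * (\<Lambda> * (4 * (LINT X|lborel. dgx X) + 2 * (LINT X|lborel. dux X))))"

lemma AB0: "0 \<le> (LINT X|lborel. dgx X)" "0 \<le> (LINT X|lborel. dux X)"
  using nonneg by (auto intro: integral_nonneg)

lemma Ms_mono: "0 \<le> a \<Longrightarrow> a \<le> a' \<Longrightarrow> b \<le> b' \<Longrightarrow> Ms a b \<le> Ms a' b'"
  unfolding Ms_def using AB0 Lam by (intro add_mono mult_left_mono mult_right_mono power_mono) auto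

text \<open>The increment is split at X + (0, \<tau>). This point may lie outside Q, but \<xi> is 1
  there as well, since \<xi> does not depend on time, and its time lies in the slab, being the time
  of X + (z, \<tau>). So the time step is covered by \<open>time_diff\<close> and the space step by
  \<open>space_diff\<close>.\<close>

lemma increment_pos:
  assumes \<tau>: "0 \<le> \<tau>" and Q: "Q \<in> sets borel" "\<And>X. X \<in> Q \<Longrightarrow> X \<in> slab (s\<^sub>0 + 2 * l) q" "\<And>X. X \<in> Q \<Longrightarrow> \<xi> X = 1"
  shows "(\<integral>\<^sup>+X. ennreal (indicator Q X * indicator Q (X + (z, \<tau>)) * (u (X + (z, \<tau>)) - u X)\<^sup>2) \<partial>lborel) \<le> ennreal (Ms (norm z) \<tau>)"
proof -
  define T where "T X = indicator (slab (s\<^sub>0 + 2 * l + \<tau>) q) X * ((\<xi> X)\<^sup>2 * (u X - u (X - (0, \<tau>)))\<^sup>2)" for X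
  define V where "V X = (wx (X + (z, 0)) - wx X)\<^sup>2" for X
  have Lus: "L2 (\<lambda>X. u (X - (0, \<tau>)))" using L2_shift(1)[OF wsolD(3)[OF w], of "(0, - \<tau>)"] by (simp add: minus_shift)
  have "integrable lborel (\<lambda>X. (u X - u (X - (0, \<tau>)))\<^sup>2)"
    using L2_int[OF L2_diff(1)[OF wsolD(3)[OF w] Lus]] by simp
  then have "integrable lborel (\<lambda>X. (indicator (slab (s\<^sub>0 + 2 * l + \<tau>) q) X * (\<xi> X)\<^sup>2) * (u X - u (X - (0, \<tau>)))\<^sup>2)"
    by (rule bdd_integrable[of _ _ 1]) (use \<xi>2 in \<open>auto simp: indicator_def\<close>)
  then have iT: "integrable lborel T" unfolding T_def[abs_def] by (simp add: mult.assoc)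
  have iV: "integrable lborel V" unfolding V_def[abs_def] by (rule space_diff(2))
  have T: "(LINT X|lborel. T X) \<le> \<tau> * (\<Lambda> * (4 * (LINT X|lborel. dgx X) + 2 * (LINT X|lborel. dux X)))"
  proof (cases "\<tau> = 0")
    case True
    then show ?thesis by (simp add: T_def zero_prod_def[symmetric])
  next
    case False
    then show ?thesis using time_diff[of \<tau>] \<tau> by (simp add: T_def)
  qed
  have V: "(LINT X|lborel. V X) \<le> (norm z)\<^sup>2 * (2 * (LINT X|lborel. dgx X) + 2 * (LINT X|lborel. dux X))"
    unfolding V_def by (rule space_diff(1))
  have pw: "indicator Q X * indicator Q (X + (z, \<tau>)) * (u (X + (z, \<tau>)) - u X)\<^sup>2 \<le> 2 * V (X + (0, \<tau>)) + 2 * T (X + (0, \<tau>))" for X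
  proof (cases "X \<in> Q \<and> X + (z, \<tau>) \<in> Q")
    case True
    let ?Y = "X + (0, \<tau>)"
    have e: "?Y + (z, 0) = X + (z, \<tau>)" by (cases X) simp
    have e2: "?Y - (0, \<tau>) = X" by simp
    have s: "X \<in> slab (s\<^sub>0 + 2 * l) q" "X + (z, \<tau>) \<in> slab (s\<^sub>0 + 2 * l) q" "\<xi> X = 1" "\<xi> (X + (z, \<tau>)) = 1" using True Q by auto
    have sY: "?Y \<in> slab (s\<^sub>0 + 2 * l) q" "?Y \<in> slab (s\<^sub>0 + 2 * l + \<tau>) q" using s \<tau> by (auto simp: slab_iff)
    have \<xi>Y: "\<xi> ?Y = 1" by (simp add: \<xi>(5) s)
    have "wx (?Y + (z, 0)) = u (X + (z, \<tau>))" unfolding e using s by (simp add: wx_def)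
    moreover have "wx ?Y = u ?Y" using sY \<xi>Y by (simp add: wx_def)
    ultimately have v: "V ?Y = (u (X + (z, \<tau>)) - u ?Y)\<^sup>2" by (simp add: V_def)
    have t: "T ?Y = (u ?Y - u X)\<^sup>2" unfolding T_def e2 using sY \<xi>Y by simp
    have "(u (X + (z, \<tau>)) - u X)\<^sup>2 = ((u (X + (z, \<tau>)) - u ?Y) + (u ?Y - u X))\<^sup>2" by simp
    also have "\<dots> \<le> 2 * (u (X + (z, \<tau>)) - u ?Y)\<^sup>2 + 2 * (u ?Y - u X)\<^sup>2"
      using norm_add_sq[of "u (X + (z, \<tau>)) - u ?Y" "u ?Y - u X"] by simp
    finally show ?thesis using True v t by simp
  next
    case False
    have "0 \<le> V Y" "0 \<le> T Y" for Y by (auto simp: V_def T_def)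
    then show ?thesis using False by (auto simp: indicator_def)
  qed
  have [measurable]: "T \<in> borel_measurable borel" "V \<in> borel_measurable borel" using iT iV by (auto dest: borel_measurable_integrable)
  have iB: "integrable lborel (\<lambda>X. 2 * V X + 2 * T X)" using iT iV by simp
  have "(\<integral>\<^sup>+X. ennreal (indicator Q X * indicator Q (X + (z, \<tau>)) * (u (X + (z, \<tau>)) - u X)\<^sup>2) \<partial>lborel)
     \<le> (\<integral>\<^sup>+X. ennreal (2 * V (X + (0, \<tau>)) + 2 * T (X + (0, \<tau>))) \<partial>lborel)"
    by (rule nn_integral_mono) (use pw in \<open>auto intro: ennreal_leI\<close>)
  also have "\<dots> = (\<integral>\<^sup>+X. ennreal (2 * V X + 2 * T X) \<partial>lborel)"
    by (rule nn_integral_shift[of "\<lambda>X. ennreal (2 * V X + 2 * T X)"]) measurable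
  also have "\<dots> = ennreal (LINT X|lborel. 2 * V X + 2 * T X)"
    by (rule nn_integral_eq_integral[OF iB]) (auto simp: V_def T_def)
  also have "\<dots> \<le> ennreal (Ms (norm z) \<tau>)"
    by (rule ennreal_leI) (use iT iV T V in \<open>simp add: Ms_def\<close>)
  finally show ?thesis .
qed

text \<open>\<open>time_diff\<close> handles steps forward in time. For negative \<tau> the two
  endpoints exchange their roles after a translation.\<close>

lemma increment_any:
  assumes Q: "Q \<in> sets borel" "\<And>X. X \<in> Q \<Longrightarrow> X \<in> slab (s\<^sub>0 + 2 * l) q" "\<And>X. X \<in> Q \<Longrightarrow> \<xi> X = 1"
  shows "(\<integral>\<^sup>+X. ennreal (indicator Q X * indicator Q (X + (z, \<tau>)) * (u (X + (z, \<tau>)) - u X)\<^sup>2) \<partial>lborel) \<le> ennreal (Ms (norm z) \<bar>\<tau>\<bar>)"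
proof (cases "0 \<le> \<tau>")
  case True
  then show ?thesis using increment_pos[OF True Q] by simp
next
  case False
  note [measurable] = Q(1)
  have "(\<integral>\<^sup>+X. ennreal (indicator Q X * indicator Q (X + (z, \<tau>)) * (u (X + (z, \<tau>)) - u X)\<^sup>2) \<partial>lborel)
    = (\<integral>\<^sup>+X. ennreal (indicator Q (X + (- z, - \<tau>)) * indicator Q ((X + (- z, - \<tau>)) + (z, \<tau>)) * (u ((X + (- z, - \<tau>)) + (z, \<tau>)) - u (X + (- z, - \<tau>)))\<^sup>2) \<partial>lborel)"
    by (rule nn_integral_shift[symmetric]) measurable
  also have "\<dots> = (\<integral>\<^sup>+X. ennreal (indicator Q X * indicator Q (X + (- z, - \<tau>)) * (u (X + (- z, - \<tau>)) - u X)\<^sup>2) \<partial>lborel)"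
    by (rule nn_integral_cong) (simp add: add.assoc zero_prod_def[symmetric] power2_commute mult.commute)
  also have "\<dots> \<le> ennreal (Ms (norm z) (- \<tau>))" using increment_pos[of "- \<tau>" Q "- z"] False Q by simp
  finally show ?thesis using False by simp
qed

text \<open>With Z = Y - X and Tonelli's theorem the double integral becomes an integral over Z in B
  of squared increments by Z. Each of these is small when B consists of short displacements.\<close>

lemma local_oscillation:
  assumes Q: "Q \<in> sets borel" "\<And>X. X \<in> Q \<Longrightarrow> X \<in> slab (s\<^sub>0 + 2 * l) q" "\<And>X. X \<in> Q \<Longrightarrow> \<xi> X = 1"
    and B: "B \<in> sets borel" "\<And>z \<tau>. (z, \<tau>) \<in> B \<Longrightarrow> norm z \<le> dz \<and> \<bar>\<tau>\<bar> \<le> \<tau>\<^sub>0"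
  shows "(\<integral>\<^sup>+X. \<integral>\<^sup>+Y. ennreal (indicator Q X * indicator Q Y * indicator B (Y - X) * (u Y - u X)\<^sup>2) \<partial>lborel \<partial>lborel)
    \<le> emeasure lborel B * ennreal ((4 * dz\<^sup>2 * (Ca + Gx\<^sup>2) + 2 * \<tau>\<^sub>0 * \<Lambda> * (4 * Ca + 2 * Gx\<^sup>2)) * E)"
proof (cases "B = {}")
  case False
  note [measurable] = Q(1) B(1)
  obtain z' \<tau>' where "(z', \<tau>') \<in> B" using False by (metis ex_in_conv surj_pair)
  then have nn: "0 \<le> dz" "0 \<le> \<tau>\<^sub>0" using B(2)[of z' \<tau>'] order_trans[OF norm_ge_zero[of z'], of dz] by auto
  let ?f = "\<lambda>Z X. ennreal (indicator Q X * indicator Q (X + Z) * (u (X + Z) - u X)\<^sup>2)"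
  have "(\<integral>\<^sup>+X. \<integral>\<^sup>+Y. ennreal (indicator Q X * indicator Q Y * indicator B (Y - X) * (u Y - u X)\<^sup>2) \<partial>lborel \<partial>lborel)
     = (\<integral>\<^sup>+X. \<integral>\<^sup>+Z. indicator B Z * ?f Z X \<partial>lborel \<partial>lborel)"
  proof (rule nn_integral_cong)
    fix X
    have "(\<integral>\<^sup>+Y. ennreal (indicator Q X * indicator Q Y * indicator B (Y - X) * (u Y - u X)\<^sup>2) \<partial>lborel)
       = (\<integral>\<^sup>+Z. ennreal (indicator Q X * indicator Q (Z + X) * indicator B ((Z + X) - X) * (u (Z + X) - u X)\<^sup>2) \<partial>lborel)"
      by (rule nn_integral_shift[symmetric]) measurable
    also have "\<dots> = (\<integral>\<^sup>+Z. indicator B Z * ?f Z X \<partial>lborel)"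
      by (rule nn_integral_cong) (auto simp: indicator_def add.commute)
    finally show "(\<integral>\<^sup>+Y. ennreal (indicator Q X * indicator Q Y * indicator B (Y - X) * (u Y - u X)\<^sup>2) \<partial>lborel) = (\<integral>\<^sup>+Z. indicator B Z * ?f Z X \<partial>lborel)" .
  qed
  also have "\<dots> = (\<integral>\<^sup>+Z. \<integral>\<^sup>+X. indicator B Z * ?f Z X \<partial>lborel \<partial>lborel)"
    by (rule lborel_pair.Fubini') measurable
  also have "\<dots> = (\<integral>\<^sup>+Z. indicator B Z * (\<integral>\<^sup>+X. ?f Z X \<partial>lborel) \<partial>lborel)"
    by (intro nn_integral_cong nn_integral_cmult) measurable
  also have "\<dots> \<le> (\<integral>\<^sup>+Z. ennreal (Ms dz \<tau>\<^sub>0) * indicator B Z \<partial>lborel)"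
  proof (rule nn_integral_mono)
    fix Z :: "'n st"
    obtain z \<tau> where Z: "Z = (z, \<tau>)" by force
    show "indicator B Z * (\<integral>\<^sup>+X. ?f Z X \<partial>lborel) \<le> ennreal (Ms dz \<tau>\<^sub>0) * indicator B Z"
    proof (cases "Z \<in> B")
      case True
      have "(\<integral>\<^sup>+X. ?f Z X \<partial>lborel) \<le> ennreal (Ms (norm z) \<bar>\<tau>\<bar>)" unfolding Z by (rule increment_any[OF Q])
      also have "\<dots> \<le> ennreal (Ms dz \<tau>\<^sub>0)" using B(2)[of z \<tau>] True Z by (intro ennreal_leI Ms_mono) auto
      finally show ?thesis using True by simp
    qed simp
  qed
  also have "\<dots> = emeasure lborel B * ennreal (Ms dz \<tau>\<^sub>0)" by (subst nn_integral_cmult_indicator) (auto simp: mult.commute)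
  also have "\<dots> \<le> emeasure lborel B * ennreal ((4 * dz\<^sup>2 * (Ca + Gx\<^sup>2) + 2 * \<tau>\<^sub>0 * \<Lambda> * (4 * Ca + 2 * Gx\<^sup>2)) * E)"
  proof (intro mult_left_mono ennreal_leI)
    have "Ms dz \<tau>\<^sub>0 \<le> 2 * (dz\<^sup>2 * (2 * (Ca * E) + 2 * (Gx\<^sup>2 * E))) + 2 * (\<tau>\<^sub>0 * (\<Lambda> * (4 * (Ca * E) + 2 * (Gx\<^sup>2 * E))))"
      unfolding Ms_def using caccioppoli dux_le nn Lam by (intro add_mono mult_left_mono) auto
    then show "Ms dz \<tau>\<^sub>0 \<le> (4 * dz\<^sup>2 * (Ca + Gx\<^sup>2) + 2 * \<tau>\<^sub>0 * \<Lambda> * (4 * Ca + 2 * Gx\<^sup>2)) * E"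
      by (simp add: algebra_simps)
  qed simp
  finally show ?thesis .
qed simp

end

section \<open>The maximum principle\<close>

lemma ppart_cube_deriv: "((\<lambda>r. (ppart (r - a)) ^ 3) has_real_derivative 3 * (ppart (r - a))\<^sup>2) (at r)"
proof -
  consider "r < a" | "r > a" | "r = a" by linarith
  then show ?thesis
  proof cases
    case 1
    have "((\<lambda>r. 0) has_real_derivative 0) (at r)" by simp
    then have "((\<lambda>r. (ppart (r - a)) ^ 3) has_real_derivative 0) (at r)"
      by (rule has_field_derivative_transform_within_open[of _ _ _ "{..<a}"]) (use 1 in \<open>auto simp: ppart_def\<close>)
    then show ?thesis using 1 by (simp add: ppart_def)
  next
    case 2
    have "((\<lambda>r. (r - a) ^ 3) has_real_derivative 3 * (r - a)\<^sup>2) (at r)"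
      by (auto intro!: derivative_eq_intros)
    then have "((\<lambda>r. (ppart (r - a)) ^ 3) has_real_derivative 3 * (r - a)\<^sup>2) (at r)"
      by (rule has_field_derivative_transform_within_open[of _ _ _ "{a<..}"]) (use 2 in \<open>auto simp: ppart_def\<close>)
    then show ?thesis using 2 by (simp add: ppart_def)
  next
    case 3
    have "((\<lambda>h. ((ppart (a + h - a)) ^ 3 - (ppart (a - a)) ^ 3) / h) \<longlongrightarrow> 0) (at 0)"
    proof (rule Lim_null_comparison)
      show "\<forall>\<^sub>F h in at 0. norm (((ppart (a + h - a)) ^ 3 - (ppart (a - a)) ^ 3) / h) \<le> h\<^sup>2"
        by (rule always_eventually) (auto simp: ppart_def max_def power2_eq_square power3_eq_cube)
      show "((\<lambda>h::real. h\<^sup>2) \<longlongrightarrow> 0) (at 0)" by (auto intro!: tendsto_eq_intros)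
    qed
    then show ?thesis using 3 by (simp add: DERIV_def ppart_def)
  qed
qed

text \<open>Provides the subgradient inequality that \<open>energy\<close> demands of H.\<close>

lemma convex_antiderivative:
  fixes H h :: "real \<Rightarrow> real"
  assumes d: "\<And>r. (H has_real_derivative h r) (at r)" and mono: "\<And>r s. r \<le> s \<Longrightarrow> h r \<le> h s"
  shows "h a * (b - a) \<le> H b - H a"
proof -
  consider "a < b" | "b < a" | "a = b" by linarith
  then show ?thesis
  proof cases
    case 1
    then obtain z where z: "a < z" "z < b" "H b - H a = (b - a) * h z" using MVT2[OF 1, of H h] d by auto
    have "h a * (b - a) \<le> h z * (b - a)" using mono[of a z] z 1 by (intro mult_right_mono) auto
    then show ?thesis using z(3) by (simp add: mult.commute)
  next
    case 2
    then obtain z where z: "b < z" "z < a" "H a - H b = (a - b) * h z" using MVT2[OF 2, of H h] d by auto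
    have "h z * (a - b) \<le> h a * (a - b)" using mono[of z a] z 2 by (intro mult_right_mono) auto
    then show ?thesis using z(3) by (simp add: algebra_simps)
  qed simp
qed

text \<open>A C^1 version of the positive part of r - M: zero up to M, (r - M)^2 / 2 up to M + 1,
  and r - M - 1/2 beyond. Passing to slope 1 keeps \<open>hcut'\<close> between 0 and 1, as
  \<open>Hcl_comp\<close> and \<open>energy\<close> require; \<open>Hcut\<close> is the
  antiderivative.\<close>

definition hcut :: "real \<Rightarrow> real \<Rightarrow> real" where "hcut M r = ((ppart (r - M))\<^sup>2 - (ppart (r - (M + 1)))\<^sup>2) / 2"
definition hcut' :: "real \<Rightarrow> real \<Rightarrow> real" where "hcut' M r = ppart (r - M) - ppart (r - (M + 1))"
definition Hcut :: "real \<Rightarrow> real \<Rightarrow> real" where "Hcut M r = ((ppart (r - M)) ^ 3 - (ppart (r - (M + 1))) ^ 3) / 6"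

lemma hcut_deriv: "(hcut M has_real_derivative hcut' M r) (at r)"
proof -
  have "((\<lambda>r. ((ppart (r - M))\<^sup>2 - (ppart (r - (M + 1)))\<^sup>2) / 2) has_real_derivative
      (2 * ppart (r - M) - 2 * ppart (r - (M + 1))) / 2) (at r)"
    by (intro DERIV_cdivide DERIV_diff ppart_sq_deriv)
  then have "(hcut M has_real_derivative (2 * ppart (r - M) - 2 * ppart (r - (M + 1))) / 2) (at r)" unfolding hcut_def[abs_def] .
  then show ?thesis by (rule DERIV_cong) (simp add: hcut'_def)
qed

lemma Hcut_deriv: "(Hcut M has_real_derivative hcut M r) (at r)"
proof -
  have "((\<lambda>r. ((ppart (r - M)) ^ 3 - (ppart (r - (M + 1))) ^ 3) / 6) has_real_derivative
      (3 * (ppart (r - M))\<^sup>2 - 3 * (ppart (r - (M + 1)))\<^sup>2) / 6) (at r)"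
    by (intro DERIV_cdivide DERIV_diff ppart_cube_deriv)
  then have "(Hcut M has_real_derivative (3 * (ppart (r - M))\<^sup>2 - 3 * (ppart (r - (M + 1)))\<^sup>2) / 6) (at r)" unfolding Hcut_def[abs_def] .
  then show ?thesis by (rule DERIV_cong) (simp add: hcut_def)
qed

lemma hcut'_bounds: "0 \<le> hcut' M r" "\<bar>hcut' M r\<bar> \<le> 1" by (auto simp: hcut'_def ppart_def max_def)
lemma hcut'_cont: "continuous_on UNIV (hcut' M)" unfolding hcut'_def[abs_def] by (intro continuous_intros)
lemma hcut_mono: "r \<le> s \<Longrightarrow> hcut M r \<le> hcut M s"
  by (rule DERIV_nonneg_imp_nondecreasing[of r s "hcut M"]) (use hcut_deriv hcut'_bounds(1) in blast)+
lemma hcut_zero: "r \<le> M \<Longrightarrow> hcut M r = 0" "r \<le> M \<Longrightarrow> Hcut M r = 0" by (auto simp: hcut_def Hcut_def ppart_def)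
lemma hcut_zero_iff: "hcut M r = 0 \<longleftrightarrow> r \<le> M"
proof (cases "r \<le> M")
  case False
  define s where "s = min r (M + 1)"
  have "0 < hcut M s" using False by (auto simp: hcut_def s_def ppart_def min_def max_def)
  then have "0 < hcut M r" using hcut_mono[of s r M] by (simp add: s_def)
  then show ?thesis using False by simp
qed (simp add: hcut_zero)
lemma Hcut_bounds:
  assumes "0 \<le> M" shows "0 \<le> Hcut M r" "\<bar>Hcut M r\<bar> \<le> r\<^sup>2"
proof -
  note c = convex_antiderivative[OF Hcut_deriv hcut_mono, of M]
  show 0: "0 \<le> Hcut M r" using c[of 0 r] hcut_zero[of 0 M] assms by simp
  have "hcut M r \<le> \<bar>r\<bar>"
  proof -
    have "norm (hcut M r - hcut M 0) \<le> 1 * norm (r - 0)"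
      by (rule field_differentiable_bound[of UNIV "hcut M" "hcut' M"]) (use hcut_deriv hcut'_bounds in auto)
    then show ?thesis using hcut_zero(1)[of 0 M] assms by simp
  qed
  then have "Hcut M r \<le> \<bar>r\<bar> * \<bar>r\<bar>"
  proof (cases "r \<le> 0")
    case False
    have "Hcut M r \<le> hcut M r * r" using c[of r 0] hcut_zero(2)[of 0 M] assms by simp
    also have "\<dots> \<le> r * r" using \<open>hcut M r \<le> \<bar>r\<bar>\<close> False by (intro mult_right_mono) auto
    finally show ?thesis using False by simp
  qed (use hcut_zero(2)[of r M] assms in simp)
  then show "\<bar>Hcut M r\<bar> \<le> r\<^sup>2" using 0 by (simp add: power2_eq_square)
qed

lemma C1_dist2:
  fixes Y :: "'n::finite st"
  shows "C1 (\<lambda>X. (dist X Y)\<^sup>2)" "gradx (\<lambda>X. (dist X Y)\<^sup>2) = (\<lambda>X. 2 *\<^sub>R (fst X - fst Y))"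
proof -
  have e: "(\<lambda>X. (dist X Y)\<^sup>2) = (\<lambda>X. (X - Y) \<bullet> (X - Y))"
    by (simp add: dist_norm power2_norm_eq_inner)
  have d: "((\<lambda>X. (dist X Y)\<^sup>2) has_derivative (\<lambda>v. (2 *\<^sub>R (fst X - fst Y)) \<bullet> fst v + snd v * (2 * (snd X - snd Y)))) (at X)" for X
    unfolding e
    by (rule has_derivative_eq_rhs, (rule derivative_intros)+)
       (auto simp: fun_eq_iff inner_prod_def inner_commute algebra_simps)
  have c: "continuous_on UNIV (\<lambda>X. 2 *\<^sub>R (fst X - fst Y))" "continuous_on UNIV (\<lambda>X. 2 * (snd X - snd Y))"
    by (auto intro!: continuous_intros)
  show "C1 (\<lambda>X. (dist X Y)\<^sup>2)" "gradx (\<lambda>X. (dist X Y)\<^sup>2) = (\<lambda>X. 2 *\<^sub>R (fst X - fst Y))"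
    using C1I[OF d c] by auto
qed

lemma sstep_affine:
  assumes "0 < (c::real)"
  shows "((\<lambda>r. sstep ((r - a) / c)) has_real_derivative sstep' ((r - a) / c) / c) (at r)"
    "continuous_on UNIV (\<lambda>r. sstep' ((r - a) / c) / c)"
proof -
  show "((\<lambda>r. sstep ((r - a) / c)) has_real_derivative sstep' ((r - a) / c) / c) (at r)"
    by (rule DERIV_cong[OF DERIV_chain2[OF sstep_deriv]]) (use assms in \<open>auto intro!: derivative_eq_intros\<close>)
  show "continuous_on UNIV (\<lambda>r. sstep' ((r - a) / c) / c)"
    by (intro continuous_intros continuous_on_compose2[OF sstep'_cont]) (use assms in auto)
qed

text \<open>The test function is \<kappa> \<open>hcut\<close> M (u), where \<kappa> vanishes within
  2 R of Y and equals 1 beyond 4 R. The weight varies only where u <= M, and there the truncation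
  vanishes; the source lies where \<kappa> vanishes. What remains says that the gradient of the test
  function is zero. The ball is a space-time ball, so one cut-off serves for the initial, lateral
  and inner parts of the boundary of the region.\<close>

lemma maximum_principle:
  fixes u :: "'n::finite st \<Rightarrow> real"
  assumes w: "wsol \<Omega> q u g F" and bd: "bounded \<Omega>" and lam: "0 < lam"
    and ell: "\<And>X. lam * (norm (g X))\<^sup>2 \<le> snd (F X) \<bullet> g X"
    and R: "0 < R" and M: "0 \<le> M"
    and F0: "\<And>X. R \<le> dist X Y \<Longrightarrow> fst (F X) = 0"
    and ann: "AE X in lborel. R \<le> dist X Y \<and> dist X Y < 4 * R \<longrightarrow> u X \<le> M"
  shows "AE X in lborel. 4 * R \<le> dist X Y \<longrightarrow> u X \<le> M"
proof -
  \<comment> \<open>16 R^2 - 4 R^2: in terms of the squared distance the step runs from radius 2 R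
    to radius 4 R. The square is used because it is differentiable at Y.\<close>
  define c where "c = 12 * R\<^sup>2"
  have c: "0 < c" using R by (simp add: c_def)
  define \<kappa> where "\<kappa> X = sstep (((dist X Y)\<^sup>2 - 4 * R\<^sup>2) / c)" for X
  note Ck = C1_comp[OF C1_dist2(1)[of Y] sstep_affine[OF c, of "4 * R\<^sup>2"]]
  have C\<kappa>: "C1 \<kappa>" unfolding \<kappa>_def[abs_def] by (rule Ck(1))
  have g\<kappa>: "gradx \<kappa> X = (sstep' (((dist X Y)\<^sup>2 - 4 * R\<^sup>2) / c) / c) *\<^sub>R (2 *\<^sub>R (fst X - fst Y))" for X
    unfolding \<kappa>_def[abs_def] Ck(2) C1_dist2(2) by simp
  have \<kappa>01: "0 \<le> \<kappa> X" "\<kappa> X \<le> 1" for X unfolding \<kappa>_def using sstep_bounds by auto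
  have \<kappa>0: "\<kappa> X = 0" if "dist X Y \<le> 2 * R" for X
  proof -
    have "(dist X Y)\<^sup>2 \<le> (2 * R)\<^sup>2" using that by (intro power_mono) auto
    then show ?thesis unfolding \<kappa>_def using c by (intro sstep_values) (auto simp: divide_nonpos_pos power_mult_distrib)
  qed
  have far: "1 \<le> ((dist X Y)\<^sup>2 - 4 * R\<^sup>2) / c" if "4 * R \<le> dist X Y" for X
  proof -
    have "(4 * R)\<^sup>2 \<le> (dist X Y)\<^sup>2" using that R by (intro power_mono) auto
    then show ?thesis using c by (simp add: c_def power_mult_distrib field_simps)
  qed
  have \<kappa>1: "\<kappa> X = 1" if "4 * R \<le> dist X Y" for X
    unfolding \<kappa>_def using far[OF that] by (rule sstep_values)
  have g\<kappa>0: "gradx \<kappa> X = 0" if "4 * R \<le> dist X Y \<or> dist X Y \<le> 2 * R" for X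
  proof -
    have "sstep' (((dist X Y)\<^sup>2 - 4 * R\<^sup>2) / c) = 0"
    proof (cases "4 * R \<le> dist X Y")
      case True then show ?thesis using far sstep'_bounds(4) by blast
    next
      case False
      then have "(dist X Y)\<^sup>2 \<le> (2 * R)\<^sup>2" using that by (intro power_mono) auto
      then show ?thesis using c by (intro sstep'_bounds) (auto simp: divide_nonpos_pos power_mult_distrib)
    qed
    then show ?thesis by (simp add: g\<kappa>)
  qed
  define K where "K = max 1 (2 / c * (2 * (4 * R)))"
  have K1: "\<bar>\<kappa> X\<bar> \<le> K" for X using \<kappa>01[of X] by (simp add: K_def)
  have K2: "norm (gradx \<kappa> X) \<le> K" for X
  proof (cases "4 * R \<le> dist X Y")
    case True then show ?thesis using g\<kappa>0[of X] by (simp add: K_def)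
  next
    case False
    have "norm (fst X - fst Y) \<le> dist X Y" unfolding dist_norm using norm_fst_le[of "fst (X - Y)" "snd (X - Y)"] unfolding prod.collapse by simp
    then have "norm (fst X - fst Y) \<le> 4 * R" using False by linarith
    then have "norm (gradx \<kappa> X) \<le> 2 / c * (2 * (4 * R))"
      unfolding g\<kappa> norm_scaleR using c sstep'_bounds(1,2)
      by (intro mult_mono) (auto intro!: divide_right_mono)
    then show ?thesis by (simp add: K_def)
  qed
  define p where "p = jmul \<kappa> (\<lambda>X. (hcut M (u X), hcut' M (u X) *\<^sub>R g X))"
  have h0: "hcut M 0 = 0" using M by (simp add: hcut_zero)
  have "(LINT X|lborel. F X \<bullet> jmul \<kappa> (\<lambda>X. (hcut M (u X), hcut' M (u X) *\<^sub>R g X)) X) \<le> (LINT X|(lborel :: 'n st measure). 0)"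
  proof (rule energy[OF w hcut_deriv hcut'_cont h0 hcut'_bounds(2) convex_antiderivative[OF Hcut_deriv hcut_mono] Hcut_bounds(2)[OF M] _ C\<kappa> \<kappa>01(1) K1 K2 R])
    show "continuous_on UNIV (Hcut M)" using Hcut_deriv by (auto intro!: continuous_at_imp_continuous_on DERIV_isCont)
    fix \<tau> assume \<tau>: "0 < \<tau>" "\<tau> < R"
    \<comment> \<open>The bound holds with k = 0. Within R the shifted weight still vanishes because
      \<tau> < R; on the annulus \<open>Hcut\<close> vanishes; beyond 4 R the weight already has its
      maximal value 1.\<close>
    show "AE X in lborel. (\<kappa> (X + (0, \<tau>)) - \<kappa> X) * Hcut M (u X) \<le> \<tau> * 0"
      using ann
    proof eventually_elim
      case (elim X)
      consider "dist X Y < R" | "R \<le> dist X Y" "dist X Y < 4 * R" | "4 * R \<le> dist X Y" by linarith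
      then show ?case
      proof cases
        case 1
        have "dist (X + (0, \<tau>)) Y \<le> dist (X + (0, \<tau>)) X + dist X Y" by (rule dist_triangle)
        also have "dist (X + (0, \<tau>)) X = \<tau>" using \<tau> by (simp add: dist_norm norm_Pair)
        finally have "\<kappa> (X + (0, \<tau>)) = 0" "\<kappa> X = 0" using \<kappa>0 1 \<tau> R by auto
        then show ?thesis by simp
      next
        case 2
        then show ?thesis using elim hcut_zero(2)[of "u X" M] by simp
      next
        case 3
        then have "\<kappa> (X + (0, \<tau>)) - \<kappa> X \<le> 0" using \<kappa>1 \<kappa>01(2)[of "X + (0, \<tau>)"] by simp
        then show ?thesis using Hcut_bounds(1)[OF M, of "u X"] by (simp add: mult_nonpos_nonneg)
      qed
    qed
  qed simp_all
  then have le0: "(LINT X|lborel. F X \<bullet> p X) \<le> 0" by (simp add: p_def)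
  have Hp: "Hcl (\<Omega> \<times> {0<..<q}) p"
    unfolding p_def by (rule Hcl_jmul[OF _ C\<kappa> K1 K2]) (use Hcl_comp[OF wsolD(2)[OF w] hcut_deriv hcut'_cont h0 hcut'_bounds(2)] in simp)
  note Lp = Hcl_L2[OF Hp]
  have iFp: "integrable lborel (\<lambda>X. F X \<bullet> p X)" by (rule L2_inner(1)[OF wsolD(1)[OF w] Lp])
  \<comment> \<open>The gradient of \<kappa> lives on the annulus, where \<open>hcut\<close> is
    zero, and the source lives where \<kappa> is zero. So F . p is a nonnegative multiple of the
    elliptic form.\<close>
  have key: "AE X in lborel. snd (p X) = (\<kappa> X * hcut' M (u X)) *\<^sub>R g X \<and> F X \<bullet> p X = \<kappa> X * hcut' M (u X) * (snd (F X) \<bullet> g X)"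
    using ann
  proof eventually_elim
    case (elim X)
    have 1: "hcut M (u X) *\<^sub>R gradx \<kappa> X = 0"
      using g\<kappa>0[of X] elim hcut_zero(1)[of "u X" M] R by (cases "4 * R \<le> dist X Y \<or> dist X Y \<le> 2 * R") auto
    have 2: "fst (F X) * \<kappa> X = 0" using F0[of X] \<kappa>0[of X] R by (cases "R \<le> dist X Y") auto
    have "snd (p X) = (\<kappa> X * hcut' M (u X)) *\<^sub>R g X" using 1 by (simp add: p_def snd_jmul)
    moreover have "fst (F X) * fst (p X) = 0" using 2 by (auto simp: p_def fst_jmul)
    ultimately show ?case by (simp only: inner_prod_def inner_real_def inner_scaleR_right) simp
  qed
  have nn: "AE X in lborel. 0 \<le> F X \<bullet> p X"
    using key
  proof eventually_elim
    case (elim X)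
    have "0 \<le> snd (F X) \<bullet> g X" using ell[of X] lam by (smt (verit) mult_nonneg_nonneg zero_le_power2)
    then show ?case using elim \<kappa>01(1)[of X] hcut'_bounds(1)[of M "u X"] by simp
  qed
  have "(LINT X|lborel. F X \<bullet> p X) = 0" using le0 integral_nonneg_AE[OF nn] by linarith
  then have z: "AE X in lborel. F X \<bullet> p X = 0" using integral_nonneg_eq_0_iff_AE[OF iFp nn] by simp
  have snd0: "AE X in lborel. snd (p X) = 0"
    using key z
  proof eventually_elim
    case (elim X)
    have "\<kappa> X * hcut' M (u X) = 0 \<or> snd (F X) \<bullet> g X = 0" using elim by auto
    then show ?case
    proof
      assume "snd (F X) \<bullet> g X = 0"
      then have "(norm (g X))\<^sup>2 \<le> 0" using ell[of X] lam by (simp add: mult_le_0_iff)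
      then show ?thesis using elim by simp
    qed (use elim in simp)
  qed
  have sq0: "sqn (\<lambda>X. snd (p X)) = 0"
  proof -
    have "sqn (\<lambda>X. snd (p X)) = (LINT X|(lborel::'n st measure). 0)"
      unfolding sqn_def using L2_meas[OF L2_snd(1)[OF Lp]] snd0
      by (intro integral_cong_AE) (auto elim: eventually_mono)
    then show ?thesis by simp
  qed
  obtain b where b: "\<And>x. x \<in> \<Omega> \<Longrightarrow> norm x \<le> b" using bd by (auto simp: bounded_iff)
  \<comment> \<open>A translation longer than the diameter of \<Omega> moves \<Omega> off itself.
    For it \<open>space_translation\<close> is a Poincare inequality, so a vanishing gradient forces
    \<kappa> \<open>hcut\<close> M (u) = 0. The coordinate \<open>undefined\<close> stands for an
    arbitrary direction.\<close>
  define z :: "real^'n" where "z = (2 * \<bar>b\<bar> + 1) *\<^sub>R axis undefined 1"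
  have nz: "norm z = 2 * \<bar>b\<bar> + 1" by (simp add: z_def norm_axis_1)
  have off: "x + z \<notin> \<Omega>" if "x \<in> \<Omega>" for x
  proof
    assume "x + z \<in> \<Omega>"
    then have "norm ((x + z) - x) \<le> b + b" using b[OF that] b[of "x + z"] norm_triangle_ineq4[of "x + z" x] by linarith
    then show False using nz by simp
  qed
  have f: "fst (p X) = \<kappa> X * hcut M (u X)" for X by (simp add: p_def fst_jmul)
  have Lf: "L2 (\<lambda>X. fst (p X))" "L2 (\<lambda>X. fst (p (X + (z, 0))) - fst (p X))"
    using L2_fst(1)[OF Lp] L2_diff(1)[OF L2_fst(1)[OF L2_shift(1)[OF Lp]] L2_fst(1)[OF Lp]] by auto
  have "sqn (\<lambda>X. fst (p X)) \<le> sqn (\<lambda>X. fst (p (X + (z, 0))) - fst (p X))"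
    unfolding sqn_def
  proof (rule integral_mono[OF L2_int[OF Lf(1)] L2_int[OF Lf(2)]])
    fix X
    show "(norm (fst (p X)))\<^sup>2 \<le> (norm (fst (p (X + (z, 0))) - fst (p X)))\<^sup>2"
    proof (cases "fst (p X) = 0")
      case False
      then have "u X \<noteq> 0" using h0 by (auto simp: f)
      then have "fst X \<in> \<Omega>" using wsolD(5)[OF w, of X] by (cases X) auto
      then have "fst (X + (z, 0)) \<notin> \<Omega>" using off by simp
      then have "u (X + (z, 0)) = 0" using wsolD(5)[OF w, of "X + (z, 0)"] by (cases X) auto
      then have "fst (p (X + (z, 0))) = 0" using h0 by (simp add: f)
      then show ?thesis by simp
    qed simp
  qed
  also have "\<dots> \<le> (norm z)\<^sup>2 * sqn (\<lambda>X. snd (p X))" by (rule space_translation[OF Hp])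
  finally have "sqn (\<lambda>X. fst (p X)) = 0" using sq0 sqn_nonneg[of "\<lambda>X. fst (p X)"] by simp
  then have "AE X in lborel. (norm (fst (p X)))\<^sup>2 = 0"
    unfolding sqn_def using integral_nonneg_eq_0_iff_AE[OF L2_int[OF Lf(1)]] by simp
  then show ?thesis
  proof eventually_elim
    case (elim X)
    show ?case
    proof
      assume "4 * R \<le> dist X Y"
      then show "u X \<le> M" using elim \<kappa>1[of X] by (simp add: f hcut_zero_iff)
    qed
  qed
qed

section \<open>Averages of the Green's function\<close>

text \<open>For a symmetric matrix the quadratic form controls the norm. Put y = A x: the form is
  nonnegative at \<Lambda> x - y and at most \<Lambda> times the squared norm at x and at y, which
  leaves |y|^2 <= (\<Lambda> |x|)^2.\<close>

lemma elliptic_norm_bound: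
  fixes A :: "real^'n::finite^'n"
  assumes sym: "transpose A = A" and lam: "0 < lam" "lam \<le> \<Lambda>"
    and ell: "\<And>\<xi>. lam * (norm \<xi>)\<^sup>2 \<le> (A *v \<xi>) \<bullet> \<xi> \<and> (A *v \<xi>) \<bullet> \<xi> \<le> \<Lambda> * (norm \<xi>)\<^sup>2"
  shows "norm (A *v x) \<le> \<Lambda> * norm x"
proof -
  define y where "y = A *v x"
  have L: "0 < \<Lambda>" using lam by simp
  have s: "(A *v v) \<bullet> w = v \<bullet> (A *v w)" for v w
    using dot_lmul_matrix[of v A w] matrix_vector_mul_lid sym
    by (metis transpose_matrix_vector)
  have "0 \<le> lam * (norm (\<Lambda> *\<^sub>R x - y))\<^sup>2" using lam by simp
  also have "\<dots> \<le> (A *v (\<Lambda> *\<^sub>R x - y)) \<bullet> (\<Lambda> *\<^sub>R x - y)" using ell by blast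
  also have "\<dots> = \<Lambda>\<^sup>2 * ((A *v x) \<bullet> x) - 2 * \<Lambda> * (y \<bullet> y) + (A *v y) \<bullet> y"
    using s[of y x] by (simp add: matrix_vector_mult_diff_distrib matrix_vector_mult_scaleR inner_diff_left inner_diff_right y_def[symmetric] power2_eq_square algebra_simps)
  also have "\<dots> \<le> \<Lambda>\<^sup>2 * (\<Lambda> * (norm x)\<^sup>2) - 2 * \<Lambda> * (norm y)\<^sup>2 + \<Lambda> * (norm y)\<^sup>2"
    using ell[of x] ell[of y] L by (intro add_mono diff_mono mult_left_mono) (auto simp: power2_norm_eq_inner)
  finally have "\<Lambda> * (norm y)\<^sup>2 \<le> \<Lambda> * (\<Lambda> * norm x)\<^sup>2" by (simp add: power_mult_distrib algebra_simps power2_eq_square)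
  then have "(norm y)\<^sup>2 \<le> (\<Lambda> * norm x)\<^sup>2" using L by simp
  then show ?thesis unfolding y_def[symmetric] by (rule power2_le_imp_le) (use L in simp)
qed

lemma time_slice_null: "AE X in (lborel :: 'n::finite st measure). snd X \<noteq> c"
proof -
  have "emeasure lborel ((UNIV :: (real^'n) set) \<times> {c}) = emeasure (lborel \<Otimes>\<^sub>M lborel) ((UNIV :: (real^'n) set) \<times> {c})"
    by (simp add: lborel_prod)
  also have "\<dots> = emeasure lborel (UNIV :: (real^'n) set) * emeasure lborel {c}"
    by (rule lborel.emeasure_pair_measure_Times) auto
  finally have "emeasure lborel ((UNIV :: (real^'n) set) \<times> {c}) = 0" by simp
  then have "(UNIV :: (real^'n) set) \<times> {c} \<in> null_sets lborel"
    by (intro null_setsI) (auto intro!: borel_closed closed_Times)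
  then show ?thesis by (rule AE_I') auto
qed

section \<open>The operator, its Green's function, and solutions with bounded sources\<close>

locale parabolic =
  fixes \<Omega> :: "(real^'n::finite) set" and T lam \<Lambda> :: real and A :: "'n st \<Rightarrow> real^'n^'n"
    and G :: "'n st \<Rightarrow> 'n st \<Rightarrow> real"
  assumes dom: "open \<Omega>" "bounded \<Omega>" and T: "0 < T" and lam: "0 < lam" "lam \<le> \<Lambda>"
    and A_meas: "\<And>i j. (\<lambda>X. A X $ i $ j) \<in> borel_measurable borel"
    and A_sym: "\<And>X. X \<in> cyl \<Omega> T \<Longrightarrow> transpose (A X) = A X"
    and A_ell: "\<And>X \<xi>. X \<in> cyl \<Omega> T \<Longrightarrow>
                  lam * (norm \<xi>)\<^sup>2 \<le> (A X *v \<xi>) \<bullet> \<xi> \<and> (A X *v \<xi>) \<bullet> \<xi> \<le> \<Lambda> * (norm \<xi>)\<^sup>2"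
    and green: "green_fun \<Omega> T A G"
begin

text \<open>The open cylinder: the continuity of G in \<open>green_fun\<close> is off the diagonal
  of this set, which differs from \<open>cyl\<close> by two null time slices.\<close>

definition oc where "oc = \<Omega> \<times> {0<..<T}"

lemma oc: "open oc" "oc \<subseteq> cyl \<Omega> T" "oc \<in> sets borel" "bounded oc"
proof -
  show "open oc" unfolding oc_def by (intro open_Times dom) auto
  then show "oc \<in> sets borel" by auto
  show "oc \<subseteq> cyl \<Omega> T" by (auto simp: oc_def cyl_def)
  show "bounded oc" unfolding oc_def by (intro bounded_Times dom) auto
qed

lemma cyl_borel: "cyl \<Omega> T \<in> sets borel"
proof -
  have "\<Omega> \<in> sets borel" "{0..T} \<in> sets borel" using dom(1) by auto
  then have "\<Omega> \<times> {0..T} \<in> sets (borel \<Otimes>\<^sub>M borel)" by auto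
  then show ?thesis unfolding cyl_def borel_prod .
qed

lemma cyl_bounded: "bounded (cyl \<Omega> T)" unfolding cyl_def by (intro bounded_Times dom) auto

lemma cyl_oc: "AE X in lborel. X \<in> cyl \<Omega> T \<longrightarrow> X \<in> oc"
  using time_slice_null[of 0] time_slice_null[of T]
  by eventually_elim (auto simp: cyl_def oc_def)

lemma finite_measure: "emeasure lborel oc < \<infinity>" "emeasure lborel (cyl \<Omega> T) < \<infinity>"
  using emeasure_bounded_finite[OF oc(4)] emeasure_bounded_finite[OF cyl_bounded] by auto

text \<open>The approximating sequence of \<open>weak_sol\<close> is controlled on the cylinder
  only, which is exactly what \<open>Hcl_cut\<close> asks for. Passing from the closed to the open
  time interval changes the integrals by nothing.\<close>

lemma wsol_of_weak_sol:
  assumes ws: "weak_sol \<Omega> T A f u" and f: "f \<in> borel_measurable borel" "bounded (range f)"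
  obtains g F where "wsol \<Omega> T (\<lambda>X. indicator oc X * u X) g F"
    "\<And>X. lam * (norm (g X))\<^sup>2 \<le> snd (F X) \<bullet> g X" "\<And>X. norm (snd (F X)) \<le> \<Lambda> * norm (g X)"
    "\<And>X. fst (F X) = - indicator oc X * f X"
proof -
  note [measurable] = f(1) oc(3) cyl_borel
  let ?I = "\<lambda>X. indicator oc X :: real"
  let ?J = "\<lambda>X. indicator (cyl \<Omega> T) X :: real"
  from ws obtain g0 \<psi> where u: "u \<in> borel_measurable lborel" "set_integrable lborel (cyl \<Omega> T) (\<lambda>X. (u X)\<^sup>2)"
    and g: "g0 \<in> borel_measurable lborel" "set_integrable lborel (cyl \<Omega> T) (\<lambda>X. (norm (g0 X))\<^sup>2)"
    and \<psi>: "\<And>k. C1c (\<Omega> \<times> UNIV) (\<psi> k)"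
      "(\<lambda>k. LINT X:cyl \<Omega> T|lborel. (\<psi> k X - u X)\<^sup>2) \<longlonglongrightarrow> 0"
      "(\<lambda>k. LINT X:cyl \<Omega> T|lborel. (norm (gradx (\<psi> k) X - g0 X))\<^sup>2) \<longlonglongrightarrow> 0"
    and weak: "\<And>\<phi>. C1c (\<Omega> \<times> {..<T}) \<phi> \<Longrightarrow>
            (LINT X:cyl \<Omega> T|lborel. - u X * dt \<phi> X + (A X *v g0 X) \<bullet> gradx \<phi> X)
              = (LINT X:cyl \<Omega> T|lborel. f X * \<phi> X)"
    unfolding weak_sol_def by blast
  have [measurable]: "u \<in> borel_measurable borel" "g0 \<in> borel_measurable borel" using u(1) g(1) by auto
  have Lu: "L2 (\<lambda>X. ?J X * u X)" and Lg: "L2 (\<lambda>X. ?J X *\<^sub>R g0 X)"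
  proof -
    have e: "(\<lambda>X. (norm (?J X * u X))\<^sup>2) = (\<lambda>X. ?J X *\<^sub>R (u X)\<^sup>2)" "(\<lambda>X. (norm (?J X *\<^sub>R g0 X))\<^sup>2) = (\<lambda>X. ?J X *\<^sub>R (norm (g0 X))\<^sup>2)"
      by (auto simp: indicator_def)
    show "L2 (\<lambda>X. ?J X * u X)" unfolding L2_def e using u(2) by (simp add: set_integrable_def)
    show "L2 (\<lambda>X. ?J X *\<^sub>R g0 X)" unfolding L2_def e using g(2) by (simp add: set_integrable_def)
  qed
  define p where "p X = (?J X * u X, ?J X *\<^sub>R g0 X)" for X
  have Lp: "L2 p" unfolding p_def[abs_def] by (rule L2_Pair(1)[OF Lu Lg])
  define g where "g X = ?I X *\<^sub>R g0 X" for X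
  \<comment> \<open>Zero outside the open cylinder, so that both ellipticity bounds hold at every X
    although A is controlled on the cylinder only.\<close>
  define F where "F X = ?I X *\<^sub>R (- f X, A X *v g0 X)" for X
  have slab_oc: "indicator (slab 0 T) X *\<^sub>R p X = (?I X * u X, g X)" for X
    by (cases X) (auto simp: p_def g_def indicator_def slab_iff cyl_def oc_def)
  have "Hcl (\<Omega> \<times> {0<..<T}) (\<lambda>X. indicator (slab 0 T) X *\<^sub>R p X)"
  proof (rule Hcl_cut[OF Lp])
    fix e :: real assume e: "0 < e"
    have "(\<lambda>k. (LINT X:cyl \<Omega> T|lborel. (\<psi> k X - u X)\<^sup>2) + (LINT X:cyl \<Omega> T|lborel. (norm (gradx (\<psi> k) X - g0 X))\<^sup>2)) \<longlonglongrightarrow> 0 + 0"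
      by (rule tendsto_add[OF \<psi>(2,3)])
    then have "\<forall>\<^sub>F k in sequentially. (LINT X:cyl \<Omega> T|lborel. (\<psi> k X - u X)\<^sup>2) + (LINT X:cyl \<Omega> T|lborel. (norm (gradx (\<psi> k) X - g0 X))\<^sup>2) < e"
      by (rule order_tendstoD(2)) (use e in simp)
    then obtain k where k: "(LINT X:cyl \<Omega> T|lborel. (\<psi> k X - u X)\<^sup>2) + (LINT X:cyl \<Omega> T|lborel. (norm (gradx (\<psi> k) X - g0 X))\<^sup>2) < e"
      by (auto simp: eventually_sequentially)
    note C = \<psi>(1)[of k]
    define d1 where "d1 X = ?J X *\<^sub>R (\<psi> k X - u X)\<^sup>2" for X
    define d2 where "d2 X = ?J X *\<^sub>R (norm (gradx (\<psi> k) X - g0 X))\<^sup>2" for X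
    have i1: "integrable lborel d1"
    proof -
      have "L2 (\<lambda>X. ?J X *\<^sub>R \<psi> k X - ?J X * u X)" by (rule L2_diff(1)[OF L2_indicator(1)[OF C1c_jet(7)[OF C] cyl_borel] Lu])
      from L2_int[OF this] have "integrable lborel (\<lambda>X. (norm (?J X *\<^sub>R \<psi> k X - ?J X * u X))\<^sup>2)" .
      moreover have "(\<lambda>X. (norm (?J X *\<^sub>R \<psi> k X - ?J X * u X))\<^sup>2) = d1" by (auto simp: d1_def indicator_def)
      ultimately show ?thesis by simp
    qed
    have i2: "integrable lborel d2"
    proof -
      have "L2 (\<lambda>X. ?J X *\<^sub>R gradx (\<psi> k) X - ?J X *\<^sub>R g0 X)" by (rule L2_diff(1)[OF L2_indicator(1)[OF C1c_jet(8)[OF C] cyl_borel] Lg])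
      from L2_int[OF this] have "integrable lborel (\<lambda>X. (norm (?J X *\<^sub>R gradx (\<psi> k) X - ?J X *\<^sub>R g0 X))\<^sup>2)" .
      moreover have "(\<lambda>X. (norm (?J X *\<^sub>R gradx (\<psi> k) X - ?J X *\<^sub>R g0 X))\<^sup>2) = d2" by (auto simp: d2_def indicator_def)
      ultimately show ?thesis by simp
    qed
    have Ld: "L2 (\<lambda>X. indicator (slab 0 T) X *\<^sub>R (jet (\<psi> k) X - p X))"
      by (rule L2_indicator(1)[OF L2_diff(1)[OF C1c_jet(2)[OF C] Lp]]) measurable
    have "sqn (\<lambda>X. indicator (slab 0 T) X *\<^sub>R (jet (\<psi> k) X - p X)) \<le> (LINT X|lborel. d1 X + d2 X)"
      unfolding sqn_def
    proof (rule integral_mono[OF L2_int[OF Ld]])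
      show "integrable lborel (\<lambda>X. d1 X + d2 X)" using i1 i2 by simp
      fix X
      show "(norm (indicator (slab 0 T) X *\<^sub>R (jet (\<psi> k) X - p X)))\<^sup>2 \<le> d1 X + d2 X"
      proof (cases "X \<in> slab 0 T")
        case True
        show ?thesis
        proof (cases "fst X \<in> \<Omega>")
          case \<Omega>: True
          have J: "?J X = 1" using True \<Omega> by (cases X) (auto simp: cyl_def slab_iff)
          show ?thesis using True J by (simp add: d1_def d2_def p_def jet_def norm_prod_def)
        next
          case False
          then have "X \<notin> tsupp (\<psi> k)" using C by (cases X) (auto simp: C1c_alt)
          moreover have "?J X = 0" using False by (cases X) (auto simp: cyl_def)
          ultimately show ?thesis using C1c_jet(3)[OF C, of X] by (simp add: p_def d1_def d2_def zero_prod_def)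
        qed
      qed (simp add: d1_def d2_def)
    qed
    also have "\<dots> < e" using k i1 i2 by (simp add: set_lebesgue_integral_def d1_def[abs_def] d2_def[abs_def])
    finally show "\<exists>\<psi>. C1c (\<Omega> \<times> UNIV) \<psi> \<and> sqn (\<lambda>X. indicator (slab 0 T) X *\<^sub>R (jet \<psi> X - p X)) < e" using C by blast
  qed
  then have H: "Hcl (\<Omega> \<times> {0<..<T}) (\<lambda>X. (?I X * u X, g X))" by (simp only: slab_oc)
  have mF: "(\<lambda>X. A X *v g0 X) \<in> borel_measurable borel"
  proof (rule borel_measurable_euclidean_space[THEN iffD2, rule_format])
    fix b :: "real^'n" assume "b \<in> Basis"
    then obtain i where b: "b = axis i 1" by (auto simp: Basis_vec_def)
    have [measurable]: "(\<lambda>X. g0 X $ j) \<in> borel_measurable borel" for j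
      by (rule measurable_compose[OF \<open>g0 \<in> borel_measurable borel\<close>]) (intro borel_measurable_continuous_onI continuous_intros)
    note [measurable] = A_meas
    have "(\<lambda>X. \<Sum>j\<in>UNIV. A X $ i $ j * g0 X $ j) \<in> borel_measurable borel" by measurable
    then show "(\<lambda>X. (A X *v g0 X) \<bullet> b) \<in> borel_measurable borel"
      by (simp add: b inner_axis matrix_vector_mult_def)
  qed
  have ocA: "norm (A X *v g0 X) \<le> \<Lambda> * norm (g0 X)" if "X \<in> oc" for X
    using that oc(2) by (intro elliptic_norm_bound[OF A_sym lam A_ell]) auto
  have nF: "norm (snd (F X)) \<le> \<Lambda> * norm (g X)" for X
    using ocA[of X] by (auto simp: F_def g_def indicator_def)
  have Lg': "L2 g" using L2_snd(1)[OF Hcl_L2[OF H]] by simp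
  obtain Bf where Bf: "\<And>X. \<bar>f X\<bar> \<le> Bf" using f(2) by (auto simp: bounded_iff)
  have Lf: "L2 (\<lambda>X. - (?I X * f X))"
  proof -
    have "integrable lborel (\<lambda>X. Bf * ?I X)"
      by (rule integrable_mult_right) (use finite_measure(1) oc(3) in simp)
    have L1: "L2 (\<lambda>X. ?I X)"
    proof -
      have "(\<lambda>x. (norm (?I x))\<^sup>2) = indicator oc" by (auto simp: indicator_def)
      then show ?thesis unfolding L2_def using oc(3) finite_measure(1) by simp
    qed
    show ?thesis
      by (rule L2_bdd(1)[OF _ L1, of _ Bf]) (use Bf in \<open>auto simp: indicator_def\<close>)
  qed
  have LA: "L2 (\<lambda>X. ?I X *\<^sub>R (A X *v g0 X))"
    by (rule L2_bdd(1)[OF _ Lg', of _ \<Lambda>]) (use mF nF in \<open>auto simp: F_def\<close>)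
  have F_eq: "F X = (- (?I X * f X), ?I X *\<^sub>R (A X *v g0 X))" for X by (simp add: F_def)
  have LF: "L2 F" unfolding F_eq[abs_def] by (rule L2_Pair(1)[OF Lf LA])
  have "wsol \<Omega> T (\<lambda>X. ?I X * u X) g F"
    unfolding wsol_def
  proof (intro conjI allI impI LF H)
    fix X assume "X \<notin> \<Omega> \<times> {0<..<T}"
    then have "?I X = 0" by (simp add: oc_def)
    then show "?I X * u X = 0" "g X = 0" "F X = 0" by (simp_all add: g_def F_def zero_prod_def)
  next
    fix \<phi> assume \<phi>: "C1c (\<Omega> \<times> {..<T}) \<phi>"
    have Lu': "L2 (\<lambda>X. ?I X * u X)" using L2_fst(1)[OF Hcl_L2[OF H]] by simp
    have i1: "integrable lborel (\<lambda>X. ?I X * u X * dt \<phi> X)" using L2_inner(1)[OF Lu' C1c_jet(4)[OF \<phi>]] by simp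
    have i2: "integrable lborel (\<lambda>X. (?I X *\<^sub>R (A X *v g0 X)) \<bullet> gradx \<phi> X)" by (rule L2_inner(1)[OF LA C1c_jet(8)[OF \<phi>]])
    have i3: "integrable lborel (\<lambda>X. ?I X * f X * \<phi> X)" using L2_inner(1)[OF Lf C1c_jet(7)[OF \<phi>]] by simp
    note [measurable] = C1_meas[OF C1c_C1[OF \<phi>]] mF
    have "(LINT X|lborel. - (?I X * u X * dt \<phi> X) + (?I X *\<^sub>R (A X *v g0 X)) \<bullet> gradx \<phi> X)
       = (LINT X:cyl \<Omega> T|lborel. - u X * dt \<phi> X + (A X *v g0 X) \<bullet> gradx \<phi> X)"
      unfolding set_lebesgue_integral_def
      by (rule integral_cong_AE, measurable) (use cyl_oc oc(2) in \<open>auto elim!: eventually_mono simp: indicator_def\<close>)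
    also have "\<dots> = (LINT X:cyl \<Omega> T|lborel. f X * \<phi> X)" by (rule weak[OF \<phi>])
    also have "\<dots> = (LINT X|lborel. ?I X * f X * \<phi> X)"
      unfolding set_lebesgue_integral_def
      by (rule integral_cong_AE, measurable) (use cyl_oc oc(2) in \<open>auto elim!: eventually_mono simp: indicator_def\<close>)
    finally have "- (LINT X|lborel. ?I X * u X * dt \<phi> X) + (LINT X|lborel. (?I X *\<^sub>R (A X *v g0 X)) \<bullet> gradx \<phi> X) = (LINT X|lborel. ?I X * f X * \<phi> X)"
      using i1 i2 by simp
    moreover have "(LINT X|lborel. F X \<bullet> jet \<phi> X) = - (LINT X|lborel. ?I X * f X * \<phi> X) + (LINT X|lborel. (?I X *\<^sub>R (A X *v g0 X)) \<bullet> gradx \<phi> X)"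
      using i2 i3 by (simp add: F_eq jet_def inner_prod_def)
    ultimately show "(LINT X|lborel. ?I X * u X * dt \<phi> X) = (LINT X|lborel. F X \<bullet> jet \<phi> X)" by linarith
  qed
  moreover have "lam * (norm (g X))\<^sup>2 \<le> snd (F X) \<bullet> g X" for X
    using A_ell[of X "g0 X"] oc(2) by (auto simp: g_def F_def indicator_def)
  moreover have "fst (F X) = - ?I X * f X" for X by (simp add: F_def)
  ultimately show ?thesis using that nF by blast
qed

section \<open>Sources of mass one on small balls, and their solutions\<close>

definition avg :: "'n st \<Rightarrow> real \<Rightarrow> 'n st \<Rightarrow> real" where
  "avg Y r = (\<lambda>Z. indicator (ball Y r) Z / measure lborel (ball Y r))"

lemma avg_props:
  assumes "0 < r"
  shows "avg Y r \<in> borel_measurable borel" "bounded (range (avg Y r))" "0 \<le> avg Y r Z"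
    "r \<le> dist Z Y \<Longrightarrow> avg Y r Z = 0" "integrable lborel (avg Y r)" "(LINT Z|lborel. avg Y r Z) = 1"
proof -
  have pos: "0 < measure lborel (ball Y r)" by (rule content_ball_pos[OF assms])
  show "avg Y r \<in> borel_measurable borel" unfolding avg_def by (intro borel_measurable_divide borel_measurable_indicator borel_measurable_const) auto
  show "bounded (range (avg Y r))"
    unfolding bounded_iff by (rule exI[of _ "1 / measure lborel (ball Y r)"]) (use pos in \<open>auto simp: avg_def indicator_def\<close>)
  show "0 \<le> avg Y r Z" using pos by (simp add: avg_def)
  show "r \<le> dist Z Y \<Longrightarrow> avg Y r Z = 0" by (auto simp: avg_def dist_commute)
  have i: "integrable lborel (indicator (ball Y r) :: 'n st \<Rightarrow> real)"
    using emeasure_bounded_finite[OF bounded_ball[of Y r]] by simp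
  then show "integrable lborel (avg Y r)" unfolding avg_def by simp
  show "(LINT Z|lborel. avg Y r Z) = 1" unfolding avg_def using pos by simp
qed

definition potential :: "('n st \<Rightarrow> real) \<Rightarrow> 'n st \<Rightarrow> real" where "potential f X = (LINT Y:cyl \<Omega> T|lborel. G X Y * f Y)"

text \<open>The solution u carries the gradient and the equation, and the potential carries the link
  to G; the two agree only almost everywhere, so both are kept.\<close>

lemma green_solution:
  assumes f: "f \<in> borel_measurable borel" "bounded (range f)"
  obtains u g F where "wsol \<Omega> T u g F"
    "\<And>X. lam * (norm (g X))\<^sup>2 \<le> snd (F X) \<bullet> g X" "\<And>X. norm (snd (F X)) \<le> \<Lambda> * norm (g X)"
    "\<And>X. f X = 0 \<Longrightarrow> fst (F X) = 0"
    "AE X in lborel. X \<in> oc \<longrightarrow> set_integrable lborel (cyl \<Omega> T) (\<lambda>Y. G X Y * f Y) \<and> u X = potential f X"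
proof -
  obtain u where u: "weak_sol \<Omega> T A f u" "AE X in lborel. X \<in> cyl \<Omega> T \<longrightarrow>
               set_integrable lborel (cyl \<Omega> T) (\<lambda>Y. G X Y * f Y) \<and> u X = (LINT Y:cyl \<Omega> T|lborel. G X Y * f Y)"
    using green f unfolding green_fun_def by auto
  obtain g F where gF: "wsol \<Omega> T (\<lambda>X. indicator oc X * u X) g F"
    "\<And>X. lam * (norm (g X))\<^sup>2 \<le> snd (F X) \<bullet> g X" "\<And>X. norm (snd (F X)) \<le> \<Lambda> * norm (g X)"
    "\<And>X. fst (F X) = - indicator oc X * f X" using wsol_of_weak_sol[OF u(1) f] by blast
  show ?thesis
  proof (rule that[OF gF(1-3)])
    show "fst (F X) = 0" if "f X = 0" for X using gF(4)[of X] that by simp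
    show "AE X in lborel. X \<in> oc \<longrightarrow> set_integrable lborel (cyl \<Omega> T) (\<lambda>Y. G X Y * f Y) \<and> indicator oc X * u X = potential f X"
      using u(2) by eventually_elim (use oc(2) in \<open>auto simp: potential_def\<close>)
  qed
qed

lemma G_cont: "continuous_on {(X, Y). X \<in> oc \<and> Y \<in> oc \<and> X \<noteq> Y} (\<lambda>(X, Y). G X Y)"
  using green by (simp add: green_fun_def oc_def)

lemma G_nonneg: "X \<in> oc \<Longrightarrow> Y \<in> oc \<Longrightarrow> X \<noteq> Y \<Longrightarrow> 0 \<le> G X Y"
  using green oc(2) by (auto simp: green_fun_def)

text \<open>G is bounded on pairs from the annulus and the small ball, by compactness, and an
  average of mass one inherits this bound on the annulus. The maximum principle carries it to
  everything beyond 4 R, up to the boundary of the cylinder, with a constant independent of r. The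
  lower bound is the sign of G.\<close>

lemma averages_bounded:
  assumes R: "0 < R" and sub: "cball Y (4 * R) \<subseteq> oc"
  shows "\<exists>M\<ge>0. \<forall>r. 0 < r \<and> r \<le> R / 2 \<longrightarrow>
    (AE X in lborel. X \<in> oc \<and> 4 * R \<le> dist X Y \<longrightarrow> 0 \<le> potential (avg Y r) X \<and> potential (avg Y r) X \<le> M)"
proof -
  \<comment> \<open>X in the closed annulus, Z in the closed ball of radius R / 2 that contains the
    support of every admissible source: a compact set away from the diagonal.\<close>
  define Kc where "Kc = {(X, Z). X \<in> cball Y (4 * R) - ball Y R \<and> Z \<in> cball Y (R / 2)}"
  have Kc: "Kc = (cball Y (4 * R) - ball Y R) \<times> cball Y (R / 2)" by (auto simp: Kc_def)
  have "compact Kc" unfolding Kc by (intro compact_Times compact_diff compact_cball open_ball)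
  moreover have Ksub: "Kc \<subseteq> {(X, Y). X \<in> oc \<and> Y \<in> oc \<and> X \<noteq> Y}"
  proof
    fix P assume "P \<in> Kc"
    then obtain X Z where P: "P = (X, Z)" "dist Y X \<le> 4 * R" "R \<le> dist Y X" "dist Y Z \<le> R / 2" by (auto simp: Kc_def)
    then have "X \<in> oc" "Z \<in> oc" using sub R by auto
    moreover have "X \<noteq> Z" using P R by auto
    ultimately show "P \<in> {(X, Y). X \<in> oc \<and> Y \<in> oc \<and> X \<noteq> Y}" using P by simp
  qed
  ultimately have "compact ((\<lambda>(X, Y). G X Y) ` Kc)"
    by (intro compact_continuous_image continuous_on_subset[OF G_cont])
  then have "bounded ((\<lambda>(X, Y). G X Y) ` Kc)" by (rule compact_imp_bounded)
  then obtain M0 where "\<forall>P\<in>Kc. norm ((\<lambda>(X, Y). G X Y) P) \<le> M0" by (auto simp: bounded_iff)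
  then have M0: "G X Z \<le> \<bar>M0\<bar>" if "(X, Z) \<in> Kc" for X Z using that by force
  show ?thesis
  proof (intro exI[of _ "\<bar>M0\<bar>"] conjI allI impI)
    fix r assume r: "0 < r \<and> r \<le> R / 2"
    note av = avg_props[where r = r and Y = Y]
    obtain u g F where s: "wsol \<Omega> T u g F"
      "\<And>X. lam * (norm (g X))\<^sup>2 \<le> snd (F X) \<bullet> g X" "\<And>X. norm (snd (F X)) \<le> \<Lambda> * norm (g X)"
      "\<And>X. avg Y r X = 0 \<Longrightarrow> fst (F X) = 0"
      "AE X in lborel. X \<in> oc \<longrightarrow> set_integrable lborel (cyl \<Omega> T) (\<lambda>Z. G X Z * avg Y r Z) \<and> u X = potential (avg Y r) X"
      using green_solution[of "avg Y r"] av(1,2) r by blast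
    have mp: "AE X in lborel. 4 * R \<le> dist X Y \<longrightarrow> u X \<le> \<bar>M0\<bar>"
    proof (rule maximum_principle[OF s(1) dom(2) lam(1) s(2) R])
      show "fst (F X) = 0" if "R \<le> dist X Y" for X
        by (rule s(4), rule av(4)) (use that r in auto)
      show "AE X in lborel. R \<le> dist X Y \<and> dist X Y < 4 * R \<longrightarrow> u X \<le> \<bar>M0\<bar>"
        using s(5)
      proof eventually_elim
        case (elim X)
        show ?case
        proof
          assume X: "R \<le> dist X Y \<and> dist X Y < 4 * R"
          then have "X \<in> oc" using sub by (auto simp: dist_commute)
          then have i: "set_integrable lborel (cyl \<Omega> T) (\<lambda>Z. G X Z * avg Y r Z)" and uX: "u X = potential (avg Y r) X" using elim by auto
          have "u X = (LINT Z|lborel. indicator (cyl \<Omega> T) Z * (G X Z * avg Y r Z))"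
            by (simp add: uX potential_def set_lebesgue_integral_def)
          also have "\<dots> \<le> (LINT Z|lborel. \<bar>M0\<bar> * avg Y r Z)"
          proof (rule integral_mono)
            show "integrable lborel (\<lambda>Z. indicator (cyl \<Omega> T) Z * (G X Z * avg Y r Z))"
              using i by (simp add: set_integrable_def)
            show "integrable lborel (\<lambda>Z. \<bar>M0\<bar> * avg Y r Z)" using av(5) r by simp
            fix Z
            show "indicator (cyl \<Omega> T) Z * (G X Z * avg Y r Z) \<le> \<bar>M0\<bar> * avg Y r Z"
            proof (cases "dist Z Y < r")
              case True
              then have "(X, Z) \<in> Kc" using X r by (auto simp: Kc_def dist_commute)
              then have "G X Z * avg Y r Z \<le> \<bar>M0\<bar> * avg Y r Z" using M0 av(3) r by (intro mult_right_mono) auto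
              then show ?thesis using av(3)[of Z] r by (auto simp: indicator_def)
            next
              case False
              then show ?thesis using av(4)[of Z] r by simp
            qed
          qed
          also have "\<dots> = \<bar>M0\<bar>" using av(6) r by simp
          finally show "u X \<le> \<bar>M0\<bar>" .
        qed
      qed
    qed simp
    show "AE X in lborel. X \<in> oc \<and> 4 * R \<le> dist X Y \<longrightarrow> 0 \<le> potential (avg Y r) X \<and> potential (avg Y r) X \<le> \<bar>M0\<bar>"
      using mp s(5)
    proof eventually_elim
      case (elim X)
      show ?case
      proof
        assume X: "X \<in> oc \<and> 4 * R \<le> dist X Y"
        have "0 \<le> indicator (cyl \<Omega> T) Z *\<^sub>R (G X Z * avg Y r Z)" for Z
        proof (cases "dist Z Y < r")
          case True
          then have "Z \<in> cball Y (4 * R)" using r by (auto simp: dist_commute)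
          then have "Z \<in> oc" using sub by blast
          moreover have "X \<noteq> Z" using True X r R by auto
          ultimately have "0 \<le> G X Z" using G_nonneg X by auto
          then show ?thesis using av(3)[of Z] r by simp
        next
          case False
          then show ?thesis using av(4)[of Z] r by simp
        qed
        then have "0 \<le> potential (avg Y r) X" unfolding potential_def set_lebesgue_integral_def by (rule Bochner_Integration.integral_nonneg)
        then show "0 \<le> potential (avg Y r) X \<and> potential (avg Y r) X \<le> \<bar>M0\<bar>" using elim X by auto
      qed
    qed
  qed simp
qed

text \<open>Continuity of G X at Y, together with mass one of the averages. Integrability is an
  assumption on the given X because it is known only for almost every X.\<close>

lemma averages_tendsto:
  assumes R: "0 < R" and sub: "cball Y (4 * R) \<subseteq> oc" and X: "X \<in> oc" "4 * R \<le> dist X Y"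
    and r: "\<And>k. 0 < r k" "\<And>k. r k \<le> R / 2" "r \<longlonglongrightarrow> 0"
    and int: "\<And>k. set_integrable lborel (cyl \<Omega> T) (\<lambda>Z. G X Z * avg Y (r k) Z)"
  shows "(\<lambda>k. potential (avg Y (r k)) X) \<longlonglongrightarrow> G X Y"
proof (rule LIMSEQ_I)
  fix e :: real assume e: "0 < e"
  have "Y \<in> cball Y (4 * R)" using R by simp
  then have Y: "Y \<in> oc" using sub by blast
  have XY: "X \<noteq> Y" using X(2) R by auto
  have "isCont (\<lambda>(X, Y). G X Y) (X, Y)"
  proof -
    have op: "open {(X, Y). X \<in> oc \<and> Y \<in> oc \<and> X \<noteq> Y}"
    proof -
      have "{(X, Y). X \<in> oc \<and> Y \<in> oc \<and> X \<noteq> Y} = (oc \<times> oc) \<inter> {P. fst P \<noteq> snd P}" by auto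
      moreover have "open {P :: 'n st \<times> 'n st. fst P \<noteq> snd P}" by (intro open_Collect_neq continuous_intros)
      ultimately show ?thesis using oc(1) by (auto intro!: open_Int open_Times)
    qed
    have "(X, Y) \<in> {(X, Y). X \<in> oc \<and> Y \<in> oc \<and> X \<noteq> Y}" using X Y XY by simp
    then show ?thesis using G_cont continuous_on_eq_continuous_at[OF op] by blast
  qed
  then have "isCont (\<lambda>Z. (\<lambda>(X, Y). G X Y) (X, Z)) Y"
    by (intro isCont_o2[where g = "\<lambda>(X, Y). G X Y" and f = "\<lambda>Z. (X, Z)"]) (auto intro!: continuous_intros)
  then have "isCont (G X) Y" by simp
  then obtain d where d: "0 < d" "\<And>Z. dist Z Y < d \<Longrightarrow> dist (G X Z) (G X Y) < e / 2"
    unfolding continuous_at_eps_delta using e half_gt_zero[OF e] by blast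
  obtain k0 where k0: "\<And>k. k0 \<le> k \<Longrightarrow> r k < d"
    using order_tendstoD(2)[OF r(3) d(1)] by (auto simp: eventually_sequentially)
  show "\<exists>k0. \<forall>k\<ge>k0. norm (potential (avg Y (r k)) X - G X Y) < e"
  proof (intro exI[of _ k0] allI impI)
    fix k assume k: "k0 \<le> k"
    note av = avg_props[OF r(1)[of k], where Y = Y]
    have i1: "integrable lborel (\<lambda>Z. indicator (cyl \<Omega> T) Z *\<^sub>R (G X Z * avg Y (r k) Z))" using int[of k] by (simp add: set_integrable_def)
    have i2: "integrable lborel (\<lambda>Z. G X Y * avg Y (r k) Z)" using av(5) by simp
    have "potential (avg Y (r k)) X - G X Y = (LINT Z|lborel. indicator (cyl \<Omega> T) Z *\<^sub>R (G X Z * avg Y (r k) Z) - G X Y * avg Y (r k) Z)"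
      using i1 i2 av(6) by (simp add: potential_def set_lebesgue_integral_def)
    also have "norm \<dots> \<le> (LINT Z|lborel. norm (indicator (cyl \<Omega> T) Z *\<^sub>R (G X Z * avg Y (r k) Z) - G X Y * avg Y (r k) Z))"
      by (rule integral_norm_bound)
    also have "\<dots> \<le> (LINT Z|lborel. e / 2 * avg Y (r k) Z)"
    proof (rule integral_mono)
      show "integrable lborel (\<lambda>Z. norm (indicator (cyl \<Omega> T) Z *\<^sub>R (G X Z * avg Y (r k) Z) - G X Y * avg Y (r k) Z))" using i1 i2 by (intro integrable_norm) simp
      show "integrable lborel (\<lambda>Z. e / 2 * avg Y (r k) Z)" using av(5) by simp
      fix Z
      show "norm (indicator (cyl \<Omega> T) Z *\<^sub>R (G X Z * avg Y (r k) Z) - G X Y * avg Y (r k) Z) \<le> e / 2 * avg Y (r k) Z"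
      proof (cases "dist Z Y < r k")
        case True
        then have "Z \<in> cball Y (4 * R)" using r(2)[of k] R by (auto simp: dist_commute)
        then have "Z \<in> cyl \<Omega> T" using sub oc(2) by blast
        then have "norm (indicator (cyl \<Omega> T) Z *\<^sub>R (G X Z * avg Y (r k) Z) - G X Y * avg Y (r k) Z) = \<bar>G X Z - G X Y\<bar> * avg Y (r k) Z"
          using av(3)[of Z] by (simp add: left_diff_distrib[symmetric] abs_mult)
        also have "\<dots> \<le> e / 2 * avg Y (r k) Z"
          using d(2)[of Z] True k0[OF k] av(3)[of Z] by (intro mult_right_mono) (auto simp: dist_real_def)
        finally show ?thesis .
      next
        case False
        then show ?thesis using av(4)[of Z] by simp
      qed
    qed
    also have "\<dots> = e / 2" using av(6) by simp
    finally show "norm (potential (avg Y (r k)) X - G X Y) < e" using e by simp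
  qed
qed

end

section \<open>Approximate projections\<close>

text \<open>A space of functions with a semidefinite form: functions equal almost everywhere are not
  identified, and nothing is assumed about completeness. Closure under v - a w gives all linear
  combinations.\<close>

locale pre_inner =
  fixes V :: "('x \<Rightarrow> real) set" and ip :: "('x \<Rightarrow> real) \<Rightarrow> ('x \<Rightarrow> real) \<Rightarrow> real"
  assumes V_sub: "\<And>v w a. v \<in> V \<Longrightarrow> w \<in> V \<Longrightarrow> (\<lambda>x. v x - a * w x) \<in> V" and V_ne: "V \<noteq> {}"
    and ip_sym: "\<And>v w. ip v w = ip w v"
    and ip_lin: "\<And>v w z a. v \<in> V \<Longrightarrow> w \<in> V \<Longrightarrow> z \<in> V \<Longrightarrow> ip (\<lambda>x. v x - a * w x) z = ip v z - a * ip w z"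
    and ip_pos: "\<And>v. v \<in> V \<Longrightarrow> 0 \<le> ip v v"
begin

definition bfun :: "(('x \<Rightarrow> real) \<Rightarrow> real) \<Rightarrow> bool" where
  "bfun lf \<longleftrightarrow> (\<forall>v\<in>V. \<forall>w\<in>V. \<forall>a. lf (\<lambda>x. v x - a * w x) = lf v - a * lf w) \<and> (\<exists>C. \<forall>v\<in>V. (lf v)\<^sup>2 \<le> C * ip v v)"

lemma ip_quad:
  assumes "v \<in> V" "w \<in> V"
  shows "ip (\<lambda>x. v x - a * w x) (\<lambda>x. v x - a * w x) = ip v v - 2 * a * ip v w + a\<^sup>2 * ip w w"
proof -
  let ?z = "\<lambda>x. v x - a * w x"
  have z: "?z \<in> V" by (rule V_sub[OF assms])
  have "ip ?z ?z = ip v ?z - a * ip w ?z" by (rule ip_lin[OF assms z])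
  also have "ip v ?z = ip v v - a * ip w v" unfolding ip_sym[of v ?z] by (rule ip_lin[OF assms assms(1)])
  also have "ip w ?z = ip v w - a * ip w w" unfolding ip_sym[of w ?z] by (rule ip_lin[OF assms assms(2)])
  finally show ?thesis using ip_sym[of v w] by (simp add: power2_eq_square algebra_simps)
qed

lemma scale_mem: "v \<in> V \<Longrightarrow> (\<lambda>x. c * v x) \<in> V"
  using V_sub[of v v "1 - c"] by (simp add: algebra_simps)

text \<open>A vector \<open>w\<close> of almost minimal norm on the affine hyperplane \<open>lf = 1\<close> is almost orthogonal to the
  kernel of \<open>lf\<close>; this replaces the orthogonal projection, which would need completeness.\<close>

lemma near_projection:
  assumes lf: "bfun lf" and K: "1 < K"
  shows "\<exists>w\<in>V. \<forall>v\<in>V. lf (\<lambda>x. v x - lf v * w x) = 0 \<and> ip (\<lambda>x. v x - lf v * w x) (\<lambda>x. v x - lf v * w x) \<le> K * ip v v"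
proof (cases "\<forall>v\<in>V. lf v = 0")
  case True
  obtain w where w: "w \<in> V" using V_ne by blast
  have "ip v v \<le> K * ip v v" if "v \<in> V" for v using ip_pos[OF that] K by (simp add: mult_le_cancel_right1)
  then show ?thesis using True w by (intro bexI[of _ w]) auto
next
  case False
  have lin: "lf (\<lambda>x. v x - a * w x) = lf v - a * lf w" if "v \<in> V" "w \<in> V" for v w a using lf that by (simp add: bfun_def)
  obtain C where C: "\<And>v. v \<in> V \<Longrightarrow> (lf v)\<^sup>2 \<le> C * ip v v" using lf unfolding bfun_def by blast
  have scale: "lf (\<lambda>x. c * v x) = c * lf v" "ip (\<lambda>x. c * v x) (\<lambda>x. c * v x) = c\<^sup>2 * ip v v" if "v \<in> V" for v c
    using lin[OF that that, of "1 - c"] ip_quad[OF that that, of "1 - c"] by (simp_all add: algebra_simps power2_eq_square)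
  define S where "S = {ip w w | w. w \<in> V \<and> lf w = 1}"
  obtain v0 where v0: "v0 \<in> V" "lf v0 \<noteq> 0" using False by blast
  have "ip (\<lambda>x. (1 / lf v0) * v0 x) (\<lambda>x. (1 / lf v0) * v0 x) \<in> S"
    unfolding S_def using v0 scale(1)[OF v0(1), of "1 / lf v0"] scale_mem[OF v0(1), of "1 / lf v0"] by auto
  then have Sne: "S \<noteq> {}" by blast
  have C1: "1 \<le> C * s" if "s \<in> S" for s using that C by (force simp: S_def)
  have S0: "0 \<le> s" if "s \<in> S" for s using that ip_pos by (auto simp: S_def)
  have C0: "0 < C"
  proof (rule ccontr)
    assume "\<not> 0 < C"
    moreover obtain s where "s \<in> S" using Sne by blast
    ultimately have "C * s \<le> 0" using S0[of s] by (simp add: mult_nonpos_nonneg)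
    then show False using C1[OF \<open>s \<in> S\<close>] by linarith
  qed
  \<comment> \<open>Boundedness of \<open>lf\<close> keeps the hyperplane \<open>lf\<close> = 1 away
    from the null vectors, so the infimum m is positive.\<close>
  have lb: "1 / C \<le> s" if "s \<in> S" for s using C1[OF that] C0 by (simp add: divide_le_eq mult.commute)
  define m where "m = Inf S"
  have "1 / C \<le> m" unfolding m_def by (rule cInf_greatest[OF Sne lb])
  moreover have "0 < 1 / C" using C0 by simp
  ultimately have m: "0 < m" by linarith
  have mle: "m \<le> s" if "s \<in> S" for s unfolding m_def by (rule cInf_lower[OF that]) (use S0 in \<open>auto intro!: bdd_belowI[of _ 0]\<close>)
  have "m < K * m" using m K by simp
  then obtain s where s: "s \<in> S" "s < K * m" using cInf_lessD[OF Sne, of "K * m"] by (auto simp: m_def)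
  then obtain w where w: "w \<in> V" "lf w = 1" "ip w w < K * m" by (auto simp: S_def)
  show ?thesis
  proof (intro bexI[of _ w] ballI conjI)
    fix v assume v: "v \<in> V"
    define a where "a = lf v"
    define r where "r = (\<lambda>x. v x - a * w x)"
    have r: "r \<in> V" unfolding r_def by (rule V_sub[OF v w(1)])
    have lr: "lf r = 0" unfolding r_def lin[OF v w(1)] by (simp add: a_def w(2))
    then show "lf (\<lambda>x. v x - lf v * w x) = 0" by (simp add: r_def a_def)
    define W where "W = ip w w"
    define B where "B = ip w r"
    define Rr where "Rr = ip r r"
    have W: "m \<le> W" unfolding W_def by (rule mle) (use w in \<open>auto simp: S_def\<close>)
    have W0: "0 < W" using W m by simp
    have "v = (\<lambda>x. r x - (- a) * w x)" by (auto simp: r_def)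
    then have iv: "ip v v = Rr + 2 * a * B + a\<^sup>2 * W"
      using ip_quad[OF r w(1), of "- a"] ip_sym[of r w] by (simp add: Rr_def B_def W_def)
    have Rr0: "0 \<le> Rr" unfolding Rr_def by (rule ip_pos[OF r])
    have "Rr \<le> K * ip v v"
    proof (cases "Rr = 0")
      case True
      then show ?thesis using ip_pos[OF v] K by simp
    next
      case False
      then have Rp: "0 < Rr" using Rr0 by simp
      \<comment> \<open>The minimiser of the squared norm of w - t r. As \<open>lf\<close> r = 0,
        this vector is still on the hyperplane, so its squared norm is at least m; this bounds the
        angle between w and the kernel.\<close>
      define t where "t = B / Rr"
      have "m \<le> ip (\<lambda>x. w x - t * r x) (\<lambda>x. w x - t * r x)"
        by (rule mle) (use V_sub[OF w(1) r] lin[OF w(1) r, of t] w(2) lr in \<open>auto simp: S_def\<close>)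
      also have "\<dots> = W - 2 * t * B + t\<^sup>2 * Rr" by (simp add: ip_quad[OF w(1) r] W_def B_def Rr_def)
      also have "\<dots> = W - B\<^sup>2 / Rr" using Rp by (simp add: t_def power2_eq_square field_simps)
      finally have "m \<le> W - B\<^sup>2 / Rr" .
      moreover have "W / K < m" using w(3) K by (simp add: W_def pos_divide_less_eq mult.commute)
      ultimately have "W / K < W - B\<^sup>2 / Rr" by linarith
      then have "B\<^sup>2 / Rr < W - W / K" by simp
      then have "B\<^sup>2 < (W - W / K) * Rr" using Rp by (simp add: pos_divide_less_eq)
      then have "B\<^sup>2 / W < ((W - W / K) * Rr) / W" using W0 by (rule divide_strict_right_mono)
      also have "\<dots> = Rr - Rr / K" using W0 K by (simp add: field_simps)
      finally have 1: "B\<^sup>2 / W < Rr - Rr / K" .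
      \<comment> \<open>Completing the square in a: the squared norm of v is at least Rr - B^2 / W,
        and the bound on B leaves more than Rr / K of it.\<close>
      have "0 \<le> (a * W + B)\<^sup>2 / W" using W0 by simp
      also have "\<dots> = a\<^sup>2 * W + 2 * a * B + B\<^sup>2 / W" using W0 by (simp add: power2_eq_square field_simps)
      finally have "Rr / K < ip v v" using 1 iv by linarith
      then show ?thesis using K by (simp add: pos_divide_less_eq mult.commute)
    qed
    then show "ip (\<lambda>x. v x - lf v * w x) (\<lambda>x. v x - lf v * w x) \<le> K * ip v v" by (simp add: Rr_def r_def a_def)
  qed (rule w(1))
qed

lemma sum_mem:
  fixes n :: nat
  assumes "v \<in> V" "\<And>i. i < n \<Longrightarrow> w i \<in> V"
  shows "(\<lambda>x. v x - (\<Sum>i<n. a i * w i x)) \<in> V"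
    and "bfun lf \<Longrightarrow> lf (\<lambda>x. v x - (\<Sum>i<n. a i * w i x)) = lf v - (\<Sum>i<n. a i * lf (w i))"
proof -
  have "(\<lambda>x. v x - (\<Sum>i<n. a i * w i x)) \<in> V \<and> (bfun lf \<longrightarrow> lf (\<lambda>x. v x - (\<Sum>i<n. a i * w i x)) = lf v - (\<Sum>i<n. a i * lf (w i)))"
    using assms(2)
  proof (induction n)
    case 0 then show ?case using assms(1) by simp
  next
    case (Suc n)
    have e: "(\<lambda>x. v x - (\<Sum>i<Suc n. a i * w i x)) = (\<lambda>x. (\<lambda>x. v x - (\<Sum>i<n. a i * w i x)) x - a n * w n x)" by auto
    have IH: "(\<lambda>x. v x - (\<Sum>i<n. a i * w i x)) \<in> V" "bfun lf \<longrightarrow> lf (\<lambda>x. v x - (\<Sum>i<n. a i * w i x)) = lf v - (\<Sum>i<n. a i * lf (w i))"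
      using Suc by auto
    have wn: "w n \<in> V" using Suc.prems by simp
    show ?case unfolding e using V_sub[OF IH(1) wn, of "a n"] IH wn by (auto simp: bfun_def)
  qed
  then show "(\<lambda>x. v x - (\<Sum>i<n. a i * w i x)) \<in> V"
    and "bfun lf \<Longrightarrow> lf (\<lambda>x. v x - (\<Sum>i<n. a i * w i x)) = lf v - (\<Sum>i<n. a i * lf (w i))" by auto
qed

text \<open>Induction on the number of functionals. Each step spends sqrt K on the old functionals
  and sqrt K on the new one, so any total loss K > 1 can be prescribed, however many functionals
  there are. The predicate P records a property of the coefficient functionals that is stable under
  linear combinations; it will be measurability in a parameter.\<close>

lemma near_projection_many:
  fixes N :: nat
  assumes lf: "\<And>j. j < N \<Longrightarrow> bfun (lf j)" and K: "1 < K"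
    and P: "\<And>j. j < N \<Longrightarrow> P (lf j)" "\<And>c d a. P c \<Longrightarrow> P d \<Longrightarrow> P (\<lambda>v. c v + a * d v)"
  shows "\<exists>w c. (\<forall>i<N. w i \<in> V \<and> P (c i)) \<and> (\<forall>v\<in>V. \<forall>j<N. lf j (\<lambda>x. v x - (\<Sum>i<N. c i v * w i x)) = 0) \<and>
    (\<forall>v\<in>V. ip (\<lambda>x. v x - (\<Sum>i<N. c i v * w i x)) (\<lambda>x. v x - (\<Sum>i<N. c i v * w i x)) \<le> K * ip v v)"
  using lf K P(1)
proof (induction N arbitrary: K)
  case 0
  have "ip v v \<le> K * ip v v" if "v \<in> V" for v using ip_pos[OF that] 0 by (simp add: mult_le_cancel_right1)
  then show ?case by simp
next
  case (Suc N)
  define K1 where "K1 = sqrt K"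
  have K1: "1 < K1" "K1 * K1 = K" using Suc.prems(2) by (auto simp: K1_def)
  obtain w c where wc: "\<forall>i<N. w i \<in> V \<and> P (c i)" "\<forall>v\<in>V. \<forall>j<N. lf j (\<lambda>x. v x - (\<Sum>i<N. c i v * w i x)) = 0"
    "\<forall>v\<in>V. ip (\<lambda>x. v x - (\<Sum>i<N. c i v * w i x)) (\<lambda>x. v x - (\<Sum>i<N. c i v * w i x)) \<le> K1 * ip v v"
    using Suc.IH[OF _ K1(1)] Suc.prems(1,3) by (auto simp: less_Suc_eq)
  \<comment> \<open>The new functional is treated on the common kernel of the old ones: a correction
    by a vector from this kernel does not disturb the zeros already achieved.\<close>
  define V' where "V' = {v \<in> V. \<forall>j<N. lf j v = 0}"
  have lin: "lf j (\<lambda>x. v x - a * w x) = lf j v - a * lf j w" if "j < Suc N" "v \<in> V" "w \<in> V" for j v w a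
    using Suc.prems(1)[OF that(1)] that(2,3) by (simp add: bfun_def)
  obtain v0 where v0: "v0 \<in> V" using V_ne by blast
  have red: "(\<lambda>x. v x - (\<Sum>i<N. c i v * w i x)) \<in> V'" if "v \<in> V" for v
    unfolding V'_def using sum_mem(1)[OF that, of N w "\<lambda>i. c i v"] wc(1,2) that by auto
  interpret V': pre_inner V' ip
  proof
    show "(\<lambda>x. v x - a * w x) \<in> V'" if "v \<in> V'" "w \<in> V'" for v w a
      using that V_sub[of v w a] lin[of _ v w a] by (auto simp: V'_def)
    show "V' \<noteq> {}" using red[OF v0] by blast
    show "ip v w = ip w v" for v w by (rule ip_sym)
    show "ip (\<lambda>x. v x - a * w x) z = ip v z - a * ip w z" if "v \<in> V'" "w \<in> V'" "z \<in> V'" for v w z a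
      using that ip_lin by (auto simp: V'_def)
    show "0 \<le> ip v v" if "v \<in> V'" for v using that ip_pos by (auto simp: V'_def)
  qed
  have b: "bfun (lf N)" using Suc.prems(1) by simp
  then have "V'.bfun (lf N)"
  proof -
    have "V' \<subseteq> V" by (auto simp: V'_def)
    then show ?thesis using b unfolding V'.bfun_def bfun_def by blast
  qed
  from V'.near_projection[OF this K1(1)] obtain wN where wN: "wN \<in> V'"
    "\<And>v. v \<in> V' \<Longrightarrow> lf N (\<lambda>x. v x - lf N v * wN x) = 0"
    "\<And>v. v \<in> V' \<Longrightarrow> ip (\<lambda>x. v x - lf N v * wN x) (\<lambda>x. v x - lf N v * wN x) \<le> K1 * ip v v" by blast
  have wNV: "wN \<in> V" using wN(1) by (simp add: V'_def)
  \<comment> \<open>The value of \<open>lf\<close> N on the vector already reduced by the first N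
    corrections, expanded by linearity as a functional of the original v; this form shows that P
    holds for it.\<close>
  define cN where "cN v = lf N v + (\<Sum>i<N. (- lf N (w i)) * c i v)" for v
  have PN: "P (\<lambda>v. lf N v + (\<Sum>i<n. (- lf N (w i)) * c i v))" if "n \<le> N" for n
    using that
  proof (induction n)
    case 0 then show ?case using Suc.prems(3)[of N] by simp
  next
    case (Suc n)
    have "P (\<lambda>v. (\<lambda>v. lf N v + (\<Sum>i<n. (- lf N (w i)) * c i v)) v + (- lf N (w n)) * c n v)"
      by (rule P(2)) (use Suc wc(1) in auto)
    then show ?case by (simp only: sum.lessThan_Suc add.assoc)
  qed
  define w' where "w' i = (if i = N then wN else w i)" for i
  define c' where "c' i = (if i = N then cN else c i)" for i
  have eq: "(\<lambda>x. v x - (\<Sum>i<Suc N. c' i v * w' i x)) = (\<lambda>x. (\<lambda>x. v x - (\<Sum>i<N. c i v * w i x)) x - lf N (\<lambda>x. v x - (\<Sum>i<N. c i v * w i x)) * wN x)"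
    if "v \<in> V" for v
  proof -
    have "lf N (\<lambda>x. v x - (\<Sum>i<N. c i v * w i x)) = cN v"
      using sum_mem(2)[OF that _ b, of N w "\<lambda>i. c i v"] wc(1) by (simp add: cN_def sum_negf mult.commute)
    moreover have "(\<Sum>i<N. c' i v * w' i x) = (\<Sum>i<N. c i v * w i x)" for x
      by (rule sum.cong) (auto simp: c'_def w'_def)
    ultimately show ?thesis by (simp add: c'_def w'_def algebra_simps)
  qed
  show ?case
  proof (intro exI[of _ w'] exI[of _ c'] conjI allI impI ballI)
    fix i assume "i < Suc N"
    then show "w' i \<in> V" "P (c' i)" using wc(1) wNV PN[of N] by (auto simp: w'_def c'_def cN_def[abs_def] less_Suc_eq)
  next
    fix v j assume v: "v \<in> V" and j: "j < Suc N"
    let ?r = "\<lambda>x. v x - (\<Sum>i<N. c i v * w i x)"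
    have r: "?r \<in> V'" by (rule red[OF v])
    show "lf j (\<lambda>x. v x - (\<Sum>i<Suc N. c' i v * w' i x)) = 0"
    proof (cases "j = N")
      case True then show ?thesis unfolding eq[OF v] using wN(2)[OF r] by simp
    next
      case False
      then show ?thesis unfolding eq[OF v] using V'.V_sub[OF r wN(1), of "lf N ?r"] j by (simp add: V'_def)
    qed
  next
    fix v assume v: "v \<in> V"
    let ?r = "\<lambda>x. v x - (\<Sum>i<N. c i v * w i x)"
    have r: "?r \<in> V'" by (rule red[OF v])
    have "ip (\<lambda>x. ?r x - lf N ?r * wN x) (\<lambda>x. ?r x - lf N ?r * wN x) \<le> K1 * ip ?r ?r" by (rule wN(3)[OF r])
    also have "\<dots> \<le> K1 * (K1 * ip v v)" using wc(3) v K1(1) by (intro mult_left_mono) auto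
    also have "\<dots> = K * ip v v" using K1(2) by (simp add: mult.assoc[symmetric])
    finally show "ip (\<lambda>x. v x - (\<Sum>i<Suc N. c' i v * w' i x)) (\<lambda>x. v x - (\<Sum>i<Suc N. c' i v * w' i x)) \<le> K * ip v v"
      unfolding eq[OF v] .
  qed
qed

end

section \<open>Parabolic grids\<close>

lemma norm_sq_le_card:
  fixes v :: "real^'n::finite"
  assumes "\<And>k. \<bar>v $ k\<bar> \<le> s"
  shows "(norm v)\<^sup>2 \<le> real CARD('n) * s\<^sup>2"
proof -
  have "(norm v)\<^sup>2 = (\<Sum>k\<in>UNIV. (v $ k)\<^sup>2)"
    unfolding power2_norm_eq_inner inner_vec_def by (simp add: power2_eq_square)
  also have "\<dots> \<le> (\<Sum>k\<in>(UNIV::'n set). s\<^sup>2)"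
  proof (rule sum_mono)
    fix k
    have "\<bar>v $ k\<bar>\<^sup>2 \<le> s\<^sup>2" by (rule power_mono[OF assms]) simp
    then show "(v $ k)\<^sup>2 \<le> s\<^sup>2" by simp
  qed
  finally show ?thesis by simp
qed

lemma norm_le_card:
  fixes v :: "real^'n::finite"
  assumes "\<And>k. \<bar>v $ k\<bar> \<le> s" "0 \<le> s"
  shows "norm v \<le> real CARD('n) * s"
proof (rule power2_le_imp_le)
  have "real CARD('n) * s\<^sup>2 \<le> real CARD('n) * (real CARD('n) * s\<^sup>2)"
    by (intro mult_left_mono) (auto simp: mult_le_cancel_right1 Suc_leI)
  then show "(norm v)\<^sup>2 \<le> (real CARD('n) * s)\<^sup>2"
    using norm_sq_le_card[of v s, OF assms(1)] by (simp add: power_mult_distrib power2_eq_square mult_ac)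
qed (use assms(2) in simp)

lemma card_sq_le: "real CARD('n::finite) * \<eta>\<^sup>2 \<le> (real CARD('n) * \<eta>)\<^sup>2"
proof -
  have "1 \<le> real CARD('n)" by (simp add: Suc_leI)
  then have "real CARD('n) * \<eta>\<^sup>2 \<le> (real CARD('n) * real CARD('n)) * \<eta>\<^sup>2"
    by (intro mult_right_mono) (auto simp: mult_le_cancel_right1)
  then show ?thesis by (simp add: power2_eq_square mult_ac)
qed

text \<open>A cube of side \<eta> lies in the ball of radius sqrt n \<eta> / 2 around its centre;
  the cut-off is 1 on this ball and 0 outside the ball of twice the radius. The step is taken in the
  squared distance, which gives the gradient bound 16 / (3 \<eta>), rounded up to 6 /
  \<eta>.\<close>

lemma radial_cutoff:
  fixes xc :: "real^'n::finite" and \<eta> :: real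
  assumes \<eta>: "0 < \<eta>"
  defines "\<xi> \<equiv> (\<lambda>X::'n st. 1 - sstep (((norm (fst X - xc))\<^sup>2 - real CARD('n) * \<eta>\<^sup>2 / 4) / (3 * real CARD('n) * \<eta>\<^sup>2 / 4)))"
  shows "C1 \<xi>" "0 \<le> \<xi> X" "\<xi> X \<le> 1" "norm (gradx \<xi> X) \<le> 6 / \<eta>" "\<xi> (X + (0, r)) = \<xi> X"
    "real CARD('n) * \<eta>\<^sup>2 \<le> (norm (fst X - xc))\<^sup>2 \<Longrightarrow> \<xi> X = 0"
    "real CARD('n) * \<eta>\<^sup>2 \<le> (norm (fst X - xc))\<^sup>2 \<Longrightarrow> gradx \<xi> X = 0"
    "(norm (fst X - xc))\<^sup>2 \<le> real CARD('n) * \<eta>\<^sup>2 / 4 \<Longrightarrow> \<xi> X = 1"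
proof -
  let ?n = "real CARD('n)"
  define c where "c = 3 * ?n * \<eta>\<^sup>2 / 4"
  define a where "a = ?n * \<eta>\<^sup>2 / 4"
  have n1: "1 \<le> ?n" by (simp add: Suc_leI)
  have c: "0 < c" using \<eta> n1 by (simp add: c_def)
  have ac: "a + c = ?n * \<eta>\<^sup>2" by (simp add: a_def c_def)
  define N where "N X = (norm (fst X - xc))\<^sup>2" for X :: "'n st"
  have \<xi>: "\<xi> = (\<lambda>X. 1 - sstep ((N X - a) / c))" by (simp add: \<xi>_def N_def a_def c_def)
  have d: "(N has_derivative (\<lambda>v. (2 *\<^sub>R (fst X - xc)) \<bullet> fst v + snd v * 0)) (at X)" for X
    unfolding N_def power2_norm_eq_inner
    by (rule has_derivative_eq_rhs, (rule derivative_intros)+) (auto simp: fun_eq_iff inner_commute)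
  have CN: "C1 N" "gradx N = (\<lambda>X. 2 *\<^sub>R (fst X - xc))"
  proof -
    have cc: "continuous_on UNIV (\<lambda>X::'n st. 2 *\<^sub>R (fst X - xc))" by (intro continuous_intros)
    show "C1 N" "gradx N = (\<lambda>X. 2 *\<^sub>R (fst X - xc))" using C1I[OF d cc continuous_on_const] by simp_all
  qed
  have hd: "((\<lambda>r. 1 - sstep ((r - a) / c)) has_real_derivative - (sstep' ((r - a) / c) / c)) (at r)" for r
    by (rule DERIV_cong[OF DERIV_diff[OF DERIV_const sstep_affine(1)[OF c]]]) simp
  have hc: "continuous_on UNIV (\<lambda>r. - (sstep' ((r - a) / c) / c))" by (intro continuous_intros sstep_affine(2)[OF c])
  show "C1 \<xi>" unfolding \<xi> by (rule C1_comp(1)[OF CN(1) hd hc])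
  have g: "gradx \<xi> X = - (sstep' ((N X - a) / c) / c) *\<^sub>R (2 *\<^sub>R (fst X - xc))" for X
    unfolding \<xi> C1_comp(2)[OF CN(1) hd hc] CN(2) by simp
  show "0 \<le> \<xi> X" "\<xi> X \<le> 1" unfolding \<xi> using sstep_bounds by auto
  show "\<xi> (X + (0, r)) = \<xi> X" by (simp add: \<xi> N_def)
  have far: "1 \<le> (N X - a) / c" if "?n * \<eta>\<^sup>2 \<le> N X" for X using that c ac by (simp add: le_divide_eq)
  show "\<xi> X = 0" if "?n * \<eta>\<^sup>2 \<le> (norm (fst X - xc))\<^sup>2"
    using far[of X] that sstep_values(2) by (simp add: \<xi> N_def)
  show g0: "gradx \<xi> X = 0" if "?n * \<eta>\<^sup>2 \<le> (norm (fst X - xc))\<^sup>2" for X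
    using far[of X] that sstep'_bounds(4) by (simp add: g N_def)
  show "\<xi> X = 1" if "(norm (fst X - xc))\<^sup>2 \<le> ?n * \<eta>\<^sup>2 / 4"
  proof -
    have "(N X - a) / c \<le> 0" using that c by (simp add: N_def a_def divide_nonpos_pos)
    then show ?thesis using sstep_values(1) by (simp add: \<xi>)
  qed
  show "norm (gradx \<xi> X) \<le> 6 / \<eta>"
  proof (cases "?n * \<eta>\<^sup>2 \<le> (norm (fst X - xc))\<^sup>2")
    case True then show ?thesis using g0 \<eta> by simp
  next
    case False
    have "?n * \<eta>\<^sup>2 \<le> (?n * \<eta>)\<^sup>2" by (rule card_sq_le)
    then have "(norm (fst X - xc))\<^sup>2 \<le> (?n * \<eta>)\<^sup>2" using False by linarith
    then have nb: "norm (fst X - xc) \<le> ?n * \<eta>" by (rule power2_le_imp_le) (use \<eta> in simp)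
    have "norm (gradx \<xi> X) = sstep' ((N X - a) / c) / c * (2 * norm (fst X - xc))"
      using c sstep'_bounds(1) by (simp add: g)
    also have "\<dots> \<le> 2 / c * (2 * (?n * \<eta>))"
      using c sstep'_bounds(1,2) nb by (intro mult_mono divide_right_mono) auto
    also have "\<dots> = 16 / (3 * \<eta>)" using \<eta> n1 by (simp add: c_def power2_eq_square field_simps)
    also have "\<dots> \<le> 6 / \<eta>" using \<eta> by (simp add: field_simps)
    finally show ?thesis .
  qed
qed

lemma emeasure_times_lborel:
  fixes A :: "(real^'n::finite) set" and B :: "real set"
  assumes "A \<in> sets borel" "B \<in> sets borel"
  shows "emeasure lborel (A \<times> B) = emeasure lborel A * emeasure lborel B"
proof -
  have "emeasure lborel (A \<times> B) = emeasure (lborel \<Otimes>\<^sub>M lborel) (A \<times> B)" by (simp add: lborel_prod)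
  also have "\<dots> = emeasure lborel A * emeasure lborel B"
    by (rule lborel.emeasure_pair_measure_Times) (use assms in auto)
  finally show ?thesis .
qed

lemma const_vec_inner_Basis: "b \<in> Basis \<Longrightarrow> (\<chi> k. (s :: real)) \<bullet> (b :: real^'n::finite) = s"
  by (auto simp: Basis_vec_def inner_axis)

text \<open>Time cells are counted from the upper end \<open>b1\<close>, so the cells before \<open>b1\<close> have negative index. The estimates only
  look backwards in time, hence \<open>nbr B\<close> contains no later cells than \<open>B\<close>.\<close>

locale grid =
  fixes x0 :: "real^'n::finite" and b1 \<eta> \<beta> :: real and m :: nat
  assumes pos: "0 < \<eta>" "0 < \<beta>" "0 < m"
begin

text \<open>Parabolic scaling: a time step l has length \<eta> in the metric
  \<open>pmetric\<close>.\<close>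

definition l where "l = \<beta> * \<eta>\<^sup>2"
definition cell :: "'n st \<Rightarrow> ('n \<Rightarrow> int) \<times> int" where
  "cell X = ((\<lambda>k. \<lfloor>(fst X $ k - x0 $ k) / \<eta>\<rfloor>), \<lfloor>(snd X - b1) / l\<rfloor>)"
definition subcell :: "'n st \<Rightarrow> ('n \<Rightarrow> int) \<times> int" where
  "subcell X = ((\<lambda>k. \<lfloor>real m * ((fst X $ k - x0 $ k) / \<eta>)\<rfloor>), \<lfloor>real m * ((snd X - b1) / l)\<rfloor>)"
text \<open>Large enough to contain the support of a spatial cut-off that is 1 on the cell, together
  with one earlier time step in which a cut-off in time can rise.\<close>

definition nbr :: "('n \<Rightarrow> int) \<times> int \<Rightarrow> (('n \<Rightarrow> int) \<times> int) set" where
  "nbr B = {B'. (\<forall>k. \<bar>fst B' k - fst B k\<bar> \<le> int CARD('n)) \<and> (snd B' = snd B \<or> snd B' = snd B - 1)}"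
definition \<mu> where "\<mu> = (\<eta> / real m) ^ CARD('n) * (l / real m)"

lemma l: "0 < l" using pos by (simp add: l_def)
lemma \<mu>: "0 < \<mu>" using pos l by (simp add: \<mu>_def)

lemma floor_refine: "\<lfloor>real m * y\<rfloor> div int m = \<lfloor>y\<rfloor>"
  using floor_divide_real_eq_div[of "int m" "real m * y"] pos by simp

text \<open>The cell that contains a given subcell. Integer division computes it because the floor
  of m y, divided by m, is the floor of y.\<close>

definition coarse :: "('n \<Rightarrow> int) \<times> int \<Rightarrow> ('n \<Rightarrow> int) \<times> int" where
  "coarse s = ((\<lambda>k. fst s k div int m), snd s div int m)"

lemma cell_subcell: "cell X = coarse (subcell X)"
  by (simp only: cell_def subcell_def coarse_def fst_conv snd_conv floor_refine)

lemma subcell_cell: "subcell X = subcell Y \<Longrightarrow> cell X = cell Y" by (simp add: cell_subcell)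

lemma cell_iff: "cell X = (z, i) \<longleftrightarrow> (\<forall>k. x0 $ k + \<eta> * z k \<le> fst X $ k \<and> fst X $ k < x0 $ k + \<eta> * (z k + 1)) \<and> b1 + i * l \<le> snd X \<and> snd X < b1 + (i + 1) * l"
  using pos l by (simp add: cell_def fun_eq_iff floor_eq_iff pos_le_divide_eq pos_divide_less_eq algebra_simps)

lemma meas_coord [measurable]: "(\<lambda>X::'n st. fst X $ k) \<in> borel_measurable borel" "(\<lambda>X::'n st. snd X) \<in> borel_measurable borel"
  by (intro borel_measurable_continuous_onI continuous_intros)+

lemma subcell_eq_alt: "subcell X = s \<longleftrightarrow> (\<forall>k. real_of_int \<lfloor>real m * ((fst X $ k - x0 $ k) / \<eta>)\<rfloor> = real_of_int (fst s k)) \<and> real_of_int \<lfloor>real m * ((snd X - b1) / l)\<rfloor> = real_of_int (snd s)"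
  by (cases s) (auto simp: subcell_def fun_eq_iff)

lemma subcell_set [measurable]: "{X. subcell X = s} \<in> sets borel"
  unfolding subcell_eq_alt by measurable

lemma cell_eq_alt: "cell X = s \<longleftrightarrow> (\<forall>k. real_of_int \<lfloor>(fst X $ k - x0 $ k) / \<eta>\<rfloor> = real_of_int (fst s k)) \<and> real_of_int \<lfloor>(snd X - b1) / l\<rfloor> = real_of_int (snd s)"
  by (cases s) (auto simp: cell_def fun_eq_iff)

lemma cell_set [measurable]: "{X. cell X = s} \<in> sets borel"
  unfolding cell_eq_alt by measurable

lemma cell_set': "finite I \<Longrightarrow> {X. cell X \<in> I} \<in> sets borel"
proof -
  assume "finite I"
  moreover have "{X. cell X \<in> I} = (\<Union>s\<in>I. {X. cell X = s})" by auto
  ultimately show ?thesis by auto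
qed

text \<open>Equality of the integer indices is encoded as the vanishing of a finite sum of absolute
  differences, whose measurability is routine.\<close>

lemma subcell_pair [measurable]: "Measurable.pred (borel \<Otimes>\<^sub>M borel) (\<lambda>(X, Y). subcell X = subcell Y)"
proof -
  have sum0: "(\<Sum>k\<in>UNIV. \<bar>a k\<bar>) + \<bar>b\<bar> = 0 \<longleftrightarrow> (\<forall>k. a k = 0) \<and> b = 0" for a :: "'n \<Rightarrow> real" and b :: real
    by (simp add: add_nonneg_eq_0_iff sum_nonneg sum_nonneg_eq_0_iff)
  have "(\<lambda>(X, Y). subcell X = subcell Y) = (\<lambda>P. (\<Sum>k\<in>UNIV. \<bar>real_of_int \<lfloor>real m * ((fst (fst P) $ k - x0 $ k) / \<eta>)\<rfloor> - real_of_int \<lfloor>real m * ((fst (snd P) $ k - x0 $ k) / \<eta>)\<rfloor>\<bar>)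
     + \<bar>real_of_int \<lfloor>real m * ((snd (fst P) - b1) / l)\<rfloor> - real_of_int \<lfloor>real m * ((snd (snd P) - b1) / l)\<rfloor>\<bar> = 0)"
    unfolding sum0 by (auto simp: subcell_def fun_eq_iff)
  moreover have "Measurable.pred (borel \<Otimes>\<^sub>M borel) \<dots>"
  proof -
    have [measurable]: "(\<lambda>P::'n st \<times> 'n st. fst (fst P) $ k) \<in> borel_measurable (borel \<Otimes>\<^sub>M borel)"
      "(\<lambda>P::'n st \<times> 'n st. fst (snd P) $ k) \<in> borel_measurable (borel \<Otimes>\<^sub>M borel)"
      "(\<lambda>P::'n st \<times> 'n st. snd (fst P)) \<in> borel_measurable (borel \<Otimes>\<^sub>M borel)"
      "(\<lambda>P::'n st \<times> 'n st. snd (snd P)) \<in> borel_measurable (borel \<Otimes>\<^sub>M borel)" for k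
      unfolding borel_prod by (intro borel_measurable_continuous_onI continuous_intros)+
    show ?thesis by measurable
  qed
  ultimately show ?thesis by simp
qed

text \<open>The volume is used from below only, to divide by it in \<open>cell_poincare\<close>; an
  inscribed open box gives the bound.\<close>

lemma small_cell_emeasure: "ennreal \<mu> \<le> emeasure lborel {X. subcell X = s}" "emeasure lborel {X. subcell X = s} < \<infinity>"
proof -
  let ?h = "\<eta> / real m"
  have h: "0 < ?h" "0 < l / real m" using pos l by auto
  define lo where "lo = x0 + (\<chi> k. ?h * fst s k)"
  define up where "up = x0 + (\<chi> k. ?h * fst s k + ?h)"
  define t where "t = b1 + l / real m * snd s"
  have dif: "up - lo = (\<chi> k. ?h)" by (simp add: lo_def up_def vec_eq_iff)
  have le: "lo \<bullet> b \<le> up \<bullet> b" if "b \<in> Basis" for b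
  proof -
    have "(up - lo) \<bullet> b = ?h" unfolding dif by (rule const_vec_inner_Basis[OF that])
    then show ?thesis using h by (simp add: inner_diff_left)
  qed
  have subcell: "subcell X = s \<longleftrightarrow> (\<forall>k. lo $ k \<le> fst X $ k \<and> fst X $ k < up $ k) \<and> t \<le> snd X \<and> snd X < t + l / real m" for X
    using pos l by (cases s) (simp add: subcell_def fun_eq_iff floor_eq_iff lo_def up_def t_def field_simps)
  have "emeasure lborel (box lo up) = ennreal (\<Prod>b\<in>Basis. (up - lo) \<bullet> b)"
    by (rule emeasure_lborel_box[OF le])
  also have "(\<Prod>b\<in>Basis. (up - lo) \<bullet> b) = (\<Prod>b\<in>(Basis :: (real^'n) set). ?h)"
    unfolding dif by (rule prod.cong) (auto intro: const_vec_inner_Basis)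
  finally have e: "emeasure lborel (box lo up) = ennreal (?h ^ CARD('n))" by simp
  have "emeasure lborel (box lo up \<times> {t<..<t + l / real m}) = ennreal (?h ^ CARD('n)) * ennreal (l / real m)"
    using h by (subst emeasure_times_lborel) (auto simp: e)
  also have "\<dots> = ennreal \<mu>" unfolding \<mu>_def by (rule ennreal_mult[symmetric]) (use h in auto)
  finally have "ennreal \<mu> = emeasure lborel (box lo up \<times> {t<..<t + l / real m})" by simp
  also have "\<dots> \<le> emeasure lborel {X. subcell X = s}"
    by (rule emeasure_mono) (use subcell_set in \<open>auto simp: subcell mem_box_cart less_imp_le\<close>)
  finally show "ennreal \<mu> \<le> emeasure lborel {X. subcell X = s}" .
  have "{X. subcell X = s} \<subseteq> cbox lo up \<times> {t..t + l / real m}" by (auto simp: subcell mem_box_cart less_imp_le)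
  then have "bounded {X. subcell X = s}" by (rule bounded_subset[rotated]) (intro bounded_Times bounded_cbox bounded_closed_interval)
  then show "emeasure lborel {X. subcell X = s} < \<infinity>" by (rule emeasure_bounded_finite)
qed

text \<open>The box of all differences between two points of one subcell. Its volume is 2^(n + 1)
  times that of a subcell, a ratio independent of m; so the gain from short displacements is not
  lost when the oscillation bound is divided by \<mu>.\<close>

definition Bx :: "'n st set" where "Bx = cbox (\<chi> k. - (\<eta> / real m)) (\<chi> k. \<eta> / real m) \<times> {- (l / real m)..l / real m}"

lemma Bx: "Bx \<in> sets borel" "emeasure lborel Bx = ennreal (2 ^ (CARD('n) + 1) * \<mu>)"
proof -
  let ?h = "\<eta> / real m"
  have h: "0 < ?h" "0 < l / real m" using pos l by auto
  let ?lo = "(\<chi> k. - ?h) :: real^'n" and ?up = "(\<chi> k. ?h) :: real^'n"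
  have dif: "?up - ?lo = (\<chi> k. 2 * ?h)" by (simp add: vec_eq_iff)
  have le: "?lo \<bullet> b \<le> ?up \<bullet> b" if "b \<in> Basis" for b
    using const_vec_inner_Basis[OF that] h by simp
  have "emeasure lborel (cbox ?lo ?up) = ennreal (\<Prod>b\<in>Basis. (?up - ?lo) \<bullet> b)"
    using emeasure_lborel_cbox[OF le] .
  also have "(\<Prod>b\<in>Basis. (?up - ?lo) \<bullet> b) = (\<Prod>b\<in>(Basis :: (real^'n) set). 2 * ?h)"
    unfolding dif by (rule prod.cong) (auto intro: const_vec_inner_Basis)
  finally have e: "emeasure lborel (cbox ?lo ?up) = ennreal ((2 * ?h) ^ CARD('n))" by simp
  have "emeasure lborel Bx = ennreal ((2 * ?h) ^ CARD('n)) * ennreal (2 * (l / real m))"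
    unfolding Bx_def using h by (subst emeasure_times_lborel) (auto simp: e)
  also have "\<dots> = ennreal ((2 * ?h) ^ CARD('n) * (2 * (l / real m)))" by (rule ennreal_mult[symmetric]) (use h in auto)
  also have "(2 * ?h) ^ CARD('n) * (2 * (l / real m)) = 2 ^ (CARD('n) + 1) * \<mu>"
    unfolding \<mu>_def power_mult_distrib by simp
  finally show "emeasure lborel Bx = ennreal (2 ^ (CARD('n) + 1) * \<mu>)" .
  show "Bx \<in> sets borel" unfolding Bx_def by (intro borel_closed closed_Times closed_cbox closed_atLeastAtMost)
qed

lemma floor_eq_close: "\<lfloor>a\<rfloor> = \<lfloor>b\<rfloor> \<Longrightarrow> \<bar>b - a\<bar> \<le> (1::real)" by linarith

lemma subcell_diff: "subcell X = subcell Y \<Longrightarrow> Y - X \<in> Bx"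
proof -
  assume e: "subcell X = subcell Y"
  have "\<bar>fst Y $ k - fst X $ k\<bar> \<le> \<eta> / real m" for k
  proof -
    have "\<lfloor>real m * ((fst X $ k - x0 $ k) / \<eta>)\<rfloor> = \<lfloor>real m * ((fst Y $ k - x0 $ k) / \<eta>)\<rfloor>" using e by (simp add: subcell_def fun_eq_iff)
    from floor_eq_close[OF this] have "\<bar>real m * ((fst Y $ k - fst X $ k) / \<eta>)\<bar> \<le> 1"
      by (simp add: diff_divide_distrib right_diff_distrib)
    then have "real m * (\<bar>fst Y $ k - fst X $ k\<bar> / \<eta>) \<le> 1" using pos by (simp add: abs_mult)
    then show ?thesis using pos by (simp add: field_simps)
  qed
  moreover have "\<bar>snd Y - snd X\<bar> \<le> l / real m"
  proof -
    have "\<lfloor>real m * ((snd X - b1) / l)\<rfloor> = \<lfloor>real m * ((snd Y - b1) / l)\<rfloor>" using e by (simp add: subcell_def)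
    from floor_eq_close[OF this] have "\<bar>real m * ((snd Y - snd X) / l)\<bar> \<le> 1"
      by (simp add: diff_divide_distrib right_diff_distrib)
    then have "real m * (\<bar>snd Y - snd X\<bar> / l) \<le> 1" using pos l by (simp add: abs_mult)
    then show ?thesis using pos l by (simp add: field_simps)
  qed
  ultimately show "Y - X \<in> Bx" by (auto simp: Bx_def mem_box_cart mem_Times_iff abs_le_iff) (smt (verit))+
qed

lemma Bx_norm: "(z, \<tau>) \<in> Bx \<Longrightarrow> norm z \<le> real CARD('n) * (\<eta> / real m) \<and> \<bar>\<tau>\<bar> \<le> l / real m"
proof
  assume "(z, \<tau>) \<in> Bx"
  then have "\<And>k. \<bar>z $ k\<bar> \<le> \<eta> / real m" "\<bar>\<tau>\<bar> \<le> l / real m" by (auto simp: Bx_def mem_box_cart abs_le_iff) (smt (verit))+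
  then show "norm z \<le> real CARD('n) * (\<eta> / real m)" "\<bar>\<tau>\<bar> \<le> l / real m" using norm_le_card[of z "\<eta> / real m"] pos by auto
qed

definition center :: "('n \<Rightarrow> int) \<Rightarrow> real^'n" where "center z = (\<chi> k. x0 $ k + \<eta> * (z k + 1 / 2))"

lemma near_center:
  assumes "cell X = (z, i)" shows "(norm (fst X - center z))\<^sup>2 \<le> real CARD('n) * \<eta>\<^sup>2 / 4"
proof -
  have "\<bar>(fst X - center z) $ k\<bar> \<le> \<eta> / 2" for k
    using assms by (auto simp: cell_iff center_def abs_le_iff algebra_simps) (smt (verit) field_sum_of_halves)+
  from norm_sq_le_card[of "fst X - center z" "\<eta> / 2", OF this] show ?thesis by (simp add: power_divide)
qed

text \<open>The reason for the range n in \<open>nbr\<close>: the cut-off reaches sqrt n \<eta> <= n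
  \<eta> from the centre, and a real number within n of z + 1/2 has its floor within n of the
  integer z.\<close>

lemma near_center_nbr:
  assumes "(norm (fst X - center z))\<^sup>2 < real CARD('n) * \<eta>\<^sup>2" "b1 + (i - 1) * l < snd X" "snd X < b1 + (i + 1) * l"
  shows "cell X \<in> nbr (z, i)"
proof -
  have n1: "1 \<le> real CARD('n)" by (simp add: Suc_leI)
  have "real CARD('n) * \<eta>\<^sup>2 \<le> (real CARD('n) * \<eta>)\<^sup>2" by (rule card_sq_le)
  then have "(norm (fst X - center z))\<^sup>2 \<le> (real CARD('n) * \<eta>)\<^sup>2" using assms(1) by linarith
  then have nb: "norm (fst X - center z) \<le> real CARD('n) * \<eta>" by (rule power2_le_imp_le) (use pos in simp)
  have "\<bar>\<lfloor>(fst X $ k - x0 $ k) / \<eta>\<rfloor> - z k\<bar> \<le> int CARD('n)" for k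
  proof -
    have "\<bar>(fst X - center z) $ k\<bar> \<le> real CARD('n) * \<eta>" using component_le_norm_cart[of "fst X - center z" k] nb by linarith
    then have "\<bar>(fst X $ k - x0 $ k) - \<eta> * (z k + 1/2)\<bar> \<le> real CARD('n) * \<eta>" by (simp add: center_def algebra_simps)
    moreover define y where "y = (fst X $ k - x0 $ k) / \<eta>"
    then have "fst X $ k - x0 $ k = \<eta> * y" using pos by simp
    ultimately have "\<bar>\<eta> * (y - (z k + 1/2))\<bar> \<le> real CARD('n) * \<eta>" by (simp add: right_diff_distrib)
    then have "\<bar>y - (z k + 1/2)\<bar> \<le> real CARD('n)" using pos by (simp add: abs_mult mult.commute)
    then have "\<bar>\<lfloor>y\<rfloor> - z k\<bar> \<le> int CARD('n)" by linarith
    then show ?thesis by (simp add: y_def)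
  qed
  moreover have "\<lfloor>(snd X - b1) / l\<rfloor> = i \<or> \<lfloor>(snd X - b1) / l\<rfloor> = i - 1"
  proof -
    have "real_of_int (i - 1) < (snd X - b1) / l" unfolding pos_less_divide_eq[OF l] using assms(2) by simp
    moreover have "(snd X - b1) / l < real_of_int (i + 1)" unfolding pos_divide_less_eq[OF l] using assms(3) by simp
    ultimately
    show ?thesis by linarith
  qed
  ultimately show ?thesis by (simp add: nbr_def cell_def)
qed

text \<open>\<open>cacc_const\<close> is \<open>Ca\<close> for layers of height l / 4 and gradient
  bound 6 / \<eta>, with the factor 1 / \<eta>^2 taken out. \<open>osc_const\<close> bounds m times
  the resulting factor in \<open>local_oscillation\<close>. By scaling neither depends on
  \<eta>.\<close>

definition cacc_const where "cacc_const lam \<Lambda> = 2 / lam * (4 / \<beta> + 72 * \<Lambda>\<^sup>2 / lam)" for lam \<Lambda> :: real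
definition osc_const where "osc_const lam \<Lambda> = 4 * (real CARD('n))\<^sup>2 * (cacc_const lam \<Lambda> + 36) + 2 * \<beta> * \<Lambda> * (4 * cacc_const lam \<Lambda> + 72)" for lam \<Lambda> :: real

lemma osc_const_nonneg: "0 < lam \<Longrightarrow> lam \<le> \<Lambda> \<Longrightarrow> 0 \<le> osc_const lam \<Lambda>"
  unfolding osc_const_def cacc_const_def using pos by simp

text \<open>\<open>local_oscillation\<close> on one cell, the solution being stopped at the upper
  end of the cell. Points of a common subcell are at most of order \<eta> / m apart in space and l /
  m in time, whence the factor 1 / m.\<close>

lemma cell_oscillation:
  fixes u :: "'n st \<Rightarrow> real"
  assumes w: "wsol \<Omega> T u g F" and lam: "0 < lam" "lam \<le> \<Lambda>"
    and ell: "\<And>X. lam * (norm (g X))\<^sup>2 \<le> snd (F X) \<bullet> g X" "\<And>X. norm (snd (F X)) \<le> \<Lambda> * norm (g X)"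
    and b1: "b1 \<le> T" and i: "i \<le> - 1" and src: "\<And>X. cell X \<in> nbr (z, i) \<Longrightarrow> fst (F X) = 0"
  shows "(\<integral>\<^sup>+X. \<integral>\<^sup>+Y. ennreal (of_bool (cell X = (z, i) \<and> subcell X = subcell Y) * (u Y - u X)\<^sup>2) \<partial>lborel \<partial>lborel)
     \<le> ennreal (2 ^ (CARD('n) + 1) * \<mu> * (osc_const lam \<Lambda> / real m)) * (\<integral>\<^sup>+X. ennreal (of_bool (cell X \<in> nbr (z, i)) * (u X)\<^sup>2) \<partial>lborel)"
proof -
  let ?n = "real CARD('n)"
  define q where "q = b1 + (i + 1) * l"
  \<comment> \<open>The lower end of the preceding time cell. With layers of height l / 4 the
    cut-off is complete at s + l / 2, strictly below the cell, so the half-open cell lies in the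
    open slab.\<close>
  define s where "s = b1 + (i - 1) * l"
  define I where "I X = (indicator (slab 0 q) X :: real)" for X :: "'n st"
  define \<xi> where "\<xi> = (\<lambda>X::'n st. 1 - sstep (((norm (fst X - center z))\<^sup>2 - ?n * \<eta>\<^sup>2 / 4) / (3 * ?n * \<eta>\<^sup>2 / 4)))"
  define D where "D = {X :: 'n st. (norm (fst X - center z))\<^sup>2 < ?n * \<eta>\<^sup>2}"
  have rc: "C1 \<xi>" "0 \<le> \<xi> X" "\<xi> X \<le> 1" "norm (gradx \<xi> X) \<le> 6 / \<eta>" "\<xi> (X + (0, r)) = \<xi> X"
    "?n * \<eta>\<^sup>2 \<le> (norm (fst X - center z))\<^sup>2 \<Longrightarrow> \<xi> X = 0"
    "?n * \<eta>\<^sup>2 \<le> (norm (fst X - center z))\<^sup>2 \<Longrightarrow> gradx \<xi> X = 0"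
    "(norm (fst X - center z))\<^sup>2 \<le> ?n * \<eta>\<^sup>2 / 4 \<Longrightarrow> \<xi> X = 1" for X r
    unfolding \<xi>_def by (rule radial_cutoff[OF pos(1)]; assumption)+
  have q: "q \<le> T" using i b1 l by (simp add: q_def mult_nonpos_nonneg order_trans[of _ b1])
  have cont: "continuous_on UNIV (\<lambda>X::'n st. (norm (fst X - center z))\<^sup>2)" by (intro continuous_intros)
  have Dopen: "open D" unfolding D_def by (rule open_Collect_less[OF cont continuous_on_const])
  have nb: "cell X \<in> nbr (z, i)" if "X \<in> D" "s < snd X" "snd X < q" for X
    by (rule near_center_nbr) (use that in \<open>auto simp: D_def s_def q_def\<close>)
  interpret L: local_solution \<Omega> q "\<lambda>X. I X * u X" "\<lambda>X. I X *\<^sub>R g X" "\<lambda>X. I X *\<^sub>R F X" lam \<Lambda> \<xi> D "6 / \<eta>" s "l / 4"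
  proof
    show "wsol \<Omega> q (\<lambda>X. I X * u X) (\<lambda>X. I X *\<^sub>R g X) (\<lambda>X. I X *\<^sub>R F X)"
      unfolding I_def by (rule wsol_cut[OF w q])
    show "0 < lam" "0 \<le> \<Lambda>" "0 < l / 4" using lam l by auto
    show "lam * (norm (I X *\<^sub>R g X))\<^sup>2 \<le> snd (I X *\<^sub>R F X) \<bullet> (I X *\<^sub>R g X)" for X
      using ell(1)[of X] by (auto simp: I_def indicator_def)
    show "norm (snd (I X *\<^sub>R F X)) \<le> \<Lambda> * norm (I X *\<^sub>R g X)" for X
      using ell(2)[of X] by (auto simp: I_def indicator_def)
    show "C1 \<xi>" "0 \<le> \<xi> X" "\<xi> X \<le> 1" "norm (gradx \<xi> X) \<le> 6 / \<eta>" "\<xi> (X + (0, r)) = \<xi> X" for X r by (rule rc)+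
    show "D \<in> sets borel" using Dopen by auto
    show D0: "\<xi> X = 0" if "X \<notin> D" for X using that rc(6)[of X] by (auto simp: D_def)
    show "gradx \<xi> X = 0" if "X \<notin> D" for X using that rc(7)[of X] by (auto simp: D_def)
    show "fst (I X *\<^sub>R F X) = 0" if "\<xi> X \<noteq> 0" "s < snd X" for X
      using D0[of X] that src[OF nb[of X]] by (auto simp: I_def indicator_def slab_iff)
  qed
  define Q where "Q = {X. cell X = (z, i)}"
  have ev: "?n * (\<eta> / real m) \<ge> 0" using pos by simp
  have osc: "(\<integral>\<^sup>+X. \<integral>\<^sup>+Y. ennreal (indicator Q X * indicator Q Y * indicator Bx (Y - X) * (I Y * u Y - I X * u X)\<^sup>2) \<partial>lborel \<partial>lborel)
    \<le> emeasure lborel Bx * ennreal ((4 * (?n * (\<eta> / real m))\<^sup>2 * (L.Ca + (6 / \<eta>)\<^sup>2) + 2 * (l / real m) * \<Lambda> * (4 * L.Ca + 2 * (6 / \<eta>)\<^sup>2)) * L.E)"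
  proof (rule L.local_oscillation)
    show "Q \<in> sets borel" unfolding Q_def by (rule cell_set)
    show "X \<in> slab (s + 2 * (l / 4)) q" if "X \<in> Q" for X
      using that l by (auto simp: Q_def cell_iff slab_iff s_def q_def algebra_simps)
    show "\<xi> X = 1" if "X \<in> Q" for X by (rule rc(8)[OF near_center]) (use that in \<open>auto simp: Q_def\<close>)
  qed (use Bx(1) Bx_norm in auto)
  have Ca: "L.Ca = cacc_const lam \<Lambda> / \<eta>\<^sup>2" unfolding L.Ca_def unfolding cacc_const_def l_def using pos lam by (simp add: field_simps power2_eq_square)
  \<comment> \<open>The contribution of the space increments is of order 1 / m^2, that of the time
    increments of order 1 / m; the latter decides.\<close>
  have K: "4 * (?n * (\<eta> / real m))\<^sup>2 * (L.Ca + (6 / \<eta>)\<^sup>2) + 2 * (l / real m) * \<Lambda> * (4 * L.Ca + 2 * (6 / \<eta>)\<^sup>2) \<le> osc_const lam \<Lambda> / real m"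
  proof -
    have cacc_const: "0 \<le> cacc_const lam \<Lambda>" unfolding cacc_const_def using pos lam by simp
    have m1: "1 \<le> real m" using pos by simp
    have "4 * (?n * (\<eta> / real m))\<^sup>2 * (L.Ca + (6 / \<eta>)\<^sup>2) = 4 * ?n\<^sup>2 * (cacc_const lam \<Lambda> + 36) / (real m)\<^sup>2"
      using pos by (simp add: Ca power_mult_distrib power_divide add_divide_distrib[symmetric])
    also have "\<dots> \<le> 4 * ?n\<^sup>2 * (cacc_const lam \<Lambda> + 36) / real m"
      using m1 cacc_const by (intro divide_left_mono) (auto simp: power2_eq_square)
    finally have 1: "4 * (?n * (\<eta> / real m))\<^sup>2 * (L.Ca + (6 / \<eta>)\<^sup>2) \<le> 4 * ?n\<^sup>2 * (cacc_const lam \<Lambda> + 36) / real m" .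
    have 2: "2 * (l / real m) * \<Lambda> * (4 * L.Ca + 2 * (6 / \<eta>)\<^sup>2) = 2 * \<beta> * \<Lambda> * (4 * cacc_const lam \<Lambda> + 72) / real m"
      unfolding Ca unfolding l_def using pos by (simp add: power_divide add_divide_distrib[symmetric])
    show ?thesis using 1 2 unfolding osc_const_def add_divide_distrib by linarith
  qed
  have E0: "0 \<le> L.E" unfolding L.E_def by (rule Bochner_Integration.integral_nonneg) simp
  have E: "ennreal L.E \<le> (\<integral>\<^sup>+X. ennreal (of_bool (cell X \<in> nbr (z, i)) * (u X)\<^sup>2) \<partial>lborel)"
  proof -
    have "ennreal L.E = (\<integral>\<^sup>+X. ennreal (indicator (D \<inter> slab s q) X * (I X * u X)\<^sup>2) \<partial>lborel)"
      unfolding L.E_def by (rule nn_integral_eq_integral[OF L.iE, symmetric]) simp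
    also have "\<dots> \<le> (\<integral>\<^sup>+X. ennreal (of_bool (cell X \<in> nbr (z, i)) * (u X)\<^sup>2) \<partial>lborel)"
    proof (intro nn_integral_mono ennreal_leI)
      fix X
      show "indicator (D \<inter> slab s q) X * (I X * u X)\<^sup>2 \<le> of_bool (cell X \<in> nbr (z, i)) * (u X)\<^sup>2"
        using nb[of X] by (auto simp: indicator_def slab_iff I_def)
    qed
    finally show ?thesis .
  qed
  \<comment> \<open>On the cell the truncation to times between 0 and q changes nothing: the cell
    ends at q, and u vanishes at nonpositive times.\<close>
  have Iu: "I X * u X = u X" if "X \<in> Q" for X
  proof (cases "0 < snd X")
    case True
    then have "I X = 1" using that by (auto simp: I_def Q_def cell_iff slab_iff q_def)
    then show ?thesis by simp
  next
    case False
    then have "u X = 0" using wsolD(5)[OF w, of X] by (cases X) auto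
    then show ?thesis by simp
  qed
  have "(\<integral>\<^sup>+X. \<integral>\<^sup>+Y. ennreal (of_bool (cell X = (z, i) \<and> subcell X = subcell Y) * (u Y - u X)\<^sup>2) \<partial>lborel \<partial>lborel)
     \<le> (\<integral>\<^sup>+X. \<integral>\<^sup>+Y. ennreal (indicator Q X * indicator Q Y * indicator Bx (Y - X) * (I Y * u Y - I X * u X)\<^sup>2) \<partial>lborel \<partial>lborel)"
  proof (intro nn_integral_mono ennreal_leI)
    fix X Y
    show "of_bool (cell X = (z, i) \<and> subcell X = subcell Y) * (u Y - u X)\<^sup>2 \<le> indicator Q X * indicator Q Y * indicator Bx (Y - X) * (I Y * u Y - I X * u X)\<^sup>2"
    proof (cases "cell X = (z, i) \<and> subcell X = subcell Y")
      case True
      then have "X \<in> Q" "Y \<in> Q" "Y - X \<in> Bx" using subcell_cell[of X Y] subcell_diff[of X Y] by (auto simp: Q_def)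
      moreover have "I X * u X = u X" "I Y * u Y = u Y" using Iu \<open>X \<in> Q\<close> \<open>Y \<in> Q\<close> by auto
      ultimately show ?thesis using True by (simp only: indicator_simps) simp
    qed auto
  qed
  also note osc
  also have "emeasure lborel Bx * ennreal ((4 * (?n * (\<eta> / real m))\<^sup>2 * (L.Ca + (6 / \<eta>)\<^sup>2) + 2 * (l / real m) * \<Lambda> * (4 * L.Ca + 2 * (6 / \<eta>)\<^sup>2)) * L.E)
      \<le> emeasure lborel Bx * ennreal (osc_const lam \<Lambda> / real m * L.E)"
    by (intro mult_left_mono ennreal_leI mult_right_mono[OF K E0]) simp
  also have "\<dots> = ennreal (2 ^ (CARD('n) + 1) * \<mu> * (osc_const lam \<Lambda> / real m)) * ennreal L.E"
  proof -
    have gen: "ennreal p * ennreal (a * e) = ennreal (p * a) * ennreal e" if "0 \<le> p" "0 \<le> a" "0 \<le> e" for p a e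
      using that by (simp add: ennreal_mult mult.assoc)
    show ?thesis unfolding Bx(2) by (rule gen) (use E0 \<mu> osc_const_nonneg[OF lam] in auto)
  qed
  also have "\<dots> \<le> ennreal (2 ^ (CARD('n) + 1) * \<mu> * (osc_const lam \<Lambda> / real m)) * (\<integral>\<^sup>+X. ennreal (of_bool (cell X \<in> nbr (z, i)) * (u X)\<^sup>2) \<partial>lborel)"
    by (rule mult_left_mono[OF E]) simp
  finally show ?thesis .
qed

end

section \<open>From vanishing subcell means to decay over layers\<close>

context grid
begin

lemma cell_pred [measurable]: "Measurable.pred borel (\<lambda>Y. cell Y = B)"
  using cell_set[of B] by (simp add: pred_def)

lemma L2_small_cell: "L2 (\<lambda>Y. indicator {X. subcell X = s} Y :: real)"
proof -
  have "(\<lambda>x. (norm (indicator {X. subcell X = s} x :: real))\<^sup>2) = indicator {X. subcell X = s}" by (auto simp: indicator_def)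
  moreover have "integrable lborel (indicator {X. subcell X = s} :: 'n st \<Rightarrow> real)"
    using small_cell_emeasure(2)[of s] subcell_set[of s] by simp
  ultimately show ?thesis unfolding L2_def using subcell_set[of s] by simp
qed

text \<open>If v has mean zero on a subcell, then for every constant c the integral of (v - c)^2
  over it is at least c^2 times its volume. With c = v X, integrating over X bounds \<mu> times the
  squared norm by the oscillation.\<close>

lemma cell_poincare:
  assumes v: "L2 v" and zero: "\<And>s. (LINT X|lborel. indicator {X. subcell X = s} X * v X) = 0"
    and osc: "(\<integral>\<^sup>+X. \<integral>\<^sup>+Y. ennreal (of_bool (cell X = B \<and> subcell X = subcell Y) * (v Y - v X)\<^sup>2) \<partial>lborel \<partial>lborel)
     \<le> ennreal (\<mu> * K) * R" and K: "0 \<le> K"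
  shows "(\<integral>\<^sup>+X. ennreal (of_bool (cell X = B) * (v X)\<^sup>2) \<partial>lborel) \<le> ennreal K * R"
proof -
  note [measurable] = L2_meas[OF v]
  have inner: "ennreal \<mu> * ennreal (of_bool (cell X = B) * (v X)\<^sup>2) \<le> (\<integral>\<^sup>+Y. ennreal (of_bool (cell X = B \<and> subcell X = subcell Y) * (v Y - v X)\<^sup>2) \<partial>lborel)" for X
  proof (cases "cell X = B")
    case True
    define c where "c = v X"
    let ?I = "\<lambda>Y. indicator {Z. subcell Z = subcell X} Y :: real"
    note LI = L2_small_cell[of "subcell X"]
    have i1: "integrable lborel (\<lambda>Y. ?I Y * v Y)" using L2_inner(1)[OF LI v] by simp
    have i2: "integrable lborel (\<lambda>Y. ?I Y * (v Y)\<^sup>2)"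
    proof -
      have "(\<lambda>Y. (norm (?I Y *\<^sub>R v Y))\<^sup>2) = (\<lambda>Y. ?I Y * (v Y)\<^sup>2)" by (rule ext) (simp add: indicator_def)
      then show ?thesis using L2_int[OF L2_indicator(1)[OF v subcell_set[of "subcell X"]]] by simp
    qed
    have i3: "integrable lborel ?I" using small_cell_emeasure(2)[of "subcell X"] subcell_set[of "subcell X"] by simp
    have \<mu>le: "\<mu> \<le> measure lborel {Z. subcell Z = subcell X}"
    proof -
      have "ennreal \<mu> \<le> ennreal (measure lborel {Z. subcell Z = subcell X})"
        using small_cell_emeasure[of "subcell X"] by (simp add: emeasure_eq_ennreal_measure less_top)
      then show ?thesis by (simp add: ennreal_le_iff)
    qed
    have e: "(\<lambda>Y. ?I Y * (v Y - c)\<^sup>2) = (\<lambda>Y. ?I Y * (v Y)\<^sup>2 - 2 * c * (?I Y * v Y) + c\<^sup>2 * ?I Y)"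
      by (auto simp: power2_diff algebra_simps)
    have i: "integrable lborel (\<lambda>Y. ?I Y * (v Y - c)\<^sup>2)" unfolding e using i1 i2 i3 by simp
    have "(LINT Y|lborel. ?I Y * (v Y - c)\<^sup>2) = (LINT Y|lborel. ?I Y * (v Y)\<^sup>2) + c\<^sup>2 * measure lborel {Z. subcell Z = subcell X}"
      unfolding e using i1 i2 i3 zero[of "subcell X"] by simp
    moreover have "0 \<le> (LINT Y|lborel. ?I Y * (v Y)\<^sup>2)" by (rule Bochner_Integration.integral_nonneg) simp
    moreover have "\<mu> * c\<^sup>2 \<le> c\<^sup>2 * measure lborel {Z. subcell Z = subcell X}"
      unfolding mult.commute[of \<mu>] using \<mu>le by (rule mult_left_mono) simp
    ultimately have "\<mu> * c\<^sup>2 \<le> (LINT Y|lborel. ?I Y * (v Y - c)\<^sup>2)" by linarith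
    then have "ennreal (\<mu> * c\<^sup>2) \<le> ennreal (LINT Y|lborel. ?I Y * (v Y - c)\<^sup>2)" by (rule ennreal_leI)
    also have "\<dots> = (\<integral>\<^sup>+Y. ennreal (?I Y * (v Y - c)\<^sup>2) \<partial>lborel)"
      by (rule nn_integral_eq_integral[OF i, symmetric]) simp
    also have "\<dots> = (\<integral>\<^sup>+Y. ennreal (of_bool (cell X = B \<and> subcell X = subcell Y) * (v Y - v X)\<^sup>2) \<partial>lborel)"
      by (rule nn_integral_cong) (auto simp: True c_def indicator_def)
    finally show ?thesis using True \<mu> by (simp add: ennreal_mult[symmetric] c_def)
  qed simp
  have "ennreal \<mu> * (\<integral>\<^sup>+X. ennreal (of_bool (cell X = B) * (v X)\<^sup>2) \<partial>lborel) = (\<integral>\<^sup>+X. ennreal \<mu> * ennreal (of_bool (cell X = B) * (v X)\<^sup>2) \<partial>lborel)"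
    by (rule nn_integral_cmult[symmetric]) measurable
  also have "\<dots> \<le> (\<integral>\<^sup>+X. \<integral>\<^sup>+Y. ennreal (of_bool (cell X = B \<and> subcell X = subcell Y) * (v Y - v X)\<^sup>2) \<partial>lborel \<partial>lborel)"
    by (rule nn_integral_mono) (rule inner)
  also have "\<dots> \<le> ennreal \<mu> * (ennreal K * R)" using osc \<mu> K by (simp add: ennreal_mult mult.assoc)
  finally show ?thesis using \<mu> by (subst (asm) ennreal_mult_le_mult_iff) auto
qed

text \<open>Fatou's lemma for both integrals on the left, dominated convergence on the right. The
  bound M and convergence are required on the cells of N only, that is, away from the source
  points.\<close>

lemma oscillation_limit:
  fixes u :: "nat \<Rightarrow> 'n st \<Rightarrow> real"
  assumes osc: "\<And>k. (\<integral>\<^sup>+X. \<integral>\<^sup>+Y. ennreal (of_bool (cell X = B \<and> subcell X = subcell Y) * (u k Y - u k X)\<^sup>2) \<partial>lborel \<partial>lborel)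
     \<le> ennreal C * (\<integral>\<^sup>+X. ennreal (of_bool (cell X \<in> N) * (u k X)\<^sup>2) \<partial>lborel)"
    and N: "B \<in> N" "finite N" "emeasure lborel {X. cell X \<in> N} < \<infinity>"
    and m: "\<And>k. u k \<in> borel_measurable borel" "v \<in> borel_measurable borel"
    and lim: "AE X in lborel. cell X \<in> N \<longrightarrow> (\<lambda>k. u k X) \<longlonglongrightarrow> v X"
    and bd: "\<And>k. AE X in lborel. cell X \<in> N \<longrightarrow> \<bar>u k X\<bar> \<le> M"
  shows "(\<integral>\<^sup>+X. \<integral>\<^sup>+Y. ennreal (of_bool (cell X = B \<and> subcell X = subcell Y) * (v Y - v X)\<^sup>2) \<partial>lborel \<partial>lborel)
     \<le> ennreal C * (\<integral>\<^sup>+X. ennreal (of_bool (cell X \<in> N) * (v X)\<^sup>2) \<partial>lborel)"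
proof -
  note [measurable] = m
  have [measurable]: "{X. cell X \<in> N} \<in> sets borel" by (rule cell_set'[OF N(2)])
  then have [measurable]: "Measurable.pred borel (\<lambda>X. cell X \<in> N)" by (simp add: pred_def)
  let ?f = "\<lambda>w X Y. ennreal (of_bool (cell X = B \<and> subcell X = subcell Y) * (w Y - w X)\<^sup>2)"
  have mf: "(\<lambda>Y. ?f w X Y) \<in> borel_measurable borel" "(\<lambda>X. \<integral>\<^sup>+Y. ?f w X Y \<partial>lborel) \<in> borel_measurable borel"
    if [measurable]: "w \<in> borel_measurable borel" for w X
  proof -
    show "(\<lambda>Y. ?f w X Y) \<in> borel_measurable borel" by measurable
    have "(\<lambda>(X, Y). ?f w X Y) \<in> borel_measurable (borel \<Otimes>\<^sub>M borel)"
    proof -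
      have 1: "Measurable.pred (borel \<Otimes>\<^sub>M borel) (\<lambda>P::'n st \<times> 'n st. cell (fst P) = B)" by measurable
      have 2: "Measurable.pred (borel \<Otimes>\<^sub>M borel) (\<lambda>P. subcell (fst P) = subcell (snd P))" using subcell_pair by (simp add: case_prod_beta)
      note [measurable] = 1 2
      show ?thesis unfolding case_prod_beta by measurable
    qed
    then have "(\<lambda>(X, Y). ?f w X Y) \<in> borel_measurable (borel \<Otimes>\<^sub>M (lborel :: 'n st measure))"
      by (subst measurable_cong_sets[OF sets_pair_measure_cong[OF refl sets_lborel] refl])
    from lborel.borel_measurable_nn_integral[OF this] show "(\<lambda>X. \<integral>\<^sup>+Y. ?f w X Y \<partial>lborel) \<in> borel_measurable borel" by simp
  qed
  have Rlim: "(\<lambda>k. \<integral>\<^sup>+X. ennreal (of_bool (cell X \<in> N) * (u k X)\<^sup>2) \<partial>lborel) \<longlonglongrightarrow> (\<integral>\<^sup>+X. ennreal (of_bool (cell X \<in> N) * (v X)\<^sup>2) \<partial>lborel)"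
  proof (rule nn_integral_dominated_convergence[where w = "\<lambda>X. ennreal (M\<^sup>2) * indicator {X. cell X \<in> N} X"])
    show "(\<integral>\<^sup>+X. ennreal (M\<^sup>2) * indicator {X. cell X \<in> N} X \<partial>lborel) < \<infinity>"
      using N(3) by (subst nn_integral_cmult_indicator) (auto simp: ennreal_mult_less_top)
    show "AE X in lborel. ennreal (of_bool (cell X \<in> N) * (u k X)\<^sup>2) \<le> ennreal (M\<^sup>2) * indicator {X. cell X \<in> N} X" for k
      using bd[of k]
    proof eventually_elim
      case (elim X)
      show ?case
      proof (cases "cell X \<in> N")
        case True
        then have "\<bar>u k X\<bar>\<^sup>2 \<le> M\<^sup>2" using elim by (intro power_mono) auto
        then show ?thesis using True by (simp add: ennreal_leI)
      qed simp
    qed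
    show "AE X in lborel. (\<lambda>k. ennreal (of_bool (cell X \<in> N) * (u k X)\<^sup>2)) \<longlonglongrightarrow> ennreal (of_bool (cell X \<in> N) * (v X)\<^sup>2)"
      using lim
    proof eventually_elim
      case (elim X)
      show ?case
      proof (cases "cell X \<in> N")
        case True
        then show ?thesis using elim by (intro tendsto_ennrealI tendsto_intros) auto
      qed simp
    qed
  qed measurable
  have inner: "AE X in lborel. (\<integral>\<^sup>+Y. ?f v X Y \<partial>lborel) \<le> liminf (\<lambda>k. \<integral>\<^sup>+Y. ?f (u k) X Y \<partial>lborel)"
    using lim
  proof eventually_elim
    case (elim X)
    have "AE Y in lborel. ?f v X Y = liminf (\<lambda>k. ?f (u k) X Y)"
      using lim
    proof eventually_elim
      case (elim Y)
      show ?case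
      proof (cases "cell X = B \<and> subcell X = subcell Y")
        case True
        then have "cell X \<in> N" "cell Y \<in> N" using subcell_cell[of X Y] N(1) by auto
        then have "(\<lambda>k. u k X) \<longlonglongrightarrow> v X" "(\<lambda>k. u k Y) \<longlonglongrightarrow> v Y"
          using \<open>cell X \<in> N \<longrightarrow> (\<lambda>k. u k X) \<longlonglongrightarrow> v X\<close> elim by auto
        then have "(\<lambda>k. ?f (u k) X Y) \<longlonglongrightarrow> ?f v X Y" by (intro tendsto_ennrealI tendsto_intros)
        then show ?thesis by (rule lim_imp_Liminf[OF sequentially_bot, symmetric])
      next
        case False
        have "(\<lambda>k. ?f (u k) X Y) \<longlonglongrightarrow> ?f v X Y" using False by auto
        then show ?thesis by (rule lim_imp_Liminf[OF sequentially_bot, symmetric])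
      qed
    qed
    then have "(\<integral>\<^sup>+Y. ?f v X Y \<partial>lborel) = (\<integral>\<^sup>+Y. liminf (\<lambda>k. ?f (u k) X Y) \<partial>lborel)" by (rule nn_integral_cong_AE)
    also have "\<dots> \<le> liminf (\<lambda>k. \<integral>\<^sup>+Y. ?f (u k) X Y \<partial>lborel)" by (rule nn_integral_liminf) (use mf(1)[OF m(1)] in simp)
    finally show ?case .
  qed
  have "(\<integral>\<^sup>+X. \<integral>\<^sup>+Y. ?f v X Y \<partial>lborel \<partial>lborel) \<le> (\<integral>\<^sup>+X. liminf (\<lambda>k. \<integral>\<^sup>+Y. ?f (u k) X Y \<partial>lborel) \<partial>lborel)"
    by (rule nn_integral_mono_AE[OF inner])
  also have "\<dots> \<le> liminf (\<lambda>k. \<integral>\<^sup>+X. \<integral>\<^sup>+Y. ?f (u k) X Y \<partial>lborel \<partial>lborel)"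
    by (rule nn_integral_liminf) (use mf(2)[OF m(1)] in simp)
  also have "\<dots> \<le> liminf (\<lambda>k. ennreal C * (\<integral>\<^sup>+X. ennreal (of_bool (cell X \<in> N) * (u k X)\<^sup>2) \<partial>lborel))"
    by (rule Liminf_mono) (simp add: osc)
  also have "\<dots> = ennreal C * (\<integral>\<^sup>+X. ennreal (of_bool (cell X \<in> N) * (v X)\<^sup>2) \<partial>lborel)"
    by (rule lim_imp_Liminf[OF sequentially_bot ennreal_tendsto_cmult[OF _ Rlim]]) simp
  finally show ?thesis .
qed

lemma finite_funs: "finite {f :: 'n \<Rightarrow> int. \<forall>k. f k \<in> A k}" "card {f :: 'n \<Rightarrow> int. \<forall>k. f k \<in> A k} = (\<Prod>k\<in>UNIV. card (A k))"
  if "\<And>k. finite (A k)" for A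
proof -
  have e: "{f :: 'n \<Rightarrow> int. \<forall>k. f k \<in> A k} = Pi\<^sub>E UNIV A" by (auto simp: PiE_UNIV_domain)
  show "finite {f :: 'n \<Rightarrow> int. \<forall>k. f k \<in> A k}" unfolding e by (rule finite_PiE) (auto simp: that)
  show "card {f :: 'n \<Rightarrow> int. \<forall>k. f k \<in> A k} = (\<Prod>k\<in>UNIV. card (A k))" unfolding e by (rule card_PiE) simp
qed

lemma nbr_finite: "finite (nbr B)"
proof -
  have "nbr B \<subseteq> {f. \<forall>k. f k \<in> {fst B k - int CARD('n)..fst B k + int CARD('n)}} \<times> {snd B - 1, snd B}"
    by (auto simp: nbr_def abs_le_iff) (smt (verit))+
  then show ?thesis by (rule finite_subset) (intro finite_cartesian_product finite_funs; simp)
qed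

definition nbr_card_bound where "nbr_card_bound = (2 * CARD('n) + 1) ^ CARD('n) * 2"

lemma nbr_inverse_card: "card {B. B' \<in> nbr B} \<le> nbr_card_bound" "finite {B. B' \<in> nbr B}"
proof -
  let ?S = "{f. \<forall>k. f k \<in> {fst B' k - int CARD('n)..fst B' k + int CARD('n)}} \<times> {snd B', snd B' + 1}"
  have sub: "{B. B' \<in> nbr B} \<subseteq> ?S"
    by (auto simp: nbr_def abs_le_iff) (smt (verit))+
  have fin: "finite ?S" by (intro finite_cartesian_product finite_funs; simp)
  have "card ?S = (\<Prod>k\<in>(UNIV::'n set). card {fst B' k - int CARD('n)..fst B' k + int CARD('n)}) * 2"
    unfolding card_cartesian_product by (subst finite_funs(2)) auto
  also have "\<dots> = nbr_card_bound" by (simp add: nbr_card_bound_def nat_add_distrib nat_mult_distrib)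
  finally have c: "card ?S = nbr_card_bound" .
  show "card {B. B' \<in> nbr B} \<le> nbr_card_bound" using card_mono[OF fin sub] c by simp
  show "finite {B. B' \<in> nbr B}" by (rule finite_subset[OF sub fin])
qed

lemma layer_sum:
  assumes [measurable]: "v \<in> borel_measurable borel" and I: "finite I"
  shows "(\<integral>\<^sup>+X. ennreal (of_bool (cell X \<in> I) * (v X)\<^sup>2) \<partial>lborel) = (\<Sum>B\<in>I. \<integral>\<^sup>+X. ennreal (of_bool (cell X = B) * (v X)\<^sup>2) \<partial>lborel)"
proof -
  have "(\<Sum>B\<in>I. \<integral>\<^sup>+X. ennreal (of_bool (cell X = B) * (v X)\<^sup>2) \<partial>lborel) = (\<integral>\<^sup>+X. (\<Sum>B\<in>I. ennreal (of_bool (cell X = B) * (v X)\<^sup>2)) \<partial>lborel)"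
    by (rule nn_integral_sum[symmetric]) measurable
  also have "\<dots> = (\<integral>\<^sup>+X. ennreal (of_bool (cell X \<in> I) * (v X)\<^sup>2) \<partial>lborel)"
  proof (rule nn_integral_cong)
    fix X
    have "(\<Sum>B\<in>I. ennreal (of_bool (cell X = B) * (v X)\<^sup>2)) = (\<Sum>B\<in>I. if cell X = B then ennreal ((v X)\<^sup>2) else 0)"
      by (rule sum.cong) auto
    also have "\<dots> = ennreal (of_bool (cell X \<in> I) * (v X)\<^sup>2)" using I by simp
    finally show "(\<Sum>B\<in>I. ennreal (of_bool (cell X = B) * (v X)\<^sup>2)) = ennreal (of_bool (cell X \<in> I) * (v X)\<^sup>2)" .
  qed
  finally show ?thesis by simp
qed

text \<open>Summing the cell estimates counts a cell of J once for every cell of I that has it as a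
  neighbour; exchanging the sums shows that this happens at most \<open>nbr_card_bound\<close>
  times.\<close>

lemma layer_step:
  assumes v: "v \<in> borel_measurable borel" and I: "finite I" "finite J" and sub: "\<And>B. B \<in> I \<Longrightarrow> nbr B \<subseteq> J"
    and st: "\<And>B. B \<in> I \<Longrightarrow> (\<integral>\<^sup>+X. ennreal (of_bool (cell X = B) * (v X)\<^sup>2) \<partial>lborel) \<le> ennreal K * (\<integral>\<^sup>+X. ennreal (of_bool (cell X \<in> nbr B) * (v X)\<^sup>2) \<partial>lborel)"
  shows "(\<integral>\<^sup>+X. ennreal (of_bool (cell X \<in> I) * (v X)\<^sup>2) \<partial>lborel) \<le> (ennreal K * of_nat nbr_card_bound) * (\<integral>\<^sup>+X. ennreal (of_bool (cell X \<in> J) * (v X)\<^sup>2) \<partial>lborel)"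
proof -
  define a where "a B = (\<integral>\<^sup>+X. ennreal (of_bool (cell X = B) * (v X)\<^sup>2) \<partial>lborel)" for B
  have "(\<integral>\<^sup>+X. ennreal (of_bool (cell X \<in> I) * (v X)\<^sup>2) \<partial>lborel) = (\<Sum>B\<in>I. a B)"
    unfolding a_def by (rule layer_sum[OF v I(1)])
  also have "\<dots> \<le> (\<Sum>B\<in>I. ennreal K * (\<Sum>B'\<in>nbr B. a B'))"
    unfolding a_def by (rule sum_mono) (use st in \<open>simp add: layer_sum[OF v nbr_finite]\<close>)
  also have "\<dots> = ennreal K * (\<Sum>B\<in>I. \<Sum>B'\<in>nbr B. a B')" by (simp add: sum_distrib_left)
  also have "(\<Sum>B\<in>I. \<Sum>B'\<in>nbr B. a B') = (\<Sum>B\<in>I. \<Sum>B'\<in>J. if B' \<in> nbr B then a B' else 0)"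
  proof (rule sum.cong[OF refl])
    fix B assume "B \<in> I"
    then have "J \<inter> nbr B = nbr B" using sub by blast
    then show "(\<Sum>B'\<in>nbr B. a B') = (\<Sum>B'\<in>J. if B' \<in> nbr B then a B' else 0)"
      using sum.inter_restrict[OF I(2), of a "nbr B"] by simp
  qed
  also have "\<dots> = (\<Sum>B'\<in>J. \<Sum>B\<in>I. if B' \<in> nbr B then a B' else 0)" by (rule sum.swap)
  also have "\<dots> \<le> (\<Sum>B'\<in>J. of_nat nbr_card_bound * a B')"
  proof (rule sum_mono)
    fix B' assume "B' \<in> J"
    have "(\<Sum>B\<in>I. if B' \<in> nbr B then a B' else 0) = (\<Sum>B\<in>I \<inter> {B. B' \<in> nbr B}. a B')"
      using sum.inter_restrict[OF I(1), of "\<lambda>_. a B'" "{B. B' \<in> nbr B}"] by simp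
    also have "\<dots> = of_nat (card (I \<inter> {B. B' \<in> nbr B})) * a B'" by simp
    also have "\<dots> \<le> of_nat nbr_card_bound * a B'"
      using card_mono[OF nbr_inverse_card(2)[of B'], of "I \<inter> {B. B' \<in> nbr B}"] nbr_inverse_card(1)[of B']
      by (intro mult_right_mono) auto
    finally show "(\<Sum>B\<in>I. if B' \<in> nbr B then a B' else 0) \<le> of_nat nbr_card_bound * a B'" .
  qed
  also have "\<dots> = of_nat nbr_card_bound * (\<integral>\<^sup>+X. ennreal (of_bool (cell X \<in> J) * (v X)\<^sup>2) \<partial>lborel)"
    unfolding a_def layer_sum[OF v I(2)] by (simp add: sum_distrib_left)
  finally have "(\<integral>\<^sup>+X. ennreal (of_bool (cell X \<in> I) * (v X)\<^sup>2) \<partial>lborel) \<le> ennreal K * (of_nat nbr_card_bound * (\<integral>\<^sup>+X. ennreal (of_bool (cell X \<in> J) * (v X)\<^sup>2) \<partial>lborel))"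
    by (simp add: mult_left_mono)
  then show ?thesis by (simp add: mult.assoc)
qed

text \<open>In the application one function v satisfies the cell estimate in every layer, so the
  factor of \<open>layer_step\<close> is simply iterated.\<close>

lemma layers_decay:
  assumes v: "v \<in> borel_measurable borel" and I: "\<And>j. finite (I j)" and sub: "\<And>j B. B \<in> I j \<Longrightarrow> nbr B \<subseteq> I (Suc j)"
    and st: "\<And>j B. j < L \<Longrightarrow> B \<in> I j \<Longrightarrow> (\<integral>\<^sup>+X. ennreal (of_bool (cell X = B) * (v X)\<^sup>2) \<partial>lborel) \<le> ennreal K * (\<integral>\<^sup>+X. ennreal (of_bool (cell X \<in> nbr B) * (v X)\<^sup>2) \<partial>lborel)"
  shows "(\<integral>\<^sup>+X. ennreal (of_bool (cell X \<in> I 0) * (v X)\<^sup>2) \<partial>lborel) \<le> (ennreal K * of_nat nbr_card_bound) ^ L * (\<integral>\<^sup>+X. ennreal (of_bool (cell X \<in> I L) * (v X)\<^sup>2) \<partial>lborel)"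
  using st
proof (induction L)
  case (Suc L)
  have "(\<integral>\<^sup>+X. ennreal (of_bool (cell X \<in> I 0) * (v X)\<^sup>2) \<partial>lborel) \<le> (ennreal K * of_nat nbr_card_bound) ^ L * (\<integral>\<^sup>+X. ennreal (of_bool (cell X \<in> I L) * (v X)\<^sup>2) \<partial>lborel)"
    by (rule Suc.IH, rule Suc.prems) auto
  also have "\<dots> \<le> (ennreal K * of_nat nbr_card_bound) ^ L * ((ennreal K * of_nat nbr_card_bound) * (\<integral>\<^sup>+X. ennreal (of_bool (cell X \<in> I (Suc L)) * (v X)\<^sup>2) \<partial>lborel))"
    by (intro mult_left_mono layer_step[OF v I I sub Suc.prems]) auto
  finally show ?case by (simp add: mult_ac)
qed simp

end

section \<open>Separable approximation\<close>

context parabolic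
begin

lemma green_integrable:
  assumes f: "f \<in> borel_measurable borel" "bounded (range f)"
  shows "AE X in lborel. X \<in> oc \<longrightarrow> set_integrable lborel (cyl \<Omega> T) (\<lambda>Y. G X Y * f Y)"
proof -
  obtain u where "AE X in lborel. X \<in> cyl \<Omega> T \<longrightarrow>
               set_integrable lborel (cyl \<Omega> T) (\<lambda>Y. G X Y * f Y) \<and> u X = (LINT Y:cyl \<Omega> T|lborel. G X Y * f Y)"
    using green f unfolding green_fun_def by auto
  then show ?thesis by eventually_elim (use oc(2) in auto)
qed

text \<open>The source is replaced by the same combination of averages over balls of radius r k. On
  the neighbouring cells this source vanishes, the solutions are bounded uniformly in k, and they
  converge to the combination of the functions G(., Y); then \<open>oscillation_limit\<close>
  applies. Combinations are needed, not just single kernels, because the residual of the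
  approximation is one.\<close>

lemma combination_oscillation:
  assumes gr: "grid \<eta> \<beta> m" and b1: "b1 \<le> T" and i: "i \<le> - 1"
    and Ys: "finite Ys"
    and RR: "\<And>Y. Y \<in> Ys \<Longrightarrow> 0 < RR Y" "\<And>Y. Y \<in> Ys \<Longrightarrow> cball Y (4 * RR Y) \<subseteq> oc"
      "\<And>X Y. Y \<in> Ys \<Longrightarrow> X \<in> oc \<Longrightarrow> grid.cell x0 b1 \<eta> \<beta> X \<in> grid.nbr (z, i) \<Longrightarrow> 4 * RR Y \<le> dist X Y"
    and v: "v \<in> borel_measurable borel" "\<And>X. X \<notin> oc \<Longrightarrow> v X = 0"
      "\<And>X. X \<in> oc \<Longrightarrow> grid.cell x0 b1 \<eta> \<beta> X \<in> grid.nbr (z, i) \<Longrightarrow> v X = (\<Sum>Y\<in>Ys. c Y * G X Y)"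
  shows "(\<integral>\<^sup>+X. \<integral>\<^sup>+Y. ennreal (of_bool (grid.cell x0 b1 \<eta> \<beta> X = (z, i) \<and> grid.subcell x0 b1 \<eta> \<beta> m X = grid.subcell x0 b1 \<eta> \<beta> m Y) * (v Y - v X)\<^sup>2) \<partial>lborel \<partial>lborel)
     \<le> ennreal (2 ^ (CARD('n) + 1) * grid.\<mu> TYPE('n) \<eta> \<beta> m * (grid.osc_const TYPE('n) \<beta> lam \<Lambda> / real m)) * (\<integral>\<^sup>+X. ennreal (of_bool (grid.cell x0 b1 \<eta> \<beta> X \<in> grid.nbr (z, i)) * (v X)\<^sup>2) \<partial>lborel)"
proof -
  interpret gr: grid x0 b1 \<eta> \<beta> m by (rule gr)
  \<comment> \<open>At most half of every radius RR Y and tending to zero. Inserting 1 keeps the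
    minimum meaningful when Ys is empty.\<close>
  define r where "r k = Min (insert 1 (RR ` Ys)) / 2 / (real k + 1)" for k
  have Rm: "0 < Min (insert 1 (RR ` Ys))" using Ys RR(1) by (subst Min_gr_iff) auto
  have r0: "0 < r k" for k using Rm by (simp add: r_def)
  have rle: "r k \<le> RR Y / 2" if "Y \<in> Ys" for k Y
  proof -
    have "r k \<le> Min (insert 1 (RR ` Ys)) / 2 / 1" unfolding r_def using Rm by (intro divide_left_mono) auto
    also have "\<dots> \<le> RR Y / 2" using Ys that by simp
    finally show ?thesis .
  qed
  have rlim: "r \<longlonglongrightarrow> 0"
  proof -
    have "(\<lambda>k. Min (insert 1 (RR ` Ys)) / 2 * (1 / real (Suc k))) \<longlonglongrightarrow> Min (insert 1 (RR ` Ys)) / 2 * 0"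
      by (intro tendsto_mult_left LIMSEQ_Suc[OF lim_inverse_n'])
    then show ?thesis unfolding r_def[abs_def] by (simp add: add.commute)
  qed
  define f where "f k Z = (\<Sum>Y\<in>Ys. c Y * avg Y (r k) Z)" for k Z
  have fm: "f k \<in> borel_measurable borel" for k
    unfolding f_def[abs_def] using avg_props(1)[OF r0[of k]] by measurable
  have fb: "bounded (range (f k))" for k
  proof -
    have "\<exists>b. \<forall>Z. \<bar>avg Y (r k) Z\<bar> \<le> b" for Y using avg_props(2)[OF r0[of k], of Y] by (auto simp: bounded_iff)
    then obtain b where b: "\<And>Y Z. \<bar>avg Y (r k) Z\<bar> \<le> b Y" by metis
    have "\<bar>f k Z\<bar> \<le> (\<Sum>Y\<in>Ys. \<bar>c Y\<bar> * b Y)" for Z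
      unfolding f_def by (rule order_trans[OF sum_abs]) (auto simp: abs_mult intro!: sum_mono mult_left_mono b)
    then show ?thesis by (auto simp: bounded_iff intro!: exI[of _ "\<Sum>Y\<in>Ys. \<bar>c Y\<bar> * b Y"])
  qed
  define P where "P k u g F \<longleftrightarrow> wsol \<Omega> T u g F \<and> (\<forall>X. lam * (norm (g X))\<^sup>2 \<le> snd (F X) \<bullet> g X) \<and> (\<forall>X. norm (snd (F X)) \<le> \<Lambda> * norm (g X))
    \<and> (\<forall>X. f k X = 0 \<longrightarrow> fst (F X) = 0) \<and> (AE X in lborel. X \<in> oc \<longrightarrow> u X = potential (f k) X)" for k u g F
  have "\<exists>u g F. P k u g F" for k
  proof -
    obtain u g F where s: "wsol \<Omega> T u g F"
      "\<And>X. lam * (norm (g X))\<^sup>2 \<le> snd (F X) \<bullet> g X" "\<And>X. norm (snd (F X)) \<le> \<Lambda> * norm (g X)"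
      "\<And>X. f k X = 0 \<Longrightarrow> fst (F X) = 0"
      "AE X in lborel. X \<in> oc \<longrightarrow> set_integrable lborel (cyl \<Omega> T) (\<lambda>Y. G X Y * f k Y) \<and> u X = potential (f k) X"
      using green_solution[OF fm[of k] fb[of k]] by blast
    have "AE X in lborel. X \<in> oc \<longrightarrow> u X = potential (f k) X" using s(5) by eventually_elim auto
    then show ?thesis using s(1-4) unfolding P_def by blast
  qed
  then obtain u g F where "\<And>k. P k (u k) (g k) (F k)" by metis
  then have s: "\<And>k. wsol \<Omega> T (u k) (g k) (F k)"
      "\<And>k X. lam * (norm (g k X))\<^sup>2 \<le> snd (F k X) \<bullet> g k X" "\<And>k X. norm (snd (F k X)) \<le> \<Lambda> * norm (g k X)"
      "\<And>k X. f k X = 0 \<Longrightarrow> fst (F k X) = 0"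
      "\<And>k. AE X in lborel. X \<in> oc \<longrightarrow> u k X = potential (f k) X"
    unfolding P_def by blast+
  have int: "AE X in lborel. X \<in> oc \<longrightarrow> set_integrable lborel (cyl \<Omega> T) (\<lambda>Z. G X Z * avg Y (r k) Z)" for Y k
    by (rule green_integrable[OF avg_props(1,2)[OF r0[of k], of Y]])
  \<comment> \<open>Integrability fails on a null set that depends on Y and k; there are finitely
    many Y and countably many k, so one null set serves for all.\<close>
  have int': "AE X in lborel. \<forall>Y\<in>Ys. \<forall>k. X \<in> oc \<longrightarrow> set_integrable lborel (cyl \<Omega> T) (\<lambda>Z. G X Z * avg Y (r k) Z)"
    by (rule AE_finite_allI[OF Ys], unfold AE_all_countable, intro allI, rule int)
  have GIf: "potential (f k) X = (\<Sum>Y\<in>Ys. c Y * potential (avg Y (r k)) X)"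
    if "\<forall>Y\<in>Ys. \<forall>k. set_integrable lborel (cyl \<Omega> T) (\<lambda>Z. G X Z * avg Y (r k) Z)" for k X
  proof -
    have "potential (f k) X = (LINT Z|lborel. (\<Sum>Y\<in>Ys. c Y * (indicator (cyl \<Omega> T) Z * (G X Z * avg Y (r k) Z))))"
      unfolding potential_def set_lebesgue_integral_def f_def
      by (rule Bochner_Integration.integral_cong) (auto simp: sum_distrib_left algebra_simps)
    also have "\<dots> = (\<Sum>Y\<in>Ys. LINT Z|lborel. c Y * (indicator (cyl \<Omega> T) Z * (G X Z * avg Y (r k) Z)))"
      by (rule Bochner_Integration.integral_sum) (use that in \<open>simp add: set_integrable_def\<close>)
    finally show ?thesis by (simp add: potential_def set_lebesgue_integral_def)
  qed
  define PM where "PM Y M \<longleftrightarrow> 0 \<le> M \<and> (\<forall>k. AE X in lborel. X \<in> oc \<and> 4 * RR Y \<le> dist X Y \<longrightarrow> 0 \<le> potential (avg Y (r k)) X \<and> potential (avg Y (r k)) X \<le> M)" for Y M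
  have "\<exists>M. PM Y M" if "Y \<in> Ys" for Y
    unfolding PM_def using averages_bounded[OF RR(1,2)[OF that]] r0 rle[OF that] by blast
  then obtain M where "\<And>Y. Y \<in> Ys \<Longrightarrow> PM Y (M Y)" by metis
  then have M: "\<And>Y. Y \<in> Ys \<Longrightarrow> 0 \<le> M Y"
    "\<And>Y k. Y \<in> Ys \<Longrightarrow> AE X in lborel. X \<in> oc \<and> 4 * RR Y \<le> dist X Y \<longrightarrow> 0 \<le> potential (avg Y (r k)) X \<and> potential (avg Y (r k)) X \<le> M Y"
    unfolding PM_def by blast+
  have Mall: "AE X in lborel. \<forall>Y\<in>Ys. X \<in> oc \<and> 4 * RR Y \<le> dist X Y \<longrightarrow> 0 \<le> potential (avg Y (r k)) X \<and> potential (avg Y (r k)) X \<le> M Y" for k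
    by (rule AE_finite_allI[OF Ys], rule M(2))
  have nf: "finite (gr.nbr (z, i))" by (rule gr.nbr_finite)
  show ?thesis
  proof (rule gr.oscillation_limit[where u = u and M = "\<Sum>Y\<in>Ys. \<bar>c Y\<bar> * M Y"])
    show "(\<integral>\<^sup>+X. \<integral>\<^sup>+Y. ennreal (of_bool (gr.cell X = (z, i) \<and> gr.subcell X = gr.subcell Y) * (u k Y - u k X)\<^sup>2) \<partial>lborel \<partial>lborel)
     \<le> ennreal (2 ^ (CARD('n) + 1) * gr.\<mu> * (gr.osc_const lam \<Lambda> / real m)) * (\<integral>\<^sup>+X. ennreal (of_bool (gr.cell X \<in> gr.nbr (z, i)) * (u k X)\<^sup>2) \<partial>lborel)" for k
    proof (rule gr.cell_oscillation[OF s(1) lam s(2,3) b1 i])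
      fix X assume X: "gr.cell X \<in> gr.nbr (z, i)"
      show "fst (F k X) = 0"
      proof (cases "X \<in> oc")
        case True
        have "f k X = 0" unfolding f_def
        proof (rule sum.neutral, rule ballI)
          fix Y assume Y: "Y \<in> Ys"
          have "r k \<le> dist X Y" using RR(3)[OF Y True X] rle[OF Y, of k] RR(1)[OF Y] by linarith
          then show "c Y * avg Y (r k) X = 0" using avg_props(4)[OF r0[of k], of X Y] by simp
        qed
        then show ?thesis by (rule s(4))
      next
        case False
        then show ?thesis using wsolD(7)[OF s(1), of X k] by (simp add: oc_def)
      qed
    qed
    show "(z, i) \<in> gr.nbr (z, i)" by (simp add: gr.nbr_def)
    show "finite (gr.nbr (z, i))" by (rule nf)
    show "emeasure lborel {X. gr.cell X \<in> gr.nbr (z, i)} < \<infinity>"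
    proof -
      have sub: "{X. gr.cell X \<in> gr.nbr (z, i)} \<subseteq> (\<Union>B\<in>gr.nbr (z, i). {X. gr.cell X = B})" by auto
      have "bounded {X. gr.cell X = B}" for B
      proof -
        obtain z' i' where B: "B = (z', i')" by force
        have "{X. gr.cell X = B} \<subseteq> cbox (\<chi> k. x0 $ k + \<eta> * z' k) (\<chi> k. x0 $ k + \<eta> * (z' k + 1)) \<times> {b1 + i' * gr.l..b1 + (i' + 1) * gr.l}"
          by (auto simp: B gr.cell_iff mem_box_cart mem_Times_iff less_imp_le)
        then show ?thesis by (rule bounded_subset[rotated]) (intro bounded_Times bounded_cbox bounded_closed_interval)
      qed
      then have "bounded (\<Union>B\<in>gr.nbr (z, i). {X. gr.cell X = B})" using nf by auto
      then show ?thesis using emeasure_bounded_finite[OF bounded_subset[OF _ sub]] by blast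
    qed
    show "u k \<in> borel_measurable borel" for k by (rule L2_meas[OF wsolD(3)[OF s(1)]])
    show "v \<in> borel_measurable borel" by (rule v(1))
    have sall: "AE X in lborel. \<forall>k. X \<in> oc \<longrightarrow> u k X = potential (f k) X" unfolding AE_all_countable using s(5) by blast
    show "AE X in lborel. gr.cell X \<in> gr.nbr (z, i) \<longrightarrow> (\<lambda>k. u k X) \<longlonglongrightarrow> v X"
      using sall int'
    proof eventually_elim
      case (elim X)
      show ?case
      proof
        assume X: "gr.cell X \<in> gr.nbr (z, i)"
        show "(\<lambda>k. u k X) \<longlonglongrightarrow> v X"
        proof (cases "X \<in> oc")
          case True
          have i: "\<forall>Y\<in>Ys. \<forall>k. set_integrable lborel (cyl \<Omega> T) (\<lambda>Z. G X Z * avg Y (r k) Z)" using elim(2) True by simp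
          have "u k X = (\<Sum>Y\<in>Ys. c Y * potential (avg Y (r k)) X)" for k using elim(1) True GIf[OF i] by simp
          moreover have "(\<lambda>k. \<Sum>Y\<in>Ys. c Y * potential (avg Y (r k)) X) \<longlonglongrightarrow> (\<Sum>Y\<in>Ys. c Y * G X Y)"
          proof (intro tendsto_sum tendsto_mult_left)
            fix Y assume Y: "Y \<in> Ys"
            show "(\<lambda>k. potential (avg Y (r k)) X) \<longlonglongrightarrow> G X Y"
              by (rule averages_tendsto[OF RR(1,2)[OF Y] True RR(3)[OF Y True X] r0 rle[OF Y] rlim]) (use i Y in auto)
          qed
          ultimately show ?thesis using v(3)[OF True X] by simp
        next
          case False
          then have "u k X = 0" for k using wsolD(5)[OF s(1), of X k] by (simp add: oc_def)
          then show ?thesis using v(2)[OF False] by simp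
        qed
      qed
    qed
    show "AE X in lborel. gr.cell X \<in> gr.nbr (z, i) \<longrightarrow> \<bar>u k X\<bar> \<le> (\<Sum>Y\<in>Ys. \<bar>c Y\<bar> * M Y)" for k
      using sall int' Mall[of k]
    proof eventually_elim
      case (elim X)
      show ?case
      proof
        assume X: "gr.cell X \<in> gr.nbr (z, i)"
        show "\<bar>u k X\<bar> \<le> (\<Sum>Y\<in>Ys. \<bar>c Y\<bar> * M Y)"
        proof (cases "X \<in> oc")
          case True
          have i: "\<forall>Y\<in>Ys. \<forall>k. set_integrable lborel (cyl \<Omega> T) (\<lambda>Z. G X Z * avg Y (r k) Z)" using elim(2) True by simp
          have "\<bar>u k X\<bar> = \<bar>\<Sum>Y\<in>Ys. c Y * potential (avg Y (r k)) X\<bar>" using elim(1) True GIf[OF i] by simp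
          also have "\<dots> \<le> (\<Sum>Y\<in>Ys. \<bar>c Y * potential (avg Y (r k)) X\<bar>)" by (rule sum_abs)
          also have "\<dots> \<le> (\<Sum>Y\<in>Ys. \<bar>c Y\<bar> * M Y)"
          proof (rule sum_mono)
            fix Y assume Y: "Y \<in> Ys"
            have "0 \<le> potential (avg Y (r k)) X \<and> potential (avg Y (r k)) X \<le> M Y" using elim(3) Y True RR(3)[OF Y True X] by blast
            then show "\<bar>c Y * potential (avg Y (r k)) X\<bar> \<le> \<bar>c Y\<bar> * M Y" by (simp add: abs_mult mult_left_mono)
          qed
          finally show ?thesis .
        next
          case False
          then have "u k X = 0" using wsolD(5)[OF s(1), of X k] by (simp add: oc_def)
          then show ?thesis using M(1) by (simp add: sum_nonneg)
        qed
      qed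
    qed
  qed
qed

text \<open>Continuity of G says nothing near the boundary of the cylinder, where S may reach. There
  the bound comes from the averages: they are uniformly bounded by the maximum principle and
  converge to G almost everywhere on S.\<close>

lemma G_square_integrable:
  assumes R: "0 < R" "cball Y (4 * R) \<subseteq> oc" and S: "S \<in> sets borel" "S \<subseteq> oc" "\<And>X. X \<in> S \<Longrightarrow> 4 * R \<le> dist X Y"
  shows "L2 (\<lambda>X. indicator S X * G X Y)"
proof -
  have Y: "Y \<in> oc" using R by (metis centre_in_cball less_imp_le mult_nonneg_nonneg subsetD zero_le_numeral)
  have YS: "Y \<notin> S" using S(3)[of Y] R(1) by auto
  have "continuous_on S (\<lambda>X. (\<lambda>(X, Y). G X Y) (X, Y))"
    by (rule continuous_on_compose2[OF G_cont]) (use S Y YS in \<open>auto intro!: continuous_intros\<close>)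
  then have "(\<lambda>X. indicator S X *\<^sub>R G X Y) \<in> borel_measurable borel"
    by (intro borel_measurable_continuous_on_indicator S) simp
  then have m: "(\<lambda>X. indicator S X * G X Y) \<in> borel_measurable borel" by simp
  define r where "r k = R / 2 / (real k + 1)" for k
  have r0: "0 < r k" for k using R by (simp add: r_def)
  have rle: "r k \<le> R / 2" for k unfolding r_def using R by (simp add: divide_le_eq mult_le_cancel_left1)
  have rlim: "r \<longlonglongrightarrow> 0"
  proof -
    have "(\<lambda>k. R / 2 * (1 / real (Suc k))) \<longlonglongrightarrow> R / 2 * 0"
      by (intro tendsto_mult_left LIMSEQ_Suc[OF lim_inverse_n'])
    then show ?thesis unfolding r_def[abs_def] by (simp add: add.commute)
  qed
  have "AE X in lborel. X \<in> oc \<longrightarrow> set_integrable lborel (cyl \<Omega> T) (\<lambda>Z. G X Z * avg Y (r k) Z)" for k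
    by (rule green_integrable[OF avg_props(1,2)[OF r0[of k], of Y]])
  then have int: "AE X in lborel. \<forall>k. X \<in> oc \<longrightarrow> set_integrable lborel (cyl \<Omega> T) (\<lambda>Z. G X Z * avg Y (r k) Z)"
    unfolding AE_all_countable by blast
  obtain M where M: "0 \<le> M" "\<And>k. AE X in lborel. X \<in> oc \<and> 4 * R \<le> dist X Y \<longrightarrow> 0 \<le> potential (avg Y (r k)) X \<and> potential (avg Y (r k)) X \<le> M"
    using averages_bounded[OF R] r0 rle by blast
  have "AE X in lborel. \<forall>k. X \<in> oc \<and> 4 * R \<le> dist X Y \<longrightarrow> 0 \<le> potential (avg Y (r k)) X \<and> potential (avg Y (r k)) X \<le> M"
    unfolding AE_all_countable using M(2) by blast
  then have bd: "AE X in lborel. norm (indicator S X * G X Y) \<le> M * norm (indicator oc X :: real)"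
    using int
  proof eventually_elim
    case (elim X)
    show ?case
    proof (cases "X \<in> S")
      case True
      then have X: "X \<in> oc" "4 * R \<le> dist X Y" using S by auto
      have lim: "(\<lambda>k. potential (avg Y (r k)) X) \<longlonglongrightarrow> G X Y"
        by (rule averages_tendsto[OF R X r0 rle rlim]) (use elim(2) X in auto)
      have "G X Y \<le> M" by (rule LIMSEQ_le_const2[OF lim]) (use elim(1) X in auto)
      moreover have "0 \<le> G X Y" by (rule G_nonneg) (use X Y True YS in auto)
      ultimately show ?thesis using True X by simp
    next
      case False then show ?thesis using M(1) by simp
    qed
  qed
  have "L2 (\<lambda>X. indicator oc X :: real)"
  proof -
    have "(\<lambda>x. (norm (indicator oc x :: real))\<^sup>2) = indicator oc" by (auto simp: indicator_def)
    then show ?thesis unfolding L2_def using oc(3) finite_measure(1) by simp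
  qed
  from L2_bdd(1)[OF m this bd] show ?thesis .
qed

end

section \<open>Approximation on a given grid\<close>

context parabolic
begin

text \<open>The approximation acts on the span of the functions \<open>G(\<sqdot>, Y)\<close>, restricted to \<open>R\<close>; the functionals are the means
  over all subcells of the outermost layer.\<close>

lemma grid_approximation:
  fixes QX QY :: "'n st set" and I :: "nat \<Rightarrow> (('n \<Rightarrow> int) \<times> int) set"
  assumes gr: "grid \<eta> \<beta> m" and b1: "b1 \<le> T"
    and I: "\<And>j. finite (I j)" "\<And>j B. B \<in> I j \<Longrightarrow> grid.nbr B \<subseteq> I (Suc j)" "\<And>j z i. (z, i) \<in> I j \<Longrightarrow> i \<le> - 1"
    and m: "2 ^ (CARD('n) + 1) * (grid.osc_const TYPE('n) \<beta> lam \<Lambda> / real m) * real (grid.nbr_card_bound TYPE('n)) \<le> exp (- 2)"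
    and QX: "QX \<subseteq> oc" "\<And>X. X \<in> QX \<Longrightarrow> grid.cell x0 b1 \<eta> \<beta> X \<in> I 0"
    and QY: "open QY" "QY \<subseteq> oc"
    and R: "R = {X \<in> oc. grid.cell x0 b1 \<eta> \<beta> X \<in> I L}"
    and sep: "\<And>Y. Y \<in> QY \<Longrightarrow> \<exists>r>0. cball Y (4 * r) \<subseteq> oc \<and> (\<forall>X\<in>R. 4 * r \<le> dist X Y)"
  shows "\<exists>k u v. k \<le> card (I L) * m ^ (CARD('n) + 1) \<and>
    (\<forall>i<k. u i \<in> borel_measurable borel \<and> v i \<in> borel_measurable borel) \<and>
    (\<forall>Y\<in>QY. L2sq QX (\<lambda>X. G X Y - (\<Sum>i<k. u i X * v i Y)) \<le> ennreal (exp (- 2) ^ L * exp 2) * L2sq R (\<lambda>X. G X Y))"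
proof -
  interpret gr: grid x0 b1 \<eta> \<beta> m by (rule gr)
  have nbr_self: "B \<in> gr.nbr B" for B by (simp add: gr.nbr_def)
  have Imono: "I j \<subseteq> I (j + d)" for j d
  proof (induction d)
    case (Suc d)
    have "I (j + d) \<subseteq> I (Suc (j + d))" using I(2) nbr_self by blast
    then show ?case using Suc by simp
  qed simp
  have IL: "I j \<subseteq> I L" if "j \<le> L" for j using Imono[of j "L - j"] that by simp
  have Rm: "R \<in> sets borel" "R \<subseteq> oc"
  proof -
    have "R = oc \<inter> {X. gr.cell X \<in> I L}" unfolding R by auto
    then show "R \<in> sets borel" using oc(3) gr.cell_set'[OF I(1)] by auto
  qed (auto simp: R)
  \<comment> \<open>The cut to R makes the kernel square integrable, while on the cells of all
    layers inside the open cylinder it is still G(., Y).\<close>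
  define K where "K Y X = indicator R X * G X Y" for Y X
  have KL2: "L2 (K Y)" if Y: "Y \<in> QY" for Y
  proof -
    obtain r where r: "0 < r" "cball Y (4 * r) \<subseteq> oc" "\<forall>X\<in>R. 4 * r \<le> dist X Y" using sep[OF Y] by blast
    show ?thesis unfolding K_def[abs_def] by (rule G_square_integrable[OF r(1,2) Rm]) (use r(3) in blast)
  qed
  \<comment> \<open>The span over all Y in QY: the representers are then the same for every Y, and
    every residual is again a finite combination of kernels, to which
    \<open>combination_oscillation\<close> applies.\<close>
  define V where "V = {v. \<exists>Ys c. finite Ys \<and> Ys \<subseteq> QY \<and> v = (\<lambda>X. \<Sum>Y\<in>Ys. c Y * K Y X)}"
  have VL2: "L2 v" if "v \<in> V" for v
  proof -
    obtain Ys c where Yc: "finite Ys" "Ys \<subseteq> QY" "v = (\<lambda>X. \<Sum>Y\<in>Ys. c Y * K Y X)" using \<open>v \<in> V\<close> by (auto simp: V_def)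
    have "L2 (\<lambda>X. \<Sum>Y\<in>Ys. c Y * K Y X)" using Yc(1,2)
    proof (induction Ys rule: finite_induct)
      case (insert Y F)
      have "L2 (\<lambda>X. c Y * K Y X)" by (rule L2_mult[OF KL2]) (use insert.prems in auto)
      from L2_add(1)[OF this insert.IH] show ?case using insert by simp
    qed simp
    then show ?thesis by (simp add: Yc(3))
  qed
  define ip where "ip v w = (LINT X|lborel. v X * w X)" for v w :: "'n st \<Rightarrow> real"
  interpret pre_inner V ip
  proof
    fix v w a assume "v \<in> V" "w \<in> V"
    then obtain Ys c Ys' c' where Yc: "finite Ys" "Ys \<subseteq> QY" "v = (\<lambda>X. \<Sum>Y\<in>Ys. c Y * K Y X)"
      "finite Ys'" "Ys' \<subseteq> QY" "w = (\<lambda>X. \<Sum>Y\<in>Ys'. c' Y * K Y X)" unfolding V_def by blast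
    define d where "d Y = (if Y \<in> Ys then c Y else 0) - a * (if Y \<in> Ys' then c' Y else 0)" for Y
    have "v X - a * w X = (\<Sum>Y\<in>Ys \<union> Ys'. d Y * K Y X)" for X
    proof -
      have 1: "v X = (\<Sum>Y\<in>Ys \<union> Ys'. (if Y \<in> Ys then c Y else 0) * K Y X)"
        unfolding Yc(3) by (rule sum.mono_neutral_cong_left) (use Yc in auto)
      have 2: "w X = (\<Sum>Y\<in>Ys \<union> Ys'. (if Y \<in> Ys' then c' Y else 0) * K Y X)"
        unfolding Yc(6) by (rule sum.mono_neutral_cong_left) (use Yc in auto)
      show ?thesis unfolding 1 2 d_def by (simp add: sum_distrib_left sum_subtractf[symmetric] algebra_simps)
    qed
    then show "(\<lambda>x. v x - a * w x) \<in> V" unfolding V_def using Yc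
      by (intro CollectI exI[of _ "Ys \<union> Ys'"] exI[of _ d]) auto
  next
    have "(\<lambda>X. \<Sum>Y\<in>{}. (0::real) * K Y X) \<in> V" unfolding V_def
      by (intro CollectI exI[of _ "{}"] exI[of _ "\<lambda>_. 0"]) auto
    then show "V \<noteq> {}" by blast
  next
    show "ip v w = ip w v" for v w by (simp add: ip_def mult.commute)
  next
    fix v w z a assume "v \<in> V" "w \<in> V" "z \<in> V"
    then have "integrable lborel (\<lambda>X. v X * z X)" "integrable lborel (\<lambda>X. w X * z X)"
      using L2_inner(1)[OF VL2 VL2, of v z] L2_inner(1)[OF VL2 VL2, of w z] by auto
    then show "ip (\<lambda>x. v x - a * w x) z = ip v z - a * ip w z"
      by (simp add: ip_def left_diff_distrib mult.assoc)
  next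
    show "0 \<le> ip v v" for v unfolding ip_def by (rule Bochner_Integration.integral_nonneg) simp
  qed
  have ip_sqn: "ip v v = sqn v" for v by (simp add: ip_def sqn_def power2_eq_square)
  have Vzero: "v X = 0" if "v \<in> V" "X \<notin> R" for v X using that by (auto simp: V_def K_def)
  \<comment> \<open>All subcells of the cells in the outermost layer, m^(n + 1) of them per cell.
    The inner layers are contained in it, so these means serve for all layers.\<close>
  define SS where "SS = {s. gr.coarse s \<in> I L}"
  have SSc: "finite SS" "card SS \<le> card (I L) * m ^ (CARD('n) + 1)"
  proof -
    let ?D = "\<lambda>b::int. {int m * b..int m * b + int m - 1}"
    let ?S = "\<lambda>B. {f :: 'n \<Rightarrow> int. \<forall>k. f k \<in> ?D (fst B k)} \<times> ?D (snd B)"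
    have mp: "0 < int m" using gr.pos(3) by simp
    have dv: "a \<in> ?D (a div int m)" for a
    proof -
      have "a = int m * (a div int m) + a mod int m" by simp
      then have "int m * (a div int m) \<le> a" "a \<le> int m * (a div int m) + int m - 1"
        using pos_mod_bound[OF mp, of a] pos_mod_sign[OF mp, of a] by linarith+
      then show ?thesis by (simp only: atLeastAtMost_iff simp_thms)
    qed
    have sub: "SS \<subseteq> (\<Union>B\<in>I L. ?S B)"
    proof
      fix s assume "s \<in> SS"
      then have "gr.coarse s \<in> I L" by (simp add: SS_def)
      moreover have "s \<in> ?S (gr.coarse s)" using dv by (auto simp: gr.coarse_def mem_Times_iff)
      ultimately show "s \<in> (\<Union>B\<in>I L. ?S B)" by blast
    qed
    have fS: "finite (?S B)" for B by (intro finite_cartesian_product gr.finite_funs; simp)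
    have cS: "card (?S B) = m ^ (CARD('n) + 1)" for B
      unfolding card_cartesian_product by (subst gr.finite_funs(2)) auto
    have fU: "finite (\<Union>B\<in>I L. ?S B)" using I(1) fS by blast
    show "finite SS" by (rule finite_subset[OF sub fU])
    have "card SS \<le> card (\<Union>B\<in>I L. ?S B)" by (rule card_mono[OF fU sub])
    also have "\<dots> \<le> (\<Sum>B\<in>I L. card (?S B))" by (rule card_UN_le[OF I(1)])
    also have "\<dots> = card (I L) * m ^ (CARD('n) + 1)" by (simp only: cS sum_constant of_nat_id)
    finally show "card SS \<le> card (I L) * m ^ (CARD('n) + 1)" .
  qed
  define N where "N = card SS"
  obtain e where e: "bij_betw e {0..<N} SS" using ex_bij_betw_nat_finite[OF SSc(1)] by (auto simp: N_def)
  define lf where "lf s v = (LINT X|lborel. indicator {X. gr.subcell X = s} X * v X)" for s and v :: "'n st \<Rightarrow> real"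
  have bf: "bfun (lf s)" for s
    unfolding bfun_def
  proof (intro conjI ballI allI)
    fix v w a assume vw: "v \<in> V" "w \<in> V"
    have "integrable lborel (\<lambda>X. indicator {X. gr.subcell X = s} X * v X)" "integrable lborel (\<lambda>X. indicator {X. gr.subcell X = s} X * w X)"
      using L2_inner(1)[OF gr.L2_small_cell VL2[OF vw(1)], of s] L2_inner(1)[OF gr.L2_small_cell VL2[OF vw(2)], of s] by auto
    then show "lf s (\<lambda>x. v x - a * w x) = lf s v - a * lf s w"
      by (simp add: lf_def right_diff_distrib mult.left_commute[of _ a])
  next
    show "\<exists>C. \<forall>v\<in>V. (lf s v)\<^sup>2 \<le> C * ip v v"
    proof (intro exI[of _ "sqn (\<lambda>Y. indicator {X. gr.subcell X = s} Y :: real)"] ballI)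
      fix v assume v: "v \<in> V"
      have "\<bar>lf s v\<bar> \<le> sqrt (sqn (\<lambda>Y. indicator {X. gr.subcell X = s} Y :: real)) * sqrt (sqn v)"
        using L2_inner(3)[OF gr.L2_small_cell VL2[OF v], of s] by (simp add: lf_def)
      then have "\<bar>lf s v\<bar>\<^sup>2 \<le> (sqrt (sqn (\<lambda>Y. indicator {X. gr.subcell X = s} Y :: real)) * sqrt (sqn v))\<^sup>2"
        by (rule power_mono) simp
      then show "(lf s v)\<^sup>2 \<le> sqn (\<lambda>Y. indicator {X. gr.subcell X = s} Y :: real) * ip v v"
        by (simp add: power_mult_distrib ip_sqn)
    qed
  qed
  \<comment> \<open>The functionals whose value at K Y depends measurably on Y in QY. It holds for
    the means and is inherited by the coefficients through \<open>near_projection_many\<close>,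
    which makes the factors v_i measurable.\<close>
  define P where "P c \<longleftrightarrow> (\<lambda>Y. indicator QY Y * c (K Y)) \<in> borel_measurable borel" for c :: "('n st \<Rightarrow> real) \<Rightarrow> real"
  have QYb: "QY \<in> sets borel" using QY(1) by auto
  have joint: "(\<lambda>(Y, X). indicator QY Y * K Y X) \<in> borel_measurable (borel \<Otimes>\<^sub>M borel)"
  proof -
    have S: "QY \<times> R \<in> sets borel"
    proof -
      have "QY \<times> R \<in> sets (borel \<Otimes>\<^sub>M borel)" using QYb Rm(1) by auto
      then show ?thesis unfolding borel_prod .
    qed
    \<comment> \<open>R keeps a positive distance from every Y in QY, so the product avoids the
      diagonal and G is jointly continuous on it.\<close>
    have "continuous_on (QY \<times> R) (\<lambda>P. (\<lambda>(X, Y). G X Y) (snd P, fst P))"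
    proof (rule continuous_on_compose2[OF G_cont, where f = "\<lambda>P. (snd P, fst P)"])
      show "(\<lambda>P. (snd P, fst P)) ` (QY \<times> R) \<subseteq> {(X, Y). X \<in> oc \<and> Y \<in> oc \<and> X \<noteq> Y}"
      proof
        fix PP assume "PP \<in> (\<lambda>P. (snd P, fst P)) ` (QY \<times> R)"
        then obtain Y X where YX: "Y \<in> QY" "X \<in> R" and PP: "PP = (X, Y)" by auto
        obtain r where r: "0 < r" "\<forall>X\<in>R. 4 * r \<le> dist X Y" using sep[OF YX(1)] by blast
        then have "X \<noteq> Y" using YX(2) by force
        then show "PP \<in> {(X, Y). X \<in> oc \<and> Y \<in> oc \<and> X \<noteq> Y}" using YX QY(2) Rm(2) by (auto simp: PP)
      qed
    qed (intro continuous_intros)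
    then have "(\<lambda>P. indicator (QY \<times> R) P *\<^sub>R (\<lambda>(X, Y). G X Y) (snd P, fst P)) \<in> borel_measurable borel"
      by (rule borel_measurable_continuous_on_indicator[OF S])
    moreover have "(\<lambda>P. indicator (QY \<times> R) P *\<^sub>R (\<lambda>(X, Y). G X Y) (snd P, fst P)) = (\<lambda>(Y, X). indicator QY Y * K Y X)"
      by (auto simp: K_def indicator_def fun_eq_iff)
    ultimately show ?thesis by (simp add: borel_prod)
  qed
  have Plf: "P (lf s)" for s
  proof -
    have si1: "(\<lambda>X. indicator {X. gr.subcell X = s} X :: real) \<in> borel_measurable borel" using gr.subcell_set[of s] by simp
    have m1: "(\<lambda>PP. indicator {X. gr.subcell X = s} (snd PP) * (\<lambda>(Y, X). indicator QY Y * K Y X) PP :: real) \<in> borel_measurable (borel \<Otimes>\<^sub>M borel)"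
      by (rule borel_measurable_times[OF measurable_compose[OF measurable_snd si1] joint])
    have "(\<lambda>PP. indicator {X. gr.subcell X = s} (snd PP) * (\<lambda>(Y, X). indicator QY Y * K Y X) PP :: real) = (\<lambda>(Y, X). indicator {X. gr.subcell X = s} X * (indicator QY Y * K Y X))"
      by (auto simp: fun_eq_iff)
    with m1 have "(\<lambda>(Y, X). indicator {X. gr.subcell X = s} X * (indicator QY Y * K Y X) :: real) \<in> borel_measurable (borel \<Otimes>\<^sub>M (lborel :: 'n st measure))"
      by (subst measurable_cong_sets[OF sets_pair_measure_cong[OF refl sets_lborel] refl]) simp
    from lborel.borel_measurable_lebesgue_integral[OF this]
    have "(\<lambda>Y. LINT X|lborel. indicator {X. gr.subcell X = s} X * (indicator QY Y * K Y X)) \<in> borel_measurable borel" .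
    moreover have "(LINT X|lborel. indicator {X. gr.subcell X = s} X * (indicator QY Y * K Y X)) = indicator QY Y * lf s (K Y)" for Y
      by (simp add: lf_def mult.left_commute[of _ "indicator QY Y"])
    ultimately show ?thesis by (simp add: P_def)
  qed
  have Padd: "P (\<lambda>v. c v + a * d v)" if "P c" "P d" for c d a
  proof -
    have "(\<lambda>Y. indicator QY Y * c (K Y) + a * (indicator QY Y * d (K Y))) \<in> borel_measurable borel"
      using that unfolding P_def by measurable
    then show ?thesis by (simp add: P_def algebra_simps)
  qed
  \<comment> \<open>exp 2 is the loss granted to the almost orthogonal projection; it reappears as
    the factor exp 2 of the conclusion.\<close>
  have e1: "(1::real) < exp 2" by simp
  obtain w c where wc: "\<forall>i<N. w i \<in> V \<and> P (c i)"
    "\<forall>v\<in>V. \<forall>j<N. lf (e j) (\<lambda>x. v x - (\<Sum>i<N. c i v * w i x)) = 0"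
    "\<forall>v\<in>V. ip (\<lambda>x. v x - (\<Sum>i<N. c i v * w i x)) (\<lambda>x. v x - (\<Sum>i<N. c i v * w i x)) \<le> exp 2 * ip v v"
    using near_projection_many[of N "\<lambda>j. lf (e j)", OF bf e1, of P, OF Plf Padd] by blast
  define vv where "vv i Y = indicator QY Y * c i (K Y)" for i Y
  define K0 where "K0 = 2 ^ (CARD('n) + 1) * (gr.osc_const lam \<Lambda> / real m)"
  have K0: "0 \<le> K0" unfolding K0_def using gr.osc_const_nonneg[OF lam] by simp
  show ?thesis
  proof (rule exI[of _ N], rule exI[of _ w], rule exI[of _ vv], intro conjI allI impI ballI)
    show "N \<le> card (I L) * m ^ (CARD('n) + 1)" unfolding N_def by (rule SSc(2))
    show "w i \<in> borel_measurable borel" if "i < N" for i using L2_meas[OF VL2] wc(1) that by blast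
    show "vv i \<in> borel_measurable borel" if "i < N" for i using wc(1) that unfolding P_def vv_def[abs_def] by blast
  next
    fix Y assume Y: "Y \<in> QY"
    have KV: "K Y \<in> V"
    proof -
      have "K Y = (\<lambda>X. \<Sum>Y\<in>{Y}. 1 * K Y X)" by simp
      then show ?thesis unfolding V_def using Y by (intro CollectI exI[of _ "{Y}"] exI[of _ "\<lambda>_. 1"]) auto
    qed
    define r where "r = (\<lambda>X. K Y X - (\<Sum>i<N. c i (K Y) * w i X))"
    have rV: "r \<in> V" unfolding r_def by (rule sum_mem(1)[OF KV]) (use wc(1) in blast)
    note rL = VL2[OF rV]
    \<comment> \<open>The means over subcells outside SS vanish as well, since the residual is
      supported in R and R meets only cells of the outermost layer.\<close>
    have zero: "(LINT X|lborel. indicator {X. gr.subcell X = s} X * r X) = 0" for s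
    proof (cases "s \<in> SS")
      case True
      then obtain j where "j < N" "e j = s" using e by (force simp: bij_betw_def)
      then show ?thesis using wc(2) KV by (auto simp: r_def lf_def)
    next
      case False
      have "indicator {X. gr.subcell X = s} X * r X = 0" for X
      proof (cases "gr.subcell X = s \<and> X \<in> R")
        case True
        then have "gr.coarse s \<in> I L" using R gr.cell_subcell[of X] by auto
        then show ?thesis using False by (simp add: SS_def)
      qed (use Vzero[OF rV, of X] in auto)
      then have "(\<lambda>X. indicator {X. gr.subcell X = s} X * r X) = (\<lambda>X. 0)" by (rule ext)
      then show ?thesis by (simp only: Bochner_Integration.integral_zero)
    qed
    obtain Ys d where Yd: "finite Ys" "Ys \<subseteq> QY" "r = (\<lambda>X. \<Sum>Y\<in>Ys. d Y * K Y X)" using rV by (auto simp: V_def)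
    have "\<forall>Y. \<exists>\<rho>. Y \<in> QY \<longrightarrow> 0 < \<rho> \<and> cball Y (4 * \<rho>) \<subseteq> oc \<and> (\<forall>X\<in>R. 4 * \<rho> \<le> dist X Y)" using sep by blast
    from choice[OF this] obtain RR where RR: "\<And>Y. Y \<in> QY \<Longrightarrow> 0 < RR Y" "\<And>Y. Y \<in> QY \<Longrightarrow> cball Y (4 * RR Y) \<subseteq> oc"
      "\<And>Y X. Y \<in> QY \<Longrightarrow> X \<in> R \<Longrightarrow> 4 * RR Y \<le> dist X Y" by blast
    have st: "(\<integral>\<^sup>+X. ennreal (of_bool (gr.cell X = B) * (r X)\<^sup>2) \<partial>lborel) \<le> ennreal K0 * (\<integral>\<^sup>+X. ennreal (of_bool (gr.cell X \<in> gr.nbr B) * (r X)\<^sup>2) \<partial>lborel)"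
      if j: "j < L" and B: "B \<in> I j" for j B
    proof -
      obtain z i where zi: "B = (z, i)" by force
      \<comment> \<open>For j < L the neighbours of a cell of layer j belong to layer j + 1 <= L,
        hence to R up to the boundary; there the residual equals the combination of the uncut
        functions G(., Y).\<close>
      have nR: "X \<in> R" if "X \<in> oc" "gr.cell X \<in> gr.nbr (z, i)" for X
        using that I(2)[OF B] IL[of "Suc j"] j zi by (auto simp: R)
      have osc: "(\<integral>\<^sup>+X. \<integral>\<^sup>+Y. ennreal (of_bool (gr.cell X = (z, i) \<and> gr.subcell X = gr.subcell Y) * (r Y - r X)\<^sup>2) \<partial>lborel \<partial>lborel)
         \<le> ennreal (2 ^ (CARD('n) + 1) * gr.\<mu> * (gr.osc_const lam \<Lambda> / real m)) * (\<integral>\<^sup>+X. ennreal (of_bool (gr.cell X \<in> gr.nbr (z, i)) * (r X)\<^sup>2) \<partial>lborel)"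
      proof (rule combination_oscillation[OF gr b1 I(3)[of z i j] Yd(1), where RR = RR and c = d])
        show "(z, i) \<in> I j" using B zi by simp
        show "0 < RR Y" if "Y \<in> Ys" for Y using RR(1) Yd(2) that by blast
        show "cball Y (4 * RR Y) \<subseteq> oc" if "Y \<in> Ys" for Y using RR(2) Yd(2) that by blast
        show "4 * RR Y \<le> dist X Y" if "Y \<in> Ys" "X \<in> oc" "gr.cell X \<in> gr.nbr (z, i)" for X Y
          using RR(3) Yd(2) that nR by blast
        show "r \<in> borel_measurable borel" by (rule L2_meas[OF rL])
        show "r X = 0" if "X \<notin> oc" for X using Vzero[OF rV] that Rm(2) by blast
        show "r X = (\<Sum>Y\<in>Ys. d Y * G X Y)" if "X \<in> oc" "gr.cell X \<in> gr.nbr (z, i)" for X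
          using nR[OF that] by (simp add: Yd(3) K_def)
      qed
      also have "2 ^ (CARD('n) + 1) * gr.\<mu> * (gr.osc_const lam \<Lambda> / real m) = gr.\<mu> * K0" by (simp add: K0_def)
      finally show ?thesis unfolding zi by (rule gr.cell_poincare[OF rL zero _ K0])
    qed
    have "L2sq QX (\<lambda>X. G X Y - (\<Sum>i<N. w i X * vv i Y)) = (\<integral>\<^sup>+X. ennreal ((G X Y - (\<Sum>i<N. w i X * vv i Y))\<^sup>2) * indicator QX X \<partial>lborel)"
      by (simp add: L2sq_def)
    also have "\<dots> \<le> (\<integral>\<^sup>+X. ennreal (of_bool (gr.cell X \<in> I 0) * (r X)\<^sup>2) \<partial>lborel)"
    proof (rule nn_integral_mono)
      fix X
      show "ennreal ((G X Y - (\<Sum>i<N. w i X * vv i Y))\<^sup>2) * indicator QX X \<le> ennreal (of_bool (gr.cell X \<in> I 0) * (r X)\<^sup>2)"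
      proof (cases "X \<in> QX")
        case True
        have "gr.cell X \<in> I 0" by (rule QX(2)[OF True])
        moreover from this have "X \<in> R" using QX(1) True IL[of 0] by (auto simp: R)
        moreover from \<open>X \<in> R\<close> have "G X Y - (\<Sum>i<N. w i X * vv i Y) = r X"
          using Y by (simp add: r_def K_def vv_def mult.commute)
        ultimately show ?thesis using True by simp
      qed simp
    qed
    also have "\<dots> \<le> (ennreal K0 * of_nat gr.nbr_card_bound) ^ L * (\<integral>\<^sup>+X. ennreal (of_bool (gr.cell X \<in> I L) * (r X)\<^sup>2) \<partial>lborel)"
      by (rule gr.layers_decay[where v = r and I = I and L = L and K = K0, OF L2_meas[OF rL] I(1,2) st])
    also have "\<dots> \<le> ennreal (exp (- 2) ^ L) * (ennreal (exp 2) * L2sq R (\<lambda>X. G X Y))"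
    proof (rule mult_mono)
      have "ennreal K0 * of_nat gr.nbr_card_bound = ennreal (K0 * real gr.nbr_card_bound)" using K0 by (simp add: ennreal_mult ennreal_of_nat_eq_real_of_nat)
      also have "\<dots> \<le> ennreal (exp (- 2))" using m by (intro ennreal_leI) (simp add: K0_def)
      finally have "(ennreal K0 * of_nat gr.nbr_card_bound) ^ L \<le> ennreal (exp (- 2)) ^ L" by (rule power_mono) simp
      then show "(ennreal K0 * of_nat gr.nbr_card_bound) ^ L \<le> ennreal (exp (- 2) ^ L)" by (simp add: ennreal_power)
      have "(\<integral>\<^sup>+X. ennreal (of_bool (gr.cell X \<in> I L) * (r X)\<^sup>2) \<partial>lborel) \<le> (\<integral>\<^sup>+X. ennreal ((norm (r X))\<^sup>2) \<partial>lborel)"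
        by (intro nn_integral_mono ennreal_leI) auto
      also have "\<dots> = ennreal (sqn r)" unfolding sqn_def by (rule nn_integral_eq_integral[OF L2_int[OF rL]]) simp
      also have "\<dots> \<le> ennreal (exp 2 * sqn (K Y))"
        using wc(3) KV by (intro ennreal_leI) (simp add: ip_sqn r_def)
      also have "\<dots> = ennreal (exp 2) * ennreal (sqn (K Y))" by (simp add: ennreal_mult)
      also have "ennreal (sqn (K Y)) = (\<integral>\<^sup>+X. ennreal ((norm (K Y X))\<^sup>2) \<partial>lborel)"
        unfolding sqn_def by (rule nn_integral_eq_integral[OF L2_int[OF KL2[OF Y]], symmetric]) simp
      also have "\<dots> = L2sq R (\<lambda>X. G X Y)"
        unfolding L2sq_def by (rule nn_integral_cong) (simp add: K_def indicator_def)
      finally show "(\<integral>\<^sup>+X. ennreal (of_bool (gr.cell X \<in> I L) * (r X)\<^sup>2) \<partial>lborel) \<le> ennreal (exp 2) * L2sq R (\<lambda>X. G X Y)" .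
    qed simp_all
    also have "\<dots> = ennreal (exp (- 2) ^ L * exp 2) * L2sq R (\<lambda>X. G X Y)" by (simp add: ennreal_mult mult.assoc)
    finally show "L2sq QX (\<lambda>X. G X Y - (\<Sum>i<N. w i X * vv i Y)) \<le> ennreal (exp (- 2) ^ L * exp 2) * L2sq R (\<lambda>X. G X Y)" .
  qed
qed

end

section \<open>The parabolic metric\<close>

lemma infnorm_le:
  fixes v :: "real^'n::finite"
  assumes "\<And>k. \<bar>v $ k\<bar> \<le> s" shows "infnorm v \<le> s"
  unfolding infnorm_def
proof (rule cSup_least)
  show "{\<bar>v \<bullet> i\<bar> |i. i \<in> Basis} \<noteq> {}" by auto
  fix x assume "x \<in> {\<bar>v \<bullet> i\<bar> |i. i \<in> Basis}"
  then show "x \<le> s" using assms by (auto simp: Basis_vec_def inner_axis)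
qed

lemma pmetric_nonneg: "0 \<le> pmetric \<beta> X Y"
  by (simp add: pmetric_def infnorm_pos_le max.coboundedI1)

lemma pmetric_sym: "pmetric \<beta> X Y = pmetric \<beta> Y X"
  by (simp add: pmetric_def infnorm_sub abs_minus_commute)

text \<open>Subadditivity of the square root turns the triangle inequality for times into one for
  the square roots of time differences.\<close>

lemma pmetric_triangle:
  assumes "0 < \<beta>"
  shows "pmetric \<beta> X Z \<le> pmetric \<beta> X Y + pmetric \<beta> Y Z"
proof -
  have "infnorm (fst X - fst Z) \<le> infnorm (fst X - fst Y) + infnorm (fst Y - fst Z)"
    using infnorm_triangle[of "fst X - fst Y" "fst Y - fst Z"] by simp
  then have 1: "infnorm (fst X - fst Z) \<le> pmetric \<beta> X Y + pmetric \<beta> Y Z" by (simp add: pmetric_def max_def)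
  have "sqrt (\<bar>snd X - snd Z\<bar> / \<beta>) \<le> sqrt (\<bar>snd X - snd Y\<bar> / \<beta> + \<bar>snd Y - snd Z\<bar> / \<beta>)"
    using assms by (simp add: add_divide_distrib[symmetric] divide_right_mono)
  also have "\<dots> \<le> sqrt (\<bar>snd X - snd Y\<bar> / \<beta>) + sqrt (\<bar>snd Y - snd Z\<bar> / \<beta>)"
    by (rule sqrt_add_le_add_sqrt) (use assms in auto)
  finally have 2: "sqrt (\<bar>snd X - snd Z\<bar> / \<beta>) \<le> pmetric \<beta> X Y + pmetric \<beta> Y Z" by (simp add: pmetric_def max_def)
  show ?thesis using 1 2 unfolding pmetric_def[of \<beta> X Z] by (rule max.boundedI)
qed

text \<open>The maximum principle works with Euclidean space-time balls, whereas admissibility is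
  expressed in the parabolic metric; this converts one separation into the other.\<close>

lemma pmetric_dist:
  assumes "0 < \<beta>" "0 < \<delta>" "\<delta> \<le> pmetric \<beta> X Y"
  shows "min \<delta> (\<beta> * \<delta>\<^sup>2) \<le> dist X Y"
proof -
  have f: "norm (fst X - fst Y) \<le> dist X Y" "\<bar>snd X - snd Y\<bar> \<le> dist X Y"
    using dist_fst_le[of X Y] dist_snd_le[of X Y] by (auto simp: dist_norm)
  consider "\<delta> \<le> infnorm (fst X - fst Y)" | "\<delta> \<le> sqrt (\<bar>snd X - snd Y\<bar> / \<beta>)" using assms(3) by (auto simp: pmetric_def le_max_iff_disj)
  then show ?thesis
  proof cases
    case 1
    then show ?thesis using infnorm_le_norm[of "fst X - fst Y"] f(1) by simp
  next
    case 2
    then have "\<delta>\<^sup>2 \<le> (sqrt (\<bar>snd X - snd Y\<bar> / \<beta>))\<^sup>2" using assms(2) by (intro power_mono) auto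
    then have "\<delta>\<^sup>2 \<le> \<bar>snd X - snd Y\<bar> / \<beta>" using assms(1) by simp
    then have "\<beta> * \<delta>\<^sup>2 \<le> \<bar>snd X - snd Y\<bar>" using assms(1) by (simp add: pos_le_divide_eq mult.commute)
    then show ?thesis using f(2) by simp
  qed
qed

section \<open>Choice of the grid and count of the cells\<close>

context parabolic
begin

text \<open>For each L the grid is made so fine that L + 1 layers fit into the
  \<delta>-neighbourhood of the cylinder. The subdivision m is fixed in advance, so the number of
  subcells grows only through the number of cells, like L^n in space times L^2 in time. The constant
  C may depend on everything except L.\<close>

lemma separable_approximation:
  fixes E :: "(real^'n) set" and QY :: "'n st set"
  assumes E: "open E" "E \<subseteq> \<Omega>" "E \<noteq> {}" and I1: "0 \<le> a1" "a1 < b1" "b1 \<le> T" and \<beta>: "0 < \<beta>" and \<delta>: "0 < \<delta>"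
    and QY: "open QY" "QY \<subseteq> oc"
    and sep: "\<And>X Y X'. X \<in> oc \<Longrightarrow> Y \<in> QY \<Longrightarrow> X' \<in> E \<times> {a1<..<b1} \<Longrightarrow> pmetric \<beta> X X' \<le> \<delta> \<Longrightarrow> \<delta> \<le> pmetric \<beta> X Y"
  shows "\<exists>C. \<forall>L::nat. 1 \<le> L \<longrightarrow> (\<exists>k u v R. real k \<le> C * real L ^ (CARD('n) + 2) \<and>
    (\<forall>i<k. u i \<in> borel_measurable borel \<and> v i \<in> borel_measurable borel) \<and>
    R \<in> sets borel \<and> R \<subseteq> oc \<and> (\<forall>X\<in>R. \<exists>X'\<in>E \<times> {a1<..<b1}. pmetric \<beta> X X' \<le> \<delta>) \<and>
    (\<forall>Y\<in>QY. L2sq (E \<times> {a1<..<b1}) (\<lambda>X. G X Y - (\<Sum>i<k. u i X * v i Y)) \<le> ennreal (exp (- 2 * real L)) * L2sq R (\<lambda>X. G X Y)))"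
proof -
  let ?n = "CARD('n)"
  obtain x0 where x0: "x0 \<in> E" using E(3) by blast
  have n1: "1 \<le> real ?n" by (simp add: Suc_leI)
  obtain b where b: "\<And>x. x \<in> \<Omega> \<Longrightarrow> norm x \<le> b" using dom(2) by (auto simp: bounded_iff)
  define De where "De = 2 * \<bar>b\<bar>"
  have De: "\<bar>x $ k - x0 $ k\<bar> \<le> De" if "x \<in> E" for x k
  proof -
    have "\<bar>(x - x0) $ k\<bar> \<le> norm (x - x0)" by (rule component_le_norm_cart)
    also have "\<dots> \<le> norm x + norm x0" by (rule norm_triangle_ineq4)
    also have "\<dots> \<le> De"
    proof -
      have "norm x \<le> b" "norm x0 \<le> b" using b that x0 E(2) by auto
      then show ?thesis unfolding De_def by linarith
    qed
    finally show ?thesis by simp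
  qed
  \<comment> \<open>m times the one-layer factor of \<open>grid_approximation\<close>. Any m >= W
    exp 2 makes that factor at most exp (-2), whatever L and \<eta> are.\<close>
  define W where "W = 2 ^ (?n + 1) * grid.osc_const TYPE('n) \<beta> lam \<Lambda> * real (grid.nbr_card_bound TYPE('n))"
  define m where "m = nat \<lceil>W * exp 2\<rceil> + 1"
  have m: "0 < m" "W * exp 2 \<le> real m" by (auto simp: m_def) linarith
  have mW: "2 ^ (?n + 1) * (grid.osc_const TYPE('n) \<beta> lam \<Lambda> / real m) * real (grid.nbr_card_bound TYPE('n)) \<le> exp (- 2)"
  proof -
    have "W \<le> real m * exp (- 2)" using m(2) by (simp add: exp_minus field_simps)
    then have "W / real m \<le> exp (- 2)" using m(1) by (simp add: pos_divide_le_eq mult.commute)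
    then show ?thesis by (simp add: W_def)
  qed
  \<comment> \<open>\<open>cA\<close> * L bounds the number of cell indices per coordinate,
    \<open>cB\<close> * L^2 the number of time levels. The factors 8 = 2 * 4 and 16 = 4^2 arise from
    L + 3 <= 4 L in the size of \<eta>; the power of m in C counts the subcells of a cell.\<close>
  define cA where "cA = 8 * De * (real ?n + 1) / \<delta> + 5 + 4 * real ?n"
  define cB where "cB = 16 * (b1 - a1) * (real ?n + 1)\<^sup>2 / (\<beta> * \<delta>\<^sup>2) + 3"
  define C where "C = cA ^ ?n * cB * real (m ^ (?n + 1))"
  show ?thesis
  proof (intro exI[of _ C] allI impI)
    fix L :: nat assume L: "1 \<le> L"
    then have L1: "1 \<le> real L" by simp
    \<comment> \<open>A point of layer L + 1 is at most n (L + 1) + 1 cells away from E in each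
      coordinate, so it stays within \<delta>. The summand 3 also leaves room in time for the
      rounding of the number of levels and for a point inside the open interval.\<close>
    define \<eta> where "\<eta> = \<delta> / ((real ?n + 1) * (real L + 3))"
    have \<eta>: "0 < \<eta>" using \<delta> by (simp add: \<eta>_def add_pos_pos)
    have gr: "grid \<eta> \<beta> m" by unfold_locales (use \<eta> \<beta> m in auto)
    interpret gr: grid x0 b1 \<eta> \<beta> m by (rule gr)
    define l where "l = gr.l"
    have l: "0 < l" "l = \<beta> * \<eta>\<^sup>2" by (simp_all add: l_def gr.l) (simp add: gr.l_def)
    define Nt where "Nt = \<lceil>(b1 - a1) / l\<rceil>"
    have Nt: "0 \<le> Nt" "(b1 - a1) / l \<le> Nt" "Nt < (b1 - a1) / l + 1"
    proof -
      have "0 < (b1 - a1) / l" using I1(2) l(1) by simp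
      then show "0 \<le> Nt" "(b1 - a1) / l \<le> Nt" "Nt < (b1 - a1) / l + 1"
        unfolding Nt_def by linarith+
    qed
    define fl where "fl x = (\<lambda>k. \<lfloor>(x $ k - x0 $ k) / \<eta>\<rfloor>)" for x :: "real^'n"
    \<comment> \<open>Distances are counted from the cells that meet E, not from a bounding box,
      because every point of the outermost layer must lie within \<delta> of the cylinder. Each
      neighbour step adds at most n to every coordinate and one earlier time level; index -1 is the
      last cell before b1.\<close>
    define I where "I j = {(z, i). (\<exists>x\<in>E. \<forall>k. \<bar>z k - fl x k\<bar> \<le> int ?n * int j) \<and> - (Nt + int j) \<le> i \<and> i \<le> - 1}" for j
    define Z where "Z j = \<lceil>De / \<eta>\<rceil> + 1 + int ?n * int j" for j
    have De0: "0 \<le> De" by (simp add: De_def)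
    have Isub: "I j \<subseteq> {f. \<forall>k. f k \<in> {- Z j..Z j}} \<times> {- (Nt + int j)..- 1}" for j
    proof
      fix B assume "B \<in> I j"
      then obtain z i x where B: "B = (z, i)" "x \<in> E" "\<And>k. \<bar>z k - fl x k\<bar> \<le> int ?n * int j" "- (Nt + int j) \<le> i" "i \<le> - 1"
        by (auto simp: I_def)
      have "z k \<in> {- Z j..Z j}" for k
      proof -
        have "\<bar>(x $ k - x0 $ k) / \<eta>\<bar> \<le> De / \<eta>" using De[OF B(2), of k] \<eta> by (simp add: divide_right_mono)
        then have "\<bar>fl x k\<bar> \<le> \<lceil>De / \<eta>\<rceil> + 1" unfolding fl_def by linarith
        then have "\<bar>z k\<bar> \<le> Z j" using B(3)[of k] unfolding Z_def by linarith
        then show ?thesis by (simp add: abs_le_iff)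
      qed
      then show "B \<in> {f. \<forall>k. f k \<in> {- Z j..Z j}} \<times> {- (Nt + int j)..- 1}" using B by auto
    qed
    have fin: "finite ({f :: 'n \<Rightarrow> int. \<forall>k. f k \<in> {- Z j..Z j}} \<times> {- (Nt + int j)..- 1})" for j
      by (intro finite_cartesian_product gr.finite_funs; simp)
    have If: "finite (I j)" for j by (rule finite_subset[OF Isub fin])
    have Z0: "0 \<le> Z j" for j
    proof -
      have "0 \<le> De / \<eta>" using De0 \<eta> by simp
      then have "0 \<le> \<lceil>De / \<eta>\<rceil>" by linarith
      moreover have "0 \<le> int ?n * int j" by simp
      ultimately show ?thesis unfolding Z_def by linarith
    qed
    have cI: "real (card (I j)) \<le> (2 * Z j + 1) ^ ?n * (Nt + int j)" for j
    proof -
      have "card (I j) \<le> card ({f :: 'n \<Rightarrow> int. \<forall>k. f k \<in> {- Z j..Z j}} \<times> {- (Nt + int j)..- 1})"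
        by (rule card_mono[OF fin Isub])
      also have "\<dots> = nat (2 * Z j + 1) ^ ?n * nat (Nt + int j)"
        unfolding card_cartesian_product by (subst gr.finite_funs(2)) auto
      finally have "real (card (I j)) \<le> real (nat (2 * Z j + 1) ^ ?n * nat (Nt + int j))" by (simp only: of_nat_le_iff)
      also have "\<dots> = (2 * Z j + 1) ^ ?n * (Nt + int j)" using Z0[of j] Nt(1) by simp
      finally show ?thesis .
    qed
    have Inbr: "gr.nbr B \<subseteq> I (Suc j)" if B: "B \<in> I j" for j B
    proof
      fix B' assume B': "B' \<in> gr.nbr B"
      obtain z i x where Bz: "B = (z, i)" "x \<in> E" "\<And>k. \<bar>z k - fl x k\<bar> \<le> int ?n * int j" "- (Nt + int j) \<le> i" "i \<le> - 1"
        using B by (auto simp: I_def)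
      obtain z' i' where Bz': "B' = (z', i')" by force
      have "\<bar>z' k - fl x k\<bar> \<le> int ?n * int (Suc j)" for k
      proof -
        have "\<bar>z' k - z k\<bar> \<le> int ?n" using B' by (simp add: gr.nbr_def Bz(1) Bz')
        then show ?thesis using Bz(3)[of k] by (simp add: algebra_simps)
      qed
      moreover have "- (Nt + int (Suc j)) \<le> i' \<and> i' \<le> - 1" using B' Bz by (auto simp: gr.nbr_def Bz')
      ultimately show "B' \<in> I (Suc j)" using Bz(2) by (auto simp: I_def Bz')
    qed
    define R where "R = {X \<in> oc. gr.cell X \<in> I (L + 1)}"
    have Rm: "R \<in> sets borel" "R \<subseteq> oc"
    proof -
      have "R = oc \<inter> {X. gr.cell X \<in> I (L + 1)}" unfolding R_def by auto
      then show "R \<in> sets borel" using oc(3) gr.cell_set'[OF If] by auto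
    qed (auto simp: R_def)
    have \<eta>b: "real ?n * real (L + 1) + 1 \<le> (real ?n + 1) * (real L + 3)" using n1 by (simp add: algebra_simps)
    have \<eta>\<delta>: "(real ?n * real (L + 1) + 1) * \<eta> \<le> \<delta>"
    proof -
      have "(real ?n * real (L + 1) + 1) * \<eta> \<le> ((real ?n + 1) * (real L + 3)) * \<eta>" using \<eta>b \<eta> by (intro mult_right_mono) auto
      also have "\<dots> = \<delta>" using L1 n1 by (simp add: \<eta>_def)
      finally show ?thesis .
    qed
    \<comment> \<open>Time is not the bottleneck: L + 3 time steps have length only sqrt (L + 3)
      \<eta> in the parabolic metric.\<close>
    have l\<delta>: "(real L + 3) * l \<le> \<beta> * \<delta>\<^sup>2"
    proof -
      have "(real L + 3) \<le> (real L + 3)\<^sup>2" using L1 by (simp add: power2_eq_square)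
      also have "\<dots> \<le> ((real ?n + 1) * (real L + 3))\<^sup>2" using n1 L1 by (intro power_mono) (auto simp: mult_le_cancel_right1)
      finally have "(real L + 3) * \<eta>\<^sup>2 \<le> ((real ?n + 1) * (real L + 3))\<^sup>2 * \<eta>\<^sup>2" by (rule mult_right_mono) simp
      also have "\<dots> = \<delta>\<^sup>2"
      proof -
        have "((real ?n + 1) * (real L + 3)) * \<eta> = \<delta>" using L1 n1 by (simp add: \<eta>_def)
        then show ?thesis by (simp only: power_mult_distrib[symmetric])
      qed
      finally show ?thesis using \<beta> by (simp add: l(2))
    qed
    have near: "\<exists>X'\<in>E \<times> {a1<..<b1}. pmetric \<beta> X X' \<le> \<delta>" if X: "X \<in> R" for X
    proof -
      obtain z i where zi: "gr.cell X = (z, i)" by force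
      then have "(z, i) \<in> I (L + 1)" using X by (simp add: R_def)
      then obtain x where x: "x \<in> E" "\<And>k. \<bar>z k - fl x k\<bar> \<le> int ?n * int (L + 1)" and i: "- (Nt + int (L + 1)) \<le> i" "i \<le> - 1"
        by (auto simp: I_def)
      have sp: "infnorm (fst X - x) \<le> \<delta>"
      proof (rule infnorm_le)
        fix k
        have zk: "z k = \<lfloor>(fst X $ k - x0 $ k) / \<eta>\<rfloor>" using zi by (auto simp: gr.cell_def)
        have "\<bar>(fst X $ k - x0 $ k) / \<eta> - (x $ k - x0 $ k) / \<eta>\<bar> \<le> real ?n * real (L + 1) + 1"
        proof -
          have "\<bar>\<lfloor>(fst X $ k - x0 $ k) / \<eta>\<rfloor> - \<lfloor>(x $ k - x0 $ k) / \<eta>\<rfloor>\<bar> \<le> int (?n * (L + 1))"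
            using x(2)[of k] by (simp add: zk fl_def algebra_simps)
          then have "\<bar>(fst X $ k - x0 $ k) / \<eta> - (x $ k - x0 $ k) / \<eta>\<bar> \<le> real (?n * (L + 1)) + 1" by linarith
          then show ?thesis by (simp add: algebra_simps)
        qed
        then have "\<bar>(fst X $ k - x $ k) / \<eta>\<bar> \<le> real ?n * real (L + 1) + 1" by (simp add: diff_divide_distrib)
        then have "\<bar>fst X $ k - x $ k\<bar> \<le> (real ?n * real (L + 1) + 1) * \<eta>" using \<eta> by (simp add: pos_divide_le_eq)
        then show "\<bar>(fst X - x) $ k\<bar> \<le> \<delta>" using \<eta>\<delta> by simp
      qed
      have it: "i = \<lfloor>(snd X - b1) / l\<rfloor>" using zi by (auto simp: gr.cell_def l_def)
      have "(snd X - b1) / l < 0" using i(2) unfolding it by linarith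
      then have tb: "snd X < b1" using l(1) by (simp add: divide_less_0_iff)
      have ta: "a1 - (real L + 2) * l \<le> snd X"
      proof -
        have "- ((b1 - a1) / l + 1 + real (L + 1)) \<le> (snd X - b1) / l" using i(1) Nt(3) unfolding it by linarith
        then have "- ((b1 - a1) / l + 1 + real (L + 1)) * l \<le> snd X - b1" by (simp add: pos_le_divide_eq[OF l(1)])
        moreover have "- ((b1 - a1) / l + 1 + real (L + 1)) * l = - (b1 - a1) - (real L + 2) * l"
        proof -
          have "- (y + 1 + real (L + 1)) * l = - (y * l) - (real L + 2) * l" for y by (simp add: algebra_simps)
          from this[of "(b1 - a1) / l"] show ?thesis using l(1) by simp
        qed
        ultimately show ?thesis by simp
      qed
      \<comment> \<open>A point at or before a1 needs a partner strictly inside the interval; a1 +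
        mm / 2 lies in it and costs less than one further time step.\<close>
      define mm where "mm = min l (b1 - a1)"
      have mm: "0 < mm" "mm \<le> l" "mm \<le> b1 - a1" using l(1) I1(2) by (auto simp: mm_def)
      define t where "t = (if a1 < snd X then snd X else a1 + mm / 2)"
      have t: "a1 < t" "t < b1" using tb mm by (auto simp: t_def)
      have "\<bar>snd X - t\<bar> \<le> (real L + 3) * l"
      proof (cases "a1 < snd X")
        case False
        then have "\<bar>snd X - t\<bar> = a1 + mm / 2 - snd X" using mm by (simp add: t_def)
        also have "\<dots> \<le> (real L + 2) * l + l" using ta mm by linarith
        finally show ?thesis by (simp add: algebra_simps)
      qed (use l(1) in \<open>simp add: t_def\<close>)
      then have "\<bar>snd X - t\<bar> \<le> \<beta> * \<delta>\<^sup>2" using l\<delta> by linarith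
      then have "\<bar>snd X - t\<bar> / \<beta> \<le> \<delta>\<^sup>2" using \<beta> by (simp add: pos_divide_le_eq mult.commute)
      then have "sqrt (\<bar>snd X - t\<bar> / \<beta>) \<le> \<delta>" using \<delta> by (intro real_le_lsqrt) auto
      then have "pmetric \<beta> X (x, t) \<le> \<delta>" using sp by (simp add: pmetric_def)
      then show ?thesis using x(1) t by (intro bexI[of _ "(x, t)"]) auto
    qed
    have QXsub: "E \<times> {a1<..<b1} \<subseteq> oc" using E(2) I1 by (auto simp: oc_def)
    have QXbi: "gr.cell X \<in> I 0" if X: "X \<in> E \<times> {a1<..<b1}" for X
    proof -
      obtain x t where xt: "X = (x, t)" "x \<in> E" "a1 < t" "t < b1" using X by auto
      have "gr.cell X = (fl x, \<lfloor>(t - b1) / l\<rfloor>)" by (simp add: gr.cell_def fl_def l_def xt(1))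
      moreover have "\<lfloor>(t - b1) / l\<rfloor> \<le> - 1"
      proof -
        have "(t - b1) / l < 0" using xt l(1) by (simp add: divide_less_0_iff)
        then show ?thesis by linarith
      qed
      moreover have "- Nt \<le> \<lfloor>(t - b1) / l\<rfloor>"
      proof -
        have "(a1 - b1) / l \<le> (t - b1) / l" using xt l(1) by (intro divide_right_mono) auto
        moreover have "(a1 - b1) / l = - ((b1 - a1) / l)" by (simp add: minus_divide_left[symmetric] diff_divide_distrib)
        ultimately have "- real_of_int Nt \<le> (t - b1) / l" using Nt(2) by linarith
        then show ?thesis by linarith
      qed
      ultimately show ?thesis using xt(2) by (auto simp: I_def)
    qed
    have sep': "\<exists>r>0. cball Y (4 * r) \<subseteq> oc \<and> (\<forall>X\<in>R. 4 * r \<le> dist X Y)" if Y: "Y \<in> QY" for Y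
    proof -
      obtain r1 where r1: "0 < r1" "cball Y r1 \<subseteq> oc" using oc(1) QY(2) Y open_contains_cball by blast
      \<comment> \<open>The division by 4 matches the radius 4 r that the maximum principle and the
        bounds on averages work with.\<close>
      define r where "r = min r1 (min \<delta> (\<beta> * \<delta>\<^sup>2)) / 4"
      have r: "0 < r" using r1 \<delta> \<beta> by (simp add: r_def)
      have "4 * r \<le> r1" by (simp add: r_def)
      then have "cball Y (4 * r) \<subseteq> oc" using r1(2) by (meson order_trans subset_cball)
      moreover have "4 * r \<le> dist X Y" if X: "X \<in> R" for X
      proof -
        obtain X' where "X' \<in> E \<times> {a1<..<b1}" "pmetric \<beta> X X' \<le> \<delta>" using near[OF X] by blast
        then have "\<delta> \<le> pmetric \<beta> X Y" using sep X Rm(2) Y by blast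
        from pmetric_dist[OF \<beta> \<delta> this] show ?thesis by (simp add: r_def)
      qed
      ultimately show ?thesis using r by blast
    qed
    have I3: "i \<le> - 1" if "(z, i) \<in> I j" for j z i using that by (simp add: I_def)
    have "\<exists>k u v. k \<le> card (I (L + 1)) * m ^ (?n + 1) \<and>
      (\<forall>i<k. u i \<in> borel_measurable borel \<and> v i \<in> borel_measurable borel) \<and>
      (\<forall>Y\<in>QY. L2sq (E \<times> {a1<..<b1}) (\<lambda>X. G X Y - (\<Sum>i<k. u i X * v i Y)) \<le> ennreal (exp (- 2) ^ (L + 1) * exp 2) * L2sq R (\<lambda>X. G X Y))"
    proof (rule grid_approximation[where \<eta> = \<eta> and \<beta> = \<beta> and m = m and ?b1.0 = b1 and I = I and ?x0.0 = x0 and L = "L + 1" and R = R and QX = "E \<times> {a1<..<b1}" and QY = QY])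
      show "grid \<eta> \<beta> m" by (rule gr)
      show "b1 \<le> T" by (rule I1(3))
      show "finite (I j)" for j by (rule If)
      show "gr.nbr B \<subseteq> I (Suc j)" if "B \<in> I j" for j B by (rule Inbr[OF that])
      show "i \<le> - 1" if "(z, i) \<in> I j" for j z i by (rule I3[OF that])
      show "2 ^ (?n + 1) * (gr.osc_const lam \<Lambda> / real m) * real gr.nbr_card_bound \<le> exp (- 2)" by (rule mW)
      show "E \<times> {a1<..<b1} \<subseteq> oc" by (rule QXsub)
      show "gr.cell X \<in> I 0" if "X \<in> E \<times> {a1<..<b1}" for X by (rule QXbi[OF that])
      show "open QY" "QY \<subseteq> oc" by (rule QY)+
      show "R = {X \<in> oc. gr.cell X \<in> I (L + 1)}" by (rule R_def)
      show "\<exists>r>0. cball Y (4 * r) \<subseteq> oc \<and> (\<forall>X\<in>R. 4 * r \<le> dist X Y)" if "Y \<in> QY" for Y by (rule sep'[OF that])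
    qed
    then obtain k u v where kuv: "k \<le> card (I (L + 1)) * m ^ (?n + 1)"
      "\<forall>i<k. u i \<in> borel_measurable borel \<and> v i \<in> borel_measurable borel"
      "\<forall>Y\<in>QY. L2sq (E \<times> {a1<..<b1}) (\<lambda>X. G X Y - (\<Sum>i<k. u i X * v i Y)) \<le> ennreal (exp (- 2) ^ (L + 1) * exp 2) * L2sq R (\<lambda>X. G X Y)"
      by (elim exE conjE) (rule that)
    \<comment> \<open>The extra layer exactly pays for the factor exp 2 lost in the almost
      orthogonal projection.\<close>
    have ex: "exp (- 2) ^ (L + 1) * exp 2 = exp (- 2 * real L)"
      by (simp add: exp_of_nat_mult[symmetric] exp_add[symmetric] algebra_simps)
    have kb: "real k \<le> C * real L ^ (?n + 2)"
    proof -
      have A: "real_of_int (2 * Z (L + 1) + 1) \<le> cA * real L"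
      proof -
        have c8: "0 \<le> 8 * De * (real ?n + 1) / \<delta>" using De0 \<delta> by simp
        have "real_of_int \<lceil>De / \<eta>\<rceil> \<le> De / \<eta> + 1" by linarith
        moreover have "real_of_int (2 * Z (L + 1) + 1) = 2 * (real_of_int \<lceil>De / \<eta>\<rceil> + 1 + real ?n * real (L + 1)) + 1"
          unfolding Z_def by simp
        moreover have "c \<le> y + 1 \<Longrightarrow> a = 2 * (c + 1 + w) + 1 \<Longrightarrow> a \<le> 2 * (y + 1 + 1 + w) + 1" for a c w y :: real by simp
        ultimately have "real_of_int (2 * Z (L + 1) + 1) \<le> 2 * (De / \<eta> + 1 + 1 + real ?n * real (L + 1)) + 1"
          by blast
        also have "De / \<eta> = De * (real ?n + 1) / \<delta> * (real L + 3)" by (simp add: \<eta>_def)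
        also have "\<dots> \<le> De * (real ?n + 1) / \<delta> * (4 * real L)" using L1 De0 \<delta> by (intro mult_left_mono) auto
        also have "2 * (De * (real ?n + 1) / \<delta> * (4 * real L) + 1 + 1 + real ?n * real (L + 1)) + 1
            = 8 * De * (real ?n + 1) / \<delta> * real L + 5 + 2 * real ?n * (real L + 1)" by (simp add: algebra_simps)
        also have "\<dots> \<le> 8 * De * (real ?n + 1) / \<delta> * real L + 5 * real L + 2 * real ?n * (2 * real L)"
          using L1 c8 by (intro add_mono mult_left_mono) auto
        also have "\<dots> = cA * real L" by (simp add: cA_def algebra_simps)
        finally show ?thesis by simp
      qed
      have B: "real_of_int (Nt + int (L + 1)) \<le> cB * (real L)\<^sup>2"
      proof -
        have sq: "real L \<le> (real L)\<^sup>2" "1 \<le> (real L)\<^sup>2"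
          using mult_left_mono[OF L1, of "real L"] one_le_power[OF L1, of 2] by (simp_all add: power2_eq_square)
        have "real_of_int (Nt + int (L + 1)) \<le> (b1 - a1) / l + 1 + real (L + 1)" using Nt(3) by simp
        also have "(b1 - a1) / l = (b1 - a1) * (real ?n + 1)\<^sup>2 / (\<beta> * \<delta>\<^sup>2) * (real L + 3)\<^sup>2"
          by (simp add: l(2) \<eta>_def power_divide power_mult_distrib)
        also have "\<dots> \<le> (b1 - a1) * (real ?n + 1)\<^sup>2 / (\<beta> * \<delta>\<^sup>2) * (4 * real L)\<^sup>2"
          using L1 I1 \<beta> \<delta> by (intro mult_left_mono power_mono) auto
        also have "(b1 - a1) * (real ?n + 1)\<^sup>2 / (\<beta> * \<delta>\<^sup>2) * (4 * real L)\<^sup>2 + 1 + real (L + 1)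
            = 16 * (b1 - a1) * (real ?n + 1)\<^sup>2 / (\<beta> * \<delta>\<^sup>2) * (real L)\<^sup>2 + (2 + real L)" by (simp add: power_mult_distrib)
        also have "\<dots> \<le> 16 * (b1 - a1) * (real ?n + 1)\<^sup>2 / (\<beta> * \<delta>\<^sup>2) * (real L)\<^sup>2 + 3 * (real L)\<^sup>2" using sq by linarith
        also have "\<dots> = cB * (real L)\<^sup>2" by (simp add: cB_def algebra_simps)
        finally show ?thesis by simp
      qed
      have "real k \<le> real (card (I (L + 1))) * real (m ^ (?n + 1))"
        unfolding of_nat_mult[symmetric] of_nat_le_iff by (rule kuv(1))
      also have "\<dots> \<le> ((2 * Z (L + 1) + 1) ^ ?n * (Nt + int (L + 1))) * real (m ^ (?n + 1))"
        using cI[of "L + 1"] by (intro mult_right_mono) auto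
      also have "\<dots> \<le> ((cA * real L) ^ ?n * (cB * (real L)\<^sup>2)) * real (m ^ (?n + 1))"
      proof (intro mult_right_mono)
        have "real_of_int (2 * Z (L + 1) + 1) ^ ?n \<le> (cA * real L) ^ ?n" using A Z0[of "L + 1"] by (intro power_mono) auto
        then have "real_of_int (2 * Z (L + 1) + 1) ^ ?n * real_of_int (Nt + int (L + 1)) \<le> (cA * real L) ^ ?n * (cB * (real L)\<^sup>2)"
          using B Z0[of "L + 1"] Nt(1) order_trans[OF _ A, of 0] by (intro mult_mono) auto
        then show "real_of_int ((2 * Z (L + 1) + 1) ^ ?n * (Nt + int (L + 1))) \<le> (cA * real L) ^ ?n * (cB * (real L)\<^sup>2)" by simp
      qed simp
      also have "\<dots> = C * real L ^ (?n + 2)" by (simp add: C_def power_mult_distrib power_add power2_eq_square mult_ac)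
      finally show ?thesis .
    qed
    show "\<exists>k u v R. real k \<le> C * real L ^ (?n + 2) \<and>
      (\<forall>i<k. u i \<in> borel_measurable borel \<and> v i \<in> borel_measurable borel) \<and>
      R \<in> sets borel \<and> R \<subseteq> oc \<and> (\<forall>X\<in>R. \<exists>X'\<in>E \<times> {a1<..<b1}. pmetric \<beta> X X' \<le> \<delta>) \<and>
      (\<forall>Y\<in>QY. L2sq (E \<times> {a1<..<b1}) (\<lambda>X. G X Y - (\<Sum>i<k. u i X * v i Y)) \<le> ennreal (exp (- 2 * real L)) * L2sq R (\<lambda>X. G X Y))"
      by (rule exI[of _ k], rule exI[of _ u], rule exI[of _ v], rule exI[of _ R])
         (intro conjI kb kuv(2) Rm ballI near kuv(3)[unfolded ex, rule_format])
  qed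
qed

end

section \<open>Norms over the product of the two cylinders\<close>

lemma L2sq_mono: "A \<subseteq> B \<Longrightarrow> L2sq A f \<le> L2sq B f"
  unfolding L2sq_def by (intro nn_integral_mono) (auto simp: indicator_def)

text \<open>Tonelli's theorem with Y as the outer variable. The indicator is multiplied in before
  squaring, so that measurability is demanded of f on the product only.\<close>

lemma L2sq_prod:
  fixes f :: "'a::euclidean_space \<Rightarrow> 'b::euclidean_space \<Rightarrow> real"
  assumes f: "(\<lambda>P. indicator (A \<times> B) P * (case P of (X, Y) \<Rightarrow> f X Y)) \<in> borel_measurable borel"
  shows "L2sq (A \<times> B) (\<lambda>(X, Y). f X Y) = (\<integral>\<^sup>+Y. indicator B Y * L2sq A (\<lambda>X. f X Y) \<partial>lborel)"
    and "(\<lambda>Y. indicator B Y * L2sq A (\<lambda>X. f X Y)) \<in> borel_measurable lborel"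
proof -
  define F where "F P = ennreal ((indicator (A \<times> B) P * (case P of (X, Y) \<Rightarrow> f X Y))\<^sup>2)" for P
  have mF: "F \<in> borel_measurable borel" unfolding F_def[abs_def] using f by measurable
  have mF': "F \<in> borel_measurable (lborel \<Otimes>\<^sub>M lborel)" using mF by (simp add: lborel_prod)
  have F: "(\<integral>\<^sup>+X. F (X, Y) \<partial>lborel) = indicator B Y * L2sq A (\<lambda>X. f X Y)" for Y
  proof (cases "Y \<in> B")
    case True
    then show ?thesis by (simp add: L2sq_def F_def) (rule nn_integral_cong, auto simp: indicator_def)
  next
    case False
    then show ?thesis by (simp add: F_def)
  qed
  have "L2sq (A \<times> B) (\<lambda>(X, Y). f X Y) = integral\<^sup>N lborel F"
    unfolding L2sq_def F_def by (rule nn_integral_cong) (auto simp: indicator_def)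
  also have "\<dots> = integral\<^sup>N (lborel \<Otimes>\<^sub>M lborel) F" by (simp add: lborel_prod)
  also have "\<dots> = (\<integral>\<^sup>+Y. \<integral>\<^sup>+X. F (X, Y) \<partial>lborel \<partial>lborel)"
    by (rule lborel_pair.nn_integral_snd[symmetric]) (use mF' in simp)
  finally show "L2sq (A \<times> B) (\<lambda>(X, Y). f X Y) = (\<integral>\<^sup>+Y. indicator B Y * L2sq A (\<lambda>X. f X Y) \<partial>lborel)"
    unfolding F .
  from lborel.borel_measurable_nn_integral_fst[OF measurable_compose[OF measurable_pair_swap' mF']]
  have "(\<lambda>Y. \<integral>\<^sup>+X. F (X, Y) \<partial>lborel) \<in> borel_measurable lborel" by simp
  then show "(\<lambda>Y. indicator B Y * L2sq A (\<lambda>X. f X Y)) \<in> borel_measurable lborel"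
    unfolding F .
qed

text \<open>The factor c does not depend on Y, so the estimate for fixed Y can be integrated over
  B.\<close>

lemma L2sq_prod_le:
  fixes f :: "'a::euclidean_space \<Rightarrow> 'b::euclidean_space \<Rightarrow> real"
  assumes f: "(\<lambda>P. indicator (A \<times> B) P * (case P of (X, Y) \<Rightarrow> f X Y)) \<in> borel_measurable borel"
    and g: "(\<lambda>P. indicator (A' \<times> B) P * (case P of (X, Y) \<Rightarrow> g X Y)) \<in> borel_measurable borel"
    and le: "\<And>Y. Y \<in> B \<Longrightarrow> L2sq A (\<lambda>X. f X Y) \<le> c * L2sq A' (\<lambda>X. g X Y)"
  shows "L2sq (A \<times> B) (\<lambda>(X, Y). f X Y) \<le> c * L2sq (A' \<times> B) (\<lambda>(X, Y). g X Y)"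
proof -
  have "(\<integral>\<^sup>+Y. indicator B Y * L2sq A (\<lambda>X. f X Y) \<partial>lborel)
      \<le> (\<integral>\<^sup>+Y. c * (indicator B Y * L2sq A' (\<lambda>X. g X Y)) \<partial>lborel)"
    by (intro nn_integral_mono) (use le in \<open>auto simp: indicator_def\<close>)
  then show ?thesis
    unfolding L2sq_prod(1)[OF f] L2sq_prod(1)[OF g] nn_integral_cmult[OF L2sq_prod(2)[OF g]] .
qed

lemma measurable_separable_sum:
  fixes u :: "nat \<Rightarrow> 'a::euclidean_space \<Rightarrow> real" and v :: "nat \<Rightarrow> 'b::euclidean_space \<Rightarrow> real"
  assumes "\<forall>i<k. u i \<in> borel_measurable borel \<and> v i \<in> borel_measurable borel"
  shows "(\<lambda>P. \<Sum>i<k. u i (fst P) * v i (snd P)) \<in> borel_measurable borel"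
proof (rule borel_measurable_sum, rule borel_measurable_times)
  fix i assume i: "i \<in> {..<k}"
  show "(\<lambda>P::'a \<times> 'b. u i (fst P)) \<in> borel_measurable borel"
    by (rule measurable_compose[OF borel_measurable_continuous_onI[OF continuous_on_fst[OF continuous_on_id]]]) (use assms i in auto)
  show "(\<lambda>P::'a \<times> 'b. v i (snd P)) \<in> borel_measurable borel"
    by (rule measurable_compose[OF borel_measurable_continuous_onI[OF continuous_on_snd[OF continuous_on_id]]]) (use assms i in auto)
qed

theorem theorem1:
  fixes \<Omega> D\<^sub>1 D\<^sub>2 :: "(real^'n) set"
    and T \<beta> \<rho> lam \<Lambda> a\<^sub>1 b\<^sub>1 a\<^sub>2 b\<^sub>2 :: real
    and A :: "(real^'n) \<times> real \<Rightarrow> (real^'n^'n)"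
    and G :: "(real^'n) \<times> real \<Rightarrow> (real^'n) \<times> real \<Rightarrow> real"
  assumes dom: "open \<Omega>" "connected \<Omega>" "bounded \<Omega>" "\<Omega> \<noteq> {}"
    and cone: "uniform_interior_cone \<Omega>"
    and T: "0 < T" and beta: "0 < \<beta>" and rho: "0 < \<rho>"
    and ell: "0 < lam" "lam \<le> \<Lambda>"
    and A_meas: "\<And>i j. (\<lambda>X. A X $ i $ j) \<in> borel_measurable lborel"
    and A_sym: "\<And>X. X \<in> cyl \<Omega> T \<Longrightarrow> transpose (A X) = A X"
    and A_ell: "\<And>X \<xi>. X \<in> cyl \<Omega> T \<Longrightarrow>
                  lam * (norm \<xi>)\<^sup>2 \<le> (A X *v \<xi>) \<bullet> \<xi> \<and> (A X *v \<xi>) \<bullet> \<xi> \<le> \<Lambda> * (norm \<xi>)\<^sup>2"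
    and green: "green_fun \<Omega> T A G"
    and D: "open D\<^sub>1" "connected D\<^sub>1" "convex D\<^sub>1" "open D\<^sub>2" "connected D\<^sub>2"
    and I: "0 \<le> a\<^sub>1" "a\<^sub>1 < b\<^sub>1" "b\<^sub>1 \<le> T" "0 \<le> a\<^sub>2" "a\<^sub>2 < b\<^sub>2" "b\<^sub>2 \<le> T"
    and adm: "pdist \<beta> ((D\<^sub>1 \<inter> \<Omega>) \<times> {a\<^sub>1<..<b\<^sub>1}) ((D\<^sub>2 \<inter> \<Omega>) \<times> {a\<^sub>2<..<b\<^sub>2})
              \<ge> \<rho> * max (pdiam \<beta> ((D\<^sub>1 \<inter> \<Omega>) \<times> {a\<^sub>1<..<b\<^sub>1})) (pdiam \<beta> ((D\<^sub>2 \<inter> \<Omega>) \<times> {a\<^sub>2<..<b\<^sub>2}))"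
    and cube: "0 < \<delta>\<^sub>0" "0 < \<theta>" "\<theta> < 1" "cube_property \<Omega> \<delta>\<^sub>0 \<theta>"
  shows
    "\<exists>\<epsilon>\<^sub>0>0. \<forall>\<epsilon>. 0 < \<epsilon> \<and> \<epsilon> < \<epsilon>\<^sub>0 \<longrightarrow>
      (let QX = (D\<^sub>1 \<inter> \<Omega>) \<times> {a\<^sub>1<..<b\<^sub>1};
           QY = (D\<^sub>2 \<inter> \<Omega>) \<times> {a\<^sub>2<..<b\<^sub>2};
           QXhat = {X \<in> cyl \<Omega> T. pdist_pt \<beta> X QX \<le> \<rho> / 2 * pdiam \<beta> QX};
           n = CARD('n);
           c = c_rho (\<rho> / 2) (kappa_c lam \<Lambda> \<beta>)
                 (c_appr n (measure lborel (ball (0::real^'n) 1)) \<theta> \<Lambda> \<beta>);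
           L = real_of_int (\<lceil>ln (1 / \<epsilon>)\<rceil>)
       in \<exists>k::nat. \<exists>u v :: nat \<Rightarrow> (real^'n) \<times> real \<Rightarrow> real.
            real k \<le> c ^ (n + 2) * L ^ (n + 3) + L \<and>
            (\<forall>i<k. u i \<in> borel_measurable lborel \<and> v i \<in> borel_measurable lborel) \<and>
            (\<forall>Y\<in>QY. L2sq QX (\<lambda>X. G X Y - (\<Sum>i<k. u i X * v i Y))
                        \<le> ennreal (\<epsilon>\<^sup>2) * L2sq QXhat (\<lambda>X. G X Y)) \<and>
            L2sq (QX \<times> QY) (\<lambda>(X, Y). G X Y - (\<Sum>i<k. u i X * v i Y))
              \<le> ennreal (\<epsilon>\<^sup>2) * L2sq (QXhat \<times> QY) (\<lambda>(X, Y). G X Y))"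
proof -
  let ?E = "D\<^sub>1 \<inter> \<Omega>"
  let ?QX = "?E \<times> {a\<^sub>1<..<b\<^sub>1}"
  let ?QY = "(D\<^sub>2 \<inter> \<Omega>) \<times> {a\<^sub>2<..<b\<^sub>2}"
  let ?n = "CARD('n)"
  define QXhat where "QXhat = {X \<in> cyl \<Omega> T. pdist_pt \<beta> X ?QX \<le> \<rho> / 2 * pdiam \<beta> ?QX}"
  define c where "c = c_rho (\<rho> / 2) (kappa_c lam \<Lambda> \<beta>) (c_appr ?n (measure lborel (ball (0::real^'n) 1)) \<theta> \<Lambda> \<beta>)"
  \<comment> \<open>Positivity of c is what allows the one spare power of L to dominate the
    uncontrolled constant C.\<close>
  have c0: "0 < c"
  proof -
    define \<omega> where "\<omega> = measure lborel (ball (0::real^'n) 1)"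
    have \<omega>: "0 < \<omega>" unfolding \<omega>_def by (rule content_ball_pos) simp
    have "0 < \<omega> powr (2 - 2 / real ?n) * \<theta> powr (- 2)" using \<omega> cube(2) by simp
    moreover have "0 \<le> 2 * \<Lambda>\<^sup>2 * \<omega> powr (2 / real ?n) * \<beta>\<^sup>2 * \<theta> powr (- 2 - 2 / real ?n)" by simp
    ultimately have "0 < c_appr ?n \<omega> \<theta> \<Lambda> \<beta>" unfolding c_appr_def by (intro mult_pos_pos real_sqrt_gt_zero add_pos_nonneg) auto
    moreover have "0 < kappa_c lam \<Lambda> \<beta>" unfolding kappa_c_def
      using ell beta by (intro real_sqrt_gt_zero add_nonneg_pos) auto
    moreover have "0 < 2 + 1 / (\<rho> / 2)" using rho by (intro add_pos_pos) auto
    ultimately show ?thesis unfolding c_def c_rho_def \<omega>_def by (intro mult_pos_pos exp_gt_zero)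
  qed
  have main: "\<exists>\<epsilon>\<^sub>0>0. \<forall>\<epsilon>. 0 < \<epsilon> \<and> \<epsilon> < \<epsilon>\<^sub>0 \<longrightarrow>
    (\<exists>k::nat. \<exists>u v :: nat \<Rightarrow> (real^'n) \<times> real \<Rightarrow> real.
            real k \<le> c ^ (?n + 2) * real_of_int \<lceil>ln (1 / \<epsilon>)\<rceil> ^ (?n + 3) + real_of_int \<lceil>ln (1 / \<epsilon>)\<rceil> \<and>
            (\<forall>i<k. u i \<in> borel_measurable lborel \<and> v i \<in> borel_measurable lborel) \<and>
            (\<forall>Y\<in>?QY. L2sq ?QX (\<lambda>X. G X Y - (\<Sum>i<k. u i X * v i Y)) \<le> ennreal (\<epsilon>\<^sup>2) * L2sq QXhat (\<lambda>X. G X Y)) \<and>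
            L2sq (?QX \<times> ?QY) (\<lambda>(X, Y). G X Y - (\<Sum>i<k. u i X * v i Y))
              \<le> ennreal (\<epsilon>\<^sup>2) * L2sq (QXhat \<times> ?QY) (\<lambda>(X, Y). G X Y))"
  proof (cases "?E = {} \<or> D\<^sub>2 \<inter> \<Omega> = {}")
    \<comment> \<open>If a cylinder is empty, diameter or distance involve a supremum or infimum
      over an empty set and admissibility carries no information; rank 0 settles this case.\<close>
    case True
    have z: "L2sq {} f = 0" for f :: "((real^'n) \<times> real) \<times> (real^'n) \<times> real \<Rightarrow> real" by (simp add: L2sq_def)
    have z': "L2sq {} f = 0" for f :: "(real^'n) \<times> real \<Rightarrow> real" by (simp add: L2sq_def)
    show ?thesis
    proof (rule exI[of _ 1], intro conjI allI impI)
      fix \<epsilon> :: real assume \<epsilon>: "0 < \<epsilon> \<and> \<epsilon> < 1"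
      then have "0 < ln (1 / \<epsilon>)" by simp
      then have "0 \<le> real_of_int \<lceil>ln (1 / \<epsilon>)\<rceil>" by linarith
      then have "0 \<le> c ^ (?n + 2) * real_of_int \<lceil>ln (1 / \<epsilon>)\<rceil> ^ (?n + 3) + real_of_int \<lceil>ln (1 / \<epsilon>)\<rceil>" using c0 by simp
      moreover have "?QX = {} \<or> ?QY = {}" "?QX \<times> ?QY = {}" using True by auto
      ultimately show "\<exists>k::nat. \<exists>u v :: nat \<Rightarrow> (real^'n) \<times> real \<Rightarrow> real.
            real k \<le> c ^ (?n + 2) * real_of_int \<lceil>ln (1 / \<epsilon>)\<rceil> ^ (?n + 3) + real_of_int \<lceil>ln (1 / \<epsilon>)\<rceil> \<and>
            (\<forall>i<k. u i \<in> borel_measurable lborel \<and> v i \<in> borel_measurable lborel) \<and>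
            (\<forall>Y\<in>?QY. L2sq ?QX (\<lambda>X. G X Y - (\<Sum>i<k. u i X * v i Y)) \<le> ennreal (\<epsilon>\<^sup>2) * L2sq QXhat (\<lambda>X. G X Y)) \<and>
            L2sq (?QX \<times> ?QY) (\<lambda>(X, Y). G X Y - (\<Sum>i<k. u i X * v i Y))
              \<le> ennreal (\<epsilon>\<^sup>2) * L2sq (QXhat \<times> ?QY) (\<lambda>(X, Y). G X Y)"
        by (intro exI[of _ 0] exI[of _ "\<lambda>_ _. 0"]) (auto simp: z z')
    qed simp
  next
    case False
    interpret parabolic \<Omega> T lam \<Lambda> A G
      by unfold_locales (use dom T ell A_meas A_sym A_ell green in auto)
    obtain x\<^sub>0 where x\<^sub>0: "x\<^sub>0 \<in> ?E" using False by blast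
    define d where "d = pdiam \<beta> ?QX"
    \<comment> \<open>Half of the admissible distance. The other half remains after the enlargement:
      by the triangle inequality every point within \<delta> of \<open>?QX\<close> is still at least
      \<delta> away from \<open>?QY\<close>.\<close>
    define \<delta> where "\<delta> = \<rho> / 2 * d"
    obtain b where b: "\<And>x. x \<in> \<Omega> \<Longrightarrow> norm x \<le> b" using dom(2) by (auto simp: bounded_iff)
    have dle: "pmetric \<beta> X X' \<le> d" if "X \<in> ?QX" "X' \<in> ?QX" for X X'
      unfolding d_def pdiam_def
    proof (rule cSup_upper)
      show "pmetric \<beta> X X' \<in> {pmetric \<beta> X Y |X Y. X \<in> ?QX \<and> Y \<in> ?QX}" using that by blast
      show "bdd_above {pmetric \<beta> X Y |X Y. X \<in> ?QX \<and> Y \<in> ?QX}"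
      proof (rule bdd_aboveI)
        fix s assume "s \<in> {pmetric \<beta> X Y |X Y. X \<in> ?QX \<and> Y \<in> ?QX}"
        then obtain X Y where s: "s = pmetric \<beta> X Y" "X \<in> ?QX" "Y \<in> ?QX" by blast
        have "infnorm (fst X - fst Y) \<le> norm (fst X) + norm (fst Y)"
          by (rule order_trans[OF infnorm_le_norm norm_triangle_ineq4])
        also have "\<dots> \<le> b + b" using b s by (intro add_mono) auto
        finally have 1: "infnorm (fst X - fst Y) \<le> b + b" .
        have "\<bar>snd X - snd Y\<bar> \<le> b\<^sub>1 - a\<^sub>1" using s by auto
        then have 2: "sqrt (\<bar>snd X - snd Y\<bar> / \<beta>) \<le> sqrt ((b\<^sub>1 - a\<^sub>1) / \<beta>)" using beta by (intro real_sqrt_le_mono divide_right_mono) auto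
        show "s \<le> max (b + b) (sqrt ((b\<^sub>1 - a\<^sub>1) / \<beta>))" unfolding s(1) pmetric_def using 1 2 by (rule max.mono)
      qed
    qed
    have d0: "0 < d"
    proof -
      define t where "t = (a\<^sub>1 + b\<^sub>1) / 2"
      define t' where "t' = (3 * a\<^sub>1 + b\<^sub>1) / 4"
      have t: "a\<^sub>1 < t'" "t' < t" "t < b\<^sub>1" using I(2) by (auto simp: t_def t'_def)
      have "0 < sqrt (\<bar>t - t'\<bar> / \<beta>)" using t beta by simp
      also have "\<dots> \<le> pmetric \<beta> (x\<^sub>0, t) (x\<^sub>0, t')" by (simp add: pmetric_def)
      also have "\<dots> \<le> d" by (rule dle) (use x\<^sub>0 t in auto)
      finally show ?thesis .
    qed
    have \<delta>: "0 < \<delta>" using rho d0 by (simp add: \<delta>_def)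
    have QY: "open ?QY" "?QY \<subseteq> oc"
      using D(4) dom(1) I(4-6) by (auto simp: oc_def intro!: open_Times open_Int)
    have far: "2 * \<delta> \<le> pmetric \<beta> X' Y" if "X' \<in> ?QX" "Y \<in> ?QY" for X' Y
    proof -
      have "2 * \<delta> = \<rho> * d" by (simp add: \<delta>_def)
      also have "\<dots> \<le> \<rho> * max (pdiam \<beta> ?QX) (pdiam \<beta> ?QY)" using rho by (intro mult_left_mono) (auto simp: d_def)
      also have "\<dots> \<le> pdist \<beta> ?QX ?QY" by (rule adm)
      also have "\<dots> \<le> pmetric \<beta> X' Y" unfolding pdist_def
        by (rule cInf_lower) (use that in \<open>blast, auto intro!: bdd_belowI[of _ 0] simp: pmetric_nonneg\<close>)
      finally show ?thesis .
    qed
    have sep: "\<delta> \<le> pmetric \<beta> X Y" if "Y \<in> ?QY" "X' \<in> ?QX" "pmetric \<beta> X X' \<le> \<delta>" for X Y and X'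
      using far[OF that(2,1)] pmetric_triangle[OF beta, of X' Y X] that(3) pmetric_sym[of \<beta> X X'] by linarith
    have Eo: "open ?E" using D(1) dom(1) by auto
    have "\<exists>C. \<forall>L::nat. 1 \<le> L \<longrightarrow> (\<exists>k u v R. real k \<le> C * real L ^ (?n + 2) \<and>
      (\<forall>i<k. u i \<in> borel_measurable borel \<and> v i \<in> borel_measurable borel) \<and>
      R \<in> sets borel \<and> R \<subseteq> oc \<and> (\<forall>X\<in>R. \<exists>X'\<in>?QX. pmetric \<beta> X X' \<le> \<delta>) \<and>
      (\<forall>Y\<in>?QY. L2sq ?QX (\<lambda>X. G X Y - (\<Sum>i<k. u i X * v i Y)) \<le> ennreal (exp (- 2 * real L)) * L2sq R (\<lambda>X. G X Y)))"
    proof (rule separable_approximation)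
      show "open ?E" "?E \<subseteq> \<Omega>" "?E \<noteq> {}" using Eo False by simp_all
      show "\<delta> \<le> pmetric \<beta> X Y" if "Y \<in> ?QY" "X' \<in> ?QX" "pmetric \<beta> X X' \<le> \<delta>" for X Y and X'
        using that by (rule sep)
    qed (rule I(1) I(2) I(3) beta \<delta> QY(1) QY(2))+
    then obtain C where C: "\<forall>L::nat. 1 \<le> L \<longrightarrow> (\<exists>k u v R. real k \<le> C * real L ^ (?n + 2) \<and>
      (\<forall>i<k. u i \<in> borel_measurable borel \<and> v i \<in> borel_measurable borel) \<and>
      R \<in> sets borel \<and> R \<subseteq> oc \<and> (\<forall>X\<in>R. \<exists>X'\<in>?QX. pmetric \<beta> X X' \<le> \<delta>) \<and>
      (\<forall>Y\<in>?QY. L2sq ?QX (\<lambda>X. G X Y - (\<Sum>i<k. u i X * v i Y)) \<le> ennreal (exp (- 2 * real L)) * L2sq R (\<lambda>X. G X Y)))"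
      by (elim exE)
    \<comment> \<open>The first bound gives ln (1 / \<epsilon>) > 1 and hence L >= 1. The second
      gives C <= c^(n + 2) L, so that C L^(n + 2) is at most c^(n + 2) L^(n + 3).\<close>
    define \<epsilon>\<^sub>0 where "\<epsilon>\<^sub>0 = min (exp (- 1)) (exp (- (C / c ^ (?n + 2))))"
    show ?thesis
    proof (rule exI[of _ \<epsilon>\<^sub>0], intro conjI allI impI)
      show "0 < \<epsilon>\<^sub>0" by (simp add: \<epsilon>\<^sub>0_def)
      fix \<epsilon> :: real assume \<epsilon>: "0 < \<epsilon> \<and> \<epsilon> < \<epsilon>\<^sub>0"
      define L where "L = nat \<lceil>ln (1 / \<epsilon>)\<rceil>"
      have ln: "ln (1 / \<epsilon>) = - ln \<epsilon>" using \<epsilon> by (simp add: ln_div)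
      have "ln \<epsilon> < ln \<epsilon>\<^sub>0" using \<epsilon> by simp
      moreover have "ln \<epsilon>\<^sub>0 \<le> - 1" "ln \<epsilon>\<^sub>0 \<le> - (C / c ^ (?n + 2))"
        using ln_mono[of \<epsilon>\<^sub>0 "exp (- 1)"] ln_mono[of \<epsilon>\<^sub>0 "exp (- (C / c ^ (?n + 2)))"] by (simp_all add: \<epsilon>\<^sub>0_def)
      ultimately have l: "1 < ln (1 / \<epsilon>)" "C / c ^ (?n + 2) < ln (1 / \<epsilon>)" unfolding ln by linarith+
      have cl: "1 \<le> \<lceil>ln (1 / \<epsilon>)\<rceil>" using l(1) by linarith
      have L: "1 \<le> L" "real L = real_of_int \<lceil>ln (1 / \<epsilon>)\<rceil>" "ln (1 / \<epsilon>) \<le> real L"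
        unfolding L_def using cl by linarith+
      \<comment> \<open>The decay exp (-2) per layer refers to squared norms, so L >= ln (1 /
        \<epsilon>) layers yield the square of \<epsilon>.\<close>
      have e2: "exp (- 2 * real L) \<le> \<epsilon>\<^sup>2"
      proof -
        have "exp (- real L) \<le> exp (ln \<epsilon>)" using L(3) unfolding ln by simp
        then have "exp (- real L) \<le> \<epsilon>" using \<epsilon> by simp
        then have "(exp (- real L))\<^sup>2 \<le> \<epsilon>\<^sup>2" by (rule power_mono) simp
        then show ?thesis by (simp add: exp_double[symmetric])
      qed
      obtain k u v R where kuv: "real k \<le> C * real L ^ (?n + 2)"
        "\<forall>i<k. u i \<in> borel_measurable borel \<and> v i \<in> borel_measurable borel"
        "R \<in> sets borel" "R \<subseteq> oc" "\<forall>X\<in>R. \<exists>X'\<in>?QX. pmetric \<beta> X X' \<le> \<delta>"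
        "\<forall>Y\<in>?QY. L2sq ?QX (\<lambda>X. G X Y - (\<Sum>i<k. u i X * v i Y)) \<le> ennreal (exp (- 2 * real L)) * L2sq R (\<lambda>X. G X Y)"
        using C[rule_format, OF L(1)] by (elim exE conjE) (rule that)
      have RQ: "R \<subseteq> QXhat"
      proof
        fix X assume X: "X \<in> R"
        obtain X' where X': "X' \<in> ?QX" "pmetric \<beta> X X' \<le> \<delta>" using kuv(5) X by blast
        have "pdist_pt \<beta> X ?QX \<le> pmetric \<beta> X X'" unfolding pdist_pt_def
          by (rule cInf_lower) (use X'(1) in \<open>blast, auto intro!: bdd_belowI[of _ 0] simp: pmetric_nonneg\<close>)
        then show "X \<in> QXhat" using X X' kuv(4) oc(2) by (auto simp: QXhat_def \<delta>_def d_def)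
      qed
      have kb: "real k \<le> c ^ (?n + 2) * real_of_int \<lceil>ln (1 / \<epsilon>)\<rceil> ^ (?n + 3) + real_of_int \<lceil>ln (1 / \<epsilon>)\<rceil>"
      proof -
        have "C \<le> c ^ (?n + 2) * real L"
        proof -
          have "C / c ^ (?n + 2) \<le> real L" using l(2) L(3) by linarith
          then show ?thesis using c0 by (simp add: pos_divide_le_eq mult.commute)
        qed
        then have "C * real L ^ (?n + 2) \<le> (c ^ (?n + 2) * real L) * real L ^ (?n + 2)" by (rule mult_right_mono) simp
        also have "\<dots> = c ^ (?n + 2) * real L ^ (?n + 3)" by (simp add: power_add power2_eq_square power3_eq_cube)
        finally show ?thesis using kuv(1) L(1) unfolding L(2)[symmetric] by linarith
      qed
      \<comment> \<open>Stated with R instead of \<open>QXhat\<close>: on R times \<open>?QY\<close>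
        the function G is jointly continuous, so the estimate can be integrated over Y there.
        \<open>QXhat\<close> may contain points at times 0 and T, and it enters only through
        monotonicity of the integral.\<close>
      have pt: "L2sq ?QX (\<lambda>X. G X Y - (\<Sum>i<k. u i X * v i Y)) \<le> ennreal (\<epsilon>\<^sup>2) * L2sq R (\<lambda>X. G X Y)" if Y: "Y \<in> ?QY" for Y
      proof -
        have "L2sq ?QX (\<lambda>X. G X Y - (\<Sum>i<k. u i X * v i Y)) \<le> ennreal (exp (- 2 * real L)) * L2sq R (\<lambda>X. G X Y)"
          using kuv(6) Y by blast
        also have "\<dots> \<le> ennreal (\<epsilon>\<^sup>2) * L2sq R (\<lambda>X. G X Y)" by (intro mult_right_mono ennreal_leI e2) simp
        finally show ?thesis .
      qed
      have pt': "L2sq ?QX (\<lambda>X. G X Y - (\<Sum>i<k. u i X * v i Y)) \<le> ennreal (\<epsilon>\<^sup>2) * L2sq QXhat (\<lambda>X. G X Y)" if Y: "Y \<in> ?QY" for Y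
        by (rule order_trans[OF pt[OF Y]]) (intro mult_left_mono L2sq_mono RQ, simp)
      have QXo: "?QX \<subseteq> oc" using I by (auto simp: oc_def)
      have QXb: "?QX \<in> sets borel" "?QY \<in> sets borel"
        using Eo QY(1) by (auto intro!: borel_open open_Times)
      have Gm: "(\<lambda>P. indicator (S \<times> ?QY) P * (case P of (X, Y) \<Rightarrow> G X Y)) \<in> borel_measurable borel"
        if S: "S \<in> sets borel" "S \<subseteq> oc" "\<And>X Y. X \<in> S \<Longrightarrow> Y \<in> ?QY \<Longrightarrow> X \<noteq> Y" for S
      proof -
        have "S \<times> ?QY \<in> sets (borel \<Otimes>\<^sub>M borel)" using S(1) QXb(2) by (rule pair_measureI)
        then have "S \<times> ?QY \<in> sets borel" by (simp only: borel_prod)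
        moreover have "continuous_on (S \<times> ?QY) (\<lambda>(X, Y). G X Y)"
        proof (rule continuous_on_subset[OF G_cont], rule subsetI)
          fix P assume "P \<in> S \<times> ?QY"
          then obtain X Y where P: "P = (X, Y)" "X \<in> S" "Y \<in> ?QY" by (rule SigmaE)
          show "P \<in> {(X, Y). X \<in> oc \<and> Y \<in> oc \<and> X \<noteq> Y}"
            unfolding P(1) using S(2) S(3)[OF P(2,3)] P(2,3) QY(2) by blast
        qed
        ultimately have "(\<lambda>P. indicator (S \<times> ?QY) P *\<^sub>R (case P of (X, Y) \<Rightarrow> G X Y)) \<in> borel_measurable borel"
          by (rule borel_measurable_continuous_on_indicator)
        then show ?thesis by simp
      qed
      have neR: "X \<noteq> Y" if XY: "X \<in> R" "Y \<in> ?QY" for X Y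
      proof
        assume "X = Y"
        obtain X' where "X' \<in> ?QX" "pmetric \<beta> X X' \<le> \<delta>" using kuv(5) XY(1) by blast
        then have "\<delta> \<le> pmetric \<beta> X Y" using sep XY(2) by blast
        then show False using \<delta> \<open>X = Y\<close> by (simp add: pmetric_def infnorm_0)
      qed
      have neQ: "X \<noteq> Y" if XY: "X \<in> ?QX" "Y \<in> ?QY" for X Y
      proof
        assume "X = Y"
        then show False using far[OF XY] \<delta> by (simp add: pmetric_def infnorm_0)
      qed
      have sm: "(\<lambda>P. \<Sum>i<k. u i (fst P) * v i (snd P)) \<in> borel_measurable borel"
        by (rule measurable_separable_sum[OF kuv(2)])
      have prod_bound: "L2sq (?QX \<times> ?QY) (\<lambda>(X, Y). G X Y - (\<Sum>i<k. u i X * v i Y)) \<le> ennreal (\<epsilon>\<^sup>2) * L2sq (QXhat \<times> ?QY) (\<lambda>(X, Y). G X Y)"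
      proof -
        have m1: "(\<lambda>P. indicator (?QX \<times> ?QY) P * (case P of (X, Y) \<Rightarrow> G X Y - (\<Sum>i<k. u i X * v i Y))) \<in> borel_measurable borel"
        proof -
          have "?QX \<times> ?QY \<in> sets (borel \<Otimes>\<^sub>M borel)" using QXb by (rule pair_measureI)
          then have I: "indicator (?QX \<times> ?QY) \<in> borel_measurable (borel :: (((real^'n) \<times> real) \<times> (real^'n) \<times> real) measure)"
            by (simp only: borel_prod borel_measurable_indicator)
          have "(\<lambda>P. indicator (?QX \<times> ?QY) P * (case P of (X, Y) \<Rightarrow> G X Y) - indicator (?QX \<times> ?QY) P * (\<Sum>i<k. u i (fst P) * v i (snd P))) \<in> borel_measurable borel"
            by (intro borel_measurable_diff borel_measurable_times I sm Gm[OF QXb(1) QXo neQ])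
          then show ?thesis by (simp add: case_prod_beta right_diff_distrib)
        qed
        have "L2sq (?QX \<times> ?QY) (\<lambda>(X, Y). G X Y - (\<Sum>i<k. u i X * v i Y))
            \<le> ennreal (\<epsilon>\<^sup>2) * L2sq (R \<times> ?QY) (\<lambda>(X, Y). G X Y)"
          by (rule L2sq_prod_le[OF m1 Gm[OF kuv(3,4) neR] pt])
        also have "ennreal (\<epsilon>\<^sup>2) * L2sq (R \<times> ?QY) (\<lambda>(X, Y). G X Y) \<le> ennreal (\<epsilon>\<^sup>2) * L2sq (QXhat \<times> ?QY) (\<lambda>(X, Y). G X Y)"
          by (intro mult_left_mono L2sq_mono) (use RQ in auto)
        finally show ?thesis .
      qed
      show "\<exists>k::nat. \<exists>u v :: nat \<Rightarrow> (real^'n) \<times> real \<Rightarrow> real.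
            real k \<le> c ^ (?n + 2) * real_of_int \<lceil>ln (1 / \<epsilon>)\<rceil> ^ (?n + 3) + real_of_int \<lceil>ln (1 / \<epsilon>)\<rceil> \<and>
            (\<forall>i<k. u i \<in> borel_measurable lborel \<and> v i \<in> borel_measurable lborel) \<and>
            (\<forall>Y\<in>?QY. L2sq ?QX (\<lambda>X. G X Y - (\<Sum>i<k. u i X * v i Y)) \<le> ennreal (\<epsilon>\<^sup>2) * L2sq QXhat (\<lambda>X. G X Y)) \<and>
            L2sq (?QX \<times> ?QY) (\<lambda>(X, Y). G X Y - (\<Sum>i<k. u i X * v i Y))
              \<le> ennreal (\<epsilon>\<^sup>2) * L2sq (QXhat \<times> ?QY) (\<lambda>(X, Y). G X Y)"
        by (rule exI[of _ k], rule exI[of _ u], rule exI[of _ v])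
           (intro conjI kb ballI pt' prod_bound, use kuv(2) in simp)
    qed
  qed
  then show ?thesis unfolding Let_def QXhat_def c_def .
qed

end
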